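(* Let $\delta>0$. For any environment $\nu$ (satisfying the subGaussian and hidden-partition assumptions below, with arbitrary $\Delta_*>0$ and $\theta_*$), the algorithm ACB$^*(\delta)$ is $\delta$-PAC, i.e. $\mathbb{P}_{ACB^*,\nu}(\hat G\sim G^* )\geq1-\delta$. Moreover there exist positive numerical constants $c,c',c''$ such that, with $\tau_{ACB^*}$ the budget of ACB$^*(\delta)$, $$\mathbb{P}_{ACB^*,\nu}\Big[\tau_{ACB^*}\leq cN+c'\frac{\sigma^2}{\Delta_*^2\theta_*}L_*\log\left(\frac{L_*K}{\delta}\right)\left[\log K+\sqrt d+\log\log(L_* )+\log\log(N/\delta)\right]+c'\frac{L_*}{\theta_*}\log\left(\frac{L_*K}{\delta}\right)+c''\frac{\sigma^2}{\Delta_*^2}\left[N\log(N/\delta)+\sqrt{dNK\log(N/\delta)}\right]\Big]\geq1-\delta,$$ where $L_*=\left\lceil\log_2\left(\frac{1}{\theta_*K}\left(\frac{\Delta_0^2}{\Delta_*^2}\vee1\right)\right)\right\rceil$ and $\Delta_0^2=\sigma^2[\log K+\sqrt d+\log\log(6N/\delta)]$.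
   Context: Setting (active clustering). $N$ arms $[N]$; arm $a$ has unknown distribution $\nu_a$ on $\mathbb{R}^d$ with mean $\mu_a$. Environments satisfy: (i) for each $a$ there is a symmetric matrix $\Sigma_a$ with $\|\Sigma_a\|_{op}\leq\sigma^2$ such that for $X\sim\nu_a$ the coordinates $E_i$ of $\Sigma_a^{-1/2}(X-\mu_a)$ are independent with $\mathbb{E}e^{tE_i}\leq e^{t^2/2}$ for all $t$; (ii) there is a partition $G^*=\{G^*_1,\dots,G^*_K\}$ of $[N]$ into $K$ nonempty groups with $\mu_a=\mu_b$ iff $a,b$ are in the same group; $\mu(k)$ is the mean of $G^*_k$. $\Delta_*=\min_{k\ne k'}\|\mu(k)-\mu(k')\|$, $\theta_*=\min_k|G^*_k|/N$. $\hat G\sim G^*$ means equality up to relabelling. The algorithm knows $\sigma,N,K,d$ but not $\Delta_*,\theta_*$; its budget is its total number of samples. Constants: $c_{HW}$ is an absolute constant such that for any random vector $Y$ with independent centered 1-subGaussian coordinates and any matrix $M$, $\mathbb{P}(Y^TMY-\mathbb{E}Y^TMY>x)\leq\exp(-\frac1{c_{HW}}(\frac{x^2}{\|M\|_F^2}\wedge\frac{x}{\|M\|_{op}}))$. Set $c_1=32^2\vee 8c_{HW}$, $c_2=16\sqrt{c_{HW}/2}\vee 32\sqrt2$, $c_3=32\sqrt2$, $c_4=8^2\vee4\sqrt2c_{HW}$, $c_5=8\sqrt{c_{HW}}$, $c_6=2048\vee 64c_{HW}\vee 92\sqrt{c_{HW}}$. $\mathrm{empirical\_mean}(a,n)$ draws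 $2n$ fresh samples of arm $a$ and returns two independent empirical means, each from $n$ of them. SRI$(\delta,\Delta,\theta)$: set $U=\lceil 8\theta^{-1}\log(8K/\delta)\rceil$, $r=\lceil\log_2\log(4U/\delta)\rceil$, $n_s=\lceil c_1\frac{\sigma^2}{\Delta^2}(2^s+\log(12K))\vee c_2\frac{\sigma^2}{\Delta^2}\sqrt{d(2^s+\log6)}\rceil$, $s_0=r\wedge\min\{s\geq1:n_s\geq2\}$, $n_{\max}=n_r\vee\lceil c_3\frac{\sigma^2}{\Delta^2}\sqrt d\log(2K)\rceil$, $T_{\max}=2K(n_{\max}+\sum_{s=s_0+1}^r n_s)+2Un_{s_0}+2U\sum_{s=s_0+1}^r n_s/2^{s-4}$. Draw $a_0$ uniformly from $[N]$, set $S=\{a_0\}$, compute $(\hat\mu_{a_0},\hat\mu'_{a_0})=\mathrm{empirical\_mean}(a_0,n_{\max})$. For $u=1,\dots,U$: draw $a_u$ uniformly from $[N]$ independently; for $s=s_0,\dots,r$: compute $(\bar\mu,\bar\mu')=\mathrm{empirical\_mean}(a_u,n_s)$; if $\min_{b\in S}\langle\bar\mu-\hat\mu_b,\bar\mu'-\hat\mu'_b\rangle\leq\Delta^2/2$, reject $a_u$ and leave the $s$-loop; otherwise if $s=r$, add $a_u$ to $S$ and compute $(\hat\mu_{a_u},\hat\mu'_{a_u})=\mathrm{empirical\_mean}(a_u,n_{\max})$. After each $u$, stop if $|S|=K$ or the number of samples used by SRI exceeds $T_{\max}$. Return $S$. ADC$(\delta,\Delta,S)$: if $|S|\neq K$ return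 nothing; else write $S=\{b_1,\dots,b_K\}$, $L_0=\log(6NK/\delta)$, $J=\lceil c_4\frac{\sigma^2}{\Delta^2}L_0\vee c_5\frac{\sigma^2}{\Delta^2}\sqrt{\frac{dN}{K}L_0}\rceil$, $I=\lceil c_4\frac{\sigma^2}{\Delta^2}L_0\vee c_5\frac{\sigma^2}{\Delta^2}\sqrt{\frac{dK}{N}L_0}\rceil$; for each $j$ compute $(\hat\mu(j),\hat\mu'(j))=\mathrm{empirical\_mean}(b_j,J)$ and put $b_j$ in $\hat G_j$; for each $a\notin S$ compute $(\hat\mu_a,\hat\mu'_a)=\mathrm{empirical\_mean}(a,I)$ and add $a$ to $\hat G_k$ with $k\in\arg\min_j\langle\hat\mu_a-\hat\mu(j),\hat\mu'_a-\hat\mu'(j)\rangle$. Return $\{\hat G_1,\dots,\hat G_K\}$. ACB$^*(\delta)$: with $\Delta_0$ as in the claim, $\delta_l=\delta/(6(l+1)^3)$, $\theta_{p,l}=1/(K2^{l-p})$, $\Delta_p=\Delta_0 2^{-p/2}$, $n'_p=\lceil c_6\frac{\sigma^2}{\Delta_p^2}(\log(3K^2/\delta)+\sqrt{d\log(3K^2/\delta)})\rceil$: for $l=0,1,\dots$ and $p=0,\dots,l$: compute $S_{p,l}=$ SRI$(\delta_l,\Delta_p,\theta_{p,l}\vee\frac1N)$; if $|S_{p,l}|=K$: for each $a\in S_{p,l}$ compute $(\bar\mu_a,\bar\mu'_a)=\mathrm{empirical\_mean}(a,n'_p)$, set $\hat\Delta^2=\min_{a\neq b\in S_{p,l}}\langle\bar\mu_a-\bar\mu_b,\bar\mu'_a-\bar\mu'_b\rangle$,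 and return ADC$(\delta/3,2^{-1/2}\hat\Delta,S_{p,l})$.
   Formalization: L_* is replaced by max(L_*,1), and log log L_* is read as 0 when L_*=1, because the stated bound contains log 0 when L_* is 0 or 1; K≥2 and d≥1 are assumed so that Δ_* is defined. *)

theory Defs
  imports "HOL-Probability.Probability"
begin

text \<open>A vector of R^d is represented by a function nat => real whose coordinates 0..d-1 are
  relevant; a d x d matrix by nat => nat => real with indices below d.  Explicit dimensions are
  used (instead of real^'d) because the numerical constants of the theorem must not depend on d.\<close>

type_synonym vec = "nat \<Rightarrow> real"
type_synonym mat = "nat \<Rightarrow> nat \<Rightarrow> real"

definition ip :: "nat \<Rightarrow> vec \<Rightarrow> vec \<Rightarrow> real" where
  "ip d x y = (\<Sum>i<d. x i * y i)"

definition vnorm :: "nat \<Rightarrow> vec \<Rightarrow> real" where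
  "vnorm d x = sqrt (ip d x x)"

definition vdiff :: "vec \<Rightarrow> vec \<Rightarrow> vec" where
  "vdiff x y = (\<lambda>i. x i - y i)"

definition veq :: "nat \<Rightarrow> vec \<Rightarrow> vec \<Rightarrow> bool" where
  "veq d x y \<longleftrightarrow> (\<forall>i<d. x i = y i)"

definition matvec :: "nat \<Rightarrow> mat \<Rightarrow> vec \<Rightarrow> vec" where
  "matvec d M x = (\<lambda>i. \<Sum>j<d. M i j * x j)"

definition mat_symmetric :: "nat \<Rightarrow> mat \<Rightarrow> bool" where
  "mat_symmetric d M \<longleftrightarrow> (\<forall>i<d. \<forall>j<d. M i j = M j i)"

definition mat_posdef :: "nat \<Rightarrow> mat \<Rightarrow> bool" where
  "mat_posdef d M \<longleftrightarrow> (\<forall>x. (\<exists>i<d. x i \<noteq> 0) \<longrightarrow> ip d x (matvec d M x) > 0)"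

definition mat_mult_eq :: "nat \<Rightarrow> mat \<Rightarrow> mat \<Rightarrow> mat \<Rightarrow> bool" where
  "mat_mult_eq d A B C \<longleftrightarrow> (\<forall>i<d. \<forall>j<d. (\<Sum>k<d. A i k * B k j) = C i j)"

definition mat_id :: mat where
  "mat_id = (\<lambda>i j. if i = j then 1 else 0)"

definition mat_opnorm :: "nat \<Rightarrow> mat \<Rightarrow> real" where
  "mat_opnorm d M = Sup {vnorm d (matvec d M x) | x. vnorm d x \<le> 1}"

definition frob2 :: "nat \<Rightarrow> mat \<Rightarrow> real" where
  "frob2 d M = (\<Sum>i<d. \<Sum>j<d. (M i j)\<^sup>2)"

definition quadf :: "nat \<Rightarrow> mat \<Rightarrow> vec \<Rightarrow> real" where
  "quadf d M y = (\<Sum>i<d. \<Sum>j<d. y i * M i j * y j)"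

definition subG1 :: "real measure \<Rightarrow> bool" where
  "subG1 P \<longleftrightarrow> prob_space P \<and> sets P = sets borel \<and>
     (\<forall>t. integrable P (\<lambda>y. exp (t * y)) \<and> (\<integral>y. exp (t * y) \<partial>P) \<le> exp (t\<^sup>2 / 2))"

definition hanson_wright :: "real \<Rightarrow> bool" where
  "hanson_wright c \<longleftrightarrow>
    (\<forall>(m::nat) (P::nat \<Rightarrow> real measure) (M::mat) (x::real).
       (\<forall>i<m. subG1 (P i) \<and> integrable (P i) (\<lambda>y. y) \<and> (\<integral>y. y \<partial>P i) = 0) \<longrightarrow>
       measure (PiM {..<m} P)
         {y \<in> space (PiM {..<m} P). quadf m M y - (\<integral>z. quadf m M z \<partial>PiM {..<m} P) > x}
       \<le> exp (- (1 / c) * min (x\<^sup>2 / frob2 m M) (x / mat_opnorm m M)))"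

text \<open>Assumption (i) for one arm with law nu and mean mu: there is a symmetric Sigma with
  operator norm at most sigma^2, R = Sigma^(1/2) (symmetric positive definite square root),
  T = R^(-1) = Sigma^(-1/2), and the coordinates of T(X - mu) are independent and
  1-subGaussian.\<close>
definition arm_ok :: "nat \<Rightarrow> real \<Rightarrow> vec measure \<Rightarrow> vec \<Rightarrow> bool" where
  "arm_ok d \<sigma> \<nu> \<mu> \<longleftrightarrow>
     prob_space \<nu> \<and> sets \<nu> = sets (PiM {..<d} (\<lambda>_. borel)) \<and>
     (\<forall>i<d. integrable \<nu> (\<lambda>x. x i) \<and> (\<integral>x. x i \<partial>\<nu>) = \<mu> i) \<and>
     (\<exists>\<Sigma> R T. mat_symmetric d \<Sigma> \<and> mat_opnorm d \<Sigma> \<le> \<sigma>\<^sup>2 \<and>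
        mat_symmetric d R \<and> mat_posdef d R \<and> mat_mult_eq d R R \<Sigma> \<and>
        mat_mult_eq d T R mat_id \<and>
        (let E = (\<lambda>i x. matvec d T (vdiff x \<mu>) i) in
          prob_space.indep_vars \<nu> (\<lambda>_. borel) E {..<d} \<and>
          (\<forall>i<d. \<forall>t. integrable \<nu> (\<lambda>x. exp (t * E i x)) \<and>
                      (\<integral>x. exp (t * E i x) \<partial>\<nu>) \<le> exp (t\<^sup>2 / 2))))"

definition Gstar :: "nat \<Rightarrow> nat \<Rightarrow> (nat \<Rightarrow> vec) \<Rightarrow> nat set set" where
  "Gstar d N \<mu> = (\<lambda>a. {b. b < N \<and> veq d (\<mu> b) (\<mu> a)}) ` {..<N}"

definition Delta_star :: "nat \<Rightarrow> nat \<Rightarrow> (nat \<Rightarrow> vec) \<Rightarrow> real" where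
  "Delta_star d N \<mu> = Min {vnorm d (vdiff (\<mu> a) (\<mu> b)) | a b. a < N \<and> b < N \<and> \<not> veq d (\<mu> a) (\<mu> b)}"

definition theta_star :: "nat \<Rightarrow> nat \<Rightarrow> (nat \<Rightarrow> vec) \<Rightarrow> real" where
  "theta_star d N \<mu> = real (Min (card ` Gstar d N \<mu>)) / real N"

definition env_ok :: "nat \<Rightarrow> nat \<Rightarrow> nat \<Rightarrow> real \<Rightarrow> (nat \<Rightarrow> vec measure) \<Rightarrow> (nat \<Rightarrow> vec) \<Rightarrow> bool" where
  "env_ok d N K \<sigma> \<nu> \<mu> \<longleftrightarrow> 0 < d \<and> 2 \<le> K \<and> card (Gstar d N \<mu>) = K \<and>
     (\<forall>a<N. arm_ok d \<sigma> (\<nu> a) (\<mu> a))"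

text \<open>Randomness: X a k is the k-th sample of arm a (i.i.d. nu_a, independent over arms) and
  Us u is the u-th uniform draw from [N] = {0..<N}.  The algorithm consumes the samples of each
  arm in order ("fresh samples"), and uniform draws in order.  The state records, for each arm,
  the number of its samples used, the number of uniform draws used, and the total number of
  samples used so far (the budget).\<close>

type_synonym smp = "nat \<Rightarrow> nat \<Rightarrow> vec"
type_synonym st = "(nat \<Rightarrow> nat) \<times> nat \<times> nat"

record params =
  pcHW :: real
  pd :: nat
  pN :: nat
  pK :: nat
  psig :: real

definition c1 :: "real \<Rightarrow> real" where "c1 c = max (32^2) (8 * c)"
definition c2 :: "real \<Rightarrow> real" where "c2 c = max (16 * sqrt (c / 2)) (32 * sqrt 2)"
definition c3 :: "real \<Rightarrow> real" where "c3 c = 32 * sqrt 2"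
definition c4 :: "real \<Rightarrow> real" where "c4 c = max (8^2) (4 * sqrt 2 * c)"
definition c5 :: "real \<Rightarrow> real" where "c5 c = 8 * sqrt c"
definition c6 :: "real \<Rightarrow> real" where "c6 c = max (max 2048 (64 * c)) (92 * sqrt c)"

definition mean_from :: "smp \<Rightarrow> nat \<Rightarrow> nat \<Rightarrow> nat \<Rightarrow> vec" where
  "mean_from X a c n = (\<lambda>i. (\<Sum>k<n. X a (c + k) i) / real n)"

definition emp_mean :: "smp \<Rightarrow> nat \<Rightarrow> nat \<Rightarrow> st \<Rightarrow> (vec \<times> vec) \<times> st" where
  "emp_mean X a n s = (case s of (cnt, uc, tot) \<Rightarrow>
     ((mean_from X a (cnt a) n, mean_from X a (cnt a + n) n),
      (cnt(a := cnt a + 2 * n), uc, tot + 2 * n)))"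

text \<open>empirical_mean(a, n a) for every arm a of a finite set A; since every arm has its own
  sample stream, the order in which the arms are processed is irrelevant.\<close>
definition emp_means :: "smp \<Rightarrow> nat set \<Rightarrow> (nat \<Rightarrow> nat) \<Rightarrow> st \<Rightarrow> (nat \<Rightarrow> vec \<times> vec) \<times> st" where
  "emp_means X A n s = (case s of (cnt, uc, tot) \<Rightarrow>
     ((\<lambda>a. (mean_from X a (cnt a) (n a), mean_from X a (cnt a + n a) (n a))),
      ((\<lambda>a. if a \<in> A then cnt a + 2 * n a else cnt a), uc, tot + (\<Sum>a\<in>A. 2 * n a))))"

definition draw :: "(nat \<Rightarrow> nat) \<Rightarrow> st \<Rightarrow> nat \<times> st" where
  "draw Us s = (case s of (cnt, uc, tot) \<Rightarrow> (Us uc, (cnt, Suc uc, tot)))"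

definition total :: "st \<Rightarrow> nat" where
  "total s = snd (snd s)"

definition sri_U :: "params \<Rightarrow> real \<Rightarrow> real \<Rightarrow> nat" where
  "sri_U P \<delta> \<theta> = nat \<lceil>8 / \<theta> * ln (8 * real (pK P) / \<delta>)\<rceil>"

definition sri_r :: "params \<Rightarrow> real \<Rightarrow> real \<Rightarrow> nat" where
  "sri_r P \<delta> \<theta> = nat \<lceil>log 2 (ln (4 * real (sri_U P \<delta> \<theta>) / \<delta>))\<rceil>"

definition sri_n :: "params \<Rightarrow> real \<Rightarrow> nat \<Rightarrow> nat" where
  "sri_n P \<Delta> s = nat \<lceil>max (c1 (pcHW P) * (psig P)\<^sup>2 / \<Delta>\<^sup>2 * (2 ^ s + ln (12 * real (pK P))))
                          (c2 (pcHW P) * (psig P)\<^sup>2 / \<Delta>\<^sup>2 * sqrt (real (pd P) * (2 ^ s + ln 6)))\<rceil>"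

definition sri_s0 :: "params \<Rightarrow> real \<Rightarrow> real \<Rightarrow> real \<Rightarrow> nat" where
  "sri_s0 P \<delta> \<Delta> \<theta> = min (sri_r P \<delta> \<theta>) (LEAST s. 1 \<le> s \<and> 2 \<le> sri_n P \<Delta> s)"

definition sri_nmax :: "params \<Rightarrow> real \<Rightarrow> real \<Rightarrow> real \<Rightarrow> nat" where
  "sri_nmax P \<delta> \<Delta> \<theta> = max (sri_n P \<Delta> (sri_r P \<delta> \<theta>))
      (nat \<lceil>c3 (pcHW P) * (psig P)\<^sup>2 / \<Delta>\<^sup>2 * sqrt (real (pd P)) * ln (2 * real (pK P))\<rceil>)"

definition sri_Tmax :: "params \<Rightarrow> real \<Rightarrow> real \<Rightarrow> real \<Rightarrow> real" where
  "sri_Tmax P \<delta> \<Delta> \<theta> =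
    (let U = real (sri_U P \<delta> \<theta>); r = sri_r P \<delta> \<theta>; s0 = sri_s0 P \<delta> \<Delta> \<theta>; n = sri_n P \<Delta> in
     2 * real (pK P) * (real (sri_nmax P \<delta> \<Delta> \<theta>) + (\<Sum>s\<in>{s0+1..r}. real (n s)))
     + 2 * U * real (n s0)
     + 2 * U * (\<Sum>s\<in>{s0+1..r}. real (n s) / 2 powr (real s - 4)))"

text \<open>Test of the arm a for s = r - f, ..., r (the s-loop); returns whether a is accepted.\<close>
fun sri_test :: "params \<Rightarrow> smp \<Rightarrow> real \<Rightarrow> nat \<Rightarrow> nat set \<Rightarrow> (nat \<Rightarrow> vec \<times> vec)
                 \<Rightarrow> nat \<Rightarrow> nat \<Rightarrow> st \<Rightarrow> bool \<times> st" where
  "sri_test P X \<Delta> r S M a f s =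
     (case emp_mean X a (sri_n P \<Delta> (r - f)) s of ((m, m'), s') \<Rightarrow>
       if Min ((\<lambda>b. ip (pd P) (vdiff m (fst (M b))) (vdiff m' (snd (M b)))) ` S) \<le> \<Delta>\<^sup>2 / 2
       then (False, s')
       else (case f of 0 \<Rightarrow> (True, s') | Suc f' \<Rightarrow> sri_test P X \<Delta> r S M a f' s'))"

text \<open>The u-loop (k = number of remaining iterations); tot0 = samples used before SRI started.\<close>
fun sri_loop :: "params \<Rightarrow> smp \<Rightarrow> (nat \<Rightarrow> nat) \<Rightarrow> real \<Rightarrow> real \<Rightarrow> real \<Rightarrow> nat \<Rightarrow> nat
                 \<Rightarrow> nat set \<Rightarrow> (nat \<Rightarrow> vec \<times> vec) \<Rightarrow> st \<Rightarrow> nat set \<times> st" where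
  "sri_loop P X Us \<delta> \<Delta> \<theta> tot0 0 S M s = (S, s)"
| "sri_loop P X Us \<delta> \<Delta> \<theta> tot0 (Suc k) S M s =
     (case draw Us s of (a, s1) \<Rightarrow>
      case sri_test P X \<Delta> (sri_r P \<delta> \<theta>) S M a (sri_r P \<delta> \<theta> - sri_s0 P \<delta> \<Delta> \<theta>) s1 of (acc, s2) \<Rightarrow>
      (let (S', M', s3) =
          (if acc then (case emp_mean X a (sri_nmax P \<delta> \<Delta> \<theta>) s2 of (mm, s3) \<Rightarrow> (insert a S, M(a := mm), s3))
           else (S, M, s2))
       in if card S' = pK P \<or> real (total s3 - tot0) > sri_Tmax P \<delta> \<Delta> \<theta> then (S', s3)
          else sri_loop P X Us \<delta> \<Delta> \<theta> tot0 k S' M' s3))"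

definition SRI :: "params \<Rightarrow> smp \<Rightarrow> (nat \<Rightarrow> nat) \<Rightarrow> real \<Rightarrow> real \<Rightarrow> real \<Rightarrow> st \<Rightarrow> nat set \<times> st" where
  "SRI P X Us \<delta> \<Delta> \<theta> s =
     (case draw Us s of (a0, s1) \<Rightarrow>
      case emp_mean X a0 (sri_nmax P \<delta> \<Delta> \<theta>) s1 of (mm, s2) \<Rightarrow>
        sri_loop P X Us \<delta> \<Delta> \<theta> (total s) (sri_U P \<delta> \<theta>) {a0} (\<lambda>_. mm) s2)"

text \<open>Ties in the argmin are broken by the (fixed but unspecified) choice of arg_min_on.
  Output: the partition {G_1,...,G_K} as a set of sets of arms, G_j containing b_j.\<close>
definition ADC :: "params \<Rightarrow> smp \<Rightarrow> real \<Rightarrow> real \<Rightarrow> nat set \<Rightarrow> st \<Rightarrow> nat set set \<times> st" where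
  "ADC P X \<delta> \<Delta> S s =
    (let d = real (pd P); N = real (pN P); K = real (pK P); \<sigma>2 = (psig P)\<^sup>2; c = pcHW P;
         L0 = ln (6 * N * K / \<delta>);
         J = nat \<lceil>max (c4 c * \<sigma>2 / \<Delta>\<^sup>2 * L0) (c5 c * \<sigma>2 / \<Delta>\<^sup>2 * sqrt (d * N / K * L0))\<rceil>;
         I = nat \<lceil>max (c4 c * \<sigma>2 / \<Delta>\<^sup>2 * L0) (c5 c * \<sigma>2 / \<Delta>\<^sup>2 * sqrt (d * K / N * L0))\<rceil>
     in case emp_means X {..<pN P} (\<lambda>a. if a \<in> S then J else I) s of (mm, s') \<Rightarrow>
       (let asg = (\<lambda>a. arg_min_on (\<lambda>b. ip (pd P) (vdiff (fst (mm a)) (fst (mm b)))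
                                               (vdiff (snd (mm a)) (snd (mm b)))) S)
        in ((\<lambda>b. insert b {a. a < pN P \<and> a \<notin> S \<and> asg a = b}) ` S, s')))"

definition Delta0_sq :: "params \<Rightarrow> real \<Rightarrow> real" where
  "Delta0_sq P \<delta> = (psig P)\<^sup>2 * (ln (real (pK P)) + sqrt (real (pd P)) + ln (ln (6 * real (pN P) / \<delta>)))"

definition Delta_p :: "params \<Rightarrow> real \<Rightarrow> nat \<Rightarrow> real" where
  "Delta_p P \<delta> p = sqrt (Delta0_sq P \<delta>) * 2 powr (- real p / 2)"

definition delta_l :: "real \<Rightarrow> nat \<Rightarrow> real" where
  "delta_l \<delta> l = \<delta> / (6 * (real l + 1) ^ 3)"

definition theta_pl :: "params \<Rightarrow> nat \<Rightarrow> nat \<Rightarrow> real" where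
  "theta_pl P p l = 1 / (real (pK P) * 2 ^ (l - p))"

definition n'_p :: "params \<Rightarrow> real \<Rightarrow> nat \<Rightarrow> nat" where
  "n'_p P \<delta> p = nat \<lceil>c6 (pcHW P) * (psig P)\<^sup>2 / (Delta_p P \<delta> p)\<^sup>2 *
      (ln (3 * real (pK P)^2 / \<delta>) + sqrt (real (pd P) * ln (3 * real (pK P)^2 / \<delta>)))\<rceil>"

definition acb_finish :: "params \<Rightarrow> smp \<Rightarrow> real \<Rightarrow> nat \<Rightarrow> nat set \<Rightarrow> st \<Rightarrow> nat set set \<times> st" where
  "acb_finish P X \<delta> p S s =
     (case emp_means X S (\<lambda>_. n'_p P \<delta> p) s of (mm, s1) \<Rightarrow>
       (let D2 = Min {ip (pd P) (vdiff (fst (mm a)) (fst (mm b))) (vdiff (snd (mm a)) (snd (mm b)))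
                      | a b. a \<in> S \<and> b \<in> S \<and> a \<noteq> b}
        in ADC P X (\<delta> / 3) (sqrt D2 / sqrt 2) S s1))"

fun acb_round :: "params \<Rightarrow> smp \<Rightarrow> (nat \<Rightarrow> nat) \<Rightarrow> real \<Rightarrow> nat \<Rightarrow> nat \<Rightarrow> nat \<Rightarrow> st
                  \<Rightarrow> nat set set option \<times> st" where
  "acb_round P X Us \<delta> l p 0 s = (None, s)"
| "acb_round P X Us \<delta> l p (Suc f) s =
     (case SRI P X Us (delta_l \<delta> l) (Delta_p P \<delta> p) (max (theta_pl P p l) (1 / real (pN P))) s of
        (S, s1) \<Rightarrow> if card S = pK P
                    then (case acb_finish P X \<delta> p S s1 of (G, s2) \<Rightarrow> (Some G, s2))
                    else acb_round P X Us \<delta> l (Suc p) f s1)"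

fun acb_rounds :: "params \<Rightarrow> smp \<Rightarrow> (nat \<Rightarrow> nat) \<Rightarrow> real \<Rightarrow> nat \<Rightarrow> nat set set option \<times> st" where
  "acb_rounds P X Us \<delta> 0 = (None, ((\<lambda>_. 0), 0, 0))"
| "acb_rounds P X Us \<delta> (Suc L) =
     (case acb_rounds P X Us \<delta> L of
        (Some G, s) \<Rightarrow> (Some G, s)
      | (None, s) \<Rightarrow> acb_round P X Us \<delta> L 0 (Suc L) s)"

text \<open>Outcome of ACB*(delta): Some (hat G, budget) if it terminates, None if it runs forever.\<close>
definition ACB :: "params \<Rightarrow> real \<Rightarrow> smp \<times> (nat \<Rightarrow> nat) \<Rightarrow> (nat set set \<times> nat) option" where
  "ACB P \<delta> \<omega> =
     (let X = fst \<omega>; Us = snd \<omega> in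
      if \<exists>L. fst (acb_rounds P X Us \<delta> L) \<noteq> None
      then (case acb_rounds P X Us \<delta> (LEAST L. fst (acb_rounds P X Us \<delta> L) \<noteq> None) of
              (G, s) \<Rightarrow> Some (the G, total s))
      else None)"

definition Omega :: "nat \<Rightarrow> (nat \<Rightarrow> vec measure) \<Rightarrow> (smp \<times> (nat \<Rightarrow> nat)) measure" where
  "Omega N \<nu> = (PiM {..<N} (\<lambda>a. PiM UNIV (\<lambda>k. \<nu> a)))
                \<Otimes>\<^sub>M (PiM UNIV (\<lambda>u. measure_pmf (pmf_of_set {..<N})))"

definition Lstar :: "params \<Rightarrow> real \<Rightarrow> real \<Rightarrow> real \<Rightarrow> real" where
  "Lstar P \<delta> D\<theta> D\<Delta> =
     max 1 (real_of_int \<lceil>log 2 (1 / (D\<theta> * real (pK P)) * max (Delta0_sq P \<delta> / D\<Delta>\<^sup>2) 1)\<rceil>)"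

definition budget_bound :: "params \<Rightarrow> real \<Rightarrow> real \<Rightarrow> real \<Rightarrow> real \<Rightarrow> real \<Rightarrow> real \<Rightarrow> real" where
  "budget_bound P \<delta> c c' c'' \<theta>s \<Delta>s =
    (let N = real (pN P); K = real (pK P); d = real (pd P); \<sigma>2 = (psig P)\<^sup>2;
         L = Lstar P \<delta> \<theta>s \<Delta>s in
     c * N
     + c' * \<sigma>2 / (\<Delta>s\<^sup>2 * \<theta>s) * L * ln (L * K / \<delta>)
         * (ln K + sqrt d + ln (ln L) + ln (ln (N / \<delta>)))
     + c' * L / \<theta>s * ln (L * K / \<delta>)
     + c'' * \<sigma>2 / \<Delta>s\<^sup>2 * (N * ln (N / \<delta>) + sqrt (d * N * K * ln (N / \<delta>))))"

end

theory Submission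
  imports Defs
begin

text \<open>
  The algorithm reads every sample and every uniform draw exactly once, so it can be run on a stream
  from which each read block is dropped; after a block has been read, the remaining stream is
  independent of it and distributed as before. The failure probability is therefore bounded by
  induction along the program, written in continuation passing style.

  Every test compares an inner product of two independent empirical differences with its mean; the
  deviation is the sum of a linear and a bilinear form of the noise, controlled by a Chernoff bound
  and by the Hanson-Wright inequality. Within SRI the remaining failure probability is dominated by a
  potential that contains an exponential moment of the samples spent beyond the planned ones. Calls
  of SRI fail with total probability \<open>\<delta> / 6\<close>, the estimate of the smallest gap with \<open>2 \<delta> / 3\<close> and
  ADC with \<open>\<delta> / 9\<close>. The round \<open>l\<close> with \<open>2 ^ l \<approx> max (\<Delta>\<^sub>0\<^sup>2 / \<Delta>\<^sub>*\<^sup>2) 1 / (\<theta>\<^sub>* K)\<close> contains a pair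
  of guesses for which SRI returns one arm per group, and the cost of the rounds up to this one is a
  geometric sum.
\<close>

section \<open>Tail bounds for blocks of sub-Gaussian noise\<close>

text \<open>Two features of the algorithm shape the proof. First, block sizes are random: a test
  goes on or stops depending on earlier blocks, and ADC takes its sizes from an estimated gap. In
  continuation form a block is integrated out with everything before it fixed, so its size is a
  constant when a tail bound is applied to it; later bounds therefore hold for arbitrary stored
  means that satisfy a deterministic condition (\<open>good\<close>, \<open>gap_ok\<close>). Second,
  most guesses of gap and group proportion are wrong. What SRI ensures for every guess, up to its
  failure probability, is separation: accepted arms have squared distance above
  \<open>\<Delta>^2 / 16\<close>. So K accepted arms meet each group exactly once, whatever the
  guesses were, and the finishing phase starts correctly; valid guesses only serve to show that K
  arms are found. The cap T_max bounds the samples of a call up to the overrun of one draw.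
  Correctness and budget are thus parts of one event, and the two claims are projections of
  it.\<close>

lemma ip_nonneg [simp]: "0 \<le> ip d x x"
  by (simp add: ip_def sum_nonneg)

lemma ip_self: "ip d x x = (\<Sum>i<d. (x i)\<^sup>2)"
  by (simp add: ip_def power2_eq_square)

lemma vnorm_squared [simp]: "(vnorm d x)\<^sup>2 = ip d x x"
  by (simp add: vnorm_def)

lemma vnorm_nonneg [simp]: "0 \<le> vnorm d x"
  by (simp add: vnorm_def)

lemma ip_Cauchy_Schwarz: "(ip d x y)\<^sup>2 \<le> ip d x x * ip d y y"
  unfolding ip_def using Cauchy_Schwarz_ineq_sum[of x y "{..<d}"] by (simp add: power2_eq_square)

lemma ip_le_vnorm: "ip d x y \<le> vnorm d x * vnorm d y"
proof -
  have "(ip d x y)\<^sup>2 \<le> (vnorm d x * vnorm d y)\<^sup>2"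
    using ip_Cauchy_Schwarz by (simp add: power_mult_distrib)
  then show ?thesis by (rule power2_le_imp_le) simp
qed

text \<open>Crude, but it makes the set behind \<open>mat_opnorm\<close> bounded above, which gives
  its \<open>Sup\<close> a meaning.\<close>

lemma vnorm_matvec_bounded: "vnorm d (matvec d M x) \<le> sqrt (frob2 d M) * vnorm d x"
proof -
  have "ip d (matvec d M x) (matvec d M x) \<le> (\<Sum>i<d. (\<Sum>j<d. (M i j)\<^sup>2) * (\<Sum>j<d. (x j)\<^sup>2))"
    unfolding ip_self matvec_def by (intro sum_mono Cauchy_Schwarz_ineq_sum)
  also have "\<dots> = frob2 d M * ip d x x"
    by (simp add: frob2_def ip_self sum_distrib_right)
  finally show ?thesis
    by (simp add: vnorm_def real_sqrt_mult[symmetric])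
qed

lemma bdd_above_opnorm: "bdd_above {vnorm d (matvec d M x) | x. vnorm d x \<le> 1}"
proof (rule bdd_aboveI[of _ "sqrt (frob2 d M)"], safe)
  fix x assume "vnorm d x \<le> 1"
  then have "sqrt (frob2 d M) * vnorm d x \<le> sqrt (frob2 d M) * 1"
    by (intro mult_left_mono) (auto simp: frob2_def sum_nonneg)
  with vnorm_matvec_bounded[of d M x] show "vnorm d (matvec d M x) \<le> sqrt (frob2 d M)" by simp
qed

lemma matvec_scale: "matvec d M (\<lambda>i. c * x i) = (\<lambda>i. c * matvec d M x i)"
  by (simp add: matvec_def sum_distrib_left mult.left_commute)

lemma ip_scale: "ip d (\<lambda>i. a * x i) (\<lambda>i. b * y i) = a * b * ip d x y"
  by (simp add: ip_def sum_distrib_left algebra_simps)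

lemma vnorm_scale: "vnorm d (\<lambda>i. c * x i) = \<bar>c\<bar> * vnorm d x"
  by (simp add: vnorm_def ip_scale real_sqrt_mult)

lemma vnorm_matvec_le: "vnorm d (matvec d M x) \<le> mat_opnorm d M * vnorm d x"
proof (cases "vnorm d x = 0")
  case True
  then show ?thesis using vnorm_matvec_bounded[of d M x] by simp
next
  case False
  let ?y = "\<lambda>i. (1 / vnorm d x) * x i"
  have pos: "vnorm d x > 0" using False vnorm_nonneg[of d x] by linarith
  have "vnorm d ?y = 1" using pos by (simp only: vnorm_scale) simp
  then have "vnorm d (matvec d M ?y) \<le> mat_opnorm d M"
    unfolding mat_opnorm_def by (intro cSup_upper bdd_above_opnorm) (auto intro!: exI[of _ ?y])
  then have "1 / vnorm d x * vnorm d (matvec d M x) \<le> mat_opnorm d M"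
    using pos by (simp only: matvec_scale vnorm_scale) simp
  then show ?thesis using pos by (simp add: field_simps)
qed

lemma mat_opnorm_le:
  assumes "0 \<le> O'" and "\<And>x. ip d (matvec d M x) (matvec d M x) \<le> O'\<^sup>2 * ip d x x"
  shows "mat_opnorm d M \<le> O'"
  unfolding mat_opnorm_def
proof (rule cSup_least)
  have "vnorm d (\<lambda>_. 0) \<le> 1" by (simp add: vnorm_def ip_def)
  then show "{vnorm d (matvec d M x) |x. vnorm d x \<le> 1} \<noteq> {}" by blast
  fix y assume "y \<in> {vnorm d (matvec d M x) |x. vnorm d x \<le> 1}"
  then obtain x where x: "y = vnorm d (matvec d M x)" "vnorm d x \<le> 1" by auto
  have "ip d x x \<le> 1" using x(2) by (simp add: vnorm_def)
  then have "O'\<^sup>2 * ip d x x \<le> O'\<^sup>2 * 1" by (intro mult_left_mono) auto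
  then have "y\<^sup>2 \<le> O'\<^sup>2" using assms(2)[of x] x(1) by simp
  then show "y \<le> O'" by (rule power2_le_imp_le) (rule assms(1))
qed

lemma ip_matvec_symmetric:
  assumes "mat_symmetric d M"
  shows "ip d x (matvec d M y) = ip d (matvec d M x) y"
proof -
  have "ip d x (matvec d M y) = (\<Sum>i<d. \<Sum>j<d. x i * M i j * y j)"
    by (simp add: ip_def matvec_def sum_distrib_left mult.assoc)
  also have "\<dots> = (\<Sum>j<d. \<Sum>i<d. x i * M j i * y j)"
    using assms by (subst sum.swap) (auto intro!: sum.cong simp: mat_symmetric_def)
  also have "\<dots> = ip d (matvec d M x) y"
    by (simp add: ip_def matvec_def sum_distrib_left sum_distrib_right algebra_simps)
  finally show ?thesis .
qed

lemma matvec_mult_eq: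
  assumes "mat_mult_eq d A B C" "i < d"
  shows "matvec d A (matvec d B x) i = matvec d C x i"
proof -
  have "matvec d A (matvec d B x) i = (\<Sum>j<d. \<Sum>k<d. A i j * B j k * x k)"
    by (simp add: matvec_def sum_distrib_left mult.assoc)
  also have "\<dots> = (\<Sum>k<d. (\<Sum>j<d. A i j * B j k) * x k)"
    by (subst sum.swap) (simp add: sum_distrib_right)
  also have "\<dots> = matvec d C x i" using assms by (auto simp: matvec_def mat_mult_eq_def intro!: sum.cong)
  finally show ?thesis .
qed

text \<open>For symmetric R the squared length of R x is <x, R R x> = <x, S x>, which Cauchy-Schwarz
  and the operator norm of S control. This is how the bound on the covariance proxy reaches its
  square root.\<close>

lemma sqrt_matrix_bounded:
  assumes "mat_symmetric d R" "mat_mult_eq d R R S" "mat_opnorm d S \<le> s"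
  shows "ip d (matvec d R x) (matvec d R x) \<le> s * ip d x x"
proof -
  have "ip d (matvec d R x) (matvec d R x) = ip d x (matvec d R (matvec d R x))"
    using assms(1) by (simp add: ip_matvec_symmetric)
  also have "\<dots> = ip d x (matvec d S x)"
    using matvec_mult_eq[OF assms(2)] by (auto simp: ip_def intro!: sum.cong)
  also have "\<dots> \<le> vnorm d x * vnorm d (matvec d S x)" by (rule ip_le_vnorm)
  also have "\<dots> \<le> vnorm d x * (s * vnorm d x)"
    using order_trans[OF vnorm_matvec_le[of d S x] mult_right_mono[OF assms(3) vnorm_nonneg]]
    by (intro mult_left_mono) auto
  also have "\<dots> = s * ip d x x" using vnorm_squared[of d x] by (simp add: power2_eq_square)
  finally show ?thesis .
qed

text \<open>Transposing T R = 1 gives R T' = 1 for the transpose T' of T, and then T = T (R T') =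
  T'. An arm is standardised by T, and recovering its noise from the standardised coordinates uses R
  T = 1.\<close>

lemma symmetric_left_inverse_is_right_inverse:
  assumes "mat_symmetric d R" "mat_mult_eq d T R mat_id"
  shows "mat_mult_eq d R T mat_id"
proof -
  let ?T' = "\<lambda>i j. T j i"
  have RT': "mat_mult_eq d R ?T' mat_id"
    unfolding mat_mult_eq_def
  proof safe
    fix i j assume "i < d" "j < d"
    then have "(\<Sum>k<d. R i k * T j k) = (\<Sum>k<d. T j k * R k i)"
      using assms(1) by (auto intro!: sum.cong simp: mat_symmetric_def)
    also have "\<dots> = mat_id i j" using assms(2) \<open>i < d\<close> \<open>j < d\<close> by (auto simp: mat_mult_eq_def mat_id_def)
    finally show "(\<Sum>k<d. R i k * T j k) = mat_id i j" .
  qed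
  have "T i j = T j i" if ij: "i < d" "j < d" for i j
  proof -
    let ?e = "\<lambda>k. T j k"
    have 1: "matvec d T (matvec d R ?e) i = matvec d mat_id ?e i"
      by (rule matvec_mult_eq[OF assms(2) ij(1)])
    have "matvec d T (matvec d R ?e) i = (\<Sum>k<d. T i k * mat_id k j)"
      unfolding matvec_def using RT' ij by (auto simp: mat_mult_eq_def intro!: sum.cong)
    also have "\<dots> = (\<Sum>k<d. if k = j then T i k else 0)" by (intro sum.cong refl) (simp add: mat_id_def)
    also have "\<dots> = T i j" using ij by simp
    finally have "T i j = matvec d mat_id ?e i" using 1 by simp
    also have "\<dots> = (\<Sum>k<d. if i = k then T j k else 0)" unfolding matvec_def by (intro sum.cong refl) (simp add: mat_id_def)
    also have "\<dots> = T j i" using ij by simp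
    finally show ?thesis .
  qed
  then show ?thesis using RT' by (auto simp: mat_mult_eq_def)
qed

section \<open>Quadratic and linear forms in independent sub-Gaussian blocks\<close>

lemma sum_blocks: "(\<Sum>p<Q*d. f p) = (\<Sum>B<Q. \<Sum>i<d. f (B*d+i))" for f :: "nat \<Rightarrow> real"
proof -
  have "(\<Sum>i<d. f (B*d+i)) = sum f {B*d..<B*d+d}" for B
    by (simp add: sum.shift_bounds_nat_ivl[of f 0 "B*d" d, simplified] lessThan_atLeast0 add.commute)
  then show ?thesis by (simp add: sum.nat_group)
qed

text \<open>The right side is (exp(x/2) - exp(-x/2))^2, and exp(x/2) - exp(-x/2) >= x for x >= 0. It
  turns the exponential moments at 1 and -1 into a second moment.\<close>

lemma one_plus_square_le_exp_sum: "x\<^sup>2 \<le> exp x + exp (- x) - 2" for x :: real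
proof -
  have *: "y\<^sup>2 \<le> exp y + exp (- y) - 2" if "0 \<le> y" for y :: real
  proof -
    let ?h = "\<lambda>y::real. exp (y/2) - exp (-(y/2)) - y"
    have "?h 0 \<le> ?h y"
    proof (rule DERIV_nonneg_imp_nondecreasing[OF that])
      fix x assume "0 \<le> x" "x \<le> y"
      have "(?h has_real_derivative (exp (x/2)/2 + exp (-(x/2))/2 - 1)) (at x)"
        by (auto intro!: derivative_eq_intros)
      moreover have "0 \<le> exp (x/2)/2 + exp (-(x/2))/2 - 1"
        using exp_ge_add_one_self[of "x/2"] exp_ge_add_one_self[of "-(x/2)"] by linarith
      ultimately show "\<exists>z. (?h has_real_derivative z) (at x) \<and> 0 \<le> z" by blast
    qed
    then have "y \<le> exp (y/2) - exp (-(y/2))" by simp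
    then have "y\<^sup>2 \<le> (exp (y/2) - exp (-(y/2)))\<^sup>2" using that by (intro power_mono) auto
    also have "\<dots> = (exp (y/2))\<^sup>2 + (exp (-(y/2)))\<^sup>2 - 2 * (exp (y/2) * exp (-(y/2)))"
      by (simp add: power2_diff)
    also have "\<dots> = exp y + exp (-y) - 2" by (simp add: exp_double[symmetric] exp_add[symmetric])
    finally show ?thesis .
  qed
  show ?thesis using *[of x] *[of "-x"] by (cases "0 \<le> x") auto
qed

lemma abs_le_exp_sum: "\<bar>x\<bar> \<le> exp x + exp (- x)" for x :: real
proof -
  have "\<bar>x\<bar> \<le> exp \<bar>x\<bar>" using exp_ge_add_one_self[of "\<bar>x\<bar>"] by linarith
  also have "\<dots> \<le> exp x + exp (-x)" by (cases "0 \<le> x") auto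
  finally show ?thesis .
qed

text \<open>Q noise vectors of dimension d driven by one family of Q*d scalars. Flattening the index
  to \<open>B*d+i\<close> lets the Hanson-Wright inequality, which speaks of a single vector, act on
  several empirical means at once. \<open>v B\<close> is the variance proxy of block B.\<close>

locale noise_blocks = prob_space M for M :: "'a measure" +
  fixes d Q :: nat and A :: "nat \<Rightarrow> mat" and v :: "nat \<Rightarrow> real" and Y :: "nat \<Rightarrow> 'a \<Rightarrow> real"
  assumes d_pos: "0 < d" and Q_pos: "0 < Q"
    and indep: "indep_vars (\<lambda>_. borel) Y {..<Q*d}"
    and mgf_int: "\<And>p t. p < Q*d \<Longrightarrow> integrable M (\<lambda>x. exp (t * Y p x))"
    and mgf_le: "\<And>p t. p < Q*d \<Longrightarrow> expectation (\<lambda>x. exp (t * Y p x)) \<le> exp (t\<^sup>2/2)"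
    and A_sym: "\<And>B. B < Q \<Longrightarrow> mat_symmetric d (A B)"
    and v_pos: "\<And>B. B < Q \<Longrightarrow> 0 < v B"
    and A_bound: "\<And>B x. B < Q \<Longrightarrow> ip d (matvec d (A B) x) (matvec d (A B) x) \<le> v B * ip d x x"
begin

definition w :: "nat \<Rightarrow> 'a \<Rightarrow> vec" where
  "w B \<omega> = matvec d (A B) (\<lambda>j. Y (B*d+j) \<omega>)"

lemma Y_meas [measurable]: "p < Q*d \<Longrightarrow> Y p \<in> borel_measurable M"
  using indep by (auto simp: indep_vars_def)

lemma idx: "B < Q \<Longrightarrow> j < d \<Longrightarrow> B*d+j < Q*d"
proof -
  assume "B < Q" "j < d"
  then have "B*d+j < Suc B * d" "Suc B * d \<le> Q*d" by (simp, intro mult_right_mono, auto)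
  then show ?thesis by linarith
qed

lemma Y_integrable: assumes "p < Q*d" shows "integrable M (Y p)"
proof (rule Bochner_Integration.integrable_bound)
  show "integrable M (\<lambda>x. exp (1 * Y p x) + exp (-1 * Y p x))"
    using assms by (intro Bochner_Integration.integrable_add mgf_int)
  show "AE x in M. norm (Y p x) \<le> norm (exp (1 * Y p x) + exp (-1 * Y p x))"
    using abs_le_exp_sum by (auto simp: add_nonneg_nonneg)
qed (use assms in simp)

text \<open>Centering comes out of the exponential moments: 1 + s t E Y <= E exp(s t Y) <=
  exp(t^2/2) <= 1 + t^2. Dividing by t leaves a bound that vanishes with t, which
  \<open>Y_mean\<close> uses for both signs s.\<close>

lemma Y_mean_le:
  assumes p: "p < Q*d" and t: "0 < t" "t \<le> 1" and s: "s = 1 \<or> s = -1"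
  shows "s * expectation (Y p) \<le> t"
proof -
  have "1 + s * t * expectation (Y p) = expectation (\<lambda>x. 1 + s * t * Y p x)"
    using Y_integrable[OF p] by (simp add: prob_space)
  also have "\<dots> \<le> expectation (\<lambda>x. exp (s * t * Y p x))"
    using Y_integrable[OF p] mgf_int[OF p, of "s * t"] by (intro integral_mono) auto
  also have "\<dots> \<le> exp ((s*t)\<^sup>2/2)" by (rule mgf_le[OF p])
  also have "\<dots> \<le> 1 + t\<^sup>2"
  proof -
    have "t\<^sup>2 \<le> 1" using t by (simp add: power_le_one)
    have "(s*t)\<^sup>2 = t\<^sup>2" using s by (auto simp: power2_eq_square)
    moreover have "exp (t\<^sup>2/2) \<le> 1 + t\<^sup>2/2 + (t\<^sup>2/2)\<^sup>2"
      using \<open>t\<^sup>2 \<le> 1\<close> by (intro exp_bound) auto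
    moreover have "(t\<^sup>2/2)\<^sup>2 \<le> t\<^sup>2/2"
    proof -
      have "(t\<^sup>2/2) * (t\<^sup>2/2) \<le> (t\<^sup>2/2) * 1" using \<open>t\<^sup>2 \<le> 1\<close> by (intro mult_left_mono) auto
      then show ?thesis by (simp add: power2_eq_square)
    qed
    ultimately show ?thesis by simp
  qed
  finally have "t * (s * expectation (Y p)) \<le> t * t" by (simp add: power2_eq_square algebra_simps)
  then show ?thesis using t by simp
qed

lemma Y_mean [simp]: assumes p: "p < Q*d" shows "expectation (Y p) = 0"
proof -
  have "s * expectation (Y p) \<le> 0" if s: "s = 1 \<or> s = -1" for s
  proof (rule field_le_epsilon)
    fix e :: real assume "0 < e"
    then show "s * expectation (Y p) \<le> 0 + e"
      using Y_mean_le[OF p, of "min e 1" s] s by auto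
  qed
  from this[of 1] this[of "-1"] show ?thesis by simp
qed

lemma Y_square: assumes p: "p < Q*d"
  shows "integrable M (\<lambda>x. (Y p x)\<^sup>2)" "expectation (\<lambda>x. (Y p x)\<^sup>2) \<le> 2"
proof -
  have i: "integrable M (\<lambda>x. exp (1 * Y p x) + exp (-1 * Y p x) - 2)"
    using mgf_int[OF p, of 1] mgf_int[OF p, of "-1"] by (intro Bochner_Integration.integrable_diff Bochner_Integration.integrable_add) auto
  show 1: "integrable M (\<lambda>x. (Y p x)\<^sup>2)"
  proof (rule Bochner_Integration.integrable_bound[OF i])
    have "\<bar>(Y p x)\<^sup>2\<bar> \<le> \<bar>exp (Y p x) + exp (- Y p x) - 2\<bar>" for x
      using one_plus_square_le_exp_sum[of "Y p x"] by (simp add: abs_real_def)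
    then show "AE x in M. norm ((Y p x)\<^sup>2) \<le> norm (exp (1 * Y p x) + exp (-1 * Y p x) - 2)" by simp
  qed (use p in measurable)
  have "expectation (\<lambda>x. (Y p x)\<^sup>2) \<le> expectation (\<lambda>x. exp (1 * Y p x) + exp (-1 * Y p x) - 2)"
    using one_plus_square_le_exp_sum by (intro integral_mono 1 i) auto
  also have "\<dots> = expectation (\<lambda>x. exp (1 * Y p x)) + expectation (\<lambda>x. exp (-1 * Y p x)) - 2"
    using mgf_int[OF p, of 1] mgf_int[OF p, of "-1"] by (simp add: prob_space)
  also have "\<dots> \<le> exp (1/2) + exp (1/2) - 2"
    using mgf_le[OF p, of 1] mgf_le[OF p, of "-1"] by simp
  also have "\<dots> \<le> 2"
  proof -
    have "exp (1/2::real) \<le> 1 + 1/2 + (1/2)\<^sup>2" by (intro exp_bound) auto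
    then show ?thesis by (simp add: power2_eq_square)
  qed
  finally show "expectation (\<lambda>x. (Y p x)\<^sup>2) \<le> 2" .
qed

lemma Y_prod:
  assumes "p < Q*d" "q < Q*d" "p \<noteq> q"
  shows "integrable M (\<lambda>x. Y p x * Y q x)" "expectation (\<lambda>x. Y p x * Y q x) = 0"
proof -
  have i: "indep_vars (\<lambda>_. borel) Y {p,q}" using indep by (rule indep_vars_subset) (use assms in auto)
  have int: "integrable M (Y j)" if "j \<in> {p,q}" for j using that assms Y_integrable by auto
  show "integrable M (\<lambda>x. Y p x * Y q x)" 
    using indep_vars_integrable[OF _ i int] assms(3) by simp
  show "expectation (\<lambda>x. Y p x * Y q x) = 0"
    using indep_vars_lebesgue_integral[OF _ i int] assms by simp
qed

lemma quadf_expectation: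
  "expectation (\<lambda>\<omega>. quadf (Q*d) \<Gamma> (\<lambda>p. Y p \<omega>)) = (\<Sum>p<Q*d. \<Gamma> p p * expectation (\<lambda>\<omega>. (Y p \<omega>)\<^sup>2))"
proof -
  have int: "integrable M (\<lambda>\<omega>. Y p \<omega> * \<Gamma> p q * Y q \<omega>)" if "p < Q*d" "q < Q*d" for p q
  proof -
    have "integrable M (\<lambda>\<omega>. \<Gamma> p q * (Y p \<omega> * Y q \<omega>))"
      using Y_prod(1)[OF that] Y_square(1)[OF that(1)]
      by (cases "p = q") (auto simp: power2_eq_square)
    then show ?thesis by (simp add: mult.left_commute mult.assoc mult.commute)
  qed
  have ex: "expectation (\<lambda>\<omega>. Y p \<omega> * \<Gamma> p q * Y q \<omega>) = (if q = p then \<Gamma> p p * expectation (\<lambda>\<omega>. (Y p \<omega>)\<^sup>2) else 0)"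
    if "p < Q*d" "q < Q*d" for p q
  proof -
    have "expectation (\<lambda>\<omega>. Y p \<omega> * \<Gamma> p q * Y q \<omega>) = expectation (\<lambda>\<omega>. \<Gamma> p q * (Y p \<omega> * Y q \<omega>))"
      by (simp add: algebra_simps)
    then show ?thesis using Y_prod(2)[OF that] by (auto simp: power2_eq_square)
  qed
  have "expectation (\<lambda>\<omega>. quadf (Q*d) \<Gamma> (\<lambda>p. Y p \<omega>)) =
     (\<Sum>p<Q*d. \<Sum>q<Q*d. expectation (\<lambda>\<omega>. Y p \<omega> * \<Gamma> p q * Y q \<omega>))"
    unfolding quadf_def using int by (subst Bochner_Integration.integral_sum) (auto intro!: Bochner_Integration.integrable_sum sum.cong Bochner_Integration.integral_sum)
  also have "\<dots> = (\<Sum>p<Q*d. \<Gamma> p p * expectation (\<lambda>\<omega>. (Y p \<omega>)\<^sup>2))"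
    using ex by (intro sum.cong refl) simp
  finally show ?thesis .
qed

lemma quadf_restrict: "quadf m \<Gamma> (restrict y {..<m}) = quadf m \<Gamma> y"
  by (simp add: quadf_def)

text \<open>Inverted form of the inequality: the exponent t is prescribed and the threshold x must
  satisfy one condition per norm, so that upper bounds on the two norms and on the mean are
  enough.\<close>

lemma hanson_wright_quadf:
  assumes hw: "hanson_wright c" and c: "0 < c" and t: "0 \<le> t" and x: "0 < x"
    and F: "frob2 (Q*d) \<Gamma> \<le> F" and O': "0 \<le> O'" "\<And>y. ip (Q*d) (matvec (Q*d) \<Gamma> y) (matvec (Q*d) \<Gamma> y) \<le> O'\<^sup>2 * ip (Q*d) y y"
    and bF: "c * t * F \<le> x\<^sup>2" and bO: "c * t * O' \<le> x"
    and E: "(\<Sum>p<Q*d. \<Gamma> p p * expectation (\<lambda>\<omega>. (Y p \<omega>)\<^sup>2)) \<le> e"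
  shows "prob {\<omega> \<in> space M. quadf (Q*d) \<Gamma> (\<lambda>p. Y p \<omega>) > e + x} \<le> exp (- t)"
\<comment> \<open>For the zero matrix both quotients in the Hanson-Wright bound are divisions by
  zero, hence 0, and the bound is the trivial 1. The form is then 0 and cannot exceed e + x >
  0.\<close>
proof (cases "\<forall>p<Q*d. \<forall>q<Q*d. \<Gamma> p q = 0")
  case True
  then have z: "quadf (Q*d) \<Gamma> y = 0" for y by (simp add: quadf_def)
  have "e \<ge> 0" using E True by simp
  then have "{\<omega> \<in> space M. quadf (Q*d) \<Gamma> (\<lambda>p. Y p \<omega>) > e + x} = {}" using x by (auto simp: z)
  then show ?thesis by (simp only: measure_empty exp_ge_zero)
next
  case False
  then obtain p q where pq: "p < Q*d" "q < Q*d" "\<Gamma> p q \<noteq> 0" by auto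
  let ?m = "Q*d"
  let ?P = "\<lambda>p. distr M borel (Y p)"
  let ?PM = "PiM {..<?m} ?P"
  have ne: "{..<?m} \<noteq> {}" using pq by auto
  have eq: "distr M (PiM {..<?m} (\<lambda>_. borel)) (\<lambda>x. \<lambda>i\<in>{..<?m}. Y i x) = ?PM"
    using indep_vars_iff_distr_eq_PiM'[OF ne, where M'="\<lambda>_. borel" and X=Y] indep by simp
  have sub: "subG1 (?P i) \<and> integrable (?P i) (\<lambda>y. y) \<and> (\<integral>y. y \<partial>?P i) = 0" if "i < ?m" for i
    unfolding subG1_def using that mgf_int[OF that] mgf_le[OF that] Y_integrable[OF that]
    by (auto intro!: prob_space_distr simp: integrable_distr_eq integral_distr)
  have [measurable]: "quadf ?m \<Gamma> \<in> borel_measurable (PiM {..<?m} (\<lambda>_. borel))"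
    unfolding quadf_def by measurable
  have Ymap [measurable]: "(\<lambda>x. \<lambda>i\<in>{..<?m}. Y i x) \<in> measurable M (PiM {..<?m} (\<lambda>_. borel))"
    by (intro measurable_restrict) auto
  have int: "(\<integral>z. quadf ?m \<Gamma> z \<partial>?PM) = expectation (\<lambda>\<omega>. quadf ?m \<Gamma> (\<lambda>p. Y p \<omega>))"
    unfolding eq[symmetric] by (subst integral_distr) (auto simp: quadf_restrict)
  have "prob {\<omega> \<in> space M. quadf ?m \<Gamma> (\<lambda>p. Y p \<omega>) > e + x} \<le>
        prob {\<omega> \<in> space M. quadf ?m \<Gamma> (\<lambda>p. Y p \<omega>) - (\<integral>z. quadf ?m \<Gamma> z \<partial>?PM) > x}"
    using E unfolding int quadf_expectation
    by (intro finite_measure_mono) (auto simp: quadf_def)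
  also have "\<dots> = measure ?PM {y \<in> space ?PM. quadf ?m \<Gamma> y - (\<integral>z. quadf ?m \<Gamma> z \<partial>?PM) > x}"
    unfolding eq[symmetric]
    by (subst measure_distr) (auto intro!: arg_cong[where f=prob] simp: quadf_restrict space_PiM)
  also have "\<dots> \<le> exp (- (1 / c) * min (x\<^sup>2 / frob2 ?m \<Gamma>) (x / mat_opnorm ?m \<Gamma>))"
    using hw[unfolded hanson_wright_def, rule_format, of ?m ?P x \<Gamma>] sub by blast
  also have "\<dots> \<le> exp (- t)"
  proof -
    have F0: "0 < frob2 ?m \<Gamma>"
    proof -
      have "0 < (\<Gamma> p q)\<^sup>2" using pq by simp
      also have "\<dots> \<le> (\<Sum>j<?m. (\<Gamma> p j)\<^sup>2)" using pq by (intro member_le_sum) auto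
      also have "\<dots> \<le> frob2 ?m \<Gamma>" unfolding frob2_def using pq by (intro member_le_sum[of p]) (auto simp: sum_nonneg)
      finally show ?thesis .
    qed
    have O0: "0 < mat_opnorm ?m \<Gamma>"
    proof -
      let ?e = "\<lambda>j. if j = q then 1 else 0 :: real"
      have mv: "matvec ?m \<Gamma> ?e i = \<Gamma> i q" for i using pq by (simp add: matvec_def if_distrib cong: if_cong)
      have "ip ?m ?e ?e = 1" using pq by (simp add: ip_def if_distrib cong: if_cong)
      then have e1: "vnorm ?m ?e = 1" by (simp add: vnorm_def)
      have "0 < (\<Gamma> p q)\<^sup>2" using pq by simp
      also have "\<dots> \<le> ip ?m (matvec ?m \<Gamma> ?e) (matvec ?m \<Gamma> ?e)" unfolding ip_self mv
        using pq by (intro member_le_sum[of p]) auto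
      finally have "0 < vnorm ?m (matvec ?m \<Gamma> ?e)" by (simp add: vnorm_def)
      then show ?thesis using vnorm_matvec_le[of ?m \<Gamma> ?e] e1 by simp
    qed
    have "mat_opnorm ?m \<Gamma> \<le> O'" by (rule mat_opnorm_le[OF O'])
    then have "c * t * mat_opnorm ?m \<Gamma> \<le> x" using bO c t by (meson mult_left_mono mult_nonneg_nonneg order_trans less_imp_le)
    moreover have "c * t * frob2 ?m \<Gamma> \<le> x\<^sup>2" using bF F c t by (meson mult_left_mono mult_nonneg_nonneg order_trans less_imp_le)
    ultimately have "c * t \<le> min (x\<^sup>2 / frob2 ?m \<Gamma>) (x / mat_opnorm ?m \<Gamma>)"
      using F0 O0 by (simp add: field_simps)
    then have "t \<le> (1 / c) * min (x\<^sup>2 / frob2 ?m \<Gamma>) (x / mat_opnorm ?m \<Gamma>)"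
      using c by (simp add: field_simps)
    then show ?thesis by simp
  qed
  finally show ?thesis .
qed

text \<open>Block (B, C) is \<open>\<beta> B C\<close> times the transpose of \<open>A B\<close>
  times \<open>A C\<close>. This is the matrix, in the coordinates Y, of the form with weights
  \<beta> in the inner products of the vectors w.\<close>

definition \<Gamma> :: "(nat \<Rightarrow> nat \<Rightarrow> real) \<Rightarrow> mat" where
  "\<Gamma> \<beta> p q = \<beta> (p div d) (q div d) * (\<Sum>k<d. A (p div d) k (p mod d) * A (q div d) k (q mod d))"

lemma \<Gamma>_block: "i < d \<Longrightarrow> j < d \<Longrightarrow> \<Gamma> \<beta> (B*d+i) (C*d+j) = \<beta> B C * (\<Sum>k<d. A B k i * A C k j)"
  by (simp add: \<Gamma>_def)

lemma quadf_\<Gamma>: "quadf (Q*d) (\<Gamma> \<beta>) (\<lambda>p. Y p \<omega>) = (\<Sum>B<Q. \<Sum>C<Q. \<beta> B C * ip d (w B \<omega>) (w C \<omega>))"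
proof -
  have "quadf (Q*d) (\<Gamma> \<beta>) (\<lambda>p. Y p \<omega>) =
    (\<Sum>B<Q. \<Sum>i<d. \<Sum>C<Q. \<Sum>j<d. Y (B*d+i) \<omega> * \<Gamma> \<beta> (B*d+i) (C*d+j) * Y (C*d+j) \<omega>)"
    unfolding quadf_def by (simp add: sum_blocks)
  also have "\<dots> = (\<Sum>B<Q. \<Sum>C<Q. \<Sum>i<d. \<Sum>j<d. Y (B*d+i) \<omega> * \<Gamma> \<beta> (B*d+i) (C*d+j) * Y (C*d+j) \<omega>)"
    by (intro sum.cong refl sum.swap)
  also have "\<dots> = (\<Sum>B<Q. \<Sum>C<Q. \<beta> B C * ip d (w B \<omega>) (w C \<omega>))"
  proof (intro sum.cong refl)
    fix B C
    have "(\<Sum>i<d. \<Sum>j<d. Y (B*d+i) \<omega> * \<Gamma> \<beta> (B*d+i) (C*d+j) * Y (C*d+j) \<omega>)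
       = (\<Sum>i<d. \<Sum>j<d. \<Sum>k<d. \<beta> B C * ((A B k i * Y (B*d+i) \<omega>) * (A C k j * Y (C*d+j) \<omega>)))"
    proof (intro sum.cong refl)
      fix i j assume "i \<in> {..<d}" "j \<in> {..<d}"
      then show "Y (B*d+i) \<omega> * \<Gamma> \<beta> (B*d+i) (C*d+j) * Y (C*d+j) \<omega> =
        (\<Sum>k<d. \<beta> B C * ((A B k i * Y (B*d+i) \<omega>) * (A C k j * Y (C*d+j) \<omega>)))"
        by (simp add: \<Gamma>_block sum_distrib_left sum_distrib_right mult.assoc mult.left_commute mult.commute)
    qed
    also have "\<dots> = (\<Sum>i<d. \<Sum>k<d. \<Sum>j<d. \<beta> B C * ((A B k i * Y (B*d+i) \<omega>) * (A C k j * Y (C*d+j) \<omega>)))"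
      by (intro sum.cong refl sum.swap)
    also have "\<dots> = (\<Sum>k<d. \<Sum>i<d. \<Sum>j<d. \<beta> B C * ((A B k i * Y (B*d+i) \<omega>) * (A C k j * Y (C*d+j) \<omega>)))"
      by (rule sum.swap)
    also have "\<dots> = \<beta> B C * ip d (w B \<omega>) (w C \<omega>)"
      unfolding ip_def w_def matvec_def sum_product sum_distrib_left[of "\<beta> B C"] ..
    finally show "(\<Sum>i<d. \<Sum>j<d. Y (B*d+i) \<omega> * \<Gamma> \<beta> (B*d+i) (C*d+j) * Y (C*d+j) \<omega>) = \<beta> B C * ip d (w B \<omega>) (w C \<omega>)" .
  qed
  finally show ?thesis .
qed

lemma A_col_bound: assumes "B < Q" "j < d" shows "(\<Sum>k<d. (A B k j)\<^sup>2) \<le> v B"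
proof -
  let ?e = "\<lambda>i. if i = j then 1 else 0 :: real"
  have "matvec d (A B) ?e i = A B i j" for i using assms by (simp add: matvec_def if_distrib cong: if_cong)
  moreover have "ip d ?e ?e = 1" using assms by (simp add: ip_def if_distrib cong: if_cong)
  ultimately show ?thesis using A_bound[OF assms(1), of ?e] by (simp add: ip_self)
qed

lemma A_transpose_bound: assumes "B < Q"
  shows "(\<Sum>i<d. (\<Sum>k<d. A B k i * z k)\<^sup>2) \<le> v B * (\<Sum>k<d. (z k)\<^sup>2)"
proof -
  have "(\<Sum>i<d. (\<Sum>k<d. A B k i * z k)\<^sup>2) = ip d (matvec d (A B) z) (matvec d (A B) z)"
    unfolding ip_self matvec_def using A_sym[OF assms] by (auto simp: mat_symmetric_def intro!: sum.cong arg_cong[where f="\<lambda>x. x\<^sup>2"])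
  then show ?thesis using A_bound[OF assms, of z] by (simp add: ip_self)
qed

text \<open>Squared Frobenius norm of the Q x Q matrix with entries \<beta> B C sqrt(v B v C). It
  bounds the squared operator norm of the whole form and, up to the factor d, its squared Frobenius
  norm.\<close>

definition \<phi>2 :: "(nat \<Rightarrow> nat \<Rightarrow> real) \<Rightarrow> real" where
  "\<phi>2 \<beta> = (\<Sum>B<Q. \<Sum>C<Q. (\<beta> B C)\<^sup>2 * v B * v C)"

text \<open>In a block, each of the d columns of \<open>A C\<close> has squared length at most
  \<open>v C\<close>, and multiplying it by the transpose of \<open>A B\<close> costs a factor
  \<open>v B\<close>.\<close>

lemma frob2_\<Gamma>: "frob2 (Q*d) (\<Gamma> \<beta>) \<le> real d * \<phi>2 \<beta>"
proof -
  have "frob2 (Q*d) (\<Gamma> \<beta>) = (\<Sum>B<Q. \<Sum>i<d. \<Sum>C<Q. \<Sum>j<d. (\<Gamma> \<beta> (B*d+i) (C*d+j))\<^sup>2)"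
    unfolding frob2_def by (simp add: sum_blocks)
  also have "\<dots> = (\<Sum>B<Q. \<Sum>C<Q. \<Sum>i<d. \<Sum>j<d. (\<Gamma> \<beta> (B*d+i) (C*d+j))\<^sup>2)"
    by (intro sum.cong refl sum.swap)
  also have "\<dots> \<le> (\<Sum>B<Q. \<Sum>C<Q. real d * ((\<beta> B C)\<^sup>2 * v B * v C))"
  proof (intro sum_mono)
    fix B C assume "B \<in> {..<Q}" "C \<in> {..<Q}"
    then have BC: "B < Q" "C < Q" by auto
    have "(\<Sum>i<d. \<Sum>j<d. (\<Gamma> \<beta> (B*d+i) (C*d+j))\<^sup>2) = (\<beta> B C)\<^sup>2 * (\<Sum>i<d. \<Sum>j<d. (\<Sum>k<d. A B k i * A C k j)\<^sup>2)"
      unfolding sum_distrib_left[of "(\<beta> B C)\<^sup>2"]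
      by (intro sum.cong refl) (simp add: \<Gamma>_block power_mult_distrib)
    also have "(\<Sum>i<d. \<Sum>j<d. (\<Sum>k<d. A B k i * A C k j)\<^sup>2) = (\<Sum>j<d. \<Sum>i<d. (\<Sum>k<d. A B k i * A C k j)\<^sup>2)"
      by (rule sum.swap)
    also have "(\<beta> B C)\<^sup>2 * (\<Sum>j<d. \<Sum>i<d. (\<Sum>k<d. A B k i * A C k j)\<^sup>2) \<le> (\<beta> B C)\<^sup>2 * (\<Sum>j<d. v B * v C)"
    proof (intro mult_left_mono sum_mono)
      fix j assume "j \<in> {..<d}"
      then have "(\<Sum>k<d. (A C k j)\<^sup>2) \<le> v C" using BC by (intro A_col_bound) auto
      then have "v B * (\<Sum>k<d. (A C k j)\<^sup>2) \<le> v B * v C" using v_pos[OF BC(1)] by (intro mult_left_mono) auto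
      then show "(\<Sum>i<d. (\<Sum>k<d. A B k i * A C k j)\<^sup>2) \<le> v B * v C"
        using A_transpose_bound[OF BC(1), of "\<lambda>k. A C k j"] by linarith
    qed simp
    finally show "(\<Sum>i<d. \<Sum>j<d. (\<Gamma> \<beta> (B*d+i) (C*d+j))\<^sup>2) \<le> real d * ((\<beta> B C)\<^sup>2 * v B * v C)"
      by (simp add: mult.assoc mult.left_commute)
  qed
  also have "\<dots> = real d * \<phi>2 \<beta>" by (simp add: \<phi>2_def sum_distrib_left)
  finally show ?thesis .
qed

lemma opnorm_\<Gamma>: "ip (Q*d) (matvec (Q*d) (\<Gamma> \<beta>) y) (matvec (Q*d) (\<Gamma> \<beta>) y) \<le> \<phi>2 \<beta> * ip (Q*d) y y"
proof -
  let ?z = "\<lambda>C k. \<Sum>j<d. A C k j * y (C*d+j)"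
  let ?s = "\<lambda>B k. \<Sum>C<Q. \<beta> B C * ?z C k"
  have mv: "matvec (Q*d) (\<Gamma> \<beta>) y (B*d+i) = (\<Sum>k<d. A B k i * ?s B k)" if "i < d" for B i
  proof -
    have "matvec (Q*d) (\<Gamma> \<beta>) y (B*d+i) = (\<Sum>C<Q. \<Sum>j<d. \<beta> B C * (\<Sum>k<d. A B k i * A C k j) * y (C*d+j))"
      using that by (simp add: matvec_def sum_blocks \<Gamma>_block)
    also have "\<dots> = (\<Sum>C<Q. \<Sum>j<d. \<Sum>k<d. A B k i * (\<beta> B C * (A C k j * y (C*d+j))))"
      by (simp add: sum_distrib_left sum_distrib_right algebra_simps)
    also have "\<dots> = (\<Sum>C<Q. \<Sum>k<d. \<Sum>j<d. A B k i * (\<beta> B C * (A C k j * y (C*d+j))))"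
      by (intro sum.cong refl sum.swap)
    also have "\<dots> = (\<Sum>k<d. \<Sum>C<Q. \<Sum>j<d. A B k i * (\<beta> B C * (A C k j * y (C*d+j))))"
      by (rule sum.swap)
    finally show ?thesis by (simp add: sum_distrib_left)
  qed
  have zb: "(\<Sum>k<d. (?z C k)\<^sup>2) \<le> v C * (\<Sum>j<d. (y (C*d+j))\<^sup>2)" if "C < Q" for C
    using A_bound[OF that, of "\<lambda>j. y (C*d+j)"] by (simp add: ip_self matvec_def)
  have ss: "(\<Sum>k<d. (?s B k)\<^sup>2) \<le> (\<Sum>C<Q. (\<beta> B C)\<^sup>2 * v C) * ip (Q*d) y y" for B
  proof -
    have "(\<Sum>k<d. (?s B k)\<^sup>2) \<le> (\<Sum>k<d. (\<Sum>C<Q. (\<beta> B C)\<^sup>2 * v C) * (\<Sum>C<Q. (?z C k)\<^sup>2 / v C))"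
    proof (intro sum_mono)
      fix k
      \<comment> \<open>The weights sqrt(v C) in Cauchy-Schwarz are chosen such that the second
        factor becomes the sum of |z_C|^2 / v_C, which is at most |y|^2.\<close>
      have "?s B k = (\<Sum>C<Q. (\<beta> B C * sqrt (v C)) * (?z C k / sqrt (v C)))"
      proof (intro sum.cong refl)
        fix C assume "C \<in> {..<Q}"
        then have "sqrt (v C) \<noteq> 0" using v_pos[of C] by auto
        then show "\<beta> B C * ?z C k = (\<beta> B C * sqrt (v C)) * (?z C k / sqrt (v C))" by simp
      qed
      then have "(?s B k)\<^sup>2 \<le> (\<Sum>C<Q. (\<beta> B C * sqrt (v C))\<^sup>2) * (\<Sum>C<Q. (?z C k / sqrt (v C))\<^sup>2)"
        by (simp only:) (rule Cauchy_Schwarz_ineq_sum)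
      also have "(\<Sum>C<Q. (\<beta> B C * sqrt (v C))\<^sup>2) = (\<Sum>C<Q. (\<beta> B C)\<^sup>2 * v C)"
        using v_pos by (intro sum.cong refl) (auto simp: power_mult_distrib less_imp_le)
      also have "(\<Sum>C<Q. (?z C k / sqrt (v C))\<^sup>2) = (\<Sum>C<Q. (?z C k)\<^sup>2 / v C)"
        using v_pos by (intro sum.cong refl) (auto simp: power_divide less_imp_le)
      finally show "(?s B k)\<^sup>2 \<le> (\<Sum>C<Q. (\<beta> B C)\<^sup>2 * v C) * (\<Sum>C<Q. (?z C k)\<^sup>2 / v C)" .
    qed
    also have "\<dots> = (\<Sum>C<Q. (\<beta> B C)\<^sup>2 * v C) * (\<Sum>C<Q. (\<Sum>k<d. (?z C k)\<^sup>2) / v C)"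
      by (subst sum_distrib_left[symmetric], subst sum.swap) (simp add: sum_divide_distrib)
    also have "\<dots> \<le> (\<Sum>C<Q. (\<beta> B C)\<^sup>2 * v C) * (\<Sum>C<Q. \<Sum>j<d. (y (C*d+j))\<^sup>2)"
      using v_pos zb by (intro mult_left_mono sum_mono sum_nonneg) (auto simp: field_simps less_imp_le)
    finally show ?thesis by (simp add: ip_self sum_blocks)
  qed
  have "ip (Q*d) (matvec (Q*d) (\<Gamma> \<beta>) y) (matvec (Q*d) (\<Gamma> \<beta>) y)
      = (\<Sum>B<Q. \<Sum>i<d. (\<Sum>k<d. A B k i * ?s B k)\<^sup>2)"
    by (simp add: ip_self sum_blocks mv)
  also have "\<dots> \<le> (\<Sum>B<Q. v B * ((\<Sum>C<Q. (\<beta> B C)\<^sup>2 * v C) * ip (Q*d) y y))"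
  proof (intro sum_mono)
    fix B assume "B \<in> {..<Q}"
    then have B: "B < Q" by simp
    show "(\<Sum>i<d. (\<Sum>k<d. A B k i * ?s B k)\<^sup>2) \<le> v B * ((\<Sum>C<Q. (\<beta> B C)\<^sup>2 * v C) * ip (Q*d) y y)"
      using A_transpose_bound[OF B, of "?s B"] mult_left_mono[OF ss[of B], of "v B"] v_pos[OF B] by linarith
  qed
  also have "\<dots> = \<phi>2 \<beta> * ip (Q*d) y y"
    by (simp add: \<phi>2_def sum_distrib_right sum_distrib_left algebra_simps)
  finally show ?thesis .
qed

text \<open>Without diagonal blocks the form has mean 0, because distinct scalars are uncorrelated;
  so the deviation bound is a bound on the form itself.\<close>

lemma bilinear_tail:
  assumes hw: "hanson_wright c" and c: "0 < c" and t: "0 \<le> t" and x: "0 < x"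
    and \<phi>: "\<phi>2 \<beta> \<le> \<phi>\<^sup>2" "0 \<le> \<phi>"
    and b: "c * t * (real d * \<phi>\<^sup>2) \<le> x\<^sup>2" "c * t * \<phi> \<le> x"
    and diag: "\<And>B. B < Q \<Longrightarrow> \<beta> B B = 0"
  shows "prob {\<omega> \<in> space M. (\<Sum>B<Q. \<Sum>C<Q. \<beta> B C * ip d (w B \<omega>) (w C \<omega>)) > x} \<le> exp (- t)"
proof -
  have "prob {\<omega> \<in> space M. quadf (Q*d) (\<Gamma> \<beta>) (\<lambda>p. Y p \<omega>) > 0 + x} \<le> exp (- t)"
  proof (rule hanson_wright_quadf[OF hw c t x _ \<phi>(2) _ b])
    show "frob2 (Q*d) (\<Gamma> \<beta>) \<le> real d * \<phi>\<^sup>2"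
      using frob2_\<Gamma>[of \<beta>] mult_left_mono[OF \<phi>(1), of "real d"] by simp
    show "ip (Q*d) (matvec (Q*d) (\<Gamma> \<beta>) y) (matvec (Q*d) (\<Gamma> \<beta>) y) \<le> \<phi>\<^sup>2 * ip (Q*d) y y" for y
      using opnorm_\<Gamma>[of \<beta> y] mult_right_mono[OF \<phi>(1), of "ip (Q*d) y y"] by simp
    have "\<Gamma> \<beta> p p = 0" if "p < Q*d" for p
    proof -
      have "p div d < Q" using that by (simp add: less_mult_imp_div_less)
      then show ?thesis by (simp add: \<Gamma>_def diag)
    qed
    then show "(\<Sum>p<Q*d. \<Gamma> \<beta> p p * expectation (\<lambda>\<omega>. (Y p \<omega>)\<^sup>2)) \<le> 0" by simp
  qed
  then show ?thesis by (simp add: quadf_\<Gamma>)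
qed

lemma norm_tail:
  assumes hw: "hanson_wright c" and c: "0 < c" and t: "0 < t" and B: "B < Q"
  shows "prob {\<omega> \<in> space M. ip d (w B \<omega>) (w B \<omega>) > v B * (5/2 * real d + c * t)} \<le> exp (- t)"
proof -
  let ?\<beta> = "\<lambda>C D. if C = B \<and> D = B then 1 else 0 :: real"
  \<comment> \<open>The mean is at most 2 d v. The extra d/2 serves the Frobenius condition through
    (d/2 + c t)^2 >= d c t; together this is the 5/2 of the statement.\<close>
  let ?x = "v B * (real d / 2 + c * t)"
  have vB: "0 < v B" using v_pos[OF B] .
  have \<phi>: "\<phi>2 ?\<beta> = (v B)\<^sup>2"
  proof -
    have "\<phi>2 ?\<beta> = (\<Sum>C<Q. \<Sum>D<Q. if C = B then (if D = B then v B * v B else 0) else 0)"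
      unfolding \<phi>2_def by (intro sum.cong refl) auto
    also have "\<dots> = (\<Sum>C<Q. if C = B then v B * v B else 0)" using B by (intro sum.cong refl) auto
    finally show ?thesis using B by (simp add: power2_eq_square)
  qed
  have form: "(\<Sum>C<Q. \<Sum>D<Q. ?\<beta> C D * ip d (w C \<omega>) (w D \<omega>)) = ip d (w B \<omega>) (w B \<omega>)" for \<omega>
  proof -
    have "(\<Sum>C<Q. \<Sum>D<Q. ?\<beta> C D * ip d (w C \<omega>) (w D \<omega>)) =
      (\<Sum>C<Q. \<Sum>D<Q. if C = B then (if D = B then ip d (w B \<omega>) (w B \<omega>) else 0) else 0)"
      by (intro sum.cong refl) auto
    also have "\<dots> = (\<Sum>C<Q. if C = B then ip d (w B \<omega>) (w B \<omega>) else 0)" using B by (intro sum.cong refl) auto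
    finally show ?thesis using B by simp
  qed
  have "prob {\<omega> \<in> space M. quadf (Q*d) (\<Gamma> ?\<beta>) (\<lambda>p. Y p \<omega>) > 2 * (real d * v B) + ?x} \<le> exp (- t)"
  proof (rule hanson_wright_quadf[OF hw c, of t ?x _ "real d * (v B)\<^sup>2" "v B"])
    show "frob2 (Q*d) (\<Gamma> ?\<beta>) \<le> real d * (v B)\<^sup>2"
      using frob2_\<Gamma>[of ?\<beta>] unfolding \<phi> .
    show "ip (Q*d) (matvec (Q*d) (\<Gamma> ?\<beta>) y) (matvec (Q*d) (\<Gamma> ?\<beta>) y) \<le> (v B)\<^sup>2 * ip (Q*d) y y" for y
      using opnorm_\<Gamma>[of ?\<beta> y] unfolding \<phi> .
    have "2 * (real d/2) * (c*t) \<le> (real d/2 + c*t)\<^sup>2" using c t by (simp add: power2_sum)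
    then have "(v B)\<^sup>2 * (real d * (c*t)) \<le> (v B)\<^sup>2 * (real d/2 + c*t)\<^sup>2" by (intro mult_left_mono) auto
    then show "c * t * (real d * (v B)\<^sup>2) \<le> ?x\<^sup>2" by (simp only: power_mult_distrib mult.assoc mult.left_commute mult.commute)
    show "c * t * v B \<le> ?x" using vB by (simp add: algebra_simps)
    show "0 < ?x" using vB c t by (simp add: add_nonneg_pos)
    show "(\<Sum>p<Q*d. \<Gamma> ?\<beta> p p * expectation (\<lambda>\<omega>. (Y p \<omega>)\<^sup>2)) \<le> 2 * (real d * v B)"
    proof -
      have "(\<Sum>p<Q*d. \<Gamma> ?\<beta> p p * expectation (\<lambda>\<omega>. (Y p \<omega>)\<^sup>2)) =
         (\<Sum>C<Q. \<Sum>i<d. \<Gamma> ?\<beta> (C*d+i) (C*d+i) * expectation (\<lambda>\<omega>. (Y (C*d+i) \<omega>)\<^sup>2))"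
        by (rule sum_blocks)
      also have "\<dots> \<le> (\<Sum>C<Q. if C = B then (\<Sum>i<d. 2 * v B) else 0)"
      proof (intro sum_mono)
        fix C assume "C \<in> {..<Q}"
        show "(\<Sum>i<d. \<Gamma> ?\<beta> (C*d+i) (C*d+i) * expectation (\<lambda>\<omega>. (Y (C*d+i) \<omega>)\<^sup>2)) \<le> (if C = B then (\<Sum>i<d. 2 * v B) else 0)"
        proof (cases "C = B")
          case True
          have "\<Gamma> ?\<beta> (C*d+i) (C*d+i) * expectation (\<lambda>\<omega>. (Y (C*d+i) \<omega>)\<^sup>2) \<le> 2 * v B" if i: "i < d" for i
          proof -
            have "(\<Sum>k<d. (A B k i)\<^sup>2) * expectation (\<lambda>\<omega>. (Y (B*d+i) \<omega>)\<^sup>2) \<le> v B * 2"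
              using A_col_bound[OF B i] Y_square(2)[OF idx[OF B i]] vB
              by (intro mult_mono) auto
            then show ?thesis using True i by (simp add: \<Gamma>_block power2_eq_square)
          qed
          then have "(\<Sum>i<d. \<Gamma> ?\<beta> (C*d+i) (C*d+i) * expectation (\<lambda>\<omega>. (Y (C*d+i) \<omega>)\<^sup>2)) \<le> (\<Sum>i<d. 2 * v B)"
            by (intro sum_mono) auto
          then show ?thesis using True by simp
        qed (simp add: \<Gamma>_block)
      qed
      also have "\<dots> = 2 * (real d * v B)" using B by simp
      finally show ?thesis .
    qed
  qed (use t vB in auto)
  moreover have "2 * (real d * v B) + ?x = v B * (5/2 * real d + c * t)" by (simp add: algebra_simps)
  ultimately show ?thesis by (simp add: quadf_\<Gamma> form)
qed

lemma linear_tail: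
  assumes V: "0 < V" "(\<Sum>B<Q. v B * ip d (u B) (u B)) \<le> V" and x: "0 \<le> x" and t: "2 * t * V \<le> x\<^sup>2"
  shows "prob {\<omega> \<in> space M. x \<le> (\<Sum>B<Q. ip d (u B) (w B \<omega>))} \<le> exp (- t)"
proof -
  define cf where "cf = (\<lambda>p. \<Sum>k<d. A (p div d) k (p mod d) * u (p div d) k)"
  let ?Z = "\<lambda>\<omega>. \<Sum>p<Q*d. cf p * Y p \<omega>"
  \<comment> \<open>The minimiser of l^2 V / 2 - l x, the exponent in the Chernoff bound.\<close>
  define l where "l = x / V"
  have Z: "(\<Sum>B<Q. ip d (u B) (w B \<omega>)) = ?Z \<omega>" for \<omega>
  proof -
    have "ip d (u B) (w B \<omega>) = (\<Sum>j<d. (\<Sum>k<d. A B k j * u B k) * Y (B*d+j) \<omega>)" for B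
    proof -
      have "ip d (u B) (w B \<omega>) = (\<Sum>k<d. \<Sum>j<d. A B k j * u B k * Y (B*d+j) \<omega>)"
        by (simp add: ip_def w_def matvec_def sum_distrib_left algebra_simps)
      also have "\<dots> = (\<Sum>j<d. \<Sum>k<d. A B k j * u B k * Y (B*d+j) \<omega>)" by (rule sum.swap)
      finally show ?thesis by (simp add: sum_distrib_right)
    qed
    then show ?thesis by (simp add: sum_blocks cf_def)
  qed
  have cV: "(\<Sum>p<Q*d. (cf p)\<^sup>2) \<le> V"
  proof -
    have "(\<Sum>p<Q*d. (cf p)\<^sup>2) = (\<Sum>B<Q. \<Sum>i<d. (\<Sum>k<d. A B k i * u B k)\<^sup>2)" by (simp add: sum_blocks cf_def)
    also have "\<dots> \<le> (\<Sum>B<Q. v B * ip d (u B) (u B))"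
      using A_transpose_bound by (intro sum_mono) (auto simp: ip_self)
    finally show ?thesis using V by simp
  qed
  have ind: "indep_vars (\<lambda>_. borel) (\<lambda>p \<omega>. exp (l * cf p * Y p \<omega>)) {..<Q*d}"
    by (rule indep_vars_compose2[OF indep]) auto
  have int: "integrable M (\<lambda>\<omega>. exp (l * cf p * Y p \<omega>))" if "p \<in> {..<Q*d}" for p
    using that mgf_int[of p "l * cf p"] by auto
  have eZ: "exp (l * ?Z \<omega>) = (\<Prod>p<Q*d. exp (l * cf p * Y p \<omega>))" for \<omega>
  proof -
    have "l * ?Z \<omega> = (\<Sum>p<Q*d. l * cf p * Y p \<omega>)"
      by (subst sum_distrib_left) (simp only: mult.assoc)
    then show ?thesis by (simp only: exp_sum finite_lessThan)
  qed
  have intZ: "integrable M (\<lambda>\<omega>. exp (l * ?Z \<omega>))"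
    unfolding eZ by (rule indep_vars_integrable[OF _ ind int]) auto
  have "expectation (\<lambda>\<omega>. exp (l * ?Z \<omega>)) = (\<Prod>p<Q*d. expectation (\<lambda>\<omega>. exp (l * cf p * Y p \<omega>)))"
    unfolding eZ by (rule indep_vars_lebesgue_integral[OF _ ind int]) auto
  also have "\<dots> \<le> (\<Prod>p<Q*d. exp ((l * cf p)\<^sup>2/2))"
    using mgf_le by (intro prod_mono) (auto simp: Bochner_Integration.integral_nonneg)
  also have "\<dots> = exp (l\<^sup>2/2 * (\<Sum>p<Q*d. (cf p)\<^sup>2))"
    by (simp add: exp_sum[symmetric] sum_distrib_left power_mult_distrib)
  also have "\<dots> \<le> exp (l\<^sup>2/2 * V)" using cV by (intro iffD2[OF exp_le_cancel_iff] mult_left_mono) auto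
  finally have mg: "expectation (\<lambda>\<omega>. exp (l * ?Z \<omega>)) \<le> exp (l\<^sup>2/2 * V)" .
  have l0: "0 \<le> l" using x V by (simp add: l_def)
  have "prob {\<omega> \<in> space M. x \<le> (\<Sum>B<Q. ip d (u B) (w B \<omega>))} \<le> prob {\<omega> \<in> space M. exp (l * x) \<le> exp (l * ?Z \<omega>)}"
    unfolding Z using l0 by (intro finite_measure_mono) (auto intro: mult_left_mono)
  also have "\<dots> \<le> expectation (\<lambda>\<omega>. exp (l * ?Z \<omega>)) / exp (l * x)"
    by (rule integral_Markov_inequality_measure[OF intZ, of "{}"]) auto
  also have "\<dots> \<le> exp (l\<^sup>2/2 * V) / exp (l * x)" using mg by (intro divide_right_mono) auto
  also have "\<dots> = exp (- (x\<^sup>2 / (2 * V)))"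
    using V by (simp add: exp_diff[symmetric] power2_eq_square field_simps l_def)
  also have "\<dots> \<le> exp (- t)" using t V by (simp add: field_simps)
  finally show ?thesis .
qed

end

text \<open>Independence of the outer variables and independence of their components under each
  marginal law combine: for a finite set of pairs, intersect over the inner index within each outer
  one, apply outer independence, then inner independence factor by factor.\<close>

lemma (in prob_space) indep_vars_nested:
  assumes Z: "indep_vars M' Z I"
    and inner: "\<And>a. a \<in> I \<Longrightarrow> prob_space.indep_vars (distr M (M' a) (Z a)) (N' a) (f a) (J a)"
  shows "indep_vars (\<lambda>(a, k). N' a k) (\<lambda>(a, k) \<omega>. f a k (Z a \<omega>)) (SIGMA a:I. J a)"
proof -
  have Zm: "Z a \<in> measurable M (M' a)" if "a \<in> I" for a
    using Z that by (auto simp: indep_vars_def)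
  have pd: "prob_space (distr M (M' a) (Z a))" if "a \<in> I" for a
    using Zm[OF that] by (rule prob_space_distr)
  have fm: "f a k \<in> measurable (M' a) (N' a k)" if "a \<in> I" "k \<in> J a" for a k
    using inner[OF that(1)] that(2) unfolding prob_space.indep_vars_def[OF pd[OF that(1)]]
    by (auto simp: measurable_def)
  have rv: "(\<lambda>\<omega>. f a k (Z a \<omega>)) \<in> measurable M (N' a k)" if "a \<in> I" "k \<in> J a" for a k
    using measurable_compose[OF Zm[OF that(1)] fm[OF that]] .
  show ?thesis unfolding indep_vars_def2
  proof (intro conjI ballI)
    fix i assume "i \<in> Sigma I J"
    then show "random_variable (case i of (a, k) \<Rightarrow> N' a k) (case i of (a, k) \<Rightarrow> \<lambda>\<omega>. f a k (Z a \<omega>))"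
      using rv by auto
  next
    let ?F = "\<lambda>i. {(case i of (a, k) \<Rightarrow> \<lambda>\<omega>. f a k (Z a \<omega>)) -` A \<inter> space M |A. A \<in> sets (case i of (a, k) \<Rightarrow> N' a k)}"
    show "indep_sets ?F (Sigma I J)"
    proof (rule indep_setsI)
      fix i assume "i \<in> Sigma I J"
      then show "?F i \<subseteq> events" using rv by (auto intro: measurable_sets)
    next
      fix A L assume L: "L \<noteq> {}" "L \<subseteq> Sigma I J" "finite L" and A: "\<forall>j\<in>L. A j \<in> ?F j"
      have "\<exists>B. \<forall>j\<in>L. B j \<in> sets (N' (fst j) (snd j)) \<and> A j = (\<lambda>\<omega>. f (fst j) (snd j) (Z (fst j) \<omega>)) -` B j \<inter> space M"
        using A by (intro bchoice) (auto simp: split_beta)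
      then obtain B where B: "\<And>a k. (a,k) \<in> L \<Longrightarrow> B (a,k) \<in> sets (N' a k)"
        "\<And>a k. (a,k) \<in> L \<Longrightarrow> A (a,k) = (\<lambda>\<omega>. f a k (Z a \<omega>)) -` B (a,k) \<inter> space M" by fastforce
      \<comment> \<open>A finite set of pairs is split into its projection \<open>I'\<close> and the
        fibres \<open>La a\<close>.\<close>
      define I' where "I' = fst ` L"
      define La where "La a = {k. (a,k) \<in> L}" for a
      have LS: "L = Sigma I' La" by (auto simp: I'_def La_def image_iff) force
      have I': "I' \<noteq> {}" "finite I'" "I' \<subseteq> I" using L by (auto simp: I'_def)
      have La: "La a \<noteq> {}" "finite (La a)" "La a \<subseteq> J a" if "a \<in> I'" for a
      proof -
        show "La a \<noteq> {}" "La a \<subseteq> J a" using that L by (auto simp: I'_def La_def)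
        have "La a \<subseteq> snd ` L" by (force simp: La_def)
        then show "finite (La a)" using L(3) by (meson finite_imageI finite_subset)
      qed
      define C where "C a = (\<Inter>k\<in>La a. f a k -` B (a,k) \<inter> space (M' a))" for a
      have C: "C a \<in> sets (M' a)" if "a \<in> I'" for a
        unfolding C_def using that La[OF that] I' fm B
        by (intro sets.finite_INT) (auto simp: La_def intro!: measurable_sets)
      have Zsp: "Z a \<omega> \<in> space (M' a)" if "a \<in> I'" "\<omega> \<in> space M" for a \<omega>
        using Zm[of a] that I' by (auto simp: measurable_def)
      have eq: "(\<Inter>j\<in>L. A j) = (\<Inter>a\<in>I'. Z a -` C a \<inter> space M)"
      proof -
        have "(\<Inter>j\<in>L. A j) = (\<Inter>a\<in>I'. \<Inter>k\<in>La a. A (a,k))" by (auto simp: LS)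
        also have "\<dots> = (\<Inter>a\<in>I'. Z a -` C a \<inter> space M)"
        proof (intro INF_cong refl)
          fix a assume a: "a \<in> I'"
          then obtain k0 where k0: "k0 \<in> La a" using La by blast
          show "(\<Inter>k\<in>La a. A (a,k)) = Z a -` C a \<inter> space M"
            using k0 B(2) Zsp[OF a] by (auto simp: La_def C_def)
        qed
        finally show ?thesis .
      qed
      have "prob (\<Inter>j\<in>L. A j) = (\<Prod>a\<in>I'. prob (Z a -` C a \<inter> space M))"
        unfolding eq by (rule indep_varsD[OF Z I'(1,2,3) C])
      also have "\<dots> = (\<Prod>a\<in>I'. \<Prod>k\<in>La a. prob (A (a,k)))"
      proof (intro prod.cong refl)
        fix a assume a: "a \<in> I'"
        then have aI: "a \<in> I" using I' by auto
        interpret D: prob_space "distr M (M' a) (Z a)" by (rule pd[OF aI])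
        have "prob (Z a -` C a \<inter> space M) = D.prob (C a)"
          using C[OF a] Zm[OF aI] by (simp add: measure_distr)
        also have "\<dots> = (\<Prod>k\<in>La a. D.prob (f a k -` B (a,k) \<inter> space (distr M (M' a) (Z a))))"
          unfolding C_def using D.indep_varsD[OF inner[OF aI] La[OF a], of "\<lambda>k. B (a,k)"] B(1)
          by (simp add: La_def)
        also have "\<dots> = (\<Prod>k\<in>La a. prob (A (a,k)))"
        proof (intro prod.cong refl)
          fix k assume k: "k \<in> La a"
          then have kL: "(a,k) \<in> L" "k \<in> J a" using La[OF a] by (auto simp: La_def)
          have "D.prob (f a k -` B (a,k) \<inter> space (distr M (M' a) (Z a))) = prob (Z a -` (f a k -` B (a,k) \<inter> space (M' a)) \<inter> space M)"
            using measurable_sets[OF fm[OF aI kL(2)] B(1)[OF kL(1)]] Zm[OF aI] by (simp add: measure_distr)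
          also have "Z a -` (f a k -` B (a,k) \<inter> space (M' a)) \<inter> space M = A (a,k)"
            using B(2)[OF kL(1)] Zsp[OF a] by auto
          finally show "D.prob (f a k -` B (a,k) \<inter> space (distr M (M' a) (Z a))) = prob (A (a,k))" .
        qed
        finally show "prob (Z a -` C a \<inter> space M) = (\<Prod>k\<in>La a. prob (A (a,k)))" .
      qed
      also have "\<dots> = (\<Prod>j\<in>L. prob (A j))"
        unfolding LS using I'(2) La(2) by (subst prod.Sigma) (auto simp: split_beta)
      finally show "prob (\<Inter>j\<in>L. A j) = (\<Prod>j\<in>L. prob (A j))" .
    qed
  qed
qed

text \<open>The joint law of the coordinates is the image of the product under the identity, hence
  the product of the marginal laws.\<close>

lemma indep_vars_PiM_coordinates:
  assumes "\<And>i. i \<in> I \<Longrightarrow> prob_space (M i)" "I \<noteq> {}"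
  shows "prob_space.indep_vars (PiM I M) M (\<lambda>i x. x i) I"
proof -
  interpret prob_space "PiM I M" by (rule prob_space_PiM) (use assms in auto)
  have "distr (PiM I M) (PiM I M) (\<lambda>x. \<lambda>i\<in>I. x i) = distr (PiM I M) (PiM I M) (\<lambda>x. x)"
    by (rule distr_cong) (auto simp: space_PiM PiE_def extensional_restrict)
  also have "\<dots> = PiM I (\<lambda>i. distr (PiM I M) (M i) (\<lambda>x. x i))"
    unfolding distr_id using assms(1) by (intro PiM_cong refl distr_PiM_component[symmetric]) auto
  finally show ?thesis
    by (subst indep_vars_iff_distr_eq_PiM') (auto simp: assms)
qed

section \<open>The noise of empirical means on the sample space\<close>

locale clustering =
  fixes cHW :: real and d N K :: nat and \<sigma> :: real and \<nu> :: "nat \<Rightarrow> vec measure" and \<mu> :: "nat \<Rightarrow> vec"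
  assumes cHW_pos: "0 < cHW" and HW: "hanson_wright cHW" and env: "env_ok d N K \<sigma> \<nu> \<mu>"
begin

abbreviation "\<Omega> \<equiv> Omega N \<nu>"

lemma d_pos: "0 < d" and K_ge_2: "2 \<le> K" and card_Gstar: "card (Gstar d N \<mu>) = K"
  and arms: "a < N \<Longrightarrow> arm_ok d \<sigma> (\<nu> a) (\<mu> a)"
  using env by (auto simp: env_ok_def)

lemma K_le_N: "K \<le> N"
  using card_image_le[of "{..<N}" "\<lambda>a. {b. b < N \<and> veq d (\<mu> b) (\<mu> a)}"] card_Gstar
  by (simp add: Gstar_def)

lemma N_ge_2: "2 \<le> N" using K_le_N K_ge_2 by simp

lemma prob_nu: "a < N \<Longrightarrow> prob_space (\<nu> a)"
  using arms by (auto simp: arm_ok_def)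

lemma sets_nu: "a < N \<Longrightarrow> sets (\<nu> a) = sets (PiM {..<d} (\<lambda>_. borel))"
  using arms by (auto simp: arm_ok_def)

lemma prob_stream: "a < N \<Longrightarrow> prob_space (PiM UNIV (\<lambda>k::nat. \<nu> a))"
  by (intro prob_space_PiM prob_nu)

lemma prob_arms: "prob_space (PiM {..<N} (\<lambda>a. PiM UNIV (\<lambda>k::nat. \<nu> a)))"
  by (intro prob_space_PiM prob_stream) auto

lemma prob_draws: "prob_space (PiM UNIV (\<lambda>u::nat. measure_pmf (pmf_of_set {..<N})))"
  by (intro prob_space_PiM prob_space_measure_pmf)

lemma prob_Omega: "prob_space \<Omega>"
proof -
  interpret A: prob_space "PiM {..<N} (\<lambda>a. PiM UNIV (\<lambda>k::nat. \<nu> a))" by (rule prob_arms)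
  interpret B: prob_space "PiM UNIV (\<lambda>u::nat. measure_pmf (pmf_of_set {..<N}))" by (rule prob_draws)
  interpret P: pair_prob_space "PiM {..<N} (\<lambda>a. PiM UNIV (\<lambda>k::nat. \<nu> a))" "PiM UNIV (\<lambda>u::nat. measure_pmf (pmf_of_set {..<N}))" ..
  show ?thesis unfolding Omega_def by (rule P.prob_space_axioms)
qed

sublocale \<Omega>: prob_space \<Omega> by (rule prob_Omega)

lemma distr_Omega_fst: "distr \<Omega> (PiM {..<N} (\<lambda>a. PiM UNIV (\<lambda>k. \<nu> a))) fst = PiM {..<N} (\<lambda>a. PiM UNIV (\<lambda>k. \<nu> a))"
  unfolding Omega_def using prob_draws by (rule prob_space.distr_pair_fst)

lemma distr_Omega_arm:
  assumes "a < N" shows "distr \<Omega> (PiM UNIV (\<lambda>k. \<nu> a)) (\<lambda>\<omega>. fst \<omega> a) = PiM UNIV (\<lambda>k. \<nu> a)"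
proof -
  have [measurable]: "fst \<in> measurable \<Omega> (PiM {..<N} (\<lambda>a. PiM UNIV (\<lambda>k. \<nu> a)))"
    unfolding Omega_def by simp
  have "distr \<Omega> (PiM UNIV (\<lambda>k. \<nu> a)) (\<lambda>\<omega>. fst \<omega> a) =
      distr (distr \<Omega> (PiM {..<N} (\<lambda>a. PiM UNIV (\<lambda>k. \<nu> a))) fst) (PiM UNIV (\<lambda>k. \<nu> a)) (\<lambda>X. X a)"
    using assms by (subst distr_distr) (auto simp: comp_def)
  also have "\<dots> = PiM UNIV (\<lambda>k. \<nu> a)"
    unfolding distr_Omega_fst using assms prob_stream by (intro distr_PiM_component) auto
  finally show ?thesis .
qed

lemma measurable_Omega_arm: "a < N \<Longrightarrow> (\<lambda>\<omega>. fst \<omega> a) \<in> measurable \<Omega> (PiM UNIV (\<lambda>k. \<nu> a))"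
  unfolding Omega_def by measurable

lemma distr_Omega_sample:
  assumes "a < N" shows "distr \<Omega> (\<nu> a) (\<lambda>\<omega>. fst \<omega> a k) = \<nu> a"
proof -
  have "distr \<Omega> (\<nu> a) (\<lambda>\<omega>. fst \<omega> a k) = distr (distr \<Omega> (PiM UNIV (\<lambda>k. \<nu> a)) (\<lambda>\<omega>. fst \<omega> a)) (\<nu> a) (\<lambda>x. x k)"
    using measurable_Omega_arm[OF assms] by (subst distr_distr) (auto simp: comp_def)
  also have "\<dots> = \<nu> a" unfolding distr_Omega_arm[OF assms] using prob_nu[OF assms] by (intro distr_PiM_component) auto
  finally show ?thesis .
qed

lemma measurable_Omega_sample: "a < N \<Longrightarrow> (\<lambda>\<omega>. fst \<omega> a k) \<in> measurable \<Omega> (\<nu> a)"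
  by (rule measurable_compose[OF measurable_Omega_arm measurable_component_singleton]) auto

lemma indep_samples: "\<Omega>.indep_vars (\<lambda>(a,k). \<nu> a) (\<lambda>(a,k) \<omega>. fst \<omega> a k) ({..<N} \<times> UNIV)"
proof -
  have 1: "\<Omega>.indep_vars (\<lambda>a. PiM UNIV (\<lambda>k. \<nu> a)) (\<lambda>a \<omega>. fst \<omega> a) {..<N}"
  proof (subst \<Omega>.indep_vars_iff_distr_eq_PiM')
    show "{..<N} \<noteq> {}" using N_ge_2 by (simp add: lessThan_empty_iff)
    show "(\<lambda>\<omega>. fst \<omega> a) \<in> measurable \<Omega> (PiM UNIV (\<lambda>k. \<nu> a))" if "a \<in> {..<N}" for a
      using that measurable_Omega_arm by auto
    have "distr \<Omega> (PiM {..<N} (\<lambda>a. PiM UNIV (\<lambda>k. \<nu> a))) (\<lambda>\<omega>. \<lambda>a\<in>{..<N}. fst \<omega> a) =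
        distr \<Omega> (PiM {..<N} (\<lambda>a. PiM UNIV (\<lambda>k. \<nu> a))) fst"
      by (rule distr_cong) (auto simp: Omega_def space_pair_measure space_PiM[of "{..<N}"] PiE_def extensional_restrict)
    also have "\<dots> = PiM {..<N} (\<lambda>a. distr \<Omega> (PiM UNIV (\<lambda>k. \<nu> a)) (\<lambda>\<omega>. fst \<omega> a))"
      unfolding distr_Omega_fst by (intro PiM_cong refl distr_Omega_arm[symmetric]) auto
    finally show "distr \<Omega> (PiM {..<N} (\<lambda>a. PiM UNIV (\<lambda>k. \<nu> a))) (\<lambda>\<omega>. \<lambda>a\<in>{..<N}. fst \<omega> a) =
       PiM {..<N} (\<lambda>a. distr \<Omega> (PiM UNIV (\<lambda>k. \<nu> a)) (\<lambda>\<omega>. fst \<omega> a))" .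
  qed
  show ?thesis
    using \<Omega>.indep_vars_nested[OF 1, of "\<lambda>a k. \<nu> a" "\<lambda>a k x. x k" "\<lambda>_. UNIV"]
    by (simp add: distr_Omega_arm indep_vars_PiM_coordinates prob_nu)
qed

text \<open>Read blocks are dropped, so every empirical mean is taken at the head of the stream; h =
  0 and h = 1 are the two halves of the block.\<close>

definition noise :: "nat \<Rightarrow> nat \<Rightarrow> nat \<Rightarrow> smp \<times> (nat \<Rightarrow> nat) \<Rightarrow> vec" where
  "noise a h n \<omega> = vdiff (mean_from (fst \<omega>) a (h * n) n) (\<mu> a)"

text \<open>Block 2 i + h is half h of the i-th chosen arm. Distinct arms and disjoint halves use
  disjoint sets of independent scalars, so that statistics of several arms become forms in one
  instance of \<open>noise_blocks\<close>.\<close>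

lemma noise_blocks_arms:
  fixes arm n :: "nat \<Rightarrow> nat"
  assumes q: "0 < q" and arm: "\<And>i. i < q \<Longrightarrow> arm i < N" "inj_on arm {..<q}" and n: "\<And>i. i < q \<Longrightarrow> 0 < n i"
  obtains A Y where "noise_blocks \<Omega> d (2*q) A (\<lambda>B. \<sigma>\<^sup>2 / real (n (B div 2))) Y"
    and "\<And>B \<omega> i. B < 2*q \<Longrightarrow> i < d \<Longrightarrow>
           noise_blocks.w d A Y B \<omega> i = noise (arm (B div 2)) (B mod 2) (n (B div 2)) \<omega> i"
proof -
  let ?E = "\<lambda>T a i x. matvec d T (vdiff x (\<mu> a)) i"
  have "\<forall>a\<in>{..<N}. \<exists>RT. mat_symmetric d (fst RT) \<and> mat_posdef d (fst RT) \<and> (\<exists>S. mat_mult_eq d (fst RT) (fst RT) S \<and> mat_opnorm d S \<le> \<sigma>\<^sup>2)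
     \<and> mat_mult_eq d (snd RT) (fst RT) mat_id \<and> prob_space.indep_vars (\<nu> a) (\<lambda>_. borel) (?E (snd RT) a) {..<d}
     \<and> (\<forall>i<d. \<forall>t. integrable (\<nu> a) (\<lambda>x. exp (t * ?E (snd RT) a i x)) \<and> (\<integral>x. exp (t * ?E (snd RT) a i x) \<partial>\<nu> a) \<le> exp (t\<^sup>2 / 2))" (is "\<forall>a\<in>_. ?P a")
  proof
    fix a assume "a \<in> {..<N}"
    then have "arm_ok d \<sigma> (\<nu> a) (\<mu> a)" using arms by simp
    then obtain S R T where "mat_symmetric d R" "mat_posdef d R" "mat_mult_eq d R R S" "mat_opnorm d S \<le> \<sigma>\<^sup>2"
      "mat_mult_eq d T R mat_id" "prob_space.indep_vars (\<nu> a) (\<lambda>_. borel) (?E T a) {..<d}"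
      "\<forall>i<d. \<forall>t. integrable (\<nu> a) (\<lambda>x. exp (t * ?E T a i x)) \<and> (\<integral>x. exp (t * ?E T a i x) \<partial>\<nu> a) \<le> exp (t\<^sup>2 / 2)"
      unfolding arm_ok_def Let_def by blast
    then show "?P a" by (intro exI[of _ "(R,T)"]) auto
  qed
  from bchoice[OF this] obtain RT where RT: "\<And>a. a < N \<Longrightarrow> mat_symmetric d (fst (RT a)) \<and> mat_posdef d (fst (RT a)) \<and> (\<exists>S. mat_mult_eq d (fst (RT a)) (fst (RT a)) S \<and> mat_opnorm d S \<le> \<sigma>\<^sup>2)
     \<and> mat_mult_eq d (snd (RT a)) (fst (RT a)) mat_id \<and> prob_space.indep_vars (\<nu> a) (\<lambda>_. borel) (?E (snd (RT a)) a) {..<d}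
     \<and> (\<forall>i<d. \<forall>t. integrable (\<nu> a) (\<lambda>x. exp (t * ?E (snd (RT a)) a i x)) \<and> (\<integral>x. exp (t * ?E (snd (RT a)) a i x) \<partial>\<nu> a) \<le> exp (t\<^sup>2 / 2))"
    by (auto simp: Ball_def)
  define R where "R a = fst (RT a)" for a
  define T where "T a = snd (RT a)" for a
  have R: "mat_symmetric d (R a)" "mat_posdef d (R a)" "mat_mult_eq d (T a) (R a) mat_id"
    "prob_space.indep_vars (\<nu> a) (\<lambda>_. borel) (?E (T a) a) {..<d}"
    "\<And>i t. i < d \<Longrightarrow> integrable (\<nu> a) (\<lambda>x. exp (t * ?E (T a) a i x))"
    "\<And>i t. i < d \<Longrightarrow> (\<integral>x. exp (t * ?E (T a) a i x) \<partial>\<nu> a) \<le> exp (t\<^sup>2 / 2)"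
    "\<And>x. ip d (matvec d (R a) x) (matvec d (R a) x) \<le> \<sigma>\<^sup>2 * ip d x x" if "a < N" for a
    using RT[OF that] sqrt_matrix_bounded unfolding R_def T_def by blast+
  have RTid: "mat_mult_eq d (R a) (T a) mat_id" if "a < N" for a
    using symmetric_left_inverse_is_right_inverse[OF R(1,3)[OF that]] .
  \<comment> \<open>A positive definite R with |R x|^2 <= \<sigma>^2 |x|^2 excludes \<sigma> =
    0.\<close>
  have sig: "0 < \<sigma>\<^sup>2"
  proof -
    have a: "arm 0 < N" using arm q by auto
    let ?e = "\<lambda>i. if i = 0 then 1 else 0 :: real"
    have "0 < ip d ?e (matvec d (R (arm 0)) ?e)" using R(2)[OF a] d_pos by (auto simp: mat_posdef_def)
    also have "\<dots> \<le> vnorm d ?e * vnorm d (matvec d (R (arm 0)) ?e)" by (rule ip_le_vnorm)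
    finally have "0 < vnorm d (matvec d (R (arm 0)) ?e)"
      by (metis mult_zero_right vnorm_nonneg less_irrefl less_eq_real_def)
    then have "0 < ip d (matvec d (R (arm 0)) ?e) (matvec d (R (arm 0)) ?e)" by (simp add: vnorm_def)
    then have "0 < \<sigma>\<^sup>2 * ip d ?e ?e" using R(7)[OF a, of ?e] by linarith
    then show ?thesis by (simp add: zero_less_mult_iff not_less[symmetric])
  qed
  \<comment> \<open>Standardised coordinate i of one sample. Independence is nested: samples are
    independent in the sample space, coordinates are independent within a sample.\<close>
  define EE where "EE = (\<lambda>(p, i) (\<omega> :: smp \<times> (nat \<Rightarrow> nat)). ?E (T (fst p)) (fst p) i (fst \<omega> (fst p) (snd p)))"
  have EEi: "\<Omega>.indep_vars (\<lambda>_. borel) EE (({..<N} \<times> UNIV) \<times> {..<d})"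
  proof -
    have "\<Omega>.indep_vars (\<lambda>(p, i). borel) (\<lambda>(p, i) \<omega>. ?E (T (fst p)) (fst p) i ((case p of (a,k) \<Rightarrow> \<lambda>\<omega>. fst \<omega> a k) \<omega>)) (SIGMA p:{..<N} \<times> UNIV. {..<d})"
      using R(4) by (intro \<Omega>.indep_vars_nested[OF indep_samples]) (auto simp: distr_Omega_sample)
    then show ?thesis unfolding EE_def by (simp add: split_beta')
  qed
  have EEmeas: "EE r \<in> borel_measurable \<Omega>" if "r \<in> ({..<N} \<times> UNIV) \<times> {..<d}" for r
    using EEi that by (auto simp: \<Omega>.indep_vars_def)
  have EEint: "integrable \<Omega> (\<lambda>\<omega>. exp (t * EE ((a,k),i) \<omega>))" "(\<integral>\<omega>. exp (t * EE ((a,k),i) \<omega>) \<partial>\<Omega>) \<le> exp (t\<^sup>2/2)"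
    if "a < N" "i < d" for a k i t
  proof -
    have m: "?E (T a) a i \<in> borel_measurable (\<nu> a)"
      using R(4)[OF that(1)] that(2) unfolding prob_space.indep_vars_def[OF prob_nu[OF that(1)]] by auto
    have "integrable (distr \<Omega> (\<nu> a) (\<lambda>\<omega>. fst \<omega> a k)) (\<lambda>x. exp (t * ?E (T a) a i x))"
      unfolding distr_Omega_sample[OF that(1)] by (rule R(5)[OF that])
    then show "integrable \<Omega> (\<lambda>\<omega>. exp (t * EE ((a,k),i) \<omega>))"
      using m measurable_Omega_sample[OF that(1)] by (subst (asm) integrable_distr_eq) (auto simp: EE_def)
    have "(\<integral>x. exp (t * ?E (T a) a i x) \<partial>distr \<Omega> (\<nu> a) (\<lambda>\<omega>. fst \<omega> a k)) \<le> exp (t\<^sup>2/2)"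
      unfolding distr_Omega_sample[OF that(1)] by (rule R(6)[OF that])
    then show "(\<integral>\<omega>. exp (t * EE ((a,k),i) \<omega>) \<partial>\<Omega>) \<le> exp (t\<^sup>2/2)"
      using m measurable_Omega_sample[OF that(1)] by (subst (asm) integral_distr) (auto simp: EE_def)
  qed
  define nb where "nb B = n (B div 2)" for B
  define ab where "ab B = arm (B div 2)" for B
  \<comment> \<open>The standardised coordinates that enter scalar p: half
    \<open>p div d mod 2\<close> of the arm and coordinate \<open>p mod d\<close>. Dividing their
    sum by sqrt n in Y preserves the moment bound exp(t^2/2); the remaining factor 1 / sqrt n goes
    into A.\<close>
  define Kp where "Kp p = (\<lambda>k. ((ab (p div d), (p div d mod 2) * nb (p div d) + k), p mod d)) ` {..<nb (p div d)}" for p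
  define Y where "Y p \<omega> = (\<Sum>r\<in>Kp p. EE r \<omega>) / sqrt (real (nb (p div d)))" for p \<omega>
  define A where "A B = (\<lambda>i j. R (ab B) i j / sqrt (real (nb B)))" for B
  have ab: "ab B < N" and nb: "0 < nb B" if "B < 2*q" for B
    using that arm n by (auto simp: ab_def nb_def)
  have pB: "p div d < 2*q" "p mod d < d" if "p < 2*q*d" for p
    using that d_pos by (auto simp: less_mult_imp_div_less)
  have Kp_sub: "Kp p \<subseteq> ({..<N} \<times> UNIV) \<times> {..<d}" if "p < 2*q*d" for p
    using pB[OF that] ab by (auto simp: Kp_def)
  have Kp_disj: "disjoint_family_on Kp {..<2*q*d}"
    unfolding disjoint_family_on_def
  proof (intro ballI impI)
    fix p p' assume p: "p \<in> {..<2*q*d}" "p' \<in> {..<2*q*d}" "p \<noteq> p'"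
    show "Kp p \<inter> Kp p' = {}"
    proof (rule ccontr)
      assume "Kp p \<inter> Kp p' \<noteq> {}"
      then obtain k k' where k: "ab (p div d) = ab (p' div d)" "p mod d = p' mod d" "k < nb (p div d)" "k' < nb (p' div d)"
        "(p div d mod 2) * nb (p div d) + k = (p' div d mod 2) * nb (p' div d) + k'"
        by (auto simp: Kp_def)
      have "p div d div 2 = p' div d div 2"
        using k(1) arm(2) pB(1)[of p] pB(1)[of p'] p by (auto simp: ab_def inj_on_def)
      moreover from this have nn: "nb (p div d) = nb (p' div d)" by (simp add: nb_def)
      have "p div d mod 2 = p' div d mod 2"
      proof -
        have "p div d mod 2 = 0 \<or> p div d mod 2 = 1" "p' div d mod 2 = 0 \<or> p' div d mod 2 = 1" by auto
        then show ?thesis using k(3,4,5) nn by auto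
      qed
      ultimately have "p div d = p' div d" by (metis div_mult_mod_eq)
      then have "p = p'" using k(2) by (metis div_mult_mod_eq)
      then show False using p by simp
    qed
  qed
  have Yind: "\<Omega>.indep_vars (\<lambda>_. borel) Y {..<2*q*d}"
  proof -
    have "\<Omega>.indep_vars (\<lambda>p. PiM (Kp p) (\<lambda>_. borel)) (\<lambda>p \<omega>. restrict (\<lambda>r. EE r \<omega>) (Kp p)) {..<2*q*d}"
      using Kp_sub Kp_disj by (intro \<Omega>.indep_vars_restrict[OF EEi]) auto
    then have "\<Omega>.indep_vars (\<lambda>_. borel) (\<lambda>p \<omega>. (\<lambda>y. (\<Sum>r\<in>Kp p. y r) / sqrt (real (nb (p div d)))) (restrict (\<lambda>r. EE r \<omega>) (Kp p))) {..<2*q*d}"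
      by (rule \<Omega>.indep_vars_compose2) measurable
    then show ?thesis unfolding Y_def by simp
  qed
  have Ymgf: "integrable \<Omega> (\<lambda>\<omega>. exp (t * Y p \<omega>)) \<and> (\<integral>\<omega>. exp (t * Y p \<omega>) \<partial>\<Omega>) \<le> exp (t\<^sup>2/2)" if p: "p < 2*q*d" for p t
  proof -
    let ?n = "nb (p div d)"
    define s where "s = t / sqrt (real ?n)"
    have n0: "0 < ?n" using nb pB[OF p] by auto
    have ei: "\<Omega>.indep_vars (\<lambda>_. borel) (\<lambda>r \<omega>. exp (s * EE r \<omega>)) (Kp p)"
      by (rule \<Omega>.indep_vars_compose2[OF \<Omega>.indep_vars_subset[OF EEi Kp_sub[OF p]]]) measurable
    have ib: "integrable \<Omega> (\<lambda>\<omega>. exp (s * EE r \<omega>))" "(\<integral>\<omega>. exp (s * EE r \<omega>) \<partial>\<Omega>) \<le> exp (s\<^sup>2/2)" if "r \<in> Kp p" for r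
      using that pB[OF p] ab EEint by (auto simp: Kp_def)
    have fin: "finite (Kp p)" by (simp add: Kp_def)
    have eq: "exp (t * Y p \<omega>) = (\<Prod>r\<in>Kp p. exp (s * EE r \<omega>))" for \<omega>
    proof -
      have "t * Y p \<omega> = (\<Sum>r\<in>Kp p. s * EE r \<omega>)" by (simp add: Y_def s_def sum_distrib_left sum_divide_distrib)
      then show ?thesis using fin by (simp add: exp_sum)
    qed
    have "(\<integral>\<omega>. exp (t * Y p \<omega>) \<partial>\<Omega>) = (\<Prod>r\<in>Kp p. \<integral>\<omega>. exp (s * EE r \<omega>) \<partial>\<Omega>)"
      unfolding eq by (rule \<Omega>.indep_vars_lebesgue_integral[OF fin ei ib(1)])
    also have "\<dots> \<le> (\<Prod>r\<in>Kp p. exp (s\<^sup>2/2))"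
      using ib by (intro prod_mono) (auto simp: Bochner_Integration.integral_nonneg)
    also have "\<dots> = exp (real (card (Kp p)) * (s\<^sup>2/2))" by (simp only: prod_constant exp_of_nat_mult)
    also have "card (Kp p) = ?n" unfolding Kp_def by (subst card_image) (auto simp: inj_on_def)
    also have "real ?n * (s\<^sup>2/2) = t\<^sup>2/2" using n0 by (simp add: s_def power_divide)
    finally have 1: "(\<integral>\<omega>. exp (t * Y p \<omega>) \<partial>\<Omega>) \<le> exp (t\<^sup>2/2)" .
    have 2: "integrable \<Omega> (\<lambda>\<omega>. exp (t * Y p \<omega>))"
      unfolding eq by (rule \<Omega>.indep_vars_integrable[OF fin ei ib(1)])
    from 1 2 show ?thesis by simp
  qed
  have nbl: "noise_blocks \<Omega> d (2*q) A (\<lambda>B. \<sigma>\<^sup>2 / real (n (B div 2))) Y"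
  proof unfold_locales
    show "0 < 2*q" using q by simp
    show "0 < d" by (rule d_pos)
    show "\<Omega>.indep_vars (\<lambda>_. borel) Y {..<2*q*d}" by (rule Yind)
    fix B assume B: "B < 2*q"
    show "mat_symmetric d (A B)" using R(1)[OF ab[OF B]] by (auto simp: A_def mat_symmetric_def)
    show "0 < \<sigma>\<^sup>2 / real (n (B div 2))" using sig nb[OF B] by (simp add: nb_def)
    fix x
    have "matvec d (A B) x = (\<lambda>i. (1 / sqrt (real (nb B))) * matvec d (R (ab B)) x i)"
      by (auto simp: matvec_def A_def sum_divide_distrib)
    then have "ip d (matvec d (A B) x) (matvec d (A B) x) = 1 / real (nb B) * ip d (matvec d (R (ab B)) x) (matvec d (R (ab B)) x)"
      by (simp only: ip_scale) simp
    also have "\<dots> \<le> 1 / real (nb B) * (\<sigma>\<^sup>2 * ip d x x)"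
      by (intro mult_left_mono R(7)[OF ab[OF B]]) auto
    finally show "ip d (matvec d (A B) x) (matvec d (A B) x) \<le> \<sigma>\<^sup>2 / real (n (B div 2)) * ip d x x"
      by (simp add: nb_def)
  qed (use Ymgf in auto)
  have "noise_blocks.w d A Y B \<omega> i = noise (arm (B div 2)) (B mod 2) (n (B div 2)) \<omega> i" if B: "B < 2*q" and i: "i < d" for B \<omega> i
  proof -
    let ?n = "nb B" and ?a = "ab B"
    let ?x = "\<lambda>k. fst \<omega> ?a (B mod 2 * ?n + k)"
    have n0: "0 < ?n" by (rule nb[OF B])
    have Yj: "Y (B*d+j) \<omega> = (\<Sum>k<?n. matvec d (T ?a) (vdiff (?x k) (\<mu> ?a)) j) / sqrt (real ?n)" if "j < d" for j
      using that unfolding Y_def Kp_def by (subst sum.reindex) (auto simp: inj_on_def EE_def)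
    have "noise_blocks.w d A Y B \<omega> i = (\<Sum>j<d. \<Sum>k<?n. R ?a i j * matvec d (T ?a) (vdiff (?x k) (\<mu> ?a)) j / real ?n)"
      unfolding noise_blocks.w_def[OF nbl] matvec_def[of d "A B"]
    proof (intro sum.cong refl)
      fix j assume "j \<in> {..<d}"
      then have "A B i j * Y (B*d+j) \<omega> = R ?a i j * (\<Sum>k<?n. matvec d (T ?a) (vdiff (?x k) (\<mu> ?a)) j) / (sqrt (real ?n) * sqrt (real ?n))"
        by (simp add: A_def Yj)
      then show "A B i j * Y (B*d+j) \<omega> = (\<Sum>k<?n. R ?a i j * matvec d (T ?a) (vdiff (?x k) (\<mu> ?a)) j / real ?n)"
        by (simp add: sum_distrib_left sum_divide_distrib)
    qed
    also have "\<dots> = (\<Sum>k<?n. matvec d (R ?a) (matvec d (T ?a) (vdiff (?x k) (\<mu> ?a))) i / real ?n)"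
      by (subst sum.swap) (simp add: matvec_def[of d "R ?a"] sum_divide_distrib)
    \<comment> \<open>R T = 1 turns a standardised sample back into its deviation from the
      mean.\<close>
    also have "\<dots> = (\<Sum>k<?n. (?x k i - \<mu> ?a i) / real ?n)"
    proof (intro sum.cong refl)
      fix k
      have "matvec d (R ?a) (matvec d (T ?a) (vdiff (?x k) (\<mu> ?a))) i = matvec d mat_id (vdiff (?x k) (\<mu> ?a)) i"
        by (rule matvec_mult_eq[OF RTid[OF ab[OF B]] i])
      also have "\<dots> = (\<Sum>j<d. if i = j then vdiff (?x k) (\<mu> ?a) j else 0)"
        unfolding matvec_def by (intro sum.cong refl) (simp add: mat_id_def)
      also have "\<dots> = ?x k i - \<mu> ?a i" using i by (simp add: vdiff_def)
      finally show "matvec d (R ?a) (matvec d (T ?a) (vdiff (?x k) (\<mu> ?a))) i / real ?n = (?x k i - \<mu> ?a i) / real ?n" by simp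
    qed
    also have "\<dots> = noise ?a (B mod 2) ?n \<omega> i"
      using n0 by (simp add: noise_def vdiff_def mean_from_def sum_divide_distrib[symmetric] sum_subtractf field_simps)
    finally show ?thesis by (simp add: ab_def nb_def)
  qed
  with nbl that show ?thesis by blast
qed


lemma sigma_pos: "0 < \<sigma>\<^sup>2"
proof -
  obtain A Y where nb: "noise_blocks \<Omega> d (2*1) A (\<lambda>B. \<sigma>\<^sup>2 / real ((\<lambda>_. 1) (B div 2))) Y"
    by (rule noise_blocks_arms[of 1 "\<lambda>_. 0" "\<lambda>_. 1"]) (use N_ge_2 in \<open>auto simp: inj_on_def\<close>)
  show ?thesis using noise_blocks.v_pos[OF nb, of 0] by simp
qed

lemma ip_cong: "(\<And>i. i < d \<Longrightarrow> x i = x' i) \<Longrightarrow> (\<And>i. i < d \<Longrightarrow> y i = y' i) \<Longrightarrow> ip d x y = ip d x' y'"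
  by (simp add: ip_def)

lemma sum_lessThan_numeral:
  fixes f :: "nat \<Rightarrow> real"
  shows "(\<Sum>B<2. f B) = f 0 + f 1" "(\<Sum>B<4. f B) = f 0 + f 1 + f 2 + f 3"
    "(\<Sum>B<6. f B) = f 0 + f 1 + f 2 + f 3 + f 4 + f 5"
  by (simp_all add: eval_nat_numeral)

lemma noise_norm_tail:
  assumes a: "a < N" and n: "0 < n" and h: "h < 2" and t: "0 < t"
  shows "\<Omega>.prob {\<omega> \<in> space \<Omega>. ip d (noise a h n \<omega>) (noise a h n \<omega>) > \<sigma>\<^sup>2 / real n * (5/2 * real d + cHW * t)} \<le> exp (- t)"
proof -
  obtain A Y where nb: "noise_blocks \<Omega> d (2*1) A (\<lambda>B. \<sigma>\<^sup>2 / real ((\<lambda>_. n) (B div 2))) Y"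
    and w: "\<And>B \<omega> i. B < 2*1 \<Longrightarrow> i < d \<Longrightarrow>
           noise_blocks.w d A Y B \<omega> i = noise ((\<lambda>_. a) (B div 2)) (B mod 2) ((\<lambda>_. n) (B div 2)) \<omega> i"
    by (rule noise_blocks_arms[of 1 "\<lambda>_. a" "\<lambda>_. n"]) (use a n in \<open>auto simp: inj_on_def\<close>)
  interpret nb: noise_blocks \<Omega> d "2*1" A "\<lambda>B. \<sigma>\<^sup>2 / real ((\<lambda>_. n) (B div 2))" Y by (rule nb)
  have "ip d (nb.w h \<omega>) (nb.w h \<omega>) = ip d (noise a h n \<omega>) (noise a h n \<omega>)" for \<omega>
    using w[of h] h by (intro ip_cong) auto
  then show ?thesis using nb.norm_tail[OF HW cHW_pos t, of h] h by simp
qed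

lemma noise_linear_tail:
  assumes a: "a < N" and n: "0 < n" and V: "0 < V" "\<sigma>\<^sup>2 / real n * (ip d u u + ip d u' u') \<le> V"
    and x: "0 \<le> x" and t: "2 * t * V \<le> x\<^sup>2"
  shows "\<Omega>.prob {\<omega> \<in> space \<Omega>. x \<le> ip d u (noise a 0 n \<omega>) + ip d u' (noise a 1 n \<omega>)} \<le> exp (- t)"
proof -
  obtain A Y where nb: "noise_blocks \<Omega> d (2*1) A (\<lambda>B. \<sigma>\<^sup>2 / real ((\<lambda>_. n) (B div 2))) Y"
    and w: "\<And>B \<omega> i. B < 2*1 \<Longrightarrow> i < d \<Longrightarrow>
           noise_blocks.w d A Y B \<omega> i = noise ((\<lambda>_. a) (B div 2)) (B mod 2) ((\<lambda>_. n) (B div 2)) \<omega> i"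
    by (rule noise_blocks_arms[of 1 "\<lambda>_. a" "\<lambda>_. n"]) (use a n in \<open>auto simp: inj_on_def\<close>)
  interpret nb: noise_blocks \<Omega> d "2*1" A "\<lambda>B. \<sigma>\<^sup>2 / real ((\<lambda>_. n) (B div 2))" Y by (rule nb)
  let ?u = "\<lambda>B. if B = (0::nat) then u else u'"
  have "(\<Sum>B<2*1. ip d (?u B) (nb.w B \<omega>)) = ip d u (noise a 0 n \<omega>) + ip d u' (noise a 1 n \<omega>)" for \<omega>
  proof -
    have "ip d (?u B) (nb.w B \<omega>) = ip d (?u B) (noise a (B mod 2) n \<omega>)" if "B < 2" for B
      using w[of B] that by (intro ip_cong) auto
    then show ?thesis by (simp add: sum_lessThan_numeral)
  qed
  moreover have "(\<Sum>B<2*1. \<sigma>\<^sup>2 / real ((\<lambda>_. n) (B div 2)) * ip d (?u B) (?u B)) \<le> V"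
    using V(2) by (simp add: sum_lessThan_numeral algebra_simps add_divide_distrib)
  ultimately show ?thesis using nb.linear_tail[OF V(1) _ x t, of ?u] by simp
qed

lemma noise_bilinear_tail:
  assumes a: "a < N" and n: "0 < n" and s: "s = 1 \<or> s = -1" and t: "0 \<le> t" and x: "0 < x"
    and b: "cHW * t * (real d * (\<sigma>\<^sup>2 / real n)\<^sup>2) \<le> x\<^sup>2" "cHW * t * (\<sigma>\<^sup>2 / real n) \<le> x"
  shows "\<Omega>.prob {\<omega> \<in> space \<Omega>. x < s * ip d (noise a 0 n \<omega>) (noise a 1 n \<omega>)} \<le> exp (- t)"
proof -
  obtain A Y where nb: "noise_blocks \<Omega> d (2*1) A (\<lambda>B. \<sigma>\<^sup>2 / real ((\<lambda>_. n) (B div 2))) Y"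
    and w: "\<And>B \<omega> i. B < 2*1 \<Longrightarrow> i < d \<Longrightarrow>
           noise_blocks.w d A Y B \<omega> i = noise ((\<lambda>_. a) (B div 2)) (B mod 2) ((\<lambda>_. n) (B div 2)) \<omega> i"
    by (rule noise_blocks_arms[of 1 "\<lambda>_. a" "\<lambda>_. n"]) (use a n in \<open>auto simp: inj_on_def\<close>)
  interpret nb: noise_blocks \<Omega> d "2*1" A "\<lambda>B. \<sigma>\<^sup>2 / real ((\<lambda>_. n) (B div 2))" Y by (rule nb)
  let ?\<beta> = "\<lambda>B C. if B = (0::nat) \<and> C = (1::nat) then s else 0"
  have "(\<Sum>B<2*1. \<Sum>C<2*1. ?\<beta> B C * ip d (nb.w B \<omega>) (nb.w C \<omega>)) = s * ip d (noise a 0 n \<omega>) (noise a 1 n \<omega>)" for \<omega>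
  proof -
    have "ip d (nb.w 0 \<omega>) (nb.w 1 \<omega>) = ip d (noise a 0 n \<omega>) (noise a 1 n \<omega>)"
      using w[of 0] w[of 1] by (intro ip_cong) auto
    then show ?thesis by (simp add: sum_lessThan_numeral)
  qed
  moreover have "nb.\<phi>2 ?\<beta> \<le> (\<sigma>\<^sup>2 / real n)\<^sup>2"
    unfolding nb.\<phi>2_def using s by (auto simp: sum_lessThan_numeral power2_eq_square)
  ultimately show ?thesis using nb.bilinear_tail[OF HW cHW_pos t x, of ?\<beta> "\<sigma>\<^sup>2 / real n"] b by simp
qed

lemma noise_pair:
  assumes a: "a < N" "b < N" "a \<noteq> b" and n: "0 < n"
  shows noise_pair_bilinear_tail: "\<lbrakk>s = 1 \<or> s = -1; 0 \<le> t; 0 < x;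
      cHW * t * (real d * (2 * \<sigma>\<^sup>2 / real n)\<^sup>2) \<le> x\<^sup>2; cHW * t * (2 * \<sigma>\<^sup>2 / real n) \<le> x\<rbrakk> \<Longrightarrow>
      \<Omega>.prob {\<omega> \<in> space \<Omega>. x < s * ip d (vdiff (noise a 0 n \<omega>) (noise b 0 n \<omega>)) (vdiff (noise a 1 n \<omega>) (noise b 1 n \<omega>))} \<le> exp (- t)"
    and noise_pair_linear_tail: "\<lbrakk>0 < V; 4 * (\<sigma>\<^sup>2 / real n * ip d u u) \<le> V; 0 \<le> x; 2 * t * V \<le> x\<^sup>2\<rbrakk> \<Longrightarrow>
      \<Omega>.prob {\<omega> \<in> space \<Omega>. x \<le> ip d u (noise a 0 n \<omega>) + ip d u (noise a 1 n \<omega>) - ip d u (noise b 0 n \<omega>) - ip d u (noise b 1 n \<omega>)} \<le> exp (- t)"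
proof -
  let ?arm = "\<lambda>i. if i = (0::nat) then a else b"
  obtain A Y where nb: "noise_blocks \<Omega> d (2*2) A (\<lambda>B. \<sigma>\<^sup>2 / real ((\<lambda>_. n) (B div 2))) Y"
    and w: "\<And>B \<omega> i. B < 2*2 \<Longrightarrow> i < d \<Longrightarrow>
           noise_blocks.w d A Y B \<omega> i = noise (?arm (B div 2)) (B mod 2) ((\<lambda>_. n) (B div 2)) \<omega> i"
    by (rule noise_blocks_arms[of 2 ?arm "\<lambda>_. n"]) (use a n in \<open>auto simp: inj_on_def\<close>)
  interpret nb: noise_blocks \<Omega> d "2*2" A "\<lambda>B. \<sigma>\<^sup>2 / real ((\<lambda>_. n) (B div 2))" Y by (rule nb)
  have w': "i < d \<Longrightarrow> nb.w 0 \<omega> i = noise a 0 n \<omega> i" "i < d \<Longrightarrow> nb.w 1 \<omega> i = noise a 1 n \<omega> i"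
    "i < d \<Longrightarrow> nb.w 2 \<omega> i = noise b 0 n \<omega> i" "i < d \<Longrightarrow> nb.w 3 \<omega> i = noise b 1 n \<omega> i" for i \<omega>
    using w[of 0 i \<omega>] w[of 1 i \<omega>] w[of 2 i \<omega>] w[of 3 i \<omega>] by auto
  {
    assume s: "s = 1 \<or> s = -1" and t: "0 \<le> t" and x: "0 < x"
      and b: "cHW * t * (real d * (2 * \<sigma>\<^sup>2 / real n)\<^sup>2) \<le> x\<^sup>2" "cHW * t * (2 * \<sigma>\<^sup>2 / real n) \<le> x"
    \<comment> \<open>Expansion of the inner product of the two differences: blocks 0 and 1 are the
      halves of a, blocks 2 and 3 those of b. Four entries of modulus 1 with equal variances give
      the factor 2 in the norm.\<close>
    let ?\<beta> = "\<lambda>B C. if B = (0::nat) \<and> C = (1::nat) \<or> B = 2 \<and> C = 3 then s else if B = 0 \<and> C = 3 \<or> B = 2 \<and> C = 1 then - s else 0"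
    have "(\<Sum>B<2*2. \<Sum>C<2*2. ?\<beta> B C * ip d (nb.w B \<omega>) (nb.w C \<omega>)) =
        s * ip d (vdiff (noise a 0 n \<omega>) (noise b 0 n \<omega>)) (vdiff (noise a 1 n \<omega>) (noise b 1 n \<omega>))" for \<omega>
    proof -
      have "(\<Sum>B<2*2. \<Sum>C<2*2. ?\<beta> B C * ip d (nb.w B \<omega>) (nb.w C \<omega>)) =
        s * ip d (nb.w 0 \<omega>) (nb.w 1 \<omega>) - s * ip d (nb.w 0 \<omega>) (nb.w 3 \<omega>) - s * ip d (nb.w 2 \<omega>) (nb.w 1 \<omega>) + s * ip d (nb.w 2 \<omega>) (nb.w 3 \<omega>)"
        by (simp add: sum_lessThan_numeral)
      also have "\<dots> = s * ip d (vdiff (noise a 0 n \<omega>) (noise b 0 n \<omega>)) (vdiff (noise a 1 n \<omega>) (noise b 1 n \<omega>))"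
        by (simp add: ip_def vdiff_def w' w'(2)[unfolded One_nat_def] sum_distrib_left sum_subtractf[symmetric] sum.distrib[symmetric] algebra_simps)
      finally show ?thesis .
    qed
    moreover have "nb.\<phi>2 ?\<beta> \<le> (2 * \<sigma>\<^sup>2 / real n)\<^sup>2"
      unfolding nb.\<phi>2_def using s by (auto simp: sum_lessThan_numeral power2_eq_square)
    ultimately show "\<Omega>.prob {\<omega> \<in> space \<Omega>. x < s * ip d (vdiff (noise a 0 n \<omega>) (noise b 0 n \<omega>)) (vdiff (noise a 1 n \<omega>) (noise b 1 n \<omega>))} \<le> exp (- t)"
      using nb.bilinear_tail[OF HW cHW_pos t x, of ?\<beta> "2 * \<sigma>\<^sup>2 / real n"] b by simp
  }
  {
    assume V: "0 < V" "4 * (\<sigma>\<^sup>2 / real n * ip d u u) \<le> V" and x: "0 \<le> x" and t: "2 * t * V \<le> x\<^sup>2"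
    let ?u = "\<lambda>B i. if B < (2::nat) then u i else - u i"
    have "(\<Sum>B<2*2. ip d (?u B) (nb.w B \<omega>)) =
       ip d u (noise a 0 n \<omega>) + ip d u (noise a 1 n \<omega>) - ip d u (noise b 0 n \<omega>) - ip d u (noise b 1 n \<omega>)" for \<omega>
      by (simp add: sum_lessThan_numeral ip_def w' w'(2)[unfolded One_nat_def] sum_negf)
    moreover have "(\<Sum>B<2*2. \<sigma>\<^sup>2 / real ((\<lambda>_. n) (B div 2)) * ip d (?u B) (?u B)) \<le> V"
      using V(2) by (simp add: sum_lessThan_numeral ip_def)
    ultimately show "\<Omega>.prob {\<omega> \<in> space \<Omega>. x \<le> ip d u (noise a 0 n \<omega>) + ip d u (noise a 1 n \<omega>) - ip d u (noise b 0 n \<omega>) - ip d u (noise b 1 n \<omega>)} \<le> exp (- t)"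
      using nb.linear_tail[OF V(1) _ x t, of ?u] by simp
  }
qed

text \<open>Arm a is compared with b and with j. The product of the two halves of a occurs in both
  statistics and cancels; what remains are four mixed products of size 1/(n m) and the inner
  products of b and of j, of size 1/m^2. The linear part has weight 0 on b: it is meant for b with
  the same mean as a.\<close>

lemma noise_triple:
  assumes a: "a < N" "b < N" "j < N" "a \<noteq> b" "a \<noteq> j" "b \<noteq> j" and n: "0 < n" "0 < m"
  shows noise_triple_bilinear_tail: "\<lbrakk>0 \<le> t; 0 < x; 0 \<le> \<phi>; 4 * ((\<sigma>\<^sup>2)\<^sup>2 / (real n * real m)) + 2 * ((\<sigma>\<^sup>2)\<^sup>2 / (real m)\<^sup>2) \<le> \<phi>\<^sup>2;
      cHW * t * (real d * \<phi>\<^sup>2) \<le> x\<^sup>2; cHW * t * \<phi> \<le> x\<rbrakk> \<Longrightarrow>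
      \<Omega>.prob {\<omega> \<in> space \<Omega>. x < ip d (vdiff (noise a 0 n \<omega>) (noise b 0 m \<omega>)) (vdiff (noise a 1 n \<omega>) (noise b 1 m \<omega>))
          - ip d (vdiff (noise a 0 n \<omega>) (noise j 0 m \<omega>)) (vdiff (noise a 1 n \<omega>) (noise j 1 m \<omega>))} \<le> exp (- t)"
    and noise_triple_linear_tail: "\<lbrakk>0 < V; 2 * (\<sigma>\<^sup>2 / real n * ip d u u) + 2 * (\<sigma>\<^sup>2 / real m * ip d u u) \<le> V; 0 \<le> x; 2 * t * V \<le> x\<^sup>2\<rbrakk> \<Longrightarrow>
      \<Omega>.prob {\<omega> \<in> space \<Omega>. x \<le> ip d u (noise a 0 n \<omega>) + ip d u (noise a 1 n \<omega>) - ip d u (noise j 0 m \<omega>) - ip d u (noise j 1 m \<omega>)} \<le> exp (- t)"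
proof -
  let ?arm = "\<lambda>i. if i = (0::nat) then a else if i = 1 then b else j"
  let ?n = "\<lambda>i. if i = (0::nat) then n else m"
  obtain A Y where nb: "noise_blocks \<Omega> d (2*3) A (\<lambda>B. \<sigma>\<^sup>2 / real (?n (B div 2))) Y"
    and w: "\<And>B \<omega> i. B < 2*3 \<Longrightarrow> i < d \<Longrightarrow>
           noise_blocks.w d A Y B \<omega> i = noise (?arm (B div 2)) (B mod 2) (?n (B div 2)) \<omega> i"
    by (rule noise_blocks_arms[of 3 ?arm ?n]) (use a n in \<open>auto simp: inj_on_def\<close>)
  interpret nb: noise_blocks \<Omega> d "2*3" A "\<lambda>B. \<sigma>\<^sup>2 / real (?n (B div 2))" Y by (rule nb)
  have w': "i < d \<Longrightarrow> nb.w 0 \<omega> i = noise a 0 n \<omega> i" "i < d \<Longrightarrow> nb.w 1 \<omega> i = noise a 1 n \<omega> i"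
    "i < d \<Longrightarrow> nb.w 2 \<omega> i = noise b 0 m \<omega> i" "i < d \<Longrightarrow> nb.w 3 \<omega> i = noise b 1 m \<omega> i"
    "i < d \<Longrightarrow> nb.w 4 \<omega> i = noise j 0 m \<omega> i" "i < d \<Longrightarrow> nb.w 5 \<omega> i = noise j 1 m \<omega> i" for i \<omega>
    using w[of 0 i \<omega>] w[of 1 i \<omega>] w[of 2 i \<omega>] w[of 3 i \<omega>] w[of 4 i \<omega>] w[of 5 i \<omega>] by auto
  {
    assume t: "0 \<le> t" and x: "0 < x" and p: "0 \<le> \<phi>"
      and pp: "4 * ((\<sigma>\<^sup>2)\<^sup>2 / (real n * real m)) + 2 * ((\<sigma>\<^sup>2)\<^sup>2 / (real m)\<^sup>2) \<le> \<phi>\<^sup>2"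
      and b: "cHW * t * (real d * \<phi>\<^sup>2) \<le> x\<^sup>2" "cHW * t * \<phi> \<le> x"
    let ?\<beta> = "\<lambda>B C. if B = (0::nat) \<and> C = (5::nat) \<or> B = 4 \<and> C = 1 \<or> B = 2 \<and> C = 3 then 1
         else if B = 0 \<and> C = 3 \<or> B = 2 \<and> C = 1 \<or> B = 4 \<and> C = 5 then -1 else 0 :: real"
    have "(\<Sum>B<2*3. \<Sum>C<2*3. ?\<beta> B C * ip d (nb.w B \<omega>) (nb.w C \<omega>)) =
        ip d (vdiff (noise a 0 n \<omega>) (noise b 0 m \<omega>)) (vdiff (noise a 1 n \<omega>) (noise b 1 m \<omega>))
          - ip d (vdiff (noise a 0 n \<omega>) (noise j 0 m \<omega>)) (vdiff (noise a 1 n \<omega>) (noise j 1 m \<omega>))" for \<omega>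
    proof -
      have "(\<Sum>B<2*3. \<Sum>C<2*3. ?\<beta> B C * ip d (nb.w B \<omega>) (nb.w C \<omega>)) =
        ip d (nb.w 0 \<omega>) (nb.w 5 \<omega>) + ip d (nb.w 4 \<omega>) (nb.w 1 \<omega>) + ip d (nb.w 2 \<omega>) (nb.w 3 \<omega>)
         - ip d (nb.w 0 \<omega>) (nb.w 3 \<omega>) - ip d (nb.w 2 \<omega>) (nb.w 1 \<omega>) - ip d (nb.w 4 \<omega>) (nb.w 5 \<omega>)"
        by (simp add: sum_lessThan_numeral)
      also have "\<dots> = ip d (vdiff (noise a 0 n \<omega>) (noise b 0 m \<omega>)) (vdiff (noise a 1 n \<omega>) (noise b 1 m \<omega>))
          - ip d (vdiff (noise a 0 n \<omega>) (noise j 0 m \<omega>)) (vdiff (noise a 1 n \<omega>) (noise j 1 m \<omega>))"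
        by (simp add: ip_def vdiff_def w' w'(2)[unfolded One_nat_def] sum_subtractf[symmetric] sum.distrib[symmetric] algebra_simps)
      finally show ?thesis .
    qed
    moreover have "nb.\<phi>2 ?\<beta> \<le> \<phi>\<^sup>2"
      unfolding nb.\<phi>2_def using pp by (simp add: sum_lessThan_numeral power2_eq_square algebra_simps)
    moreover have "?\<beta> B B = 0" for B by auto
    ultimately show "\<Omega>.prob {\<omega> \<in> space \<Omega>. x < ip d (vdiff (noise a 0 n \<omega>) (noise b 0 m \<omega>)) (vdiff (noise a 1 n \<omega>) (noise b 1 m \<omega>))
          - ip d (vdiff (noise a 0 n \<omega>) (noise j 0 m \<omega>)) (vdiff (noise a 1 n \<omega>) (noise j 1 m \<omega>))} \<le> exp (- t)"
      using nb.bilinear_tail[OF HW cHW_pos t x, of ?\<beta> \<phi>] b p by simp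
  }
  {
    assume V: "0 < V" "2 * (\<sigma>\<^sup>2 / real n * ip d u u) + 2 * (\<sigma>\<^sup>2 / real m * ip d u u) \<le> V" and x: "0 \<le> x" and t: "2 * t * V \<le> x\<^sup>2"
    let ?u = "\<lambda>B i. if B < (2::nat) then u i else if B < 4 then 0 else - u i"
    have "(\<Sum>B<2*3. ip d (?u B) (nb.w B \<omega>)) =
       ip d u (noise a 0 n \<omega>) + ip d u (noise a 1 n \<omega>) - ip d u (noise j 0 m \<omega>) - ip d u (noise j 1 m \<omega>)" for \<omega>
      by (simp add: sum_lessThan_numeral ip_def w' w'(2)[unfolded One_nat_def] sum_negf)
    moreover have "(\<Sum>B<2*3. \<sigma>\<^sup>2 / real (?n (B div 2)) * ip d (?u B) (?u B)) \<le> V"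
      using V(2) by (simp add: sum_lessThan_numeral ip_def)
    ultimately show "\<Omega>.prob {\<omega> \<in> space \<Omega>. x \<le> ip d u (noise a 0 n \<omega>) + ip d u (noise a 1 n \<omega>) - ip d u (noise j 0 m \<omega>) - ip d u (noise j 1 m \<omega>)} \<le> exp (- t)"
      using nb.linear_tail[OF V(1) _ x t, of ?u] by simp
  }
qed

end

section \<open>The algorithm on a stream of samples\<close>

type_synonym src = "smp \<times> (nat \<Rightarrow> nat)"

text \<open>All naturals serve as indices, also for arms and draws in \<open>SRC\<close>, so that
  the spaces are \<open>UNIV\<close> and no range conditions arise; the relevant arms and
  coordinates form a finite part.\<close>

definition VEC :: "vec measure" where "VEC = PiM UNIV (\<lambda>_. borel)"

definition SRC :: "src measure" where
  "SRC = PiM UNIV (\<lambda>_. PiM UNIV (\<lambda>_. VEC)) \<Otimes>\<^sub>M PiM UNIV (\<lambda>_. count_space UNIV)"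

definition MEANS :: "(nat \<Rightarrow> vec \<times> vec) measure" where
  "MEANS = PiM UNIV (\<lambda>_. VEC \<Otimes>\<^sub>M VEC)"

definition single :: "nat \<Rightarrow> nat \<Rightarrow> nat \<Rightarrow> nat" where
  "single a n = (\<lambda>b. if b = a then n else 0)"

definition adv :: "(nat \<Rightarrow> nat) \<Rightarrow> nat \<Rightarrow> src \<Rightarrow> src" where
  "adv n u \<omega> = (\<lambda>a k. fst \<omega> a (n a + k), \<lambda>k. snd \<omega> (u + k))"

definition means :: "(nat \<Rightarrow> nat) \<Rightarrow> src \<Rightarrow> nat \<Rightarrow> vec \<times> vec" where
  "means n \<omega> a = (mean_from (fst \<omega>) a 0 (n a), mean_from (fst \<omega>) a (n a) (n a))"

lemma space_VEC [simp]: "space VEC = UNIV" by (simp add: VEC_def space_PiM)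
lemma space_SRC [simp]: "space SRC = UNIV" by (simp add: SRC_def space_pair_measure space_PiM)
lemma space_MEANS [simp]: "space MEANS = UNIV" by (simp add: MEANS_def space_pair_measure space_PiM)

lemma measurable_VEC_coord: "f \<in> measurable M VEC \<Longrightarrow> (\<lambda>x. f x i) \<in> borel_measurable M"
  unfolding VEC_def by (erule measurable_compose[OF _ measurable_component_singleton]) simp

lemma measurable_VECI: "(\<And>i. (\<lambda>x. f x i) \<in> borel_measurable M) \<Longrightarrow> f \<in> measurable M VEC"
  unfolding VEC_def by (rule measurable_PiM_single') (auto simp: PiE_UNIV_domain)

lemma measurable_MEANS_coord: "f \<in> measurable M MEANS \<Longrightarrow> (\<lambda>x. f x a) \<in> measurable M (VEC \<Otimes>\<^sub>M VEC)"
  unfolding MEANS_def by (erule measurable_compose[OF _ measurable_component_singleton]) simp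

lemma measurable_MEANSI: "(\<And>a. (\<lambda>x. f x a) \<in> measurable M (VEC \<Otimes>\<^sub>M VEC)) \<Longrightarrow> f \<in> measurable M MEANS"
  unfolding MEANS_def by (rule measurable_PiM_single') (auto simp: PiE_UNIV_domain space_pair_measure)

lemma measurable_SRC_sample: "f \<in> measurable M SRC \<Longrightarrow> (\<lambda>x. fst (f x) a k) \<in> measurable M VEC"
  unfolding SRC_def
  by (rule measurable_compose[OF measurable_compose[OF measurable_compose[OF _ measurable_fst]
        measurable_component_singleton[of a UNIV]] measurable_component_singleton[of k UNIV]]) auto

lemma measurable_SRC_draw: "f \<in> measurable M SRC \<Longrightarrow> (\<lambda>x. snd (f x) u) \<in> measurable M (count_space UNIV)"
  unfolding SRC_def
  by (rule measurable_compose[OF measurable_compose[OF _ measurable_snd] measurable_component_singleton]) auto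

lemma measurable_SRCI:
  assumes "\<And>a k. (\<lambda>x. fst (f x) a k) \<in> measurable M VEC" "\<And>u. (\<lambda>x. snd (f x) u) \<in> measurable M (count_space UNIV)"
  shows "f \<in> measurable M SRC"
  unfolding SRC_def
proof (rule measurable_pair)
  show "fst \<circ> f \<in> measurable M (PiM UNIV (\<lambda>_. PiM UNIV (\<lambda>_. VEC)))"
    using assms(1) by (intro measurable_PiM_single') (auto simp: PiE_UNIV_domain comp_def space_PiM)
  show "snd \<circ> f \<in> measurable M (PiM UNIV (\<lambda>_. count_space UNIV))"
    using assms(2) by (intro measurable_PiM_single') (auto simp: PiE_UNIV_domain comp_def)
qed

lemma measurable_adv: "f \<in> measurable M SRC \<Longrightarrow> (\<lambda>x. adv n u (f x)) \<in> measurable M SRC"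
  by (rule measurable_SRCI) (auto simp: adv_def intro: measurable_SRC_sample measurable_SRC_draw)

lemma measurable_mean_from:
  "f \<in> measurable M SRC \<Longrightarrow> (\<lambda>x. mean_from (fst (f x)) a c n) \<in> measurable M VEC"
  unfolding mean_from_def
  by (intro measurable_VECI borel_measurable_divide borel_measurable_sum borel_measurable_const measurable_VEC_coord[OF measurable_SRC_sample])

lemma measurable_means: "f \<in> measurable M SRC \<Longrightarrow> (\<lambda>x. means n (f x)) \<in> measurable M MEANS"
  unfolding means_def[abs_def]
  by (intro measurable_MEANSI measurable_Pair measurable_mean_from)

lemma measurable_MEANS_upd:
  assumes "f \<in> measurable M MEANS" "g \<in> measurable M (VEC \<Otimes>\<^sub>M VEC)"
  shows "(\<lambda>x. (f x)(a := g x)) \<in> measurable M MEANS"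
proof (rule measurable_MEANSI)
  fix b show "(\<lambda>x. ((f x)(a := g x)) b) \<in> measurable M (VEC \<Otimes>\<^sub>M VEC)"
    using assms by (cases "b = a") (auto intro: measurable_MEANS_coord[OF assms(1)])
qed

lemma measurable_ip:
  assumes "f \<in> measurable M VEC" "g \<in> measurable M VEC"
  shows "(\<lambda>x. ip d (f x) (g x)) \<in> borel_measurable M"
  unfolding ip_def
  by (intro borel_measurable_sum borel_measurable_times measurable_VEC_coord[OF assms(1)] measurable_VEC_coord[OF assms(2)])

lemma measurable_vdiff:
  assumes "f \<in> measurable M VEC" "g \<in> measurable M VEC"
  shows "(\<lambda>x. vdiff (f x) (g x)) \<in> measurable M VEC"
  unfolding vdiff_def
  by (intro measurable_VECI borel_measurable_diff measurable_VEC_coord[OF assms(1)] measurable_VEC_coord[OF assms(2)])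

section \<open>The programs in continuation form\<close>

definition stat :: "nat \<Rightarrow> vec \<times> vec \<Rightarrow> vec \<times> vec \<Rightarrow> real" where
  "stat d m m' = ip d (vdiff (fst m) (fst m')) (vdiff (snd m) (snd m'))"

lemma measurable_stat:
  assumes "f \<in> measurable M (VEC \<Otimes>\<^sub>M VEC)" "g \<in> measurable M (VEC \<Otimes>\<^sub>M VEC)"
  shows "(\<lambda>x. stat d (f x) (g x)) \<in> borel_measurable M"
  unfolding stat_def
  by (intro measurable_ip measurable_vdiff measurable_compose[OF assms(1) measurable_fst] measurable_compose[OF assms(2) measurable_fst]
      measurable_compose[OF assms(1) measurable_snd] measurable_compose[OF assms(2) measurable_snd])

definition reject :: "nat \<Rightarrow> real \<Rightarrow> nat set \<Rightarrow> (nat \<Rightarrow> vec \<times> vec) \<Rightarrow> vec \<times> vec \<Rightarrow> bool" where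
  "reject d \<Delta> S M m \<longleftrightarrow> Min ((\<lambda>b. stat d m (M b)) ` S) \<le> \<Delta>\<^sup>2 / 2"

lemma reject_iff: "finite S \<Longrightarrow> S \<noteq> {} \<Longrightarrow> reject d \<Delta> S M m \<longleftrightarrow> (\<exists>b\<in>S. stat d m (M b) \<le> \<Delta>\<^sup>2 / 2)"
  unfolding reject_def by (subst Min_le_iff) auto

lemma measurable_reject:
  assumes "finite S" "S \<noteq> {}" and fg: "f \<in> measurable M MEANS" "g \<in> measurable M (VEC \<Otimes>\<^sub>M VEC)"
  shows "Measurable.pred M (\<lambda>x. reject d \<Delta> S (f x) (g x))"
  proof -
  have "(\<lambda>x. stat d (g x) (f x b)) \<in> borel_measurable M" for b
    by (intro measurable_stat measurable_MEANS_coord[OF fg(1)] fg(2))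
  then have "Measurable.pred M (\<lambda>x. stat d (g x) (f x b) \<le> \<Delta>\<^sup>2 / 2)" for b
    unfolding Measurable.pred_def by (intro borel_measurable_le borel_measurable_const)
  then show ?thesis unfolding reject_iff[OF assms(1,2)] using assms(1) by (intro pred_intros_finite)
qed

text \<open>The continuation receives the result, the running total and the rest of the stream. Its
  result type is left open: with values in \<open>ennreal\<close> the program is an integrand, and
  integrating block by block follows the program text.\<close>

fun testK :: "params \<Rightarrow> real \<Rightarrow> nat \<Rightarrow> nat set \<Rightarrow> (nat \<Rightarrow> vec \<times> vec) \<Rightarrow> nat \<Rightarrow> nat \<Rightarrow> nat \<Rightarrow> src
                \<Rightarrow> (bool \<Rightarrow> nat \<Rightarrow> src \<Rightarrow> 'r) \<Rightarrow> 'r" where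
  "testK P \<Delta> r S M a f tot \<omega> \<kappa> =
     (let n = sri_n P \<Delta> (r - f); \<omega>' = adv (single a (2 * n)) 0 \<omega>; tot' = tot + 2 * n in
      if reject (pd P) \<Delta> S M (means (single a n) \<omega> a) then \<kappa> False tot' \<omega>'
      else (case f of 0 \<Rightarrow> \<kappa> True tot' \<omega>' | Suc f' \<Rightarrow> testK P \<Delta> r S M a f' tot' \<omega>' \<kappa>))"

declare testK.simps [simp del] sri_test.simps [simp del]

fun loopK :: "params \<Rightarrow> real \<Rightarrow> real \<Rightarrow> real \<Rightarrow> nat \<Rightarrow> nat \<Rightarrow> nat set \<Rightarrow> (nat \<Rightarrow> vec \<times> vec) \<Rightarrow> nat \<Rightarrow> src
                \<Rightarrow> (nat set \<Rightarrow> nat \<Rightarrow> src \<Rightarrow> 'r) \<Rightarrow> 'r" where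
  "loopK P \<delta> \<Delta> \<theta> tot0 0 S M tot \<omega> \<kappa> = \<kappa> S tot \<omega>"
| "loopK P \<delta> \<Delta> \<theta> tot0 (Suc k) S M tot \<omega> \<kappa> =
     (let cont = (\<lambda>S M tot \<omega>. if card S = pK P \<or> sri_Tmax P \<delta> \<Delta> \<theta> < real (tot - tot0) then \<kappa> S tot \<omega>
                                else loopK P \<delta> \<Delta> \<theta> tot0 k S M tot \<omega> \<kappa>);
          a = snd \<omega> 0; n = sri_nmax P \<delta> \<Delta> \<theta>
      in testK P \<Delta> (sri_r P \<delta> \<theta>) S M a (sri_r P \<delta> \<theta> - sri_s0 P \<delta> \<Delta> \<theta>) tot (adv (\<lambda>_. 0) 1 \<omega>)
        (\<lambda>acc tot \<omega>. if acc then cont (insert a S) (M(a := means (single a n) \<omega> a)) (tot + 2 * n) (adv (single a (2 * n)) 0 \<omega>)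
                       else cont S M tot \<omega>))"

definition SRIK :: "params \<Rightarrow> real \<Rightarrow> real \<Rightarrow> real \<Rightarrow> nat \<Rightarrow> src \<Rightarrow> (nat set \<Rightarrow> nat \<Rightarrow> src \<Rightarrow> 'r) \<Rightarrow> 'r" where
  "SRIK P \<delta> \<Delta> \<theta> tot \<omega> \<kappa> =
     (let a = snd \<omega> 0; n = sri_nmax P \<delta> \<Delta> \<theta>; \<omega>' = adv (\<lambda>_. 0) 1 \<omega> in
      loopK P \<delta> \<Delta> \<theta> tot (sri_U P \<delta> \<theta>) {a} (\<lambda>_. means (single a n) \<omega>' a) (tot + 2 * n) (adv (single a (2 * n)) 0 \<omega>') \<kappa>)"

definition adc_L0 :: "params \<Rightarrow> real \<Rightarrow> real" where
  "adc_L0 P \<delta> = ln (6 * real (pN P) * real (pK P) / \<delta>)"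

definition adc_J :: "params \<Rightarrow> real \<Rightarrow> real \<Rightarrow> nat" where
  "adc_J P \<delta> \<Delta> = nat \<lceil>max (c4 (pcHW P) * (psig P)\<^sup>2 / \<Delta>\<^sup>2 * adc_L0 P \<delta>)
     (c5 (pcHW P) * (psig P)\<^sup>2 / \<Delta>\<^sup>2 * sqrt (real (pd P) * real (pN P) / real (pK P) * adc_L0 P \<delta>))\<rceil>"

definition adc_I :: "params \<Rightarrow> real \<Rightarrow> real \<Rightarrow> nat" where
  "adc_I P \<delta> \<Delta> = nat \<lceil>max (c4 (pcHW P) * (psig P)\<^sup>2 / \<Delta>\<^sup>2 * adc_L0 P \<delta>)
     (c5 (pcHW P) * (psig P)\<^sup>2 / \<Delta>\<^sup>2 * sqrt (real (pd P) * real (pK P) / real (pN P) * adc_L0 P \<delta>))\<rceil>"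

definition adc_n :: "params \<Rightarrow> real \<Rightarrow> real \<Rightarrow> nat set \<Rightarrow> nat \<Rightarrow> nat" where
  "adc_n P \<delta> \<Delta> S = (\<lambda>a. if a \<in> S then adc_J P \<delta> \<Delta> else adc_I P \<delta> \<Delta>)"

definition adc_out :: "params \<Rightarrow> nat set \<Rightarrow> (nat \<Rightarrow> vec \<times> vec) \<Rightarrow> nat set set" where
  "adc_out P S mm = (\<lambda>b. insert b {a. a < pN P \<and> a \<notin> S \<and> arg_min_on (\<lambda>b. stat (pd P) (mm a) (mm b)) S = b}) ` S"

definition gap2 :: "nat \<Rightarrow> nat set \<Rightarrow> (nat \<Rightarrow> vec \<times> vec) \<Rightarrow> real" where
  "gap2 d S mm = Min {stat d (mm a) (mm b) | a b. a \<in> S \<and> b \<in> S \<and> a \<noteq> b}"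

definition finishK :: "params \<Rightarrow> real \<Rightarrow> nat \<Rightarrow> nat set \<Rightarrow> nat \<Rightarrow> src \<Rightarrow> (nat set set \<Rightarrow> nat \<Rightarrow> src \<Rightarrow> 'r) \<Rightarrow> 'r" where
  "finishK P \<delta> p S tot \<omega> \<kappa> =
     (let n = n'_p P \<delta> p; m = (\<lambda>a. if a \<in> S then n else 0);
          \<Delta> = sqrt (gap2 (pd P) S (means m \<omega>)) / sqrt 2; \<omega>' = adv (\<lambda>a. 2 * m a) 0 \<omega>;
          m' = adc_n P (\<delta>/3) \<Delta> S
      in \<kappa> (adc_out P S (means m' \<omega>')) (tot + (\<Sum>a\<in>S. 2 * n) + (\<Sum>a<pN P. 2 * m' a))
           (adv (\<lambda>a. if a < pN P then 2 * m' a else 0) 0 \<omega>'))"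

fun roundK :: "params \<Rightarrow> real \<Rightarrow> nat \<Rightarrow> nat \<Rightarrow> nat \<Rightarrow> nat \<Rightarrow> src
                  \<Rightarrow> (nat set set option \<Rightarrow> nat \<Rightarrow> src \<Rightarrow> 'r) \<Rightarrow> 'r" where
  "roundK P \<delta> l p 0 tot \<omega> \<kappa> = \<kappa> None tot \<omega>"
| "roundK P \<delta> l p (Suc f) tot \<omega> \<kappa> =
     SRIK P (delta_l \<delta> l) (Delta_p P \<delta> p) (max (theta_pl P p l) (1 / real (pN P))) tot \<omega>
       (\<lambda>S tot \<omega>. if card S = pK P then finishK P \<delta> p S tot \<omega> (\<lambda>G. \<kappa> (Some G))
                   else roundK P \<delta> l (Suc p) f tot \<omega> \<kappa>)"

fun roundsK :: "params \<Rightarrow> real \<Rightarrow> nat \<Rightarrow> src \<Rightarrow> (nat set set option \<Rightarrow> nat \<Rightarrow> src \<Rightarrow> 'r) \<Rightarrow> 'r" where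
  "roundsK P \<delta> 0 \<omega> \<kappa> = \<kappa> None 0 \<omega>"
| "roundsK P \<delta> (Suc L) \<omega> \<kappa> =
     roundsK P \<delta> L \<omega> (\<lambda>G tot \<omega>. case G of None \<Rightarrow> roundK P \<delta> L 0 (Suc L) tot \<omega> \<kappa> | Some _ \<Rightarrow> \<kappa> G tot \<omega>)"

section \<open>Agreement of the two forms of the programs\<close>

definition cur :: "src \<Rightarrow> st \<Rightarrow> src" where
  "cur \<omega> s = adv (fst s) (fst (snd s)) \<omega>"

lemma adv_adv: "adv n u (adv m w \<omega>) = adv (\<lambda>a. m a + n a) (w + u) \<omega>"
  by (simp add: adv_def add.assoc)

lemma total_simp [simp]: "total (c, u, t) = t" by (simp add: total_def)

lemma mean_from_adv: "mean_from (fst (adv n u \<omega>)) a c m = mean_from (fst \<omega>) a (n a + c) m"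
  by (simp add: mean_from_def adv_def add.assoc)

lemma emp_mean_cur:
  "emp_mean (fst \<omega>) a n s = ((mean_from (fst \<omega>) a (fst s a) n, mean_from (fst \<omega>) a (fst s a + n) n), snd (emp_mean (fst \<omega>) a n s))"
  "means (single a n) (cur \<omega> s) a = (mean_from (fst \<omega>) a (fst s a) n, mean_from (fst \<omega>) a (fst s a + n) n)"
  "cur \<omega> (snd (emp_mean (fst \<omega>) a n s)) = adv (single a (2 * n)) 0 (cur \<omega> s)"
  "total (snd (emp_mean (fst \<omega>) a n s)) = total s + 2 * n"
  by (cases s; auto simp: emp_mean_def means_def cur_def mean_from_adv adv_adv single_def fun_upd_def total_def
      intro!: arg_cong2[where f="\<lambda>n u. adv n u \<omega>"])+

lemma emp_mean_fst: "fst (emp_mean (fst \<omega>) a n s) = means (single a n) (cur \<omega> s) a"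
  unfolding emp_mean_cur(2) by (subst emp_mean_cur(1)) simp

text \<open>A state is a position in the stream: \<open>cur\<close> turns its counters into a shift,
  after which only the total has to be carried along.\<close>

lemma testK_simulates:
  "testK P \<Delta> r S M a f (total s) (cur \<omega> s) \<kappa> =
     (case sri_test P (fst \<omega>) \<Delta> r S M a f s of (b, s') \<Rightarrow> \<kappa> b (total s') (cur \<omega> s'))"
proof (induction f arbitrary: s)
  case 0
  show ?case
    by (subst testK.simps, subst sri_test.simps)
       (auto simp: Let_def reject_def stat_def emp_mean_cur(3,4) split_beta emp_mean_fst[symmetric])
next
  case (Suc f)
  note IH = Suc[of "snd (emp_mean (fst \<omega>) a (sri_n P \<Delta> (r - Suc f)) s)", unfolded emp_mean_cur(3,4)]
  show ?case
    by (subst testK.simps, subst sri_test.simps)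
       (simp add: Let_def reject_def stat_def emp_mean_cur(3,4) IH split_beta emp_mean_fst)
qed

lemma loopK_simulates:
  "loopK P \<delta> \<Delta> \<theta> tot0 k S M (total s) (cur \<omega> s) \<kappa> =
     (case sri_loop P (fst \<omega>) (snd \<omega>) \<delta> \<Delta> \<theta> tot0 k S M s of (S', s') \<Rightarrow> \<kappa> S' (total s') (cur \<omega> s'))"
proof (induction k arbitrary: S M s)
  case (Suc k)
  have d: "draw (snd \<omega>) s = (snd (cur \<omega> s) 0, snd (draw (snd \<omega>) s))"
    "cur \<omega> (snd (draw (snd \<omega>) s)) = adv (\<lambda>_. 0) 1 (cur \<omega> s)" "total (snd (draw (snd \<omega>) s)) = total s"
    by (cases s; simp add: draw_def cur_def adv_def adv_adv total_def)+
  have T: "testK P \<Delta> r S M a f (total s) (adv (\<lambda>_. 0) 1 (cur \<omega> s)) \<kappa> =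
     (case sri_test P (fst \<omega>) \<Delta> r S M a f (snd (draw (snd \<omega>) s)) of (b, s') \<Rightarrow> \<kappa> b (total s') (cur \<omega> s'))"
    for r S M a f and \<kappa> :: "bool \<Rightarrow> nat \<Rightarrow> src \<Rightarrow> 'a"
    using testK_simulates[of P \<Delta> r S M a f "snd (draw (snd \<omega>) s)" \<omega> \<kappa>] by (simp only: d(2,3))
  have IH: "loopK P \<delta> \<Delta> \<theta> tot0 k S M (total s + 2 * n) (adv (single a (2 * n)) 0 (cur \<omega> s)) \<kappa> =
     (case sri_loop P (fst \<omega>) (snd \<omega>) \<delta> \<Delta> \<theta> tot0 k S M (snd (emp_mean (fst \<omega>) a n s)) of (S', s') \<Rightarrow> \<kappa> S' (total s') (cur \<omega> s'))"
    for S M s a n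
    using Suc[of S M "snd (emp_mean (fst \<omega>) a n s)"] by (simp only: emp_mean_cur(3,4))
  show ?case
    apply (subst loopK.simps)
    apply (subst sri_loop.simps)
    apply (subst d(1))
    apply (simp add: Let_def T IH Suc split_beta emp_mean_cur(3,4) emp_mean_fst del: One_nat_def)
    done
qed simp

lemma SRIK_simulates:
  "SRIK P \<delta> \<Delta> \<theta> (total s) (cur \<omega> s) \<kappa> =
     (case SRI P (fst \<omega>) (snd \<omega>) \<delta> \<Delta> \<theta> s of (S', s') \<Rightarrow> \<kappa> S' (total s') (cur \<omega> s'))"
proof -
  have d: "draw (snd \<omega>) s = (snd (cur \<omega> s) 0, snd (draw (snd \<omega>) s))"
    "cur \<omega> (snd (draw (snd \<omega>) s)) = adv (\<lambda>_. 0) 1 (cur \<omega> s)" "total (snd (draw (snd \<omega>) s)) = total s"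
    by (cases s; simp add: draw_def cur_def adv_def adv_adv total_def)+
  have L: "loopK P \<delta> \<Delta> \<theta> tot0 k S M (total s + 2 * n) (adv (single a (2 * n)) 0 (adv (\<lambda>_. 0) 1 (cur \<omega> s))) \<kappa> =
     (case sri_loop P (fst \<omega>) (snd \<omega>) \<delta> \<Delta> \<theta> tot0 k S M (snd (emp_mean (fst \<omega>) a n (snd (draw (snd \<omega>) s)))) of (S', s') \<Rightarrow> \<kappa> S' (total s') (cur \<omega> s'))"
    for S M tot0 k a n
    using loopK_simulates[of P \<delta> \<Delta> \<theta> tot0 k S M "snd (emp_mean (fst \<omega>) a n (snd (draw (snd \<omega>) s)))" \<omega> \<kappa>]
    by (simp only: emp_mean_cur(3,4) d(2,3))
  show ?thesis
    unfolding SRIK_def SRI_def Let_def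
    by (subst d(1)) (simp add: split_beta L emp_mean_fst d(2) del: One_nat_def)
qed

lemma ADC_alt: "ADC P X \<delta> \<Delta> S s = (case emp_means X {..<pN P} (adc_n P \<delta> \<Delta> S) s of (mm, s') \<Rightarrow> (adc_out P S mm, s'))"
  by (simp only: ADC_def Let_def adc_n_def adc_J_def adc_I_def adc_L0_def adc_out_def stat_def)

lemma finishK_simulates:
  "finishK P \<delta> p S (total s) (cur \<omega> s) \<kappa> =
     (case acb_finish P (fst \<omega>) \<delta> p S s of (G, s') \<Rightarrow> \<kappa> G (total s') (cur \<omega> s'))"
proof (cases s)
  case (fields cnt uc tot)
  let ?n = "n'_p P \<delta> p"
  let ?m = "\<lambda>a. if a \<in> S then ?n else 0"
  let ?mm = "\<lambda>a. (mean_from (fst \<omega>) a (cnt a) ?n, mean_from (fst \<omega>) a (cnt a + ?n) ?n)"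
  let ?cnt1 = "\<lambda>a. if a \<in> S then cnt a + 2 * ?n else cnt a"
  have mm: "means ?m (cur \<omega> s) a = ?mm a" if "a \<in> S" for a
    using that by (simp add: means_def cur_def mean_from_adv fields)
  have g: "gap2 (pd P) S (means ?m (cur \<omega> s)) = Min {ip (pd P) (vdiff (fst (?mm a)) (fst (?mm b))) (vdiff (snd (?mm a)) (snd (?mm b))) | a b. a \<in> S \<and> b \<in> S \<and> a \<noteq> b}"
    unfolding gap2_def by (rule arg_cong[where f=Min], rule Collect_cong, rule ex_cong1, rule ex_cong1) (auto simp: stat_def mm)
  have c1: "adv (\<lambda>a. 2 * ?m a) 0 (cur \<omega> s) = adv ?cnt1 uc \<omega>"
    by (auto simp: cur_def fields adv_adv intro!: arg_cong2[where f="\<lambda>n u. adv n u \<omega>"])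
  define \<Delta> where "\<Delta> = sqrt (gap2 (pd P) S (means ?m (cur \<omega> s))) / sqrt 2"
  define m' where "m' = adc_n P (\<delta>/3) \<Delta> S"
  have fin: "acb_finish P (fst \<omega>) \<delta> p S s = ADC P (fst \<omega>) (\<delta>/3) \<Delta> S (?cnt1, uc, tot + (\<Sum>a\<in>S. 2 * ?n))"
    by (simp add: acb_finish_def emp_means_def fields \<Delta>_def g[unfolded fields])
  have m2: "means m' (adv ?cnt1 uc \<omega>) = (\<lambda>a. (mean_from (fst \<omega>) a (?cnt1 a) (m' a), mean_from (fst \<omega>) a (?cnt1 a + m' a) (m' a)))"
    by (rule ext) (simp add: means_def mean_from_adv)
  have adc: "ADC P (fst \<omega>) (\<delta>/3) \<Delta> S (?cnt1, uc, tot + (\<Sum>a\<in>S. 2 * ?n)) =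
     (adc_out P S (means m' (adv ?cnt1 uc \<omega>)), ((\<lambda>a. if a < pN P then ?cnt1 a + 2 * m' a else ?cnt1 a), uc, tot + (\<Sum>a\<in>S. 2 * ?n) + (\<Sum>a<pN P. 2 * m' a)))"
    unfolding ADC_alt m'_def[symmetric] m2 emp_means_def by (simp only: prod.case lessThan_iff)
  have c2: "adv (\<lambda>a. if a < pN P then 2 * m' a else 0) 0 (adv ?cnt1 uc \<omega>) = adv (\<lambda>a. if a < pN P then ?cnt1 a + 2 * m' a else ?cnt1 a) uc \<omega>"
    by (auto simp: adv_adv intro!: arg_cong2[where f="\<lambda>n u. adv n u \<omega>"])
  show ?thesis
    unfolding finishK_def Let_def c1 \<Delta>_def[symmetric] m'_def[symmetric] fin adc
    by (simp add: c2 cur_def fields)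
qed

lemma roundK_simulates:
  "roundK P \<delta> l p f (total s) (cur \<omega> s) \<kappa> =
     (case acb_round P (fst \<omega>) (snd \<omega>) \<delta> l p f s of (G, s') \<Rightarrow> \<kappa> G (total s') (cur \<omega> s'))"
proof (induction f arbitrary: p s)
  case (Suc f)
  obtain S s1 where S: "SRI P (fst \<omega>) (snd \<omega>) (delta_l \<delta> l) (Delta_p P \<delta> p) (max (theta_pl P p l) (1 / real (pN P))) s = (S, s1)"
    by (cases "SRI P (fst \<omega>) (snd \<omega>) (delta_l \<delta> l) (Delta_p P \<delta> p) (max (theta_pl P p l) (1 / real (pN P))) s")
  show ?case
    unfolding roundK.simps acb_round.simps SRIK_simulates S prod.case finishK_simulates Suc
    by (simp split: prod.split)
qed simp

lemma roundsK_simulates: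
  "roundsK P \<delta> L \<omega> \<kappa> =
     (case acb_rounds P (fst \<omega>) (snd \<omega>) \<delta> L of (G, s') \<Rightarrow> \<kappa> G (total s') (cur \<omega> s'))"
proof (induction L arbitrary: \<kappa>)
  case 0
  show ?case by (simp add: cur_def adv_def)
next
  case (Suc L)
  obtain G s1 where G: "acb_rounds P (fst \<omega>) (snd \<omega>) \<delta> L = (G, s1)"
    by (cases "acb_rounds P (fst \<omega>) (snd \<omega>) \<delta> L")
  show ?case
    unfolding roundsK.simps acb_rounds.simps Suc G prod.case roundK_simulates
    by (cases G) (simp_all only: option.case prod.case)
qed

section \<open>Measurability of the programs in continuation form\<close>

lemma borel_measurable_curried:
  assumes "(\<lambda>x. h (fst x) (snd x)) \<in> borel_measurable (MEANS \<Otimes>\<^sub>M SRC)" "f \<in> measurable X MEANS" "g \<in> measurable X SRC"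
  shows "(\<lambda>x. h (f x) (g x)) \<in> borel_measurable X"
  using measurable_compose[OF measurable_Pair[OF assms(2,3)] assms(1)] by simp

lemma measurable_fst_MEANS: "fst \<in> measurable (MEANS \<Otimes>\<^sub>M SRC) MEANS"
  and measurable_snd_SRC: "snd \<in> measurable (MEANS \<Otimes>\<^sub>M SRC) SRC"
  by simp_all

lemma measurable_means_coord: "f \<in> measurable X SRC \<Longrightarrow> (\<lambda>x. means n (f x) a) \<in> measurable X (VEC \<Otimes>\<^sub>M VEC)"
  by (rule measurable_MEANS_coord[OF measurable_means])

text \<open>Joint measurability in the stored means and the stream is required because inside the
  loop the stored means are themselves random.\<close>

lemma testK_measurable:
  fixes \<kappa> :: "bool \<Rightarrow> nat \<Rightarrow> (nat \<Rightarrow> vec \<times> vec) \<Rightarrow> src \<Rightarrow> ennreal"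
  assumes S: "finite S" "S \<noteq> {}"
    and \<kappa>: "\<And>b t. (\<lambda>x. \<kappa> b t (fst x) (snd x)) \<in> borel_measurable (MEANS \<Otimes>\<^sub>M SRC)"
  shows "(\<lambda>x. testK P \<Delta> r S (fst x) a f tot (snd x) (\<lambda>b t. \<kappa> b t (fst x))) \<in> borel_measurable (MEANS \<Otimes>\<^sub>M SRC)"
proof (induction f arbitrary: tot)
  case 0
  show ?case
    unfolding testK.simps[of _ _ _ _ _ _ 0] Let_def nat.case
    by (intro measurable_If measurable_reject[OF S, unfolded Measurable.pred_def] borel_measurable_curried[OF \<kappa>]
        measurable_adv measurable_means_coord measurable_fst_MEANS measurable_snd_SRC)
next
  case (Suc f)
  show ?case
    unfolding testK.simps[of _ _ _ _ _ _ "Suc f"] Let_def nat.case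
    by (intro measurable_If measurable_reject[OF S, unfolded Measurable.pred_def] borel_measurable_curried[OF \<kappa>]
        borel_measurable_curried[OF Suc]
        measurable_adv measurable_means_coord measurable_fst_MEANS measurable_snd_SRC)
qed

lemma loopK_measurable:
  fixes \<kappa> :: "nat set \<Rightarrow> nat \<Rightarrow> src \<Rightarrow> ennreal"
  assumes \<kappa>: "\<And>S t. finite S \<Longrightarrow> \<kappa> S t \<in> borel_measurable SRC"
  shows "finite S \<Longrightarrow> S \<noteq> {} \<Longrightarrow>
    (\<lambda>x. loopK P \<delta> \<Delta> \<theta> tot0 k S (fst x) tot (snd x) \<kappa>) \<in> borel_measurable (MEANS \<Otimes>\<^sub>M SRC)"
proof (induction k arbitrary: S tot)
  case 0
  then show ?case
    using measurable_compose[OF measurable_snd_SRC \<kappa>[of S tot]] by simp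
next
  case (Suc k)
  define cont where "cont S M tot \<omega> = (if card S = pK P \<or> sri_Tmax P \<delta> \<Delta> \<theta> < real (tot - tot0) then \<kappa> S tot \<omega>
                                else loopK P \<delta> \<Delta> \<theta> tot0 k S M tot \<omega> \<kappa>)" for S M tot \<omega>
  let ?n = "sri_nmax P \<delta> \<Delta> \<theta>"
  define K where "K a acc t M \<omega> = (if acc then cont (insert a S) (M(a := means (single a ?n) \<omega> a)) (t + 2 * ?n) (adv (single a (2 * ?n)) 0 \<omega>)
                       else cont S M t \<omega>)" for a acc t M \<omega>
  have contm: "(\<lambda>x. cont T (fst x) t (snd x)) \<in> borel_measurable (MEANS \<Otimes>\<^sub>M SRC)" if "finite T" "T \<noteq> {}" for T t
    unfolding cont_def
    using Suc.IH[OF that] measurable_compose[OF measurable_snd_SRC \<kappa>[OF that(1)]] by simp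
  have Km: "(\<lambda>x. K a acc t (fst x) (snd x)) \<in> borel_measurable (MEANS \<Otimes>\<^sub>M SRC)" for a acc t
  proof (cases acc)
    case True
    show ?thesis unfolding K_def using True Suc.prems
      by (simp, intro borel_measurable_curried[OF contm] measurable_MEANS_upd measurable_adv measurable_means_coord
           measurable_fst_MEANS measurable_snd_SRC) auto
  next
    case False
    then show ?thesis unfolding K_def using contm[OF Suc.prems] by simp
  qed
  define T where "T a x = testK P \<Delta> (sri_r P \<delta> \<theta>) S (fst x) a (sri_r P \<delta> \<theta> - sri_s0 P \<delta> \<Delta> \<theta>) tot (adv (\<lambda>_. 0) 1 (snd x)) (\<lambda>acc t. K a acc t (fst x))" for a x
  have Tm: "T a \<in> borel_measurable (MEANS \<Otimes>\<^sub>M SRC)" for a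
    unfolding T_def
    by (rule borel_measurable_curried[OF testK_measurable[OF Suc.prems Km]])
       (intro measurable_adv measurable_fst_MEANS measurable_snd_SRC)+
  \<comment> \<open>The drawn arm takes countably many values, so measurability for each fixed arm
    suffices.\<close>
  have "(\<lambda>x. T (snd (snd x) 0) x) \<in> borel_measurable (MEANS \<Otimes>\<^sub>M SRC)"
    by (rule measurable_compose_countable[OF Tm]) (intro measurable_SRC_draw measurable_snd_SRC)
  moreover have "loopK P \<delta> \<Delta> \<theta> tot0 (Suc k) S (fst x) tot (snd x) \<kappa> = T (snd (snd x) 0) x" for x
    unfolding T_def K_def cont_def by (simp add: Let_def)
  ultimately show ?case by simp
qed

lemma SRIK_measurable:
  fixes \<kappa> :: "nat set \<Rightarrow> nat \<Rightarrow> src \<Rightarrow> ennreal"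
  assumes \<kappa>: "\<And>S t. finite S \<Longrightarrow> \<kappa> S t \<in> borel_measurable SRC"
  shows "(\<lambda>\<omega>. SRIK P \<delta> \<Delta> \<theta> tot \<omega> \<kappa>) \<in> borel_measurable SRC"
proof -
  let ?n = "sri_nmax P \<delta> \<Delta> \<theta>"
  define T where "T a \<omega> = loopK P \<delta> \<Delta> \<theta> tot (sri_U P \<delta> \<theta>) {a} (\<lambda>_. means (single a ?n) (adv (\<lambda>_. 0) 1 \<omega>) a) (tot + 2 * ?n) (adv (single a (2 * ?n)) 0 (adv (\<lambda>_. 0) 1 \<omega>)) \<kappa>" for a \<omega>
  have "T a \<in> borel_measurable SRC" for a
    unfolding T_def
    by (rule borel_measurable_curried[OF loopK_measurable[OF \<kappa>]])
       (auto intro!: measurable_MEANSI measurable_adv measurable_means_coord simp del: One_nat_def)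
  then have "(\<lambda>\<omega>. T (snd \<omega> 0) \<omega>) \<in> borel_measurable SRC"
    by (rule measurable_compose_countable) (intro measurable_SRC_draw measurable_ident_sets refl)
  then show ?thesis by (simp add: T_def SRIK_def Let_def)
qed

lemma measurable_finite_Collect:
  assumes "finite B" "\<And>z. z \<in> B \<Longrightarrow> Measurable.pred M (P z)"
  shows "(\<lambda>\<omega>. {z \<in> B. P z \<omega>}) \<in> measurable M (count_space (Pow B))"
proof (subst measurable_count_space_eq2)
  show "finite (Pow B)" using assms by simp
  show "(\<lambda>\<omega>. {z \<in> B. P z \<omega>}) \<in> space M \<rightarrow> Pow B \<and> (\<forall>q\<in>Pow B. (\<lambda>\<omega>. {z \<in> B. P z \<omega>}) -` {q} \<inter> space M \<in> sets M)"
  proof safe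
    fix q assume q: "q \<subseteq> B"
    have "Measurable.pred M (\<lambda>\<omega>. P z \<omega> \<longleftrightarrow> z \<in> q)" if "z \<in> B" for z
      using assms(2)[OF that] by (cases "z \<in> q") simp_all
    then have "Measurable.pred M (\<lambda>\<omega>. \<forall>z\<in>B. P z \<omega> \<longleftrightarrow> z \<in> q)"
      using assms(1) by (intro pred_intros_finite)
    moreover have "(\<lambda>\<omega>. {z \<in> B. P z \<omega>}) -` {q} \<inter> space M = {\<omega> \<in> space M. \<forall>z\<in>B. P z \<omega> \<longleftrightarrow> z \<in> q}"
      using q by auto
    ultimately show "(\<lambda>\<omega>. {z \<in> B. P z \<omega>}) -` {q} \<inter> space M \<in> sets M" by (simp add: pred_def)
  qed
qed

text \<open>\<open>arg_min_on\<close> is an unspecified choice, but a choice among the minimisers,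
  and these are determined by the strict comparisons alone. Ties are therefore no obstacle to
  measurability.\<close>

lemma arg_min_on_cong:
  assumes "\<And>x y. x \<in> S \<Longrightarrow> y \<in> S \<Longrightarrow> f x < f y \<longleftrightarrow> g x < g y"
  shows "arg_min_on f S = arg_min_on g S"
proof -
  have "is_arg_min f (\<lambda>x. x \<in> S) = is_arg_min g (\<lambda>x. x \<in> S)"
    using assms by (intro ext) (auto simp: is_arg_min_def)
  then show ?thesis by (simp add: arg_min_on_def arg_min_def)
qed

text \<open>The clustering is a function of the finite set of strict comparisons between the
  statistics, and that set is a measurable random variable with finitely many values.\<close>

lemma measurable_adc_out:
  assumes S: "finite S" and g: "g \<in> measurable X MEANS" and F: "\<And>G. F G \<in> borel_measurable X"
  shows "(\<lambda>x. F (adc_out P S (g x)) x) \<in> borel_measurable X"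
proof -
  let ?B = "{..<pN P} \<times> S \<times> S"
  let ?less = "\<lambda>(a,b,c) mm. stat (pd P) (mm a) (mm b) < stat (pd P) (mm a) (mm c)"
  \<comment> \<open>The number of c that beat b, as recorded in q, orders S in the same way as the
    statistic, so the comparisons alone reproduce the arg min.\<close>
  define out where "out q = (\<lambda>b. insert b {a. a < pN P \<and> a \<notin> S \<and> arg_min_on (\<lambda>b. card {c \<in> S. (a,c,b) \<in> q}) S = b}) ` S" for q
  have out: "adc_out P S mm = out {z \<in> ?B. ?less z mm}" for mm
  proof -
    have "arg_min_on (\<lambda>b. stat (pd P) (mm a) (mm b)) S =
          arg_min_on (\<lambda>b. card {c \<in> S. (a,c,b) \<in> {z \<in> ?B. ?less z mm}}) S" if a: "a < pN P" for a
    proof (rule arg_min_on_cong)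
      fix x y assume xy: "x \<in> S" "y \<in> S"
      let ?f = "\<lambda>b. stat (pd P) (mm a) (mm b)"
      have st: "{c \<in> S. (a,c,b) \<in> {z \<in> ?B. ?less z mm}} = {c \<in> S. ?f c < ?f b}" if "b \<in> S" for b using a that by auto
      show "?f x < ?f y \<longleftrightarrow> card {c \<in> S. (a,c,x) \<in> {z \<in> ?B. ?less z mm}} < card {c \<in> S. (a,c,y) \<in> {z \<in> ?B. ?less z mm}}"
        unfolding st[OF xy(1)] st[OF xy(2)]
      proof
        assume lt: "?f x < ?f y"
        then have "{c \<in> S. ?f c < ?f x} \<subseteq> {c \<in> S. ?f c < ?f y}" by auto
        moreover have "x \<in> {c \<in> S. ?f c < ?f y}" "x \<notin> {c \<in> S. ?f c < ?f x}" using lt xy by auto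
        ultimately have "{c \<in> S. ?f c < ?f x} \<subset> {c \<in> S. ?f c < ?f y}" by blast
        then show "card {c \<in> S. ?f c < ?f x} < card {c \<in> S. ?f c < ?f y}"
          using S by (intro psubset_card_mono) auto
      next
        assume *: "card {c \<in> S. ?f c < ?f x} < card {c \<in> S. ?f c < ?f y}"
        show "?f x < ?f y"
        proof (rule ccontr)
          assume "\<not> ?f x < ?f y"
          then have "card {c \<in> S. ?f c < ?f y} \<le> card {c \<in> S. ?f c < ?f x}" using S by (intro card_mono) auto
          then show False using * by simp
        qed
      qed
    qed
    then show ?thesis unfolding adc_out_def out_def by (intro image_cong refl arg_cong2[where f=insert] Collect_cong conj_cong) simp
  qed
  have m: "(\<lambda>x. {z \<in> ?B. ?less z (g x)}) \<in> measurable X (count_space (Pow ?B))"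
  proof (rule measurable_finite_Collect)
    fix z assume "z \<in> ?B"
    obtain a b c where z: "z = (a,b,c)" by (cases z)
    have "(\<lambda>x. stat (pd P) (g x a) (g x b)) \<in> borel_measurable X" for a b
      by (intro measurable_stat measurable_MEANS_coord[OF g])
    then show "Measurable.pred X (\<lambda>x. ?less z (g x))" unfolding z prod.case
      by (intro borel_measurable_pred_less)
  qed (use S in auto)
  have "(\<lambda>x. F (out {z \<in> ?B. ?less z (g x)}) x) \<in> borel_measurable X"
    by (rule measurable_compose_countable'[where f="\<lambda>q. F (out q)", OF F m]) (use S in \<open>auto intro!: countable_finite\<close>)
  then show ?thesis by (simp only: out)
qed

lemma measurable_nat_ceiling: "f \<in> borel_measurable M \<Longrightarrow> (\<lambda>x. nat \<lceil>f x :: real\<rceil>) \<in> measurable M (count_space UNIV)"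
  by measurable

lemma measurable_gap2:
  assumes S: "finite S" and g: "g \<in> measurable X MEANS"
  shows "(\<lambda>x. gap2 d S (g x)) \<in> borel_measurable X"
proof -
  let ?I = "{(a,b). a \<in> S \<and> b \<in> S \<and> a \<noteq> b}"
  have "finite ?I" by (rule finite_subset[of _ "S \<times> S"]) (use S in auto)
  then have "(\<lambda>x. Min ((\<lambda>z. stat d (g x (fst z)) (g x (snd z))) ` ?I)) \<in> borel_measurable X"
    by (intro borel_measurable_Min measurable_stat measurable_MEANS_coord[OF g])
  moreover have "gap2 d S mm = Min ((\<lambda>z. stat d (mm (fst z)) (mm (snd z))) ` ?I)" for mm
    unfolding gap2_def by (rule arg_cong[where f=Min]) (auto simp: image_def)
  ultimately show ?thesis by simp
qed

text \<open>The second half of the finishing phase, with the means behind the gap estimate as a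
  parameter. Once they are fixed, the block sizes of ADC are constants.\<close>

definition adcK :: "params \<Rightarrow> real \<Rightarrow> nat set \<Rightarrow> nat \<Rightarrow> (nat \<Rightarrow> vec \<times> vec) \<Rightarrow> src \<Rightarrow> (nat set set \<Rightarrow> nat \<Rightarrow> src \<Rightarrow> 'r) \<Rightarrow> 'r" where
  "adcK P \<delta> S tot mm \<omega> \<kappa> =
     (let m = adc_n P \<delta> (sqrt (gap2 (pd P) S mm) / sqrt 2) S
      in \<kappa> (adc_out P S (means m \<omega>)) (tot + (\<Sum>a<pN P. 2 * m a)) (adv (\<lambda>a. if a < pN P then 2 * m a else 0) 0 \<omega>))"

lemma finishK_adcK:
  fixes S n defines "m \<equiv> \<lambda>a. if a \<in> S then n else 0"
  assumes "n = n'_p P \<delta> p"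
  shows "finishK P \<delta> p S tot \<omega> \<kappa> = adcK P (\<delta>/3) S (tot + (\<Sum>a\<in>S. 2 * n)) (means m \<omega>) (adv (\<lambda>a. 2 * m a) 0 \<omega>) \<kappa>"
  unfolding m_def assms(2) finishK_def adcK_def Let_def ..

lemma adcK_measurable:
  fixes \<kappa> :: "nat set set \<Rightarrow> nat \<Rightarrow> src \<Rightarrow> ennreal"
  assumes \<kappa>: "\<And>G t. \<kappa> G t \<in> borel_measurable SRC" and S: "finite S"
  shows "(\<lambda>x. adcK P \<delta> S tot (fst x) (snd x) \<kappa>) \<in> borel_measurable (MEANS \<Otimes>\<^sub>M SRC)"
proof -
  let ?X = "MEANS \<Otimes>\<^sub>M SRC"
  let ?\<Delta> = "\<lambda>x. sqrt (gap2 (pd P) S (fst x)) / sqrt 2"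
  \<comment> \<open>The two block sizes vary with the stored means but have countably many values; F
    treats them as fixed.\<close>
  let ?JI = "\<lambda>x. (adc_J P \<delta> (?\<Delta> x), adc_I P \<delta> (?\<Delta> x))"
  define F where "F JI x = (let m = (\<lambda>a. if a \<in> S then fst JI else snd JI) in
     \<kappa> (adc_out P S (means m (snd x))) (tot + (\<Sum>a<pN P. 2 * m a))
           (adv (\<lambda>a. if a < pN P then 2 * m a else 0) 0 (snd x)))" for JI :: "nat \<times> nat" and x :: "(nat \<Rightarrow> vec \<times> vec) \<times> src"
  have F: "F JI \<in> borel_measurable ?X" for JI
    unfolding F_def Let_def
    by (rule measurable_adc_out[OF S, where F="\<lambda>G x. \<kappa> G _ (adv _ 0 (snd x))"])
       (intro measurable_means measurable_adv measurable_snd_SRC measurable_compose[OF _ \<kappa>[of _ "tot + (\<Sum>a<pN P. 2 * (if a \<in> S then fst JI else snd JI))"]])+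
  have \<Delta>: "?\<Delta> \<in> borel_measurable ?X"
    by (intro borel_measurable_divide borel_measurable_const measurable_compose[OF measurable_gap2[OF S measurable_fst_MEANS]
          borel_measurable_continuous_onI] continuous_on_real_sqrt continuous_on_id)
  have JI: "?JI \<in> measurable ?X (count_space UNIV)"
  proof -
    have "?JI \<in> measurable ?X (count_space UNIV \<Otimes>\<^sub>M count_space UNIV)"
      unfolding adc_J_def adc_I_def
      by (intro measurable_Pair measurable_nat_ceiling borel_measurable_max borel_measurable_times borel_measurable_divide
          borel_measurable_power \<Delta> borel_measurable_const)
    then show ?thesis by (simp add: pair_measure_countable)
  qed
  have "(\<lambda>x. F (?JI x) x) \<in> borel_measurable ?X" by (rule measurable_compose_countable[OF F JI])
  moreover have "F (?JI x) x = adcK P \<delta> S tot (fst x) (snd x) \<kappa>" for x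
    unfolding F_def adcK_def adc_n_def Let_def fst_conv snd_conv ..
  ultimately show ?thesis by simp
qed

lemma finishK_measurable:
  fixes \<kappa> :: "nat set set \<Rightarrow> nat \<Rightarrow> src \<Rightarrow> ennreal"
  assumes \<kappa>: "\<And>G t. \<kappa> G t \<in> borel_measurable SRC" and S: "finite S"
  shows "(\<lambda>\<omega>. finishK P \<delta> p S tot \<omega> \<kappa>) \<in> borel_measurable SRC"
  unfolding finishK_adcK[OF refl]
  by (rule borel_measurable_curried[OF adcK_measurable[OF \<kappa> S]]) (intro measurable_means measurable_adv measurable_ident_sets refl)+

lemma roundK_measurable:
  fixes \<kappa> :: "nat set set option \<Rightarrow> nat \<Rightarrow> src \<Rightarrow> ennreal"
  assumes \<kappa>: "\<And>G t. \<kappa> G t \<in> borel_measurable SRC"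
  shows "(\<lambda>\<omega>. roundK P \<delta> l p f tot \<omega> \<kappa>) \<in> borel_measurable SRC"
proof (induction f arbitrary: p tot)
  case (Suc f)
  have "(\<lambda>\<omega>. if card S = pK P then finishK P \<delta> p S t \<omega> (\<lambda>G. \<kappa> (Some G)) else roundK P \<delta> l (Suc p) f t \<omega> \<kappa>) \<in> borel_measurable SRC"
    if "finite S" for S t
    using Suc[of "Suc p" t] finishK_measurable[of "\<lambda>G. \<kappa> (Some G)", OF \<kappa> that] by simp
  then show ?case by (simp add: SRIK_measurable)
qed (simp add: \<kappa>)

lemma roundsK_measurable:
  fixes \<kappa> :: "nat set set option \<Rightarrow> nat \<Rightarrow> src \<Rightarrow> ennreal"
  assumes \<kappa>: "\<And>G t. \<kappa> G t \<in> borel_measurable SRC"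
  shows "(\<lambda>\<omega>. roundsK P \<delta> L \<omega> \<kappa>) \<in> borel_measurable SRC"
  using \<kappa>
proof (induction L arbitrary: \<kappa>)
  case (Suc L)
  have "(\<lambda>\<omega>. case G of None \<Rightarrow> roundK P \<delta> L 0 (Suc L) t \<omega> \<kappa> | Some _ \<Rightarrow> \<kappa> G t \<omega>) \<in> borel_measurable SRC" for G t
    using roundK_measurable[of \<kappa> P \<delta> L 0 "Suc L" t, OF Suc.prems] Suc.prems by (cases G) (simp_all del: roundK.simps)
  then show ?case using Suc.IH by simp
qed simp

section \<open>The law of the stream after a block has been read\<close>

context clustering
begin

text \<open>Coordinates outside the products behind \<Omega> are constant there: extensional
  functions have the value \<open>undefined\<close> off their domain.\<close>

lemma measurable_id_SRC: "(\<lambda>\<omega>. \<omega>) \<in> measurable \<Omega> SRC"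
proof (rule measurable_SRCI)
  fix a k
  show "(\<lambda>\<omega>. fst \<omega> a k) \<in> measurable \<Omega> VEC"
  proof (rule measurable_VECI)
    fix i
    show "(\<lambda>\<omega>. fst \<omega> a k i) \<in> borel_measurable \<Omega>"
    proof (cases "a < N")
      case True
      have X: "(\<lambda>\<omega>. fst \<omega> a k) \<in> measurable \<Omega> (PiM {..<d} (\<lambda>_. borel))"
        using measurable_Omega_sample[OF True, of k] measurable_cong_sets[OF refl sets_nu[OF True]] by blast
      show ?thesis
      proof (cases "i < d")
        case True
        then show ?thesis using measurable_compose[OF X measurable_component_singleton[of i "{..<d}"]] by simp
      next
        case False
        have "fst \<omega> a k i = undefined" if "\<omega> \<in> space \<Omega>" for \<omega>
        proof -
          have "fst \<omega> a k \<in> space (PiM {..<d} (\<lambda>_. borel))" using X that by (rule measurable_space)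
          then show ?thesis using False by (auto simp: space_PiM PiE_def extensional_def)
        qed
        then show ?thesis by (subst measurable_cong[where g="\<lambda>_. undefined"]) auto
      qed
    next
      case False
      then have "fst \<omega> a k i = undefined k i" if "\<omega> \<in> space \<Omega>" for \<omega>
        using that by (auto simp: Omega_def space_pair_measure space_PiM[of "{..<N}"] PiE_def extensional_def)
      then show ?thesis by (subst measurable_cong[where g="\<lambda>_. undefined k i"]) auto
    qed
  qed
next
  fix u show "(\<lambda>\<omega>. snd \<omega> u) \<in> measurable \<Omega> (count_space UNIV)"
  proof -
    have "snd \<in> measurable \<Omega> (PiM UNIV (\<lambda>u::nat. measure_pmf (pmf_of_set {..<N})))" unfolding Omega_def by (rule measurable_snd)
    from measurable_compose[OF this measurable_component_singleton[of u UNIV]]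
    have "(\<lambda>\<omega>. snd \<omega> u) \<in> measurable \<Omega> (measure_pmf (pmf_of_set {..<N}))" by simp
    then show ?thesis using measurable_cong_sets[OF refl sets_measure_pmf_count_space] by blast
  qed
qed

lemma borel_measurable_Omega: "f \<in> borel_measurable SRC \<Longrightarrow> f \<in> borel_measurable \<Omega>"
  by (rule measurable_compose[OF measurable_id_SRC])

lemma borel_measurable_pair_Omega: "f \<in> borel_measurable (SRC \<Otimes>\<^sub>M SRC) \<Longrightarrow> f \<in> borel_measurable (\<Omega> \<Otimes>\<^sub>M \<Omega>)"
proof -
  assume f: "f \<in> borel_measurable (SRC \<Otimes>\<^sub>M SRC)"
  have "(\<lambda>x. (fst x, snd x)) \<in> measurable (\<Omega> \<Otimes>\<^sub>M \<Omega>) (SRC \<Otimes>\<^sub>M SRC)"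
    by (rule measurable_Pair[OF measurable_compose[OF measurable_fst measurable_id_SRC] measurable_compose[OF measurable_snd measurable_id_SRC]])
  from measurable_compose[OF this f] show ?thesis by (simp only: prod.collapse)
qed

abbreviation "ARMS \<equiv> PiM {..<N} (\<lambda>a. PiM UNIV (\<lambda>k::nat. \<nu> a))"
abbreviation "DRAWS \<equiv> PiM UNIV (\<lambda>u::nat. measure_pmf (pmf_of_set {..<N}))"

definition splice :: "(nat \<Rightarrow> nat) \<Rightarrow> smp \<times> smp \<Rightarrow> smp" where
  "splice m = (\<lambda>(X', X). \<lambda>a\<in>{..<N}. comb_seq (m a) (X' a) (X a))"

lemma measurable_splice: "splice m \<in> measurable (ARMS \<Otimes>\<^sub>M ARMS) ARMS"
  unfolding splice_def
proof (subst split_beta', rule measurable_restrict)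
  fix a assume a: "a \<in> {..<N}"
  show "(\<lambda>z. comb_seq (m a) (fst z a) (snd z a)) \<in> measurable (ARMS \<Otimes>\<^sub>M ARMS) (PiM UNIV (\<lambda>k. \<nu> a))"
    using a by (intro measurable_comb_seq' measurable_compose[OF measurable_fst measurable_component_singleton]
      measurable_compose[OF measurable_snd measurable_component_singleton])
qed

text \<open>Gluing the prefixes of one copy of the samples to an independent second copy does not
  change the law. For a single arm this is a property of i.i.d. sequences; over the arms it is
  checked on rectangles.\<close>

lemma distr_splice: "distr (ARMS \<Otimes>\<^sub>M ARMS) ARMS (splice m) = ARMS"
proof -
  \<comment> \<open>Beyond N the law of arm 0 is substituted, because every index of the family has
    to carry a probability measure.\<close>
  define Q where "Q a = PiM UNIV (\<lambda>k::nat. \<nu> (if a < N then a else 0))" for a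
  have Qa: "Q a = PiM UNIV (\<lambda>k. \<nu> a)" if "a < N" for a using that by (simp add: Q_def)
  have AQ: "ARMS = PiM {..<N} Q" by (intro PiM_cong) (auto simp: Qa)
  have Qp: "prob_space (Q a)" for a unfolding Q_def using N_ge_2 by (intro prob_space_PiM prob_nu) auto
  interpret Q: product_prob_space Q "{..<N}" 
    by (intro product_prob_spaceI Qp)
  interpret A: prob_space ARMS by (rule prob_arms)
  have "distr (ARMS \<Otimes>\<^sub>M ARMS) ARMS (splice m) = PiM {..<N} Q"
  proof (rule Q.PiM_eqI)
    fix E assume E: "\<And>a. a \<in> {..<N} \<Longrightarrow> E a \<in> sets (Q a)"
    let ?R = "Pi\<^sub>E {..<N} E"
    have Rm: "?R \<in> sets ARMS" unfolding AQ using E by (intro sets_PiM_I_finite) auto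
    have set1: "{y \<in> space (Q a). comb_seq (m a) x y \<in> E a} \<in> sets (Q a)" if "a < N" "x \<in> space (Q a)" for a x
    proof -
      have "(\<lambda>y. comb_seq (m a) x y) \<in> measurable (Q a) (Q a)" using that unfolding Qa[OF that(1)]
        by (intro measurable_comb_seq' measurable_const measurable_ident) auto
      then show ?thesis using measurable_sets[of _ "Q a" "Q a" "E a"] E[of a] that by (simp add: vimage_def Int_def conj_commute)
    qed
    have "emeasure (distr (ARMS \<Otimes>\<^sub>M ARMS) ARMS (splice m)) ?R =
        emeasure (ARMS \<Otimes>\<^sub>M ARMS) (splice m -` ?R \<inter> space (ARMS \<Otimes>\<^sub>M ARMS))"
      using measurable_splice Rm by (rule emeasure_distr)
    also have "\<dots> = (\<integral>\<^sup>+X'. emeasure ARMS (Pair X' -` (splice m -` ?R \<inter> space (ARMS \<Otimes>\<^sub>M ARMS))) \<partial>ARMS)"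
      by (rule A.emeasure_pair_measure_alt) (rule measurable_sets[OF measurable_splice Rm])
    \<comment> \<open>For fixed prefixes the preimage of a rectangle is again a rectangle, so its
      measure factors over the arms; the outer integral then factors as well.\<close>
    also have "\<dots> = (\<integral>\<^sup>+X'. (\<Prod>a<N. emeasure (Q a) {y \<in> space (Q a). comb_seq (m a) (X' a) y \<in> E a}) \<partial>ARMS)"
    proof (rule nn_integral_cong)
      fix X' assume X': "X' \<in> space ARMS"
      then have X'a: "X' a \<in> space (Q a)" if "a < N" for a using that by (auto simp: space_PiM[of "{..<N}"] Qa PiE_def Pi_def)
      have "Pair X' -` (splice m -` ?R \<inter> space (ARMS \<Otimes>\<^sub>M ARMS)) = Pi\<^sub>E {..<N} (\<lambda>a. {y \<in> space (Q a). comb_seq (m a) (X' a) y \<in> E a})"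
        using X' by (auto simp: splice_def space_pair_measure space_PiM[of "{..<N}"] Qa PiE_iff extensional_def)
      then show "emeasure ARMS (Pair X' -` (splice m -` ?R \<inter> space (ARMS \<Otimes>\<^sub>M ARMS))) =
         (\<Prod>a<N. emeasure (Q a) {y \<in> space (Q a). comb_seq (m a) (X' a) y \<in> E a})"
        unfolding AQ by (simp only:) (rule Q.emeasure_PiM, use set1 X'a in auto)
    qed
    also have "\<dots> = (\<Prod>a<N. \<integral>\<^sup>+x. emeasure (Q a) {y \<in> space (Q a). comb_seq (m a) x y \<in> E a} \<partial>Q a)"
      unfolding AQ
    proof (rule Q.product_nn_integral_prod)
      fix a assume a: "a \<in> {..<N}"
      have "(\<lambda>z. comb_seq (m a) (fst z) (snd z)) \<in> measurable (Q a \<Otimes>\<^sub>M Q a) (Q a)"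
        using a unfolding Qa[OF lessThan_iff[THEN iffD1, OF a]]
        by (intro measurable_comb_seq' measurable_fst measurable_snd)
      then have s: "{z \<in> space (Q a \<Otimes>\<^sub>M Q a). comb_seq (m a) (fst z) (snd z) \<in> E a} \<in> sets (Q a \<Otimes>\<^sub>M Q a)"
        using measurable_sets[of _ _ _ "E a"] E[OF a] by (simp add: vimage_def Int_def conj_commute)
      have "(\<lambda>x. emeasure (Q a) (Pair x -` {z \<in> space (Q a \<Otimes>\<^sub>M Q a). comb_seq (m a) (fst z) (snd z) \<in> E a})) \<in> borel_measurable (Q a)"
        by (rule Q.M.measurable_emeasure_Pair[OF s])
      moreover have "Pair x -` {z \<in> space (Q a \<Otimes>\<^sub>M Q a). comb_seq (m a) (fst z) (snd z) \<in> E a} = {y \<in> space (Q a). comb_seq (m a) x y \<in> E a}"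
        if "x \<in> space (Q a)" for x using that by (auto simp: space_pair_measure)
      ultimately show "(\<lambda>x. emeasure (Q a) {y \<in> space (Q a). comb_seq (m a) x y \<in> E a}) \<in> borel_measurable (Q a)"
        by (simp cong: measurable_cong)
    qed simp
    also have "\<dots> = (\<Prod>a<N. emeasure (Q a) (E a))"
    proof (rule prod.cong[OF refl])
      fix a assume "a \<in> {..<N}"
      then have a: "a < N" by simp
      interpret S: sequence_space "\<nu> a" unfolding sequence_space_def by (intro product_prob_spaceI prob_nu a)
      have cm: "(\<lambda>(\<omega>, \<omega>'). comb_seq (m a) \<omega> \<omega>') \<in> measurable (Q a \<Otimes>\<^sub>M Q a) (Q a)" unfolding Qa[OF a] by (rule measurable_comb_seq)
      have "emeasure (Q a) (E a) = emeasure (distr (Q a \<Otimes>\<^sub>M Q a) (Q a) (\<lambda>(\<omega>, \<omega>'). comb_seq (m a) \<omega> \<omega>')) (E a)"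
        unfolding Qa[OF a] S.PiM_comb_seq ..
      also have "\<dots> = emeasure (Q a \<Otimes>\<^sub>M Q a) ((\<lambda>(\<omega>, \<omega>'). comb_seq (m a) \<omega> \<omega>') -` E a \<inter> space (Q a \<Otimes>\<^sub>M Q a))"
        using cm E a by (intro emeasure_distr) auto
      also have "\<dots> = (\<integral>\<^sup>+x. emeasure (Q a) (Pair x -` ((\<lambda>(\<omega>, \<omega>'). comb_seq (m a) \<omega> \<omega>') -` E a \<inter> space (Q a \<Otimes>\<^sub>M Q a))) \<partial>Q a)"
        using measurable_sets[OF cm] E a by (intro Q.M.emeasure_pair_measure_alt) auto
      also have "\<dots> = (\<integral>\<^sup>+x. emeasure (Q a) {y \<in> space (Q a). comb_seq (m a) x y \<in> E a} \<partial>Q a)"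
        by (intro nn_integral_cong arg_cong2[where f=emeasure] refl) (auto simp: space_pair_measure)
      finally show "(\<integral>\<^sup>+x. emeasure (Q a) {y \<in> space (Q a). comb_seq (m a) x y \<in> E a} \<partial>Q a) = emeasure (Q a) (E a)" ..
    qed
    finally show "emeasure (distr (ARMS \<Otimes>\<^sub>M ARMS) ARMS (splice m)) ?R = (\<Prod>a<N. emeasure (Q a) (E a))" .
  qed (simp_all add: AQ)
  then show ?thesis by (simp add: AQ)
qed


lemma distr_draws: "distr (DRAWS \<Otimes>\<^sub>M DRAWS) DRAWS (\<lambda>(x, y). comb_seq u x y) = DRAWS"
proof -
  interpret S: sequence_space "measure_pmf (pmf_of_set {..<N})"
    unfolding sequence_space_def by (intro product_prob_spaceI prob_space_measure_pmf)
  show ?thesis by (rule S.PiM_comb_seq)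
qed

lemma nn_integral_product:
  assumes "prob_space A" "prob_space B" and f: "f \<in> borel_measurable A" and g: "g \<in> borel_measurable B"
  shows "(\<integral>\<^sup>+z. f (fst z) * g (snd z) \<partial>(A \<Otimes>\<^sub>M B)) = (\<integral>\<^sup>+x. f x \<partial>A) * (\<integral>\<^sup>+y. g y \<partial>B)"
proof -
  interpret B: prob_space B by fact
  have "(\<lambda>z. f (fst z) * g (snd z)) \<in> borel_measurable (A \<Otimes>\<^sub>M B)"
    by (intro borel_measurable_times_ennreal measurable_compose[OF measurable_fst f] measurable_compose[OF measurable_snd g])
  from B.nn_integral_fst[OF this] have "(\<integral>\<^sup>+z. f (fst z) * g (snd z) \<partial>(A \<Otimes>\<^sub>M B)) = (\<integral>\<^sup>+x. \<integral>\<^sup>+y. f x * g y \<partial>B \<partial>A)" by simp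
  also have "\<dots> = (\<integral>\<^sup>+x. f x * (\<integral>\<^sup>+y. g y \<partial>B) \<partial>A)" using g by (simp add: nn_integral_cmult)
  also have "\<dots> = (\<integral>\<^sup>+x. f x \<partial>A) * (\<integral>\<^sup>+y. g y \<partial>B)" using f by (simp add: nn_integral_multc)
  finally show ?thesis .
qed

definition Comb :: "(nat \<Rightarrow> nat) \<Rightarrow> nat \<Rightarrow> src \<times> src \<Rightarrow> src" where
  "Comb m u z = (splice m (fst (fst z), fst (snd z)), comb_seq u (snd (fst z)) (snd (snd z)))"

lemma measurable_Comb: "Comb m u \<in> measurable (\<Omega> \<Otimes>\<^sub>M \<Omega>) \<Omega>"
proof -
  have f: "fst \<in> measurable \<Omega> ARMS" and s: "snd \<in> measurable \<Omega> DRAWS" unfolding Omega_def by simp_all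
  have "(\<lambda>z. splice m (fst (fst z), fst (snd z))) \<in> measurable (\<Omega> \<Otimes>\<^sub>M \<Omega>) ARMS"
    by (rule measurable_compose[OF _ measurable_splice])
       (intro measurable_Pair measurable_compose[OF measurable_fst f] measurable_compose[OF measurable_snd f])
  moreover have "(\<lambda>z. comb_seq u (snd (fst z)) (snd (snd z))) \<in> measurable (\<Omega> \<Otimes>\<^sub>M \<Omega>) DRAWS"
    by (intro measurable_comb_seq' measurable_compose[OF measurable_fst s] measurable_compose[OF measurable_snd s])
  ultimately show ?thesis unfolding Comb_def[abs_def] by (subst (3) Omega_def) (rule measurable_Pair)
qed

lemma distr_Comb: "distr (\<Omega> \<Otimes>\<^sub>M \<Omega>) \<Omega> (Comb m u) = \<Omega>"
proof -
  interpret A: prob_space ARMS by (rule prob_arms)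
  interpret D: prob_space DRAWS by (rule prob_draws)
  have "ARMS \<Otimes>\<^sub>M DRAWS = distr (\<Omega> \<Otimes>\<^sub>M \<Omega>) \<Omega> (Comb m u)"
  proof (rule pair_measure_eqI)
    show "sigma_finite_measure ARMS" "sigma_finite_measure DRAWS" by unfold_locales
    show "sets (ARMS \<Otimes>\<^sub>M DRAWS) = sets (distr (\<Omega> \<Otimes>\<^sub>M \<Omega>) \<Omega> (Comb m u))" by (simp add: Omega_def)
    fix E F assume E: "E \<in> sets ARMS" and F: "F \<in> sets DRAWS"
    let ?f = "\<lambda>X X'. indicator E (splice m (X, X')) :: ennreal"
    let ?g = "\<lambda>U U'. indicator F (comb_seq u U U') :: ennreal"
    have fm: "(\<lambda>z. ?f (fst z) (snd z)) \<in> borel_measurable (ARMS \<Otimes>\<^sub>M ARMS)"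
      using measurable_compose[OF measurable_splice borel_measurable_indicator[OF E]] by simp
    have cm: "(\<lambda>z. comb_seq u (fst z) (snd z)) \<in> measurable (DRAWS \<Otimes>\<^sub>M DRAWS) DRAWS"
      by (intro measurable_comb_seq' measurable_fst measurable_snd)
    have gm: "(\<lambda>z. ?g (fst z) (snd z)) \<in> borel_measurable (DRAWS \<Otimes>\<^sub>M DRAWS)"
      using measurable_compose[OF cm borel_measurable_indicator[OF F]] by simp
    have f1: "?f X \<in> borel_measurable ARMS" if "X \<in> space ARMS" for X
      using measurable_Pair2[OF fm that] by simp
    have g1: "?g U \<in> borel_measurable DRAWS" if "U \<in> space DRAWS" for U
      using measurable_Pair2[OF gm that] by simp
    have EF: "E \<times> F \<in> sets \<Omega>" using E F by (simp add: Omega_def)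
    have "emeasure (distr (\<Omega> \<Otimes>\<^sub>M \<Omega>) \<Omega> (Comb m u)) (E \<times> F) = (\<integral>\<^sup>+x. indicator (E \<times> F) x \<partial>distr (\<Omega> \<Otimes>\<^sub>M \<Omega>) \<Omega> (Comb m u))"
      using EF by (subst nn_integral_indicator) auto
    also have "\<dots> = (\<integral>\<^sup>+z. indicator (E \<times> F) (Comb m u z) \<partial>(\<Omega> \<Otimes>\<^sub>M \<Omega>))"
      using measurable_Comb EF by (intro nn_integral_distr) auto
    also have "\<dots> = (\<integral>\<^sup>+\<omega>. \<integral>\<^sup>+\<omega>'. indicator (E \<times> F) (Comb m u (\<omega>, \<omega>')) \<partial>\<Omega> \<partial>\<Omega>)"
      by (rule \<Omega>.nn_integral_fst[symmetric]) (intro measurable_compose[OF measurable_Comb] borel_measurable_indicator EF)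
    also have "\<dots> = (\<integral>\<^sup>+\<omega>. (\<integral>\<^sup>+X'. ?f (fst \<omega>) X' \<partial>ARMS) * (\<integral>\<^sup>+U'. ?g (snd \<omega>) U' \<partial>DRAWS) \<partial>\<Omega>)"
    proof (rule nn_integral_cong)
      fix \<omega> assume "\<omega> \<in> space \<Omega>"
      then have sp: "fst \<omega> \<in> space ARMS" "snd \<omega> \<in> space DRAWS" by (auto simp: Omega_def space_pair_measure)
      have "(\<integral>\<^sup>+\<omega>'. indicator (E \<times> F) (Comb m u (\<omega>, \<omega>')) \<partial>\<Omega>) = (\<integral>\<^sup>+\<omega>'. ?f (fst \<omega>) (fst \<omega>') * ?g (snd \<omega>) (snd \<omega>') \<partial>(ARMS \<Otimes>\<^sub>M DRAWS))"
        by (simp add: Comb_def Omega_def indicator_times)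
      also have "\<dots> = (\<integral>\<^sup>+X'. ?f (fst \<omega>) X' \<partial>ARMS) * (\<integral>\<^sup>+U'. ?g (snd \<omega>) U' \<partial>DRAWS)"
        using f1[OF sp(1)] g1[OF sp(2)] by (intro nn_integral_product prob_arms prob_draws)
      finally show "(\<integral>\<^sup>+\<omega>'. indicator (E \<times> F) (Comb m u (\<omega>, \<omega>')) \<partial>\<Omega>) = (\<integral>\<^sup>+X'. ?f (fst \<omega>) X' \<partial>ARMS) * (\<integral>\<^sup>+U'. ?g (snd \<omega>) U' \<partial>DRAWS)" .
    qed
    also have "\<dots> = (\<integral>\<^sup>+X. \<integral>\<^sup>+X'. ?f X X' \<partial>ARMS \<partial>ARMS) * (\<integral>\<^sup>+U. \<integral>\<^sup>+U'. ?g U U' \<partial>DRAWS \<partial>DRAWS)"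
      unfolding Omega_def
    proof (rule nn_integral_product[where f="\<lambda>X. \<integral>\<^sup>+X'. ?f X X' \<partial>ARMS" and g="\<lambda>U. \<integral>\<^sup>+U'. ?g U U' \<partial>DRAWS", OF prob_arms prob_draws])
      show "(\<lambda>X. \<integral>\<^sup>+X'. ?f X X' \<partial>ARMS) \<in> borel_measurable ARMS" using A.borel_measurable_nn_integral_fst[OF fm] by simp
      show "(\<lambda>U. \<integral>\<^sup>+U'. ?g U U' \<partial>DRAWS) \<in> borel_measurable DRAWS" using D.borel_measurable_nn_integral_fst[OF gm] by simp
    qed
    also have "(\<integral>\<^sup>+X. \<integral>\<^sup>+X'. ?f X X' \<partial>ARMS \<partial>ARMS) = emeasure ARMS E"
    proof -
      have "(\<integral>\<^sup>+X. \<integral>\<^sup>+X'. ?f X X' \<partial>ARMS \<partial>ARMS) = (\<integral>\<^sup>+z. indicator E (splice m z) \<partial>(ARMS \<Otimes>\<^sub>M ARMS))"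
        using A.nn_integral_fst[OF fm] by simp
      also have "\<dots> = (\<integral>\<^sup>+X. indicator E X \<partial>distr (ARMS \<Otimes>\<^sub>M ARMS) ARMS (splice m))"
        using measurable_splice E by (intro nn_integral_distr[symmetric]) auto
      finally show ?thesis unfolding distr_splice using E by simp
    qed
    also have "(\<integral>\<^sup>+U. \<integral>\<^sup>+U'. ?g U U' \<partial>DRAWS \<partial>DRAWS) = emeasure DRAWS F"
    proof -
      have "(\<integral>\<^sup>+U. \<integral>\<^sup>+U'. ?g U U' \<partial>DRAWS \<partial>DRAWS) = (\<integral>\<^sup>+z. indicator F ((\<lambda>(x, y). comb_seq u x y) z) \<partial>(DRAWS \<Otimes>\<^sub>M DRAWS))"
        using D.nn_integral_fst[OF gm] by (simp add: split_beta')
      also have "\<dots> = (\<integral>\<^sup>+U. indicator F U \<partial>distr (DRAWS \<Otimes>\<^sub>M DRAWS) DRAWS (\<lambda>(x, y). comb_seq u x y))"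
        using cm F by (intro nn_integral_distr[symmetric]) (auto simp: split_beta')
      finally show ?thesis unfolding distr_draws using F by simp
    qed
    finally show "emeasure ARMS E * emeasure DRAWS F = emeasure (distr (\<Omega> \<Otimes>\<^sub>M \<Omega>) \<Omega> (Comb m u)) (E \<times> F)" ..
  qed
  then show ?thesis by (simp add: Omega_def)
qed

lemma nn_integral_Comb:
  assumes F: "F \<in> borel_measurable SRC" and G: "(\<lambda>z. G (fst z) (snd z)) \<in> borel_measurable (SRC \<Otimes>\<^sub>M SRC)"
    and eq: "\<And>\<omega> \<omega>'. \<omega> \<in> space \<Omega> \<Longrightarrow> \<omega>' \<in> space \<Omega> \<Longrightarrow> F (Comb m u (\<omega>, \<omega>')) = G \<omega> \<omega>'"
  shows "(\<integral>\<^sup>+\<omega>. F \<omega> \<partial>\<Omega>) = (\<integral>\<^sup>+\<omega>. \<integral>\<^sup>+\<omega>'. G \<omega> \<omega>' \<partial>\<Omega> \<partial>\<Omega>)"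
proof -
  have "(\<integral>\<^sup>+\<omega>. F \<omega> \<partial>\<Omega>) = (\<integral>\<^sup>+\<omega>. F \<omega> \<partial>distr (\<Omega> \<Otimes>\<^sub>M \<Omega>) \<Omega> (Comb m u))" by (simp add: distr_Comb)
  also have "\<dots> = (\<integral>\<^sup>+z. F (Comb m u z) \<partial>(\<Omega> \<Otimes>\<^sub>M \<Omega>))"
    using measurable_Comb borel_measurable_Omega[OF F] by (intro nn_integral_distr) auto
  also have "\<dots> = (\<integral>\<^sup>+z. G (fst z) (snd z) \<partial>(\<Omega> \<Otimes>\<^sub>M \<Omega>))"
    by (intro nn_integral_cong) (auto simp: space_pair_measure eq)
  also have "\<dots> = (\<integral>\<^sup>+\<omega>. \<integral>\<^sup>+\<omega>'. G \<omega> \<omega>' \<partial>\<Omega> \<partial>\<Omega>)"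
    using \<Omega>.nn_integral_fst[OF borel_measurable_pair_Omega[OF G]] by simp
  finally show ?thesis .
qed

lemma space_Omega_arm: "\<omega> \<in> space \<Omega> \<Longrightarrow> N \<le> a \<Longrightarrow> fst \<omega> a = undefined"
  by (auto simp: Omega_def space_pair_measure space_PiM[of "{..<N}"] PiE_def extensional_def)

text \<open>Renewal: replace the stream by a glued one. The means only see the prefix, which comes
  from the first copy, and the shifted stream is exactly the second copy. Thus the rest of a run may
  be integrated over a new independent stream.\<close>

lemma fresh_means:
  assumes h: "(\<lambda>x. h (fst x) (snd x)) \<in> borel_measurable (MEANS \<Otimes>\<^sub>M SRC)" and n: "\<And>a. N \<le> a \<Longrightarrow> n a = 0"
  shows "(\<integral>\<^sup>+\<omega>. h (means n \<omega>) (adv (\<lambda>a. 2 * n a) 0 \<omega>) \<partial>\<Omega>) = (\<integral>\<^sup>+\<omega>. \<integral>\<^sup>+\<omega>'. h (means n \<omega>) \<omega>' \<partial>\<Omega> \<partial>\<Omega>)"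
proof (rule nn_integral_Comb[where m="\<lambda>a. 2 * n a" and u=0])
  show "(\<lambda>\<omega>. h (means n \<omega>) (adv (\<lambda>a. 2 * n a) 0 \<omega>)) \<in> borel_measurable SRC"
    by (intro borel_measurable_curried[OF h] measurable_means measurable_adv measurable_ident_sets refl)
  show "(\<lambda>z. h (means n (fst z)) (snd z)) \<in> borel_measurable (SRC \<Otimes>\<^sub>M SRC)"
    by (intro borel_measurable_curried[OF h] measurable_means measurable_fst measurable_snd)
  fix \<omega> \<omega>' assume sp: "\<omega> \<in> space \<Omega>" "\<omega>' \<in> space \<Omega>"
  let ?c = "Comb (\<lambda>a. 2 * n a) 0 (\<omega>, \<omega>')"
  have 1: "means n ?c = means n \<omega>"
  proof
    fix a show "means n ?c a = means n \<omega> a"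
    proof (cases "a < N")
      case True
      then have "fst ?c a k = fst \<omega> a k" if "k < 2 * n a" for k using that by (simp add: Comb_def splice_def comb_seq_less)
      then show ?thesis by (simp add: means_def mean_from_def)
    next
      case False then show ?thesis using n by (simp add: means_def mean_from_def)
    qed
  qed
  have 2: "adv (\<lambda>a. 2 * n a) 0 ?c = \<omega>'"
  proof -
    \<comment> \<open>For arms beyond N both streams are the default \<open>undefined\<close>, and
      the shift is 0 there.\<close>
    have "fst ?c a (2 * n a + k) = fst \<omega>' a k" for a k
      using n space_Omega_arm[OF sp(2), of a] by (cases "a < N") (auto simp: Comb_def splice_def comb_seq_def)
    then show ?thesis by (simp add: adv_def Comb_def comb_seq_0)
  qed
  show "h (means n ?c) (adv (\<lambda>a. 2 * n a) 0 ?c) = h (means n \<omega>) \<omega>'" by (simp only: 1 2)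
qed

lemma fresh_mean:
  assumes h: "(\<lambda>x. h (fst x) (snd x)) \<in> borel_measurable (MEANS \<Otimes>\<^sub>M SRC)" and a: "a < N"
  shows "(\<integral>\<^sup>+\<omega>. h (means (single a n) \<omega>) (adv (single a (2 * n)) 0 \<omega>) \<partial>\<Omega>) = (\<integral>\<^sup>+\<omega>. \<integral>\<^sup>+\<omega>'. h (means (single a n) \<omega>) \<omega>' \<partial>\<Omega> \<partial>\<Omega>)"
proof -
  have "single a (2 * n) = (\<lambda>b. 2 * single a n b)" by (auto simp: single_def)
  then show ?thesis using fresh_means[OF h, of "single a n"] a by (simp add: single_def)
qed

lemma fresh_draw:
  assumes f: "\<And>a. f a \<in> borel_measurable SRC"
  shows "(\<integral>\<^sup>+\<omega>. f (snd \<omega> 0) (adv (\<lambda>_. 0) 1 \<omega>) \<partial>\<Omega>) = (\<Sum>a<N. \<integral>\<^sup>+\<omega>. f a \<omega> \<partial>\<Omega>) / of_nat N"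
proof -
  have d0: "(\<lambda>\<omega>. snd \<omega> 0) \<in> measurable SRC (count_space UNIV)" by (intro measurable_SRC_draw measurable_ident_sets refl)
  have "(\<integral>\<^sup>+\<omega>. f (snd \<omega> 0) (adv (\<lambda>_. 0) 1 \<omega>) \<partial>\<Omega>) = (\<integral>\<^sup>+\<omega>. \<integral>\<^sup>+\<omega>'. f (snd \<omega> 0) \<omega>' \<partial>\<Omega> \<partial>\<Omega>)"
  proof (rule nn_integral_Comb[where m="\<lambda>_. 0" and u=1])
    show "(\<lambda>\<omega>. f (snd \<omega> 0) (adv (\<lambda>_. 0) 1 \<omega>)) \<in> borel_measurable SRC"
      by (rule measurable_compose_countable[where f="\<lambda>a \<omega>. f a (adv (\<lambda>_. 0) 1 \<omega>)", OF _ d0])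
         (intro measurable_compose[OF _ f] measurable_adv measurable_ident_sets refl)
    show "(\<lambda>z. f (snd (fst z) 0) (snd z)) \<in> borel_measurable (SRC \<Otimes>\<^sub>M SRC)"
      by (rule measurable_compose_countable[where f="\<lambda>a z. f a (snd z)" and g="\<lambda>z. snd (fst z) 0"])
         (intro measurable_compose[OF measurable_snd f] measurable_compose[OF measurable_fst d0])+
    fix \<omega> \<omega>' assume sp: "\<omega> \<in> space \<Omega>" "\<omega>' \<in> space \<Omega>"
    have "fst (Comb (\<lambda>_. 0) 1 (\<omega>, \<omega>')) a k = fst \<omega>' a k" for a k
      using space_Omega_arm[OF sp(2), of a] by (cases "a < N") (auto simp: Comb_def splice_def comb_seq_0)
    then have "adv (\<lambda>_. 0) 1 (Comb (\<lambda>_. 0) 1 (\<omega>, \<omega>')) = \<omega>'"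
      by (simp add: adv_def) (simp add: Comb_def comb_seq_def)
    then show "f (snd (Comb (\<lambda>_. 0) 1 (\<omega>, \<omega>')) 0) (adv (\<lambda>_. 0) 1 (Comb (\<lambda>_. 0) 1 (\<omega>, \<omega>'))) = f (snd \<omega> 0) \<omega>'"
      by (simp only:) (simp add: Comb_def)
  qed
  also have "\<dots> = (\<integral>\<^sup>+a. (\<integral>\<^sup>+\<omega>'. f a \<omega>' \<partial>\<Omega>) \<partial>distr \<Omega> (count_space UNIV) (\<lambda>\<omega>. snd \<omega> 0))"
    using measurable_compose[OF measurable_id_SRC d0] by (intro nn_integral_distr[symmetric]) auto
  also have "distr \<Omega> (count_space UNIV) (\<lambda>\<omega>. snd \<omega> 0) = measure_pmf (pmf_of_set {..<N})"
  proof -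
    have s: "snd \<in> measurable \<Omega> DRAWS" unfolding Omega_def by simp
    interpret A: prob_space ARMS by (rule prob_arms)
    interpret D: prob_space DRAWS by (rule prob_draws)
    interpret AD: pair_prob_space ARMS DRAWS ..
    have sd: "distr \<Omega> DRAWS snd = DRAWS"
    proof (rule measure_eqI)
      fix F assume "F \<in> sets (distr \<Omega> DRAWS snd)"
      then have F: "F \<in> sets DRAWS" by simp
      have "emeasure (distr \<Omega> DRAWS snd) F = emeasure \<Omega> (space ARMS \<times> F)"
        using F s sets.sets_into_space[OF F]
        by (subst emeasure_distr) (auto intro!: arg_cong2[where f=emeasure] simp: Omega_def space_pair_measure)
      also have "\<dots> = emeasure DRAWS F"
        unfolding Omega_def using F by (simp add: D.emeasure_pair_measure_Times A.emeasure_space_1)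
      finally show "emeasure (distr \<Omega> DRAWS snd) F = emeasure DRAWS F" .
    qed simp
    have "distr \<Omega> (measure_pmf (pmf_of_set {..<N})) (\<lambda>\<omega>. snd \<omega> 0) = distr (distr \<Omega> DRAWS snd) (measure_pmf (pmf_of_set {..<N})) (\<lambda>U. U 0)"
      using s by (subst distr_distr) (auto simp: comp_def)
    also have "\<dots> = measure_pmf (pmf_of_set {..<N})"
      unfolding sd by (rule distr_PiM_component) (auto simp: prob_space_measure_pmf)
    finally show ?thesis
      using distr_cong[of \<Omega> \<Omega> "count_space UNIV" "measure_pmf (pmf_of_set {..<N})" "\<lambda>\<omega>. snd \<omega> 0" "\<lambda>\<omega>. snd \<omega> 0"] by simp
  qed
  also have "(\<integral>\<^sup>+a. (\<integral>\<^sup>+\<omega>'. f a \<omega>' \<partial>\<Omega>) \<partial>measure_pmf (pmf_of_set {..<N})) = (\<Sum>a<N. \<integral>\<^sup>+\<omega>. f a \<omega> \<partial>\<Omega>) / of_nat N"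
    using N_ge_2 by (subst nn_integral_pmf_of_set) (auto simp: lessThan_empty_iff)
  finally show ?thesis .
qed

end

section \<open>The test of SRI\<close>

lemma real_nat_ceiling_ge: "x \<le> real (nat \<lceil>x\<rceil>)"
  by linarith

lemma nat_ceiling_double: "x \<le> 2 * y \<Longrightarrow> nat \<lceil>x\<rceil> \<le> 2 * nat \<lceil>y\<rceil>" for x y :: real
  by linarith

text \<open>Turns a lower bound on a sample size, in the form in which the algorithm prescribes it,
  into an upper bound on the variance proxy S / m.\<close>

lemma variance_from_count: "c * S / D * L \<le> m \<Longrightarrow> 0 < m \<Longrightarrow> 0 < D \<Longrightarrow> c * (L * (S / m)) \<le> D" for c S D L m :: real
  by (simp add: field_simps)

text \<open>The sum at most doubles from one level to the next; under the root a factor 4 is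
  available. Doubling of the sample sizes is used for the exponential moment in the loop and for the
  first level \<open>s0\<close>.\<close>

lemma level_double:
  fixes A B L l D :: real
  assumes "0 \<le> A" "0 \<le> B" "0 \<le> L" "0 \<le> l" "0 \<le> D"
  shows "max (A * (2 ^ Suc s + L)) (B * sqrt (D * (2 ^ Suc s + l))) \<le> 2 * max (A * (2 ^ s + L)) (B * sqrt (D * (2 ^ s + l)))"
proof -
  have "A * (2 ^ Suc s + L) \<le> A * (2 * (2 ^ s + L))" using assms by (intro mult_left_mono) auto
  then have 1: "A * (2 ^ Suc s + L) \<le> 2 * (A * (2 ^ s + L))" by (simp only: mult.left_commute)
  have "D * (2 ^ Suc s + l) \<le> D * (2\<^sup>2 * (2 ^ s + l))" using assms by (intro mult_left_mono) auto
  then have "sqrt (D * (2 ^ Suc s + l)) \<le> sqrt (2\<^sup>2 * (D * (2 ^ s + l)))"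
    by (intro real_sqrt_le_mono) (simp only: mult.left_commute)
  also have "\<dots> = 2 * sqrt (D * (2 ^ s + l))" by (simp only: real_sqrt_mult real_sqrt_abs abs_numeral)
  finally have "B * sqrt (D * (2 ^ Suc s + l)) \<le> B * (2 * sqrt (D * (2 ^ s + l)))" using assms by (intro mult_left_mono) auto
  then have 2: "B * sqrt (D * (2 ^ Suc s + l)) \<le> 2 * (B * sqrt (D * (2 ^ s + l)))" by (simp only: mult.left_commute)
  from 1 2 show ?thesis by (auto simp: max_def)
qed

context clustering
begin

abbreviation PP :: params where
  "PP \<equiv> \<lparr>pcHW = cHW, pd = d, pN = N, pK = K, psig = \<sigma>\<rparr>"

definition D2 :: "nat \<Rightarrow> nat \<Rightarrow> real" where
  "D2 a b = ip d (vdiff (\<mu> a) (\<mu> b)) (vdiff (\<mu> a) (\<mu> b))"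

lemma D2_nonneg [simp]: "0 \<le> D2 a b" by (simp add: D2_def)

lemma D2_eq_0_iff: "D2 a b = 0 \<longleftrightarrow> veq d (\<mu> a) (\<mu> b)"
  unfolding D2_def ip_self by (subst sum_nonneg_eq_0_iff) (auto simp: vdiff_def veq_def)

lemma measurable_noise: "noise a h n \<in> measurable \<Omega> VEC"
proof -
  have "(\<lambda>\<omega>. vdiff (mean_from (fst \<omega>) a (h * n) n) (\<mu> a)) \<in> measurable SRC VEC"
    by (intro measurable_vdiff measurable_mean_from measurable_ident_sets refl measurable_const) simp
  then show ?thesis unfolding noise_def[abs_def] by (rule measurable_compose[OF measurable_id_SRC])
qed

lemma ip_zero_left: "(\<And>i. i < d \<Longrightarrow> x i = 0) \<Longrightarrow> ip d x y = 0"
  by (simp add: ip_def)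

lemma means_noise:
  "vdiff (fst (means (single a n) \<omega> a)) (\<mu> a) = noise a 0 n \<omega>"
  "vdiff (snd (means (single a n) \<omega> a)) (\<mu> a) = noise a 1 n \<omega>"
  by (simp_all add: means_def noise_def single_def)

end

locale sri = clustering +
  fixes \<delta> \<Delta> \<theta> :: real
  assumes \<delta>: "0 < \<delta>" "\<delta> < 1" and \<Delta>: "0 < \<Delta>" and \<theta>: "0 < \<theta>" "\<theta> \<le> 1 / real K"
begin

abbreviation "U \<equiv> sri_U PP \<delta> \<theta>"
abbreviation "r \<equiv> sri_r PP \<delta> \<theta>"
abbreviation "s0 \<equiv> sri_s0 PP \<delta> \<Delta> \<theta>"
abbreviation "n \<equiv> sri_n PP \<Delta>"
abbreviation "nmax \<equiv> sri_nmax PP \<delta> \<Delta> \<theta>"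
abbreviation "Tmax \<equiv> sri_Tmax PP \<delta> \<Delta> \<theta>"

text \<open>Exponent with exp(-lev s) = exp(-2^s) / (12 K): a union bound over K groups or K stored
  arms leaves a constant times exp(-2^s).\<close>

definition lev :: "nat \<Rightarrow> real" where "lev s = 2 ^ s + ln (12 * real K)"

lemma K_pos: "0 < real K" using K_ge_2 by simp

lemma ln_K: "ln (12 * real K) = ln 6 + ln (2 * real K)"
proof -
  have "12 * real K = 6 * (2 * real K)" by simp
  then show ?thesis using K_pos by (simp only: ln_mult_pos)
qed

lemma ln_2K_pos: "0 < ln (2 * real K)" using K_ge_2 by simp
lemma ln_12K_pos: "0 < ln (12 * real K)" using K_ge_2 by simp

lemma lev_pos: "0 < lev s" using ln_12K_pos by (simp add: lev_def add_pos_pos)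

lemma exp_lev: "exp (- lev s) = exp (- (2 ^ s)) / (12 * real K)"
  using K_pos by (simp add: lev_def exp_diff)

lemma exp_lev_le: "exp (- lev s) \<le> exp (- (2 ^ s)) / 24"
  unfolding exp_lev using K_ge_2 by (intro divide_left_mono) auto

lemma n_ge:
  shows n_ge1: "c1 cHW * \<sigma>\<^sup>2 / \<Delta>\<^sup>2 * lev s \<le> real (n s)"
    and n_ge2: "c2 cHW * \<sigma>\<^sup>2 / \<Delta>\<^sup>2 * sqrt (real d * (2 ^ s + ln 6)) \<le> real (n s)"
  unfolding sri_n_def lev_def by (auto intro!: order_trans[OF _ real_nat_ceiling_ge])

lemma c1_ge: "1024 \<le> c1 cHW" "8 * cHW \<le> c1 cHW" by (auto simp: c1_def)

lemma c1_pos: "0 < c1 cHW" using c1_ge by linarith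

lemma n_pos: "0 < n s"
proof -
  have "0 < c1 cHW * \<sigma>\<^sup>2 / \<Delta>\<^sup>2 * lev s" using c1_pos sigma_pos \<Delta> lev_pos by simp
  then show ?thesis using n_ge1[of s] by linarith
qed

lemma nmax_ge_n: "n r \<le> nmax" by (simp add: sri_nmax_def)
lemma nmax_pos: "0 < nmax" using nmax_ge_n n_pos[of r] by linarith

lemma n_double: "n (Suc s) \<le> 2 * n s"
  unfolding sri_n_def
  by (rule nat_ceiling_double, rule level_double)
     (use c1_pos cHW_pos ln_12K_pos in \<open>auto simp: c2_def le_max_iff_disj\<close>)

text \<open>\<open>\<sigma>\<^sup>2 / m\<close> is the variance proxy of an average of \<open>m\<close> samples.\<close>

lemma var_bounds:
  assumes "n s \<le> m"
  defines "v \<equiv> \<sigma>\<^sup>2 / real m"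
  shows var_pos: "0 < v" and var1: "1024 * (lev s * v) \<le> \<Delta>\<^sup>2" and var2: "8 * (cHW * (lev s * v)) \<le> \<Delta>\<^sup>2"
    and var3: "128 * (cHW * (real d * (2 ^ s + ln 6) * v\<^sup>2)) \<le> (\<Delta>\<^sup>2)\<^sup>2"
    and var4: "32 * sqrt 2 * (v * sqrt (real d * (2 ^ s + ln 6))) \<le> \<Delta>\<^sup>2"
proof -
  have m: "0 < real m" using assms n_pos[of s] by linarith
  show "0 < v" using m sigma_pos by (simp add: v_def)
  have ns: "real (n s) \<le> real m" using assms by simp
  have "c1 cHW * \<sigma>\<^sup>2 / \<Delta>\<^sup>2 * lev s \<le> real m" using n_ge1[of s] ns by linarith
  then have A: "c1 cHW * (lev s * v) \<le> \<Delta>\<^sup>2" unfolding v_def using m \<Delta> by (intro variance_from_count) auto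
  have lv: "0 \<le> lev s * v" using lev_pos[of s] \<open>0 < v\<close> by simp
  show "1024 * (lev s * v) \<le> \<Delta>\<^sup>2" using mult_right_mono[OF c1_ge(1) lv] A by linarith
  show "8 * (cHW * (lev s * v)) \<le> \<Delta>\<^sup>2" using mult_right_mono[OF c1_ge(2) lv] A by (simp add: mult.assoc)
  let ?w = "v * sqrt (real d * (2 ^ s + ln 6))"
  have w: "0 \<le> ?w" using \<open>0 < v\<close> by simp
  have "c2 cHW * \<sigma>\<^sup>2 / \<Delta>\<^sup>2 * sqrt (real d * (2 ^ s + ln 6)) \<le> real m" using n_ge2[of s] ns by linarith
  then have B: "c2 cHW * ?w \<le> \<Delta>\<^sup>2" unfolding v_def mult.commute[of "\<sigma>\<^sup>2 / real m"] using m \<Delta> by (intro variance_from_count) auto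
  have "32 * sqrt 2 \<le> c2 cHW" "16 * sqrt (cHW / 2) \<le> c2 cHW" by (auto simp: c2_def)
  from this[THEN mult_right_mono, OF w] B have C: "16 * sqrt (cHW / 2) * ?w \<le> \<Delta>\<^sup>2" "32 * sqrt 2 * ?w \<le> \<Delta>\<^sup>2" by linarith+
  show "32 * sqrt 2 * ?w \<le> \<Delta>\<^sup>2" by (rule C(2))
  have "(16 * sqrt (cHW / 2) * ?w)\<^sup>2 \<le> (\<Delta>\<^sup>2)\<^sup>2" using C(1) w cHW_pos by (intro power_mono) auto
  moreover have "(16 * sqrt (cHW / 2) * ?w)\<^sup>2 = 128 * (cHW * (real d * (2 ^ s + ln 6) * v\<^sup>2))"
  proof -
    have "(sqrt (cHW / 2))\<^sup>2 = cHW / 2" "(sqrt (real d * (2 ^ s + ln 6)))\<^sup>2 = real d * (2 ^ s + ln 6)"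
      using cHW_pos by (auto intro!: real_sqrt_pow2 mult_nonneg_nonneg add_nonneg_nonneg)
    then show ?thesis by (simp only: power_mult_distrib) simp
  qed
  ultimately show "128 * (cHW * (real d * (2 ^ s + ln 6) * v\<^sup>2)) \<le> (\<Delta>\<^sup>2)\<^sup>2" by simp
qed

lemma product_tail:
  assumes m: "n s \<le> m" and a: "a < N" and sg: "sg = 1 \<or> sg = -1"
  shows "\<Omega>.prob {\<omega> \<in> space \<Omega>. \<Delta>\<^sup>2 / 8 < sg * ip d (noise a 0 m \<omega>) (noise a 1 m \<omega>)} \<le> exp (- (2 ^ s)) / 24"
proof -
  define v where "v = \<sigma>\<^sup>2 / real m"
  note vb = var_bounds[OF m, folded v_def]
  \<comment> \<open>Gives exp(-t) = exp(-2^s) / 24. As K >= 2, t is at most \<open>lev s\<close>,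
    which settles the operator norm condition.\<close>
  let ?t = "2 ^ s + ln (24::real)"
  have m0: "0 < m" using n_pos[of s] m by linarith
  have t0: "0 < ?t" by (simp add: add_pos_pos)
  have l24: "ln (24::real) \<le> ln (12 * real K)" using K_ge_2 by simp
  \<comment> \<open>24 <= 6^2, so t is at most twice the exponent 2^s + log 6 for which the
    dimension term of \<open>n s\<close> was chosen.\<close>
  have l36: "?t \<le> 2 * (2 ^ s + ln 6)"
  proof -
    have "ln (24::real) \<le> ln (6 * 6)" by simp
    also have "\<dots> = 2 * ln 6" by (simp only: ln_mult_pos)
    finally have "ln (24::real) \<le> 2 * ln 6" .
    then show ?thesis by (rule order_trans[of "2 ^ s + ln (24::real)" "2 ^ s + 2 * ln 6", OF add_left_mono]) simp
  qed
  have "\<Omega>.prob {\<omega> \<in> space \<Omega>. \<Delta>\<^sup>2 / 8 < sg * ip d (noise a 0 m \<omega>) (noise a 1 m \<omega>)} \<le> exp (- ?t)"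
  proof (rule noise_bilinear_tail[OF a m0 sg])
    have gen: "c * (D * w) * (2 * L) \<le> z / 64" if "128 * (c * (D * L * w)) \<le> z" for c D w L z :: real
      using that by (simp add: algebra_simps)
    have "cHW * (real d * v\<^sup>2) * ?t \<le> cHW * (real d * v\<^sup>2) * (2 * (2 ^ s + ln 6))"
      using l36 cHW_pos by (intro mult_left_mono) auto
    also have "\<dots> \<le> (\<Delta>\<^sup>2)\<^sup>2 / 64" by (rule gen[OF vb(4)])
    also have "\<dots> = (\<Delta>\<^sup>2 / 8)\<^sup>2" by (simp add: power_divide)
    finally show "cHW * ?t * (real d * (\<sigma>\<^sup>2 / real m)\<^sup>2) \<le> (\<Delta>\<^sup>2 / 8)\<^sup>2"
      unfolding v_def[symmetric] by (simp only: mult_ac)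
    have "cHW * v * ?t \<le> cHW * v * lev s"
      using l24 cHW_pos vb(1) by (intro mult_left_mono) (auto simp: lev_def)
    also have "\<dots> = cHW * (lev s * v)" by (simp only: mult_ac)
    also have "\<dots> \<le> \<Delta>\<^sup>2 / 8" using vb(3) by linarith
    finally show "cHW * ?t * (\<sigma>\<^sup>2 / real m) \<le> \<Delta>\<^sup>2 / 8"
      unfolding v_def[symmetric] by (simp only: mult_ac)
  qed (use t0 \<Delta> in auto)
  also have "exp (- ?t) = exp (- (2 ^ s)) / 24" by (simp add: exp_diff)
  finally show ?thesis .
qed

definition Bnd :: real where "Bnd = \<sigma>\<^sup>2 / real nmax * (5/2 * real d + cHW * lev r)"

text \<open>What the stored means of an accepted arm must satisfy so that later tests against it
  depend only on fresh noise: its own product and its linear terms are small, and the lengths of its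
  errors, which act as the variance of the cross term, are bounded.\<close>

definition good :: "nat \<Rightarrow> vec \<times> vec \<Rightarrow> bool" where
  "good b m \<longleftrightarrow> (let h = vdiff (fst m) (\<mu> b); h' = vdiff (snd m) (\<mu> b) in
     \<bar>ip d h h'\<bar> \<le> \<Delta>\<^sup>2 / 8 \<and> ip d h h \<le> Bnd \<and> ip d h' h' \<le> Bnd \<and>
     (\<forall>a<N. \<bar>ip d (vdiff (\<mu> a) (\<mu> b)) h + ip d (vdiff (\<mu> a) (\<mu> b)) h'\<bar> \<le> sqrt (D2 a b) * \<Delta> / 16))"

lemma linear_tail_lev:
  assumes m: "n s \<le> m" and a: "a < N" and V: "0 < V" "\<sigma>\<^sup>2 / real m * (ip d u u + ip d u' u') \<le> V"
    and x: "0 \<le> x" "2 * lev s * V \<le> x\<^sup>2"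
  shows "\<Omega>.prob {\<omega> \<in> space \<Omega>. x \<le> ip d u (noise a 0 m \<omega>) + ip d u' (noise a 1 m \<omega>)} \<le> exp (- lev s)"
  using n_pos[of s] m by (intro noise_linear_tail[OF a _ V x]) auto

text \<open>The linear terms depend on a only through its mean, so the union runs over K groups
  instead of N arms. Products and lengths contribute 4/24, linear terms 2 K / (12 K); the sum is
  1/3. A measurable superset E is claimed, so that the bad event itself need not be shown
  measurable.\<close>

lemma prob_not_good:
  assumes b: "b < N"
  shows "\<exists>E\<in>sets \<Omega>. {\<omega> \<in> space \<Omega>. \<not> good b (means (single b nmax) \<omega> b)} \<subseteq> E \<and> \<Omega>.prob E \<le> exp (- (2 ^ r)) / 3"
proof -
  let ?h = "noise b 0 nmax" and ?h' = "noise b 1 nmax"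
  define rep where "rep G = (SOME a. a \<in> G)" for G :: "nat set"
  have Gfin: "finite (Gstar d N \<mu>)" by (simp add: Gstar_def)
  have rep: "rep G \<in> G" if "G \<in> Gstar d N \<mu>" for G
  proof -
    have "G \<noteq> {}" using that by (auto simp: Gstar_def veq_def)
    then show ?thesis unfolding rep_def by (metis all_not_in_conv someI_ex)
  qed
  define E1 where "E1 sg = {\<omega> \<in> space \<Omega>. \<Delta>\<^sup>2 / 8 < sg * ip d (?h \<omega>) (?h' \<omega>)}" for sg :: real
  define E2 where "E2 i = {\<omega> \<in> space \<Omega>. ip d (noise b i nmax \<omega>) (noise b i nmax \<omega>) > \<sigma>\<^sup>2 / real nmax * (5/2 * real d + cHW * lev r)}" for i
  \<comment> \<open>With D2 = 0 the Chernoff bound would have variance 0; the linear term then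
    vanishes and needs no event.\<close>
  define E3 where "E3 sg a = (if D2 a b = 0 then {} else {\<omega> \<in> space \<Omega>. sqrt (D2 a b) * \<Delta> / 16 \<le>
     ip d (\<lambda>i. sg * vdiff (\<mu> a) (\<mu> b) i) (?h \<omega>) + ip d (\<lambda>i. sg * vdiff (\<mu> a) (\<mu> b) i) (?h' \<omega>)})" for sg :: real and a
  define E where "E = E1 1 \<union> E1 (-1) \<union> E2 0 \<union> E2 1 \<union> (\<Union>G\<in>Gstar d N \<mu>. E3 1 (rep G) \<union> E3 (-1) (rep G))"
  have hm: "?h \<in> measurable \<Omega> VEC" "?h' \<in> measurable \<Omega> VEC" by (rule measurable_noise)+
  have meas: "E1 sg \<in> sets \<Omega>" "E2 i \<in> sets \<Omega>" "E3 sg a \<in> sets \<Omega>" for sg i a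
  proof -
    show "E1 sg \<in> sets \<Omega>" unfolding E1_def
      by (intro borel_measurable_less borel_measurable_const borel_measurable_times measurable_ip hm)
    show "E2 i \<in> sets \<Omega>" unfolding E2_def
      by (intro borel_measurable_less borel_measurable_const measurable_ip measurable_noise)
    have "{\<omega> \<in> space \<Omega>. c \<le> ip d u (?h \<omega>) + ip d u (?h' \<omega>)} \<in> sets \<Omega>" for c u
      by (intro borel_measurable_le borel_measurable_const borel_measurable_add measurable_ip hm measurable_const) simp_all
    then show "E3 sg a \<in> sets \<Omega>" 
    proof (cases "D2 a b = 0")
      case True
      then have "E3 sg a = {}" by (simp add: E3_def)
      then show ?thesis by simp
    next
      case False
      then show ?thesis unfolding E3_def if_not_P[OF False] using \<open>\<And>c u. {\<omega> \<in> space \<Omega>. c \<le> ip d u (?h \<omega>) + ip d u (?h' \<omega>)} \<in> sets \<Omega>\<close> by blast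
    qed
  qed
  have p1: "\<Omega>.prob (E1 sg) \<le> exp (- (2 ^ r)) / 24" if "sg = 1 \<or> sg = -1" for sg
    unfolding E1_def by (rule product_tail[OF nmax_ge_n b that])
  have p2: "\<Omega>.prob (E2 i) \<le> exp (- (2 ^ r)) / 24" if "i < 2" for i
    unfolding E2_def using noise_norm_tail[OF b nmax_pos that lev_pos[of r]] exp_lev_le[of r] by linarith
  have p3: "\<Omega>.prob (E3 sg a) \<le> exp (- lev r)" if "sg = 1 \<or> sg = -1" for sg a
  proof (cases "D2 a b = 0")
    case False
    then have D: "0 < D2 a b" using D2_nonneg[of a b] by linarith
    note v = var_bounds[OF nmax_ge_n]
    show ?thesis unfolding E3_def if_not_P[OF False]
    proof (rule linear_tail_lev[OF nmax_ge_n b])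
      show "0 < 2 * (D2 a b * (\<sigma>\<^sup>2 / real nmax))" by (intro mult_pos_pos D v(1)) simp
      have "ip d (\<lambda>i. sg * vdiff (\<mu> a) (\<mu> b) i) (\<lambda>i. sg * vdiff (\<mu> a) (\<mu> b) i) = D2 a b"
        unfolding ip_scale D2_def using that by auto
      then show "\<sigma>\<^sup>2 / real nmax * (ip d (\<lambda>i. sg * vdiff (\<mu> a) (\<mu> b) i) (\<lambda>i. sg * vdiff (\<mu> a) (\<mu> b) i) +
         ip d (\<lambda>i. sg * vdiff (\<mu> a) (\<mu> b) i) (\<lambda>i. sg * vdiff (\<mu> a) (\<mu> b) i)) \<le> 2 * (D2 a b * (\<sigma>\<^sup>2 / real nmax))" by (simp add: algebra_simps)
      show "0 \<le> sqrt (D2 a b) * \<Delta> / 16" using \<Delta> by simp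
      have "D2 a b * (1024 * (lev r * (\<sigma>\<^sup>2 / real nmax))) \<le> D2 a b * \<Delta>\<^sup>2" using v(2) D by (intro mult_left_mono) auto
      then show "2 * lev r * (2 * (D2 a b * (\<sigma>\<^sup>2 / real nmax))) \<le> (sqrt (D2 a b) * \<Delta> / 16)\<^sup>2"
        using D by (simp add: power_mult_distrib power_divide algebra_simps)
    qed
  qed (simp add: E3_def)
  have EM: "E \<in> sets \<Omega>" unfolding E_def using Gfin meas by (intro sets.Un sets.finite_UN) auto
  have "\<Omega>.prob (\<Union>G\<in>Gstar d N \<mu>. E3 1 (rep G) \<union> E3 (-1) (rep G)) \<le> (\<Sum>G\<in>Gstar d N \<mu>. \<Omega>.prob (E3 1 (rep G) \<union> E3 (-1) (rep G)))"
    using Gfin meas by (intro measure_UNION_le) auto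
  also have "\<dots> \<le> (\<Sum>G\<in>Gstar d N \<mu>. 2 * exp (- lev r))"
  proof (intro sum_mono)
    fix G
    show "\<Omega>.prob (E3 1 (rep G) \<union> E3 (-1) (rep G)) \<le> 2 * exp (- lev r)"
      using measure_Un_le[OF meas(3)[of 1 "rep G"] meas(3)[of "-1" "rep G"]] p3[of 1 "rep G"] p3[of "-1" "rep G"] by simp
  qed
  also have "\<dots> = exp (- (2 ^ r)) / 6" using K_pos by (simp add: card_Gstar exp_lev)
  finally have pU: "\<Omega>.prob (\<Union>G\<in>Gstar d N \<mu>. E3 1 (rep G) \<union> E3 (-1) (rep G)) \<le> exp (- (2 ^ r)) / 6" .
  have "\<Omega>.prob E \<le> \<Omega>.prob (E1 1) + \<Omega>.prob (E1 (-1)) + \<Omega>.prob (E2 0) + \<Omega>.prob (E2 1) + \<Omega>.prob (\<Union>G\<in>Gstar d N \<mu>. E3 1 (rep G) \<union> E3 (-1) (rep G))"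
  proof -
    let ?F = "\<Union>G\<in>Gstar d N \<mu>. E3 1 (rep G) \<union> E3 (-1) (rep G)"
    have F: "?F \<in> sets \<Omega>" using Gfin meas by (intro sets.finite_UN) auto
    show ?thesis unfolding E_def
      using measure_Un_le[of "E1 1 \<union> E1 (-1) \<union> E2 0 \<union> E2 1" \<Omega> ?F] measure_Un_le[of "E1 1 \<union> E1 (-1) \<union> E2 0" \<Omega> "E2 1"]
        measure_Un_le[of "E1 1 \<union> E1 (-1)" \<Omega> "E2 0"] measure_Un_le[of "E1 1" \<Omega> "E1 (-1)"] meas F by auto
  qed
  also have "\<dots> \<le> exp (- (2 ^ r)) / 3" using p1[of 1] p1[of "-1"] p2[of 0] p2[of 1] pU by simp
  finally have PE: "\<Omega>.prob E \<le> exp (- (2 ^ r)) / 3" .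
  have "\<omega> \<in> E" if w: "\<omega> \<in> space \<Omega>" and ng: "\<not> good b (means (single b nmax) \<omega> b)" for \<omega>
  proof (rule ccontr)
    assume nE: "\<omega> \<notin> E"
    have 1: "\<bar>ip d (?h \<omega>) (?h' \<omega>)\<bar> \<le> \<Delta>\<^sup>2 / 8" using nE w by (auto simp: E_def E1_def abs_le_iff not_less)
    have 2: "ip d (?h \<omega>) (?h \<omega>) \<le> Bnd" "ip d (?h' \<omega>) (?h' \<omega>) \<le> Bnd"
      using nE w by (auto simp: E_def E2_def not_less Bnd_def)
    have 3: "\<bar>ip d (vdiff (\<mu> a) (\<mu> b)) (?h \<omega>) + ip d (vdiff (\<mu> a) (\<mu> b)) (?h' \<omega>)\<bar> \<le> sqrt (D2 a b) * \<Delta> / 16" if a: "a < N" for a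
    proof (cases "D2 a b = 0")
      case True
      then have "veq d (\<mu> a) (\<mu> b)" by (simp add: D2_eq_0_iff)
      then show ?thesis using True by (simp add: ip_zero_left veq_def vdiff_def)
    next
      case False
      let ?G = "{c. c < N \<and> veq d (\<mu> c) (\<mu> a)}"
      have G: "?G \<in> Gstar d N \<mu>" using a by (auto simp: Gstar_def)
      have "rep ?G \<in> ?G" by (rule rep[OF G])
      then have vr: "veq d (\<mu> (rep ?G)) (\<mu> a)" by simp
      have e: "ip d (vdiff (\<mu> (rep ?G)) (\<mu> b)) x = ip d (vdiff (\<mu> a) (\<mu> b)) x" for x
        using vr by (auto simp: ip_def veq_def vdiff_def)
      have De: "D2 (rep ?G) b = D2 a b" unfolding D2_def using vr by (auto simp: ip_def veq_def vdiff_def)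
      have es: "ip d (\<lambda>i. sg * vdiff (\<mu> (rep ?G)) (\<mu> b) i) x = sg * ip d (vdiff (\<mu> a) (\<mu> b)) x" for sg x
        using e[of x] ip_scale[of d sg "vdiff (\<mu> (rep ?G)) (\<mu> b)" 1 x] by simp
      have "\<omega> \<notin> E3 1 (rep ?G)" "\<omega> \<notin> E3 (-1) (rep ?G)" using nE G by (auto simp: E_def)
      then have "\<not> sqrt (D2 a b) * \<Delta> / 16 \<le> 1 * ip d (vdiff (\<mu> a) (\<mu> b)) (?h \<omega>) + 1 * ip d (vdiff (\<mu> a) (\<mu> b)) (?h' \<omega>)"
        "\<not> sqrt (D2 a b) * \<Delta> / 16 \<le> - 1 * ip d (vdiff (\<mu> a) (\<mu> b)) (?h \<omega>) + - 1 * ip d (vdiff (\<mu> a) (\<mu> b)) (?h' \<omega>)"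
        unfolding E3_def De es if_not_P[OF False] using w by blast+
      then show ?thesis unfolding abs_le_iff by linarith
    qed
    have "good b (means (single b nmax) \<omega> b)"
      unfolding good_def Let_def means_noise using 1 2 3 by blast
    then show False using ng by contradiction
  qed
  then show ?thesis using EM PE by blast
qed

text \<open>Of the six summands, the second, fourth and fifth contain fresh noise; the third and
  sixth belong to the stored arm and are bounded by \<open>good\<close>.\<close>

lemma stat_expand:
  "stat d (means (single a m) \<omega> a) mb =
     D2 a b + (ip d (vdiff (\<mu> a) (\<mu> b)) (noise a 0 m \<omega>) + ip d (vdiff (\<mu> a) (\<mu> b)) (noise a 1 m \<omega>))
     - (ip d (vdiff (\<mu> a) (\<mu> b)) (vdiff (fst mb) (\<mu> b)) + ip d (vdiff (\<mu> a) (\<mu> b)) (vdiff (snd mb) (\<mu> b)))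
     + ip d (noise a 0 m \<omega>) (noise a 1 m \<omega>)
     - (ip d (vdiff (snd mb) (\<mu> b)) (noise a 0 m \<omega>) + ip d (vdiff (fst mb) (\<mu> b)) (noise a 1 m \<omega>))
     + ip d (vdiff (fst mb) (\<mu> b)) (vdiff (snd mb) (\<mu> b))"
  unfolding stat_def D2_def means_noise[symmetric] ip_def vdiff_def sum_subtractf[symmetric] sum.distrib[symmetric]
  by (intro sum.cong refl) algebra

text \<open>With the stored errors h, h' fixed, the cross term is linear in the fresh noise with
  variance proxy at most 2 v Bnd. The condition on the exponent splits into three products of
  variances, one for each part of \<open>Bnd\<close> and of \<open>lev s\<close>.\<close>

lemma cross_tail:
  assumes s: "1 \<le> s" "s \<le> r" and a: "a < N" and h: "ip d h h \<le> Bnd" "ip d h' h' \<le> Bnd" and sg: "sg = 1 \<or> sg = -1"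
  shows "\<Omega>.prob {\<omega> \<in> space \<Omega>. \<Delta>\<^sup>2 / 8 \<le> ip d (\<lambda>i. sg * h' i) (noise a 0 (n s) \<omega>) + ip d (\<lambda>i. sg * h i) (noise a 1 (n s) \<omega>)} \<le> exp (- lev s)"
proof -
  define v where "v = \<sigma>\<^sup>2 / real (n s)"
  define vm where "vm = \<sigma>\<^sup>2 / real nmax"
  note b = var_bounds[OF order_refl[of "n s"], folded v_def]
  note bm = var_bounds[OF nmax_ge_n, folded vm_def]
  let ?ls = "2 ^ s + ln (6::real)" and ?lr = "2 ^ r + ln (6::real)"
  have l6: "0 < ln (6::real)" by simp
  have ls1: "1 \<le> ?ls" using one_le_power[of "2::real" s] l6 by linarith
  have lsr: "?ls \<le> ?lr" using power_increasing[of s r "2::real"] s by simp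
  have B0: "0 < Bnd" using bm(1) cHW_pos lev_pos[of r] d_pos unfolding Bnd_def vm_def[symmetric]
    by (intro mult_pos_pos add_pos_pos) auto
  have q1: "2048 * (v * vm * (real d * ?ls)) \<le> (\<Delta>\<^sup>2)\<^sup>2"
  proof -
    have "(32 * sqrt 2 * (v * sqrt (real d * ?ls))) * (32 * sqrt 2 * (vm * sqrt (real d * ?lr))) \<le> \<Delta>\<^sup>2 * \<Delta>\<^sup>2"
      using b(1,5) bm(1,5) by (intro mult_mono) auto
    moreover have "2048 * (v * vm * (real d * ?ls)) \<le> (32 * sqrt 2 * (v * sqrt (real d * ?ls))) * (32 * sqrt 2 * (vm * sqrt (real d * ?lr)))"
    proof -
      have "real d * ?ls = sqrt (real d * ?ls) * sqrt (real d * ?ls)" using ls1 by simp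
      also have "\<dots> \<le> sqrt (real d * ?ls) * sqrt (real d * ?lr)"
        using lsr by (intro mult_left_mono real_sqrt_le_mono) (auto intro: mult_left_mono)
      finally have "2048 * (v * vm) * (real d * ?ls) \<le> 2048 * (v * vm) * (sqrt (real d * ?ls) * sqrt (real d * ?lr))"
        using b(1) bm(1) by (intro mult_left_mono) auto
      also have "\<dots> = (sqrt 2 * sqrt 2) * 1024 * (v * vm) * (sqrt (real d * ?ls) * sqrt (real d * ?lr))" by simp
      also have "\<dots> = (32 * sqrt 2 * (v * sqrt (real d * ?ls))) * (32 * sqrt 2 * (vm * sqrt (real d * ?lr)))"
        by (simp only: mult_ac)
      finally show ?thesis by (simp add: mult.assoc)
    qed
    ultimately show ?thesis unfolding power2_eq_square[of "\<Delta>\<^sup>2"] by linarith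
  qed
  \<comment> \<open>The only place where the second term of \<open>nmax\<close>, with the constant
    c3, acts: it pairs the dimension with the log(2K) part of \<open>lev s\<close>.\<close>
  have q2: "2048 * (v * vm * (real d * ln (2 * real K))) \<le> (\<Delta>\<^sup>2)\<^sup>2"
  proof -
    have "c3 cHW * \<sigma>\<^sup>2 / \<Delta>\<^sup>2 * sqrt (real d) * ln (2 * real K) \<le> real (nat \<lceil>c3 cHW * \<sigma>\<^sup>2 / \<Delta>\<^sup>2 * sqrt (real d) * ln (2 * real K)\<rceil>)"
      by (rule real_nat_ceiling_ge)
    also have "\<dots> \<le> real nmax" by (simp add: sri_nmax_def)
    finally have "c3 cHW * \<sigma>\<^sup>2 / \<Delta>\<^sup>2 * sqrt (real d) * ln (2 * real K) \<le> real nmax" .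
    then have "c3 cHW * (vm * (sqrt (real d) * ln (2 * real K))) \<le> \<Delta>\<^sup>2"
      unfolding vm_def mult.commute[of "\<sigma>\<^sup>2 / real nmax"] mult.assoc[of _ "sqrt (real d)"]
      using nmax_pos \<Delta> by (intro variance_from_count) (auto simp: mult.assoc)
    then have c: "32 * sqrt 2 * (vm * (sqrt (real d) * ln (2 * real K))) \<le> \<Delta>\<^sup>2" by (simp only: c3_def)
    have "sqrt (real d) \<le> sqrt (real d * ?ls)" using ls1 mult_left_mono[of 1 ?ls "real d"] by simp
    then have "32 * sqrt 2 * (v * sqrt (real d)) \<le> 32 * sqrt 2 * (v * sqrt (real d * ?ls))"
      using b(1) by (intro mult_left_mono) auto
    then have c': "32 * sqrt 2 * (v * sqrt (real d)) \<le> \<Delta>\<^sup>2" using b(5) by linarith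
    have "(32 * sqrt 2 * (v * sqrt (real d))) * (32 * sqrt 2 * (vm * (sqrt (real d) * ln (2 * real K)))) \<le> \<Delta>\<^sup>2 * \<Delta>\<^sup>2"
      using c c' b(1) bm(1) ln_2K_pos by (intro mult_mono) auto
    moreover have "(32 * sqrt 2 * (v * sqrt (real d))) * (32 * sqrt 2 * (vm * (sqrt (real d) * ln (2 * real K)))) =
       (sqrt 2 * sqrt 2) * 1024 * (v * vm) * ((sqrt (real d) * sqrt (real d)) * ln (2 * real K))" by (simp only: mult_ac)
    moreover have "(sqrt 2 * sqrt 2) * 1024 * (v * vm) * ((sqrt (real d) * sqrt (real d)) * ln (2 * real K)) = 2048 * (v * vm * (real d * ln (2 * real K)))"
      by simp
    ultimately show ?thesis unfolding power2_eq_square[of "\<Delta>\<^sup>2"] by linarith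
  qed
  have q3: "8192 * ((cHW * (lev s * v)) * (lev r * vm)) \<le> (\<Delta>\<^sup>2)\<^sup>2"
  proof -
    have "(8 * (cHW * (lev s * v))) * (1024 * (lev r * vm)) \<le> \<Delta>\<^sup>2 * \<Delta>\<^sup>2"
      using b(3) bm(1,2) lev_pos[of r] by (intro mult_mono) auto
    then show ?thesis by (simp add: power2_eq_square)
  qed
  show ?thesis
  proof (rule linear_tail_lev[OF order_refl a])
    show "0 < 2 * (v * Bnd)" using b(1) B0 by simp
    have "ip d (\<lambda>i. sg * h' i) (\<lambda>i. sg * h' i) + ip d (\<lambda>i. sg * h i) (\<lambda>i. sg * h i) \<le> 2 * Bnd"
      unfolding ip_scale using sg h by auto
    from mult_left_mono[OF this, of v] show "\<sigma>\<^sup>2 / real (n s) * (ip d (\<lambda>i. sg * h' i) (\<lambda>i. sg * h' i) + ip d (\<lambda>i. sg * h i) (\<lambda>i. sg * h i)) \<le> 2 * (v * Bnd)"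
      using b(1) unfolding v_def[symmetric] by simp
    have "2 * lev s * (2 * (v * Bnd)) = 10 * (v * vm * (real d * ?ls)) + 10 * (v * vm * (real d * ln (2 * real K))) + 4 * ((cHW * (lev s * v)) * (lev r * vm))"
    proof -
      have gen: "2 * (x + y) * (2 * (v * (vm * (5/2 * D + c * z)))) = 10 * (v * vm * (D * x)) + 10 * (v * vm * (D * y)) + 4 * ((c * ((x + y) * v)) * (z * vm))"
        for x y D c z :: real by (simp add: algebra_simps)
      have "lev s = ?ls + ln (2 * real K)" by (simp add: lev_def ln_K)
      then show ?thesis unfolding Bnd_def vm_def[symmetric] by (simp only: gen)
    qed
    \<comment> \<open>10/2048 + 10/2048 + 4/8192 = 21/2048 is below 1/64.\<close>
    also have "\<dots> \<le> (\<Delta>\<^sup>2)\<^sup>2 / 64"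
    proof -
      have "10 * x + 10 * y + 4 * z \<le> w / 64" if "2048 * x \<le> w" "2048 * y \<le> w" "8192 * z \<le> w" "0 \<le> w" for x y z w :: real
        using that by linarith
      from this[OF q1 q2 q3] show ?thesis by simp
    qed
    finally show "2 * lev s * (2 * (v * Bnd)) \<le> (\<Delta>\<^sup>2 / 8)\<^sup>2" by (simp add: power_divide)
  qed simp
qed

end

section \<open>Real-valued expectations of continuations\<close>

lemma testK_le_1:
  fixes \<kappa> :: "bool \<Rightarrow> nat \<Rightarrow> src \<Rightarrow> ennreal"
  assumes "\<And>b t \<omega>. \<kappa> b t \<omega> \<le> 1"
  shows "testK P \<Delta> r S M a f tot \<omega> \<kappa> \<le> 1"
proof (induction f arbitrary: tot \<omega>)
  case 0
  then show ?case by (subst testK.simps) (simp add: Let_def assms)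
next
  case (Suc f)
  then show ?case by (subst testK.simps) (simp add: Let_def assms)
qed

lemma loopK_le_1:
  fixes \<kappa> :: "nat set \<Rightarrow> nat \<Rightarrow> src \<Rightarrow> ennreal"
  assumes "\<And>b t \<omega>. \<kappa> b t \<omega> \<le> 1"
  shows "loopK P \<delta> \<Delta> \<theta> tot0 k S M tot \<omega> \<kappa> \<le> 1"
proof (induction k arbitrary: S M tot \<omega>)
  case (Suc k)
  then show ?case by (simp only: loopK.simps Let_def) (intro testK_le_1, auto simp: assms)
qed (simp add: assms)

context clustering
begin

text \<open>Integrands bounded by 1 have finite integrals, so the bookkeeping of failure
  probabilities can be done in the reals, with subtraction and linear arithmetic.\<close>

definition ex :: "(src \<Rightarrow> ennreal) \<Rightarrow> real" where
  "ex f = enn2real (\<integral>\<^sup>+\<omega>. f \<omega> \<partial>\<Omega>)"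

lemma nn_integral_le_1: "(\<And>\<omega>. f \<omega> \<le> 1) \<Longrightarrow> (\<integral>\<^sup>+\<omega>. f \<omega> \<partial>\<Omega>) \<le> 1"
  using nn_integral_mono[of \<Omega> f "\<lambda>_. 1"] by (simp add: \<Omega>.emeasure_space_1)

lemma ex_eq: "(\<And>\<omega>. f \<omega> \<le> 1) \<Longrightarrow> ennreal (ex f) = (\<integral>\<^sup>+\<omega>. f \<omega> \<partial>\<Omega>)"
  unfolding ex_def using nn_integral_le_1[of f] by (intro ennreal_enn2real) (auto simp: top_unique less_top intro: le_less_trans)

lemma ex_nonneg: "0 \<le> ex f" by (simp add: ex_def)

lemma ex_le_1: "(\<And>\<omega>. f \<omega> \<le> 1) \<Longrightarrow> ex f \<le> 1"
  unfolding ex_def using nn_integral_le_1[of f] enn2real_mono[of _ 1] by force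

text \<open>An equality rather than a bound: both branches continue on the same fresh stream, which
  is independent of the test deciding between them.\<close>

lemma ex_mean_branch:
  fixes m :: nat
  assumes a: "a < N" and Q: "Measurable.pred (VEC \<Otimes>\<^sub>M VEC) Q"
    and A: "A \<in> borel_measurable SRC" "\<And>\<omega>. A \<omega> \<le> 1" and B: "B \<in> borel_measurable SRC" "\<And>\<omega>. B \<omega> \<le> 1"
  defines "p \<equiv> \<Omega>.prob {\<omega> \<in> space \<Omega>. Q (means (single a m) \<omega> a)}"
  shows "ex (\<lambda>\<omega>. if Q (means (single a m) \<omega> a) then A (adv (single a (2 * m)) 0 \<omega>) else B (adv (single a (2 * m)) 0 \<omega>))
     = p * ex A + (1 - p) * ex B"
proof -
  let ?E = "{\<omega> \<in> space \<Omega>. Q (means (single a m) \<omega> a)}"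
  have mm: "(\<lambda>\<omega>. means (single a m) \<omega> a) \<in> measurable \<Omega> (VEC \<Otimes>\<^sub>M VEC)"
    by (rule measurable_compose[OF measurable_id_SRC measurable_means_coord[OF measurable_ident_sets[OF refl]]])
  have E: "?E \<in> sets \<Omega>" using measurable_compose[OF mm Q] by (simp add: pred_def)
  have h: "(\<lambda>x. if Q (fst x a) then A (snd x) else B (snd x)) \<in> borel_measurable (MEANS \<Otimes>\<^sub>M SRC)"
    using measurable_compose[OF measurable_MEANS_coord[OF measurable_fst_MEANS] Q]
    by (intro measurable_If measurable_compose[OF measurable_snd_SRC A(1)] measurable_compose[OF measurable_snd_SRC B(1)]) (simp add: pred_def)
  have "(\<integral>\<^sup>+\<omega>. (if Q (means (single a m) \<omega> a) then A (adv (single a (2 * m)) 0 \<omega>) else B (adv (single a (2 * m)) 0 \<omega>)) \<partial>\<Omega>)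
     = (\<integral>\<^sup>+\<omega>. \<integral>\<^sup>+\<omega>'. (if Q (means (single a m) \<omega> a) then A \<omega>' else B \<omega>') \<partial>\<Omega> \<partial>\<Omega>)"
    by (rule fresh_mean[where h="\<lambda>mm \<omega>. if Q (mm a) then A \<omega> else B \<omega>", OF h a])
  also have "\<dots> = (\<integral>\<^sup>+\<omega>. ennreal (ex A) * indicator ?E \<omega> + ennreal (ex B) * indicator (space \<Omega> - ?E) \<omega> \<partial>\<Omega>)"
  proof (rule nn_integral_cong)
    fix \<omega> assume "\<omega> \<in> space \<Omega>"
    then show "(\<integral>\<^sup>+\<omega>'. (if Q (means (single a m) \<omega> a) then A \<omega>' else B \<omega>') \<partial>\<Omega>) = ennreal (ex A) * indicator ?E \<omega> + ennreal (ex B) * indicator (space \<Omega> - ?E) \<omega>"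
      unfolding ex_eq[OF A(2)] ex_eq[OF B(2)] by (cases "Q (means (single a m) \<omega> a)") simp_all
  qed
  also have "\<dots> = ennreal (ex A) * emeasure \<Omega> ?E + ennreal (ex B) * emeasure \<Omega> (space \<Omega> - ?E)"
    using E by (subst nn_integral_add) (auto simp: nn_integral_cmult)
  also have "\<dots> = ennreal (ex A * p + ex B * (1 - p))"
    using E \<Omega>.prob_compl[OF E] by (simp add: \<Omega>.emeasure_eq_measure p_def ennreal_mult[symmetric] ex_nonneg ennreal_plus[symmetric] del: ennreal_plus)
  finally have "ex (\<lambda>\<omega>. if Q (means (single a m) \<omega> a) then A (adv (single a (2 * m)) 0 \<omega>) else B (adv (single a (2 * m)) 0 \<omega>)) = enn2real (ennreal (ex A * p + ex B * (1 - p)))"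
    by (subst ex_def) (simp only:)
  moreover have "0 \<le> ex A * p + ex B * (1 - p)"
    using ex_nonneg[of A] ex_nonneg[of B] \<Omega>.prob_le_1[of ?E] by (simp add: p_def)
  ultimately show ?thesis by (simp only: enn2real_ennreal mult.commute)
qed

text \<open>The basic accounting step: on the bad event the continuation counts at most 1, off it
  the means satisfy \<open>Gd\<close> and the bound for fixed means applies.\<close>

lemma ex_means_le:
  assumes n: "\<And>a. N \<le> a \<Longrightarrow> n a = 0" and h: "(\<lambda>x. h (fst x) (snd x)) \<in> borel_measurable (MEANS \<Otimes>\<^sub>M SRC)" "\<And>mm \<omega>. h mm \<omega> \<le> 1"
    and E: "E \<in> sets \<Omega>" "{\<omega> \<in> space \<Omega>. \<not> Gd (means n \<omega>)} \<subseteq> E" "\<Omega>.prob E \<le> g"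
    and B: "0 \<le> B" "\<And>mm. Gd mm \<Longrightarrow> ex (h mm) \<le> B"
  shows "ex (\<lambda>\<omega>. h (means n \<omega>) (adv (\<lambda>a. 2 * n a) 0 \<omega>)) \<le> g + B"
proof -
  have "(\<integral>\<^sup>+\<omega>. h (means n \<omega>) (adv (\<lambda>a. 2 * n a) 0 \<omega>) \<partial>\<Omega>) = (\<integral>\<^sup>+\<omega>. \<integral>\<^sup>+\<omega>'. h (means n \<omega>) \<omega>' \<partial>\<Omega> \<partial>\<Omega>)"
    by (rule fresh_means[OF h(1) n])
  also have "\<dots> \<le> (\<integral>\<^sup>+\<omega>. indicator E \<omega> + ennreal B \<partial>\<Omega>)"
  proof (rule nn_integral_mono)
    fix \<omega> assume w: "\<omega> \<in> space \<Omega>"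
    show "(\<integral>\<^sup>+\<omega>'. h (means n \<omega>) \<omega>' \<partial>\<Omega>) \<le> indicator E \<omega> + ennreal B"
    proof (cases "\<omega> \<in> E")
      case True
      then show ?thesis using nn_integral_le_1[of "h (means n \<omega>)"] h(2) by (simp add: add_increasing2)
    next
      case False
      then have "Gd (means n \<omega>)" using E(2) w by auto
      then show ?thesis using B(2) False by (simp add: ex_eq[OF h(2), symmetric] ennreal_leI)
    qed
  qed
  also have "\<dots> = emeasure \<Omega> E + ennreal B" using E(1) by (subst nn_integral_add) (auto simp: \<Omega>.emeasure_space_1)
  also have "\<dots> \<le> ennreal (g + B)"
    using E(3) B(1) by (simp add: \<Omega>.emeasure_eq_measure ennreal_plus[symmetric] ennreal_leI del: ennreal_plus)
  finally show ?thesis unfolding ex_def using B(1) E(3) measure_nonneg[of \<Omega> E]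
    by (intro enn2real_leI) linarith+
qed

lemma ex_mean_le:
  assumes a: "a < N" and h: "(\<lambda>x. h (fst x) (snd x)) \<in> borel_measurable (MEANS \<Otimes>\<^sub>M SRC)" "\<And>mm \<omega>. h mm \<omega> \<le> 1"
    and E: "E \<in> sets \<Omega>" "{\<omega> \<in> space \<Omega>. \<not> Gd (means (single a m) \<omega>)} \<subseteq> E" "\<Omega>.prob E \<le> g"
    and B: "0 \<le> B" "\<And>mm. Gd mm \<Longrightarrow> ex (h mm) \<le> B"
  shows "ex (\<lambda>\<omega>. h (means (single a m) \<omega>) (adv (single a (2 * m)) 0 \<omega>)) \<le> g + B"
proof -
  have "single a (2 * m) = (\<lambda>b. 2 * single a m b)" by (auto simp: single_def)
  then show ?thesis using ex_means_le[where n="single a m" and h=h and Gd=Gd, OF _ h E B] a by (simp add: single_def)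
qed

lemma ex_draw:
  assumes f: "\<And>a. f a \<in> borel_measurable SRC" "\<And>a \<omega>. f a \<omega> \<le> 1"
  shows "ex (\<lambda>\<omega>. f (snd \<omega> 0) (adv (\<lambda>_. 0) 1 \<omega>)) = (\<Sum>a<N. ex (f a)) / real N"
proof -
  have "(\<integral>\<^sup>+\<omega>. f (snd \<omega> 0) (adv (\<lambda>_. 0) 1 \<omega>) \<partial>\<Omega>) = (\<Sum>a<N. ennreal (ex (f a))) / of_nat N"
    using fresh_draw[OF f(1)] by (simp add: ex_eq[OF f(2)])
  also have "\<dots> = ennreal ((\<Sum>a<N. ex (f a)) / real N)"
    using N_ge_2 by (simp add: sum_ennreal ex_nonneg sum_nonneg divide_ennreal ennreal_of_nat_eq_real_of_nat)
  finally have "(\<integral>\<^sup>+\<omega>. f (snd \<omega> 0) (adv (\<lambda>_. 0) 1 \<omega>) \<partial>\<Omega>) = ennreal ((\<Sum>a<N. ex (f a)) / real N)" .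
  then have "ex (\<lambda>\<omega>. f (snd \<omega> 0) (adv (\<lambda>_. 0) 1 \<omega>)) = enn2real (ennreal ((\<Sum>a<N. ex (f a)) / real N))"
    by (subst ex_def) (simp only:)
  then show ?thesis by (simp add: ex_nonneg sum_nonneg)
qed

lemma measurable_reject_test:
  "finite S \<Longrightarrow> S \<noteq> {} \<Longrightarrow> Measurable.pred (VEC \<Otimes>\<^sub>M VEC) (reject d' \<Delta> S M)"
  by (rule measurable_reject) (auto simp: measurable_ident_sets)

lemma ex_test:
  fixes \<kappa> :: "bool \<Rightarrow> nat \<Rightarrow> src \<Rightarrow> ennreal" and P \<Delta> r M
  assumes S: "finite S" "S \<noteq> {}" and a: "a < N"
    and \<kappa>: "\<And>b t. \<kappa> b t \<in> borel_measurable SRC" "\<And>b t \<omega>. \<kappa> b t \<omega> \<le> 1"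
  defines "m \<equiv> \<lambda>f. sri_n P \<Delta> (r - f)"
  defines "p \<equiv> \<lambda>f. \<Omega>.prob {\<omega> \<in> space \<Omega>. reject (pd P) \<Delta> S M (means (single a (m f)) \<omega> a)}"
  shows "ex (\<lambda>\<omega>. testK P \<Delta> r S M a 0 tot \<omega> \<kappa>) =
      p 0 * ex (\<kappa> False (tot + 2 * m 0)) + (1 - p 0) * ex (\<kappa> True (tot + 2 * m 0))"
    and "ex (\<lambda>\<omega>. testK P \<Delta> r S M a (Suc f) tot \<omega> \<kappa>) =
      p (Suc f) * ex (\<kappa> False (tot + 2 * m (Suc f))) + (1 - p (Suc f)) * ex (\<lambda>\<omega>. testK P \<Delta> r S M a f (tot + 2 * m (Suc f)) \<omega> \<kappa>)"
proof -
  have "(\<lambda>x. testK P \<Delta> r S (fst x) a f t (snd x) (\<lambda>b t. (\<lambda>M. \<kappa> b t) (fst x))) \<in> borel_measurable (MEANS \<Otimes>\<^sub>M SRC)" for t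
    by (rule testK_measurable[OF S]) (rule measurable_compose[OF measurable_snd_SRC \<kappa>(1)])
  from borel_measurable_curried[where f="\<lambda>_. M" and g="\<lambda>\<omega>. \<omega>", OF this]
  have tm: "(\<lambda>\<omega>. testK P \<Delta> r S M a f t \<omega> \<kappa>) \<in> borel_measurable SRC" for t by (simp add: measurable_ident_sets)
  show "ex (\<lambda>\<omega>. testK P \<Delta> r S M a 0 tot \<omega> \<kappa>) =
      p 0 * ex (\<kappa> False (tot + 2 * m 0)) + (1 - p 0) * ex (\<kappa> True (tot + 2 * m 0))"
    unfolding testK.simps[of _ _ _ _ _ _ 0] Let_def nat.case m_def p_def
    by (rule ex_mean_branch[OF a measurable_reject_test[OF S] \<kappa> \<kappa>])
  show "ex (\<lambda>\<omega>. testK P \<Delta> r S M a (Suc f) tot \<omega> \<kappa>) =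
      p (Suc f) * ex (\<kappa> False (tot + 2 * m (Suc f))) + (1 - p (Suc f)) * ex (\<lambda>\<omega>. testK P \<Delta> r S M a f (tot + 2 * m (Suc f)) \<omega> \<kappa>)"
    unfolding testK.simps[of _ _ _ _ _ _ "Suc f"] Let_def nat.case m_def p_def
    by (rule ex_mean_branch[OF a measurable_reject_test[OF S] \<kappa> tm testK_le_1[OF \<kappa>(2)]])
qed

end

section \<open>Rejection probabilities of close and far arms\<close>

context sri
begin

definition rejp :: "nat set \<Rightarrow> (nat \<Rightarrow> vec \<times> vec) \<Rightarrow> nat \<Rightarrow> nat \<Rightarrow> real" where
  "rejp S M a s = \<Omega>.prob {\<omega> \<in> space \<Omega>. reject d \<Delta> S M (means (single a (n s)) \<omega> a)}"

lemma rejp_bounds: "0 \<le> rejp S M a s" "rejp S M a s \<le> 1" by (simp_all add: rejp_def)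

lemma noise_linear_sets: "{\<omega> \<in> space \<Omega>. c \<le> ip d u (noise a 0 m \<omega>) + ip d u' (noise a 1 m \<omega>)} \<in> sets \<Omega>"
  by (intro borel_measurable_le borel_measurable_const borel_measurable_add measurable_ip measurable_noise measurable_const) simp_all

lemma noise_product_sets: "{\<omega> \<in> space \<Omega>. c < sg * ip d (noise a 0 m \<omega>) (noise a 1 m \<omega>)} \<in> sets \<Omega>"
  by (intro borel_measurable_less borel_measurable_const borel_measurable_times measurable_ip measurable_noise)

lemma sqrt_D2_close: "D2 a b \<le> \<Delta>\<^sup>2 / 16 \<Longrightarrow> sqrt (D2 a b) \<le> \<Delta> / 4"
  using real_sqrt_le_mono[of "D2 a b" "\<Delta>\<^sup>2 / 16"] \<Delta> by (simp add: real_sqrt_divide)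

text \<open>In units of \<Delta>^2 / 64 the threshold is 32. The signal takes 4, its linear terms 3
  fresh and 1 stored, and the fresh product, the cross term and the stored product 8 each, which
  adds up to 32. Three events of probability at most exp(-2^s) / 24 remain.\<close>

lemma pass_close:
  assumes s: "1 \<le> s" "s \<le> r" and a: "a < N" and S: "finite S" "b \<in> S" and g: "good b (M b)" and D: "D2 a b \<le> \<Delta>\<^sup>2 / 16"
  shows "1 - rejp S M a s \<le> exp (- (2 ^ s)) / 8"
proof -
  let ?D = "vdiff (\<mu> a) (\<mu> b)" and ?h = "vdiff (fst (M b)) (\<mu> b)" and ?h' = "vdiff (snd (M b)) (\<mu> b)"
  let ?w0 = "noise a 0 (n s)" and ?w1 = "noise a 1 (n s)"
  let ?R = "{\<omega> \<in> space \<Omega>. reject d \<Delta> S M (means (single a (n s)) \<omega> a)}"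
  define E1 where "E1 = {\<omega> \<in> space \<Omega>. \<Delta>\<^sup>2 / 8 < 1 * ip d (?w0 \<omega>) (?w1 \<omega>)}"
  define E2 where "E2 = {\<omega> \<in> space \<Omega>. \<Delta>\<^sup>2 / 8 \<le> ip d (\<lambda>i. - 1 * ?h' i) (?w0 \<omega>) + ip d (\<lambda>i. - 1 * ?h i) (?w1 \<omega>)}"
  define E3 where "E3 = {\<omega> \<in> space \<Omega>. 3 * \<Delta>\<^sup>2 / 64 \<le> ip d ?D (?w0 \<omega>) + ip d ?D (?w1 \<omega>)}"
  have G: "\<bar>ip d ?h ?h'\<bar> \<le> \<Delta>\<^sup>2 / 8" "ip d ?h ?h \<le> Bnd" "ip d ?h' ?h' \<le> Bnd" "\<bar>ip d ?D ?h + ip d ?D ?h'\<bar> \<le> sqrt (D2 a b) * \<Delta> / 16"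
    using g a by (auto simp: good_def Let_def)
  have ne: "S \<noteq> {}" using S by auto
  have "(\<lambda>\<omega>. means (single a (n s)) \<omega> a) \<in> measurable \<Omega> (VEC \<Otimes>\<^sub>M VEC)"
    by (rule measurable_compose[OF measurable_id_SRC measurable_means_coord[OF measurable_ident_sets[OF refl]]])
  from measurable_compose[OF this measurable_reject_test[OF S(1) ne, of d \<Delta> M]]
  have Rm: "?R \<in> sets \<Omega>" by (simp add: pred_def)
  have m: "E1 \<in> sets \<Omega>" "E2 \<in> sets \<Omega>" "E3 \<in> sets \<Omega>"
    unfolding E1_def E2_def E3_def by (rule noise_product_sets noise_linear_sets)+
  have sub: "space \<Omega> - ?R \<subseteq> E1 \<union> E2 \<union> E3"
  proof
    fix \<omega> assume w: "\<omega> \<in> space \<Omega> - ?R"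
    then have st: "\<Delta>\<^sup>2 / 2 < stat d (means (single a (n s)) \<omega> a) (M b)"
      using S ne by (auto simp: reject_iff not_le)
    show "\<omega> \<in> E1 \<union> E2 \<union> E3"
    proof (rule ccontr)
      assume "\<omega> \<notin> E1 \<union> E2 \<union> E3"
      then have x: "ip d (?w0 \<omega>) (?w1 \<omega>) \<le> \<Delta>\<^sup>2 / 8"
        "ip d (\<lambda>i. - 1 * ?h' i) (?w0 \<omega>) + ip d (\<lambda>i. - 1 * ?h i) (?w1 \<omega>) < \<Delta>\<^sup>2 / 8"
        "ip d ?D (?w0 \<omega>) + ip d ?D (?w1 \<omega>) < 3 * \<Delta>\<^sup>2 / 64"
        using w unfolding E1_def E2_def E3_def by auto
      have "ip d (\<lambda>i. - 1 * u i) z = - ip d u z" for u z using ip_scale[of d "-1" u 1 z] by simp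
      note x' = x(1) x(2)[unfolded this] x(3)
      have "sqrt (D2 a b) * \<Delta> \<le> \<Delta> / 4 * \<Delta>" using sqrt_D2_close[OF D] \<Delta> by (intro mult_right_mono) auto
      then have "sqrt (D2 a b) * \<Delta> / 16 \<le> \<Delta>\<^sup>2 / 64" by (simp add: power2_eq_square mult.commute)
      then have "stat d (means (single a (n s)) \<omega> a) (M b) \<le> \<Delta>\<^sup>2 / 2"
        unfolding stat_expand[where b=b] using x' G(1,4) D by linarith
      then show False using st by simp
    qed
  qed
  note v = var_bounds[OF order_refl[of "n s"]]
  have p3: "\<Omega>.prob E3 \<le> exp (- lev s)" unfolding E3_def
  proof (rule linear_tail_lev[OF order_refl a])
    let ?v = "\<sigma>\<^sup>2 / real (n s)"
    show "0 < \<Delta>\<^sup>2 / 8 * ?v" by (intro mult_pos_pos v(1)) (use \<Delta> in auto)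
    have "?v * (2 * D2 a b) \<le> ?v * (\<Delta>\<^sup>2 / 8)" using D v(1) by (intro mult_left_mono) auto
    then show "?v * (ip d ?D ?D + ip d ?D ?D) \<le> \<Delta>\<^sup>2 / 8 * ?v" unfolding D2_def by (simp add: mult.commute)
    have "\<Delta>\<^sup>2 * (1024 * (lev s * ?v)) \<le> \<Delta>\<^sup>2 * \<Delta>\<^sup>2" using v(2) by (intro mult_left_mono) auto
    moreover have "2 * lev s * (\<Delta>\<^sup>2 / 8 * ?v) = \<Delta>\<^sup>2 * (1024 * (lev s * ?v)) / 4096" by simp
    moreover have "(3 * \<Delta>\<^sup>2 / 64)\<^sup>2 = 9 * (\<Delta>\<^sup>2 * \<Delta>\<^sup>2) / 4096" by (simp add: power2_eq_square)
    moreover have "0 \<le> \<Delta>\<^sup>2 * \<Delta>\<^sup>2" by simp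
    moreover have "x / 4096 \<le> 9 * y / 4096" if "x \<le> y" "0 \<le> y" for x y :: real using that by linarith
    ultimately show "2 * lev s * (\<Delta>\<^sup>2 / 8 * ?v) \<le> (3 * \<Delta>\<^sup>2 / 64)\<^sup>2" by (simp only:)
  qed simp
  have p1: "\<Omega>.prob E1 \<le> exp (- (2 ^ s)) / 24" unfolding E1_def by (rule product_tail[OF order_refl a]) simp
  have p2: "\<Omega>.prob E2 \<le> exp (- lev s)" unfolding E2_def by (rule cross_tail[OF s a G(2,3)]) simp
  have "1 - rejp S M a s = \<Omega>.prob (space \<Omega> - ?R)" using \<Omega>.prob_compl[OF Rm] by (simp add: rejp_def)
  also have "\<dots> \<le> \<Omega>.prob (E1 \<union> E2 \<union> E3)" using sub m by (intro \<Omega>.finite_measure_mono) auto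
  also have "\<dots> \<le> \<Omega>.prob E1 + \<Omega>.prob E2 + \<Omega>.prob E3"
    using measure_Un_le[of "E1 \<union> E2" \<Omega> E3] measure_Un_le[of E1 \<Omega> E2] m by auto
  also have "\<dots> \<le> exp (- (2 ^ s)) / 8" using p1 p2 p3 exp_lev_le[of s] by linarith
  finally show ?thesis .
qed

text \<open>The two linear terms take D2/16 each and the other three \<Delta>^2/8 each, so the
  statistic stays above 7/8 D2 - 3/8 \<Delta>^2 >= \<Delta>^2 / 2. The union over at most K stored
  arms is paid by the log(12K) in \<open>lev s\<close>: 1/24 + 1/6 <= 1/4.\<close>

lemma reject_far:
  assumes s: "1 \<le> s" "s \<le> r" and a: "a < N" and S: "finite S" "S \<noteq> {}" "card S \<le> K"
    and g: "\<And>b. b \<in> S \<Longrightarrow> good b (M b)" and D: "\<And>b. b \<in> S \<Longrightarrow> \<Delta>\<^sup>2 \<le> D2 a b"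
  shows "rejp S M a s \<le> exp (- (2 ^ s)) / 4"
proof -
  let ?D = "\<lambda>b. vdiff (\<mu> a) (\<mu> b)" and ?h = "\<lambda>b. vdiff (fst (M b)) (\<mu> b)" and ?h' = "\<lambda>b. vdiff (snd (M b)) (\<mu> b)"
  let ?w0 = "noise a 0 (n s)" and ?w1 = "noise a 1 (n s)"
  let ?R = "{\<omega> \<in> space \<Omega>. reject d \<Delta> S M (means (single a (n s)) \<omega> a)}"
  define E1 where "E1 = {\<omega> \<in> space \<Omega>. \<Delta>\<^sup>2 / 8 < - 1 * ip d (?w0 \<omega>) (?w1 \<omega>)}"
  define E2 where "E2 b = {\<omega> \<in> space \<Omega>. \<Delta>\<^sup>2 / 8 \<le> ip d (\<lambda>i. 1 * ?h' b i) (?w0 \<omega>) + ip d (\<lambda>i. 1 * ?h b i) (?w1 \<omega>)}" for b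
  define E3 where "E3 b = {\<omega> \<in> space \<Omega>. D2 a b / 16 \<le> ip d (\<lambda>i. - 1 * ?D b i) (?w0 \<omega>) + ip d (\<lambda>i. - 1 * ?D b i) (?w1 \<omega>)}" for b
  have G: "\<bar>ip d (?h b) (?h' b)\<bar> \<le> \<Delta>\<^sup>2 / 8" "ip d (?h b) (?h b) \<le> Bnd" "ip d (?h' b) (?h' b) \<le> Bnd"
    "\<bar>ip d (?D b) (?h b) + ip d (?D b) (?h' b)\<bar> \<le> sqrt (D2 a b) * \<Delta> / 16" if "b \<in> S" for b
    using g[OF that] a by (auto simp: good_def Let_def)
  have m: "E1 \<in> sets \<Omega>" "E2 b \<in> sets \<Omega>" "E3 b \<in> sets \<Omega>" for b
    unfolding E1_def E2_def E3_def by (rule noise_product_sets noise_linear_sets)+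
  have sub: "?R \<subseteq> E1 \<union> (\<Union>b\<in>S. E2 b \<union> E3 b)"
  proof
    fix \<omega> assume w: "\<omega> \<in> ?R"
    then obtain b where b: "b \<in> S" and st: "stat d (means (single a (n s)) \<omega> a) (M b) \<le> \<Delta>\<^sup>2 / 2"
      using S by (auto simp: reject_iff)
    show "\<omega> \<in> E1 \<union> (\<Union>b\<in>S. E2 b \<union> E3 b)"
    proof (rule ccontr)
      assume "\<omega> \<notin> E1 \<union> (\<Union>b\<in>S. E2 b \<union> E3 b)"
      then have "\<omega> \<notin> E1" "\<omega> \<notin> E2 b" "\<omega> \<notin> E3 b" using b by auto
      then have x: "- 1 * ip d (?w0 \<omega>) (?w1 \<omega>) \<le> \<Delta>\<^sup>2 / 8"
        "ip d (\<lambda>i. 1 * ?h' b i) (?w0 \<omega>) + ip d (\<lambda>i. 1 * ?h b i) (?w1 \<omega>) < \<Delta>\<^sup>2 / 8"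
        "ip d (\<lambda>i. - 1 * ?D b i) (?w0 \<omega>) + ip d (\<lambda>i. - 1 * ?D b i) (?w1 \<omega>) < D2 a b / 16"
        using w unfolding E1_def E2_def E3_def by (auto simp: not_less not_le)
      have "ip d (\<lambda>i. - 1 * u i) z = - ip d u z" "ip d (\<lambda>i. 1 * u i) z = ip d u z" for u z using ip_scale[of d "-1" u 1 z] by simp_all
      note x' = x[unfolded this]
      have "\<Delta> \<le> sqrt (D2 a b)" using real_le_rsqrt[OF D[OF b]] .
      then have "sqrt (D2 a b) * \<Delta> \<le> sqrt (D2 a b) * sqrt (D2 a b)" by (intro mult_left_mono) auto
      then have "sqrt (D2 a b) * \<Delta> / 16 \<le> D2 a b / 16" by simp
      then have "\<Delta>\<^sup>2 / 2 < stat d (means (single a (n s)) \<omega> a) (M b)"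
        unfolding stat_expand[where b=b] using x' G(1,4)[OF b] D[OF b] by linarith
      then show False using st by simp
    qed
  qed
  note v = var_bounds[OF order_refl[of "n s"]]
  have p3: "\<Omega>.prob (E3 b) \<le> exp (- lev s)" if b: "b \<in> S" for b unfolding E3_def
  proof (rule linear_tail_lev[OF order_refl a])
    let ?v = "\<sigma>\<^sup>2 / real (n s)"
    have D0: "0 < D2 a b" using D[OF b] \<Delta> zero_less_power[of \<Delta> 2] by linarith
    show "0 < 2 * (D2 a b * ?v)" by (intro mult_pos_pos D0 v(1)) simp
    have "ip d (\<lambda>i. - 1 * ?D b i) (\<lambda>i. - 1 * ?D b i) = D2 a b" unfolding ip_scale D2_def by simp
    then show "?v * (ip d (\<lambda>i. - 1 * ?D b i) (\<lambda>i. - 1 * ?D b i) + ip d (\<lambda>i. - 1 * ?D b i) (\<lambda>i. - 1 * ?D b i)) \<le> 2 * (D2 a b * ?v)"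
      by (simp only:) (simp add: algebra_simps)
    have "1024 * (lev s * ?v) \<le> D2 a b" using v(2) D[OF b] by linarith
    then have "D2 a b * (1024 * (lev s * ?v)) \<le> D2 a b * D2 a b" using D0 by (intro mult_left_mono) auto
    moreover have "2 * lev s * (2 * (D2 a b * ?v)) = D2 a b * (1024 * (lev s * ?v)) / 256" by simp
    moreover have "(D2 a b / 16)\<^sup>2 = D2 a b * D2 a b / 256" by (simp add: power2_eq_square)
    ultimately show "2 * lev s * (2 * (D2 a b * ?v)) \<le> (D2 a b / 16)\<^sup>2" by (simp only: divide_right_mono zero_le_numeral)
  qed simp
  have p1: "\<Omega>.prob E1 \<le> exp (- (2 ^ s)) / 24" unfolding E1_def by (rule product_tail[OF order_refl a]) simp
  have p2: "\<Omega>.prob (E2 b) \<le> exp (- lev s)" if "b \<in> S" for b unfolding E2_def by (rule cross_tail[OF s a G(2,3)[OF that]]) simp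
  have UN: "(\<Union>b\<in>S. E2 b \<union> E3 b) \<in> sets \<Omega>" using S m by (intro sets.finite_UN) auto
  have "\<Omega>.prob (\<Union>b\<in>S. E2 b \<union> E3 b) \<le> (\<Sum>b\<in>S. \<Omega>.prob (E2 b \<union> E3 b))" using S m by (intro measure_UNION_le) auto
  also have "\<dots> \<le> (\<Sum>b\<in>S. 2 * exp (- lev s))"
  proof (rule sum_mono)
    fix b assume "b \<in> S"
    then show "\<Omega>.prob (E2 b \<union> E3 b) \<le> 2 * exp (- lev s)"
      using measure_Un_le[OF m(2,3), of b b] p2[of b] p3[of b] by linarith
  qed
  also have "\<dots> \<le> real K * (2 * exp (- lev s))" using S by (simp add: mult_right_mono)
  also have "\<dots> = exp (- (2 ^ s)) / 6" using K_pos by (simp add: exp_lev)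
  finally have pU: "\<Omega>.prob (\<Union>b\<in>S. E2 b \<union> E3 b) \<le> exp (- (2 ^ s)) / 6" .
  have "rejp S M a s \<le> \<Omega>.prob (E1 \<union> (\<Union>b\<in>S. E2 b \<union> E3 b))"
    unfolding rejp_def using sub m UN by (intro \<Omega>.finite_measure_mono) auto
  also have "\<dots> \<le> \<Omega>.prob E1 + \<Omega>.prob (\<Union>b\<in>S. E2 b \<union> E3 b)" using m UN by (intro measure_Un_le) auto
  also have "\<dots> \<le> exp (- (2 ^ s)) / 24 + exp (- (2 ^ s)) / 6" using p1 pU by linarith
  also have "\<dots> \<le> exp (- (2 ^ s)) / 4" by simp
  finally show ?thesis .
qed

end

section \<open>The loop of SRI\<close>

lemma exp_neg_le_half_power: "real k \<le> x \<Longrightarrow> exp (- x) \<le> (1/2) ^ k"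
proof -
  assume "real k \<le> x"
  then have "exp (- x) \<le> exp (real k * (-1))" by simp
  also have "\<dots> = exp (-1) ^ k" by (rule exp_of_nat_mult)
  also have "\<dots> \<le> (1/2) ^ k"
  proof (rule power_mono)
    have "(2::real) \<le> exp 1" using exp_ge_add_one_self[of "1::real"] by simp
    then show "exp (-1) \<le> (1/2::real)" by (simp add: exp_minus field_simps)
  qed simp
  finally show ?thesis .
qed

lemma sum_half_powers: "(\<Sum>j\<in>{m..r}. (1/2::real) ^ j) \<le> 2 * (1/2) ^ m"
proof -
  \<comment> \<open>With the last power added once more, the left side does not change from r to r +
    1.\<close>
  have "(\<Sum>j\<in>{m..r}. (1/2::real) ^ j) + (1/2) ^ r \<le> 2 * (1/2) ^ m" if "m \<le> r"
    using that
  proof (induction r rule: dec_induct)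
    case (step r)
    then show ?case by simp
  qed simp
  then show ?thesis by (cases "m \<le> r") (auto intro: order_trans[rotated])
qed

lemma le_power2_quarter: "2 \<le> j \<Longrightarrow> real (j - 1) \<le> 2 ^ j / 4" "2 \<le> j \<Longrightarrow> real (j + 1) \<le> 2 ^ j - 2 ^ j / 4" "1 \<le> j \<Longrightarrow> real (j + 1) \<le> 2 ^ j"
proof -
  have "4 * (real j - 1) \<le> 2 ^ j \<and> real j + 1 \<le> 3 / 4 * 2 ^ j" if "2 \<le> j"
    using that by (induction j rule: dec_induct) auto
  then show "2 \<le> j \<Longrightarrow> real (j - 1) \<le> 2 ^ j / 4" "2 \<le> j \<Longrightarrow> real (j + 1) \<le> 2 ^ j - 2 ^ j / 4" by (auto simp: of_nat_diff)
  show "real (j + 1) \<le> 2 ^ j" if "1 \<le> j" using that by (induction j rule: dec_induct) auto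
qed

context clustering
begin

lemma finite_gaps: "finite {vnorm d (vdiff (\<mu> a) (\<mu> b)) | a b. a < N \<and> b < N \<and> \<not> veq d (\<mu> a) (\<mu> b)}"
  by (rule finite_subset[of _ "(\<lambda>(a,b). vnorm d (vdiff (\<mu> a) (\<mu> b))) ` ({..<N} \<times> {..<N})"]) auto

lemma Gstar_disjoint: "pairwise disjnt (Gstar d N \<mu>)"
  by (auto simp: pairwise_def disjnt_def Gstar_def veq_def)

lemma Gstar_finite: "finite (Gstar d N \<mu>)" "G \<in> Gstar d N \<mu> \<Longrightarrow> finite G"
  by (auto simp: Gstar_def)

end

context sri
begin

lemma ln8K: "2 \<le> ln (8 * real K / \<delta>)"
proof -
  have e: "exp (2::real) \<le> 16"
  proof -
    have "exp (2::real) = exp 1 * exp 1" by (simp add: exp_add[symmetric])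
    also have "\<dots> \<le> 3 * 3" using exp_le by (intro mult_mono) auto
    finally show ?thesis by simp
  qed
  have "16 * \<delta> \<le> 8 * real K" using \<delta> K_ge_2 by simp
  then have "16 \<le> 8 * real K / \<delta>" using \<delta> by (simp add: field_simps)
  then have "exp 2 \<le> 8 * real K / \<delta>" using e by linarith
  then show ?thesis using \<delta> K_pos by (subst ln_ge_iff) auto
qed

lemma U_ge: "8 / \<theta> * ln (8 * real K / \<delta>) \<le> real U"
  unfolding sri_U_def using real_nat_ceiling_ge[of "8 / \<theta> * ln (8 * real K / \<delta>)"] by simp

lemma U_ge_K: "16 * real K \<le> real U" and U_ge_ln: "ln (8 * real K / \<delta>) \<le> real U"
proof -
  have t: "real K \<le> 1 / \<theta>" using \<theta> K_pos by (simp add: field_simps)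
  have "8 * real K * 2 \<le> 8 / \<theta> * ln (8 * real K / \<delta>)"
    using t ln8K \<theta> by (intro mult_mono) auto
  then show "16 * real K \<le> real U" using U_ge by linarith
  have "1 \<le> 8 / \<theta>" using t K_ge_2 by simp
  then have "1 * ln (8 * real K / \<delta>) \<le> 8 / \<theta> * ln (8 * real K / \<delta>)" using ln8K by (intro mult_right_mono) auto
  then show "ln (8 * real K / \<delta>) \<le> real U" using U_ge by linarith
qed

lemma U_pos: "0 < real U" using U_ge_K K_pos by linarith

lemma ln4U: "1 < ln (4 * real U / \<delta>)"
proof -
  have "exp (1::real) \<le> 3" by (rule exp_le)
  also have "3 < 4 * real U / \<delta>" using U_ge_K K_ge_2 \<delta> by (simp add: field_simps)
  finally have "ln (exp 1) < ln (4 * real U / \<delta>)" using U_pos \<delta> by (subst ln_less_cancel_iff) auto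
  then show ?thesis by simp
qed

lemma pow_r: "ln (4 * real U / \<delta>) \<le> 2 ^ r"
proof -
  have "log 2 (ln (4 * real U / \<delta>)) \<le> real r"
    unfolding sri_r_def by (rule real_nat_ceiling_ge)
  then have "2 powr log 2 (ln (4 * real U / \<delta>)) \<le> 2 powr real r" by simp
  then show ?thesis using ln4U by (simp add: powr_realpow)
qed

text \<open>The purpose of r: an error of this size at the last level can be summed over all U
  draws.\<close>

lemma exp_r: "exp (- (2 ^ r)) \<le> \<delta> / (4 * real U)"
proof -
  have "exp (- (2 ^ r)) \<le> exp (- ln (4 * real U / \<delta>))" using pow_r by simp
  also have "\<dots> = \<delta> / (4 * real U)" using U_pos \<delta> by (simp add: exp_minus)
  finally show ?thesis .
qed

lemma r_pos: "1 \<le> r"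
proof -
  have "0 < log 2 (ln (4 * real U / \<delta>))" using ln4U by simp
  then show ?thesis unfolding sri_r_def by (simp add: Suc_le_eq)
qed

lemma s0_bounds: "1 \<le> s0" "s0 \<le> r"
proof -
  let ?c = "c1 cHW * \<sigma>\<^sup>2 / \<Delta>\<^sup>2"
  have c: "0 < ?c" using c1_pos sigma_pos \<Delta> by simp
  \<comment> \<open>The sample sizes are unbounded in s, so some level has at least two samples and
    the \<open>LEAST\<close> in \<open>sri_s0\<close> is attained.\<close>
  obtain s where s: "2 / ?c < 2 ^ s" using real_arch_pow[of 2 "2 / ?c"] by auto
  have "2 / ?c < lev (Suc s)"
  proof -
    have "0 < (2::real) ^ s" by simp
    then show ?thesis using s ln_12K_pos unfolding lev_def power_Suc by linarith
  qed
  then have "2 < ?c * lev (Suc s)" unfolding pos_divide_less_eq[OF c] by (simp only: mult.commute)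
  then have "2 \<le> n (Suc s)" using n_ge1[of "Suc s"] by linarith
  then have "1 \<le> Suc s \<and> 2 \<le> n (Suc s)" by simp
  from LeastI[of "\<lambda>s. 1 \<le> s \<and> 2 \<le> n s", OF this] show "1 \<le> s0" using r_pos by (simp add: sri_s0_def)
  show "s0 \<le> r" by (simp add: sri_s0_def)
qed

definition easy :: bool where "easy \<longleftrightarrow> \<Delta> \<le> Delta_star d N \<mu> \<and> \<theta> \<le> theta_star d N \<mu>"

lemma easy_far:
  assumes easy "a < N" "b < N" "\<not> veq d (\<mu> a) (\<mu> b)"
  shows "\<Delta>\<^sup>2 \<le> D2 a b"
proof -
  have "Delta_star d N \<mu> \<le> vnorm d (vdiff (\<mu> a) (\<mu> b))"
    unfolding Delta_star_def using assms by (intro Min_le[OF finite_gaps]) blast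
  then have "\<Delta> \<le> vnorm d (vdiff (\<mu> a) (\<mu> b))" using assms(1) by (simp add: easy_def)
  then have "\<Delta>\<^sup>2 \<le> (vnorm d (vdiff (\<mu> a) (\<mu> b)))\<^sup>2" using \<Delta> by (intro power_mono) auto
  then show ?thesis by (simp add: D2_def)
qed

text \<open>Arms close to a stored one, in the sense of \<open>pass_close\<close>, are rejected
  whether or not the guesses are valid; so this is the invariant available for every guess. It
  places the arms of S in different groups.\<close>

definition separated :: "nat set \<Rightarrow> bool" where
  "separated S \<longleftrightarrow> S \<subseteq> {..<N} \<and> (\<forall>a\<in>S. \<forall>b\<in>S. a \<noteq> b \<longrightarrow> \<Delta>\<^sup>2 / 16 < D2 a b)"

lemma easy_group: assumes easy "G \<in> Gstar d N \<mu>" shows "\<theta> * real N \<le> real (card G)"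
proof -
  have "Min (card ` Gstar d N \<mu>) \<le> card G" using assms Gstar_finite by (intro Min_le) auto
  then have "theta_star d N \<mu> * real N \<le> real (card G)" using N_ge_2 by (simp add: theta_star_def)
  moreover have "\<theta> * real N \<le> theta_star d N \<mu> * real N" using assms(1) by (intro mult_right_mono) (auto simp: easy_def)
  ultimately show ?thesis by linarith
qed

definition far :: "nat set \<Rightarrow> nat set" where
  "far S = {a. a < N \<and> (\<forall>b\<in>S. \<not> veq d (\<mu> a) (\<mu> b))}"

text \<open>A separated set meets as many groups as it has elements, and under valid guesses each of
  the other groups contributes at least \<theta> N arms.\<close>

lemma card_far:
  assumes e: easy and S: "separated S"
  shows "(real K - real (card S)) * (\<theta> * real N) \<le> real (card (far S))"
proof -
  let ?cl = "\<lambda>a. {b. b < N \<and> veq d (\<mu> b) (\<mu> a)}"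
  have finS: "finite S" using S by (auto simp: separated_def intro: finite_subset)
  have sub: "?cl ` S \<subseteq> Gstar d N \<mu>" using S by (auto simp: Gstar_def separated_def)
  have inj: "inj_on ?cl S"
  proof (rule inj_onI, rule ccontr)
    fix a b assume ab: "a \<in> S" "b \<in> S" "?cl a = ?cl b" "a \<noteq> b"
    then have "a \<in> ?cl b" using S by (auto simp: separated_def veq_def)
    then have "D2 a b = 0" by (simp add: D2_eq_0_iff)
    then show False using S ab \<Delta> by (force simp: separated_def)
  qed
  let ?R = "Gstar d N \<mu> - ?cl ` S"
  have cR: "card ?R = K - card S" using sub inj Gstar_finite finS by (simp add: card_Diff_subset card_Gstar card_image)
  have "card S \<le> K" using card_mono[OF Gstar_finite(1) sub] inj by (simp add: card_image card_Gstar)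
  then have "(real K - real (card S)) * (\<theta> * real N) = (\<Sum>G\<in>?R. \<theta> * real N)" by (simp add: cR of_nat_diff)
  also have "\<dots> \<le> (\<Sum>G\<in>?R. real (card G))" using easy_group[OF e] by (intro sum_mono) auto
  also have "\<dots> = real (card (\<Union>?R))"
    using Gstar_disjoint Gstar_finite by (subst card_Union_disjoint) (auto intro: pairwise_subset)
  also have "\<dots> \<le> real (card (far S))"
  proof -
    have "\<Union>?R \<subseteq> far S"
    proof
      fix a assume "a \<in> \<Union>?R"
      then obtain G where G: "G \<in> Gstar d N \<mu>" "G \<notin> ?cl ` S" "a \<in> G" by auto
      then obtain c where c: "c < N" "G = ?cl c" by (auto simp: Gstar_def)
      have "\<not> veq d (\<mu> a) (\<mu> b)" if "b \<in> S" for b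
      proof
        assume "veq d (\<mu> a) (\<mu> b)"
        then have "?cl c = ?cl b" using G(3) c by (auto simp: veq_def)
        then show False using G(2) c that by auto
      qed
      then show "a \<in> far S" using G(3) c by (auto simp: far_def)
    qed
    then show ?thesis by (simp add: card_mono far_def)
  qed
  finally show ?thesis .
qed

definition Sg :: real where "Sg = (\<Sum>s\<in>{s0+1..r}. real (n s))"
definition Sw :: real where "Sw = (\<Sum>s\<in>{s0+1..r}. real (n s) / 2 powr (real s - 4))"

lemma Tmax_eq: "Tmax = 2 * real K * (real nmax + Sg) + 2 * real U * real (n s0) + 2 * real U * Sw"
  by (simp add: sri_Tmax_def Let_def Sg_def Sw_def)

lemma Sg_nonneg: "0 \<le> Sg" and Sw_nonneg: "0 \<le> Sw"
  by (simp_all add: Sg_def Sw_def sum_nonneg)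

lemma n_geometric: "real (n (Suc s0 + k)) \<le> 2 ^ k * real (n (Suc s0))"
proof (induction k)
  case (Suc k)
  have "real (n (Suc s0 + Suc k)) \<le> 2 * real (n (Suc s0 + k))" using n_double[of "Suc s0 + k"] by simp
  then show ?case using Suc by simp
qed simp

lemma sum_n_geometric: "(\<Sum>i\<in>{Suc s0..s0+k}. real (n i)) \<le> 2 ^ k * real (n (Suc s0))"
proof -
  have "(\<Sum>i\<in>{Suc s0..s0+k}. real (n i)) \<le> (2 ^ k - 1) * real (n (Suc s0))"
  proof (induction k)
    case (Suc k)
    have "(\<Sum>i\<in>{Suc s0..s0+Suc k}. real (n i)) = (\<Sum>i\<in>{Suc s0..s0+k}. real (n i)) + real (n (Suc s0 + k))" by simp
    also have "\<dots> \<le> (2 ^ k - 1) * real (n (Suc s0)) + 2 ^ k * real (n (Suc s0))" using Suc n_geometric[of k] by linarith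
    also have "\<dots> = (2 ^ Suc k - 1) * real (n (Suc s0))" by (simp add: algebra_simps)
    finally show ?case .
  qed simp
  also have "\<dots> \<le> 2 ^ k * real (n (Suc s0))" by (intro mult_right_mono) auto
  finally show ?thesis .
qed

text \<open>The rate \<eta> of the exponential moment has to be large enough for the slack in T_max
  to give exp(-2U), and small enough that the moment of the samples up to level j is at most exp(2^j
  / 4), which the test errors beat.\<close>

lemma eta_exists: "\<exists>\<eta>\<ge>0. 2 * real U \<le> \<eta> * (real nmax + real U * Sw) \<and>
    (\<forall>j\<in>{Suc s0..r}. \<eta> * (\<Sum>i\<in>{Suc s0..j}. real (n i)) \<le> 2 ^ j / 4)"
proof (cases "s0 = r")
  case True
  \<comment> \<open>No level lies above \<open>s0\<close>, so the second condition is void and 2U is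
    large enough because \<open>nmax\<close> >= 1.\<close>
  have "2 * real U * 1 \<le> 2 * real U * (real nmax + real U * Sw)"
    using nmax_pos Sw_nonneg U_pos by (intro mult_left_mono) (auto intro: add_increasing2)
  then show ?thesis using True by (intro exI[of _ "2 * real U"]) auto
next
  case False
  then have lt: "Suc s0 \<le> r" using s0_bounds by simp
  have np: "0 < real (n (Suc s0))" using n_pos by simp
  \<comment> \<open>Doubling bounds the samples of k levels above \<open>s0\<close> by 2^k n(s0+1),
    which gives 2^j / 4. The weight 2^(s-4) in T_max makes Sw at least 8 n(s0+1) / 2^s0, exactly
    what the first condition asks for.\<close>
  let ?\<eta> = "2 ^ s0 / (4 * real (n (Suc s0)))"
  have "real (n (Suc s0)) / 2 powr (real (Suc s0) - 4) \<le> Sw"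
    unfolding Sw_def using lt by (intro member_le_sum[of "Suc s0"]) auto
  moreover have e: "2 powr (real (Suc s0) - 4) = 2 ^ s0 / 8"
    by (simp add: powr_diff powr_add powr_realpow)
  ultimately have "8 * real (n (Suc s0)) / 2 ^ s0 \<le> Sw" unfolding e by (simp add: mult.commute)
  then have "?\<eta> * (real U * (8 * real (n (Suc s0)) / 2 ^ s0)) \<le> ?\<eta> * (real nmax + real U * Sw)"
  proof (intro mult_left_mono)
    assume "8 * real (n (Suc s0)) / 2 ^ s0 \<le> Sw"
    from mult_left_mono[OF this of_nat_0_le_iff]
    show "real U * (8 * real (n (Suc s0)) / 2 ^ s0) \<le> real nmax + real U * Sw" by (rule add_increasing[OF of_nat_0_le_iff])
  qed simp
  then have 1: "2 * real U \<le> ?\<eta> * (real nmax + real U * Sw)" using np by simp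
  have 2: "?\<eta> * (\<Sum>i\<in>{Suc s0..j}. real (n i)) \<le> 2 ^ j / 4" if "j \<in> {Suc s0..r}" for j
  proof -
    obtain k where k: "j = s0 + k" using \<open>j \<in> _\<close> by (metis atLeastAtMost_iff le_add_diff_inverse Suc_leD)
    have "?\<eta> * (\<Sum>i\<in>{Suc s0..j}. real (n i)) \<le> ?\<eta> * (2 ^ k * real (n (Suc s0)))"
      unfolding k using sum_n_geometric[of k] by (intro mult_left_mono) auto
    also have "\<dots> = 2 ^ j / 4" using np by (simp add: k power_add)
    finally show ?thesis .
  qed
  show ?thesis using 1 2 by (intro exI[of _ ?\<eta>]) auto
qed

definition Ej :: "real \<Rightarrow> nat \<Rightarrow> real" where "Ej \<eta> j = exp (\<eta> * (\<Sum>i\<in>{Suc s0..j}. real (n i)))"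

text \<open>A close arm reaches level j only by passing level j - 1, with probability at most
  exp(-2^(j-1)) / 8, while the moment has grown to at most exp(2^j / 4). The expected factor per
  draw is therefore at most 9/8.\<close>

lemma close_sum:
  assumes "\<forall>j\<in>{Suc s0..r}. \<eta> * (\<Sum>i\<in>{Suc s0..j}. real (n i)) \<le> 2 ^ j / 4"
  shows "Ej \<eta> s0 + (\<Sum>j\<in>{Suc s0..r}. exp (- (2 ^ (j - 1))) / 8 * Ej \<eta> j) \<le> 9/8"
proof -
  have "(\<Sum>j\<in>{Suc s0..r}. exp (- (2 ^ (j - 1))) / 8 * Ej \<eta> j) \<le> (\<Sum>j\<in>{Suc s0..r}. 1/4 * (1/2) ^ j)"
  proof (rule sum_mono)
    fix j assume j: "j \<in> {Suc s0..r}"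
    then have j2: "2 \<le> j" using s0_bounds by auto
    then obtain i where i: "j = Suc i" by (cases j) auto
    have "exp (- (2 ^ (j - 1))) * Ej \<eta> j \<le> exp (- (2 ^ (j - 1))) * exp (2 ^ j / 4)"
      unfolding Ej_def using assms j by (intro mult_left_mono) auto
    also have "\<dots> = exp (- (2 ^ j / 4))" by (simp add: exp_add[symmetric] i)
    also have "\<dots> \<le> (1/2) ^ (j - 1)" by (rule exp_neg_le_half_power[OF le_power2_quarter(1)[OF j2]])
    also have "\<dots> = 2 * (1/2) ^ j" by (simp add: i)
    finally show "exp (- (2 ^ (j - 1))) / 8 * Ej \<eta> j \<le> 1/4 * (1/2) ^ j" by simp
  qed
  also have "\<dots> = 1/4 * (\<Sum>j\<in>{Suc s0..r}. (1/2) ^ j)" by (simp add: sum_distrib_left)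
  also have "\<dots> \<le> 1/4 * (2 * (1/2) ^ Suc s0)" by (intro mult_left_mono sum_half_powers) simp
  also have "\<dots> \<le> 1/4 * (2 * (1/2) ^ 2)" using s0_bounds by (intro mult_left_mono power_decreasing) auto
  finally have "(\<Sum>j\<in>{Suc s0..r}. exp (- (2 ^ (j - 1))) / 8 * Ej \<eta> j) \<le> 1/8" by (simp add: power2_eq_square)
  then show ?thesis by (simp add: Ej_def)
qed

text \<open>For a far arm the danger is rejection at level j, of probability at most exp(-2^j) / 4;
  even weighted by the moment these sum to 1/8.\<close>

lemma far_sum:
  assumes "\<forall>j\<in>{Suc s0..r}. \<eta> * (\<Sum>i\<in>{Suc s0..j}. real (n i)) \<le> 2 ^ j / 4" and \<eta>: "0 \<le> \<eta>"
  shows "(\<Sum>j\<in>{s0..r}. exp (- (2 ^ j)) / 4 * Ej \<eta> j) \<le> 1/8" "(\<Sum>j\<in>{s0..r}. exp (- (2 ^ j)) / 4 :: real) \<le> 1/8"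
proof -
  have "(\<Sum>j\<in>{s0..r}. exp (- (2 ^ j)) / 4 * Ej \<eta> j) \<le> (\<Sum>j\<in>{s0..r}. 1/8 * (1/2) ^ j)"
  proof (rule sum_mono)
    fix j assume j: "j \<in> {s0..r}"
    have "exp (- (2 ^ j)) * Ej \<eta> j \<le> (1/2) ^ (j + 1)"
    proof (cases "j = s0")
      case True
      then show ?thesis using exp_neg_le_half_power[OF le_power2_quarter(3)[of j]] s0_bounds by (simp add: Ej_def)
    next
      case False
      then have j': "j \<in> {Suc s0..r}" "2 \<le> j" using j s0_bounds by auto
      have "exp (- (2 ^ j)) * Ej \<eta> j \<le> exp (- (2 ^ j)) * exp (2 ^ j / 4)"
        unfolding Ej_def using assms j' by (intro mult_left_mono) auto
      also have "\<dots> = exp (- (2 ^ j - 2 ^ j / 4))" by (simp add: exp_add[symmetric])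
      also have "\<dots> \<le> (1/2) ^ (j + 1)" by (rule exp_neg_le_half_power[OF le_power2_quarter(2)[OF j'(2)]])
      finally show ?thesis .
    qed
    then show "exp (- (2 ^ j)) / 4 * Ej \<eta> j \<le> 1/8 * (1/2) ^ j" by simp
  qed
  also have "\<dots> = 1/8 * (\<Sum>j\<in>{s0..r}. (1/2) ^ j)" by (simp add: sum_distrib_left)
  also have "\<dots> \<le> 1/8 * (2 * (1/2) ^ s0)" by (intro mult_left_mono sum_half_powers) simp
  also have "\<dots> \<le> 1/8 * (2 * (1/2) ^ 1)" using s0_bounds by (intro mult_left_mono power_decreasing) auto
  finally show 1: "(\<Sum>j\<in>{s0..r}. exp (- (2 ^ j)) / 4 * Ej \<eta> j) \<le> 1/8" by simp
  have "(\<Sum>j\<in>{s0..r}. exp (- (2 ^ j)) / 4 * 1) \<le> (\<Sum>j\<in>{s0..r}. exp (- (2 ^ j)) / 4 * Ej \<eta> j)"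
    using \<eta> by (intro sum_mono mult_left_mono) (auto simp: Ej_def sum_nonneg)
  then show "(\<Sum>j\<in>{s0..r}. exp (- (2 ^ j)) / 4 :: real) \<le> 1/8" using 1 by simp
qed

section \<open>Expected value of one test\<close>

context
  fixes \<kappa> :: "bool \<Rightarrow> nat \<Rightarrow> src \<Rightarrow> ennreal" and S :: "nat set" and M :: "nat \<Rightarrow> vec \<times> vec"
    and a tot :: nat and A Z :: real and E :: "nat \<Rightarrow> real"
  assumes \<kappa>: "\<And>b t. \<kappa> b t \<in> borel_measurable SRC" "\<And>b t \<omega>. \<kappa> b t \<omega> \<le> 1"
    and S: "finite S" "S \<noteq> {}" and a: "a < N" and A0: "0 \<le> A" and Z0: "0 \<le> Z" and E0: "\<And>j. 0 \<le> E j"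
    and rej: "\<And>j. s0 \<le> j \<Longrightarrow> j \<le> r \<Longrightarrow> ex (\<kappa> False (tot + 2 * (\<Sum>i\<in>{s0..j}. n i))) \<le> A + Z * E j"
begin

text \<open>The test at the point where level r - f is about to run and all levels from
  \<open>s0\<close> below it have been passed.\<close>

abbreviation T where "T f \<equiv> ex (\<lambda>\<omega>. testK PP \<Delta> r S M a f (tot + 2 * (\<Sum>i\<in>{s0..<r-f}. n i)) \<omega> \<kappa>)"

lemma T_0: "T 0 = rejp S M a r * ex (\<kappa> False (tot + 2 * (\<Sum>i\<in>{s0..r}. n i))) + (1 - rejp S M a r) * ex (\<kappa> True (tot + 2 * (\<Sum>i\<in>{s0..r}. n i)))"
proof -
  have e: "(\<Sum>i\<in>{s0..r}. n i) = (\<Sum>i\<in>{s0..<r}. n i) + n r" using s0_bounds by (simp add: sum.last_plus atLeastLessThanSuc_atLeastAtMost[symmetric])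
  show ?thesis unfolding e ex_test(1)[OF S a \<kappa>, of PP] rejp_def by (simp add: algebra_simps)
qed

lemma T_Suc:
  assumes "Suc f \<le> r - s0"
  defines "s \<equiv> r - Suc f"
  shows "T (Suc f) = rejp S M a s * ex (\<kappa> False (tot + 2 * (\<Sum>i\<in>{s0..s}. n i))) + (1 - rejp S M a s) * T f"
proof -
  have s: "s0 \<le> s" "r - f = Suc s" using assms by auto
  have e: "(\<Sum>i\<in>{s0..s}. n i) = (\<Sum>i\<in>{s0..<s}. n i) + n s" using s by (simp add: atLeastLessThanSuc_atLeastAtMost[symmetric])
  have e': "(\<Sum>i\<in>{s0..<r-f}. n i) = (\<Sum>i\<in>{s0..<s}. n i) + n s" using s by simp
  have sd: "r - Suc f = s" by (simp add: s_def)
  show ?thesis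
    using ex_test(2)[where P=PP and \<Delta>=\<Delta> and r=r and M=M and f=f and tot="tot + 2 * (\<Sum>i\<in>{s0..<s}. n i)", OF S a \<kappa>]
    unfolding e e' sd rejp_def by (simp add: algebra_simps)
qed

text \<open>Backward induction over the levels. Rejection at level j costs A + Z E j; surviving all
  levels is a wrong acceptance and is charged as certain failure, with weight exp(-2^r) / 8.\<close>

lemma test_close:
  assumes b: "b \<in> S" "good b (M b)" "D2 a b \<le> \<Delta>\<^sup>2 / 16" and f: "f \<le> r - s0"
  shows "T f \<le> A + Z * (E (r - f) + (\<Sum>j\<in>{Suc (r - f)..r}. exp (- (2 ^ (j - 1))) / 8 * E j)) + exp (- (2 ^ r)) / 8"
  using f
proof (induction f)
  case 0
  let ?R = "rejp S M a r"
  have R: "0 \<le> ?R" "?R \<le> 1" "1 - ?R \<le> exp (- (2 ^ r)) / 8"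
    using rejp_bounds pass_close[where M=M, OF r_pos order_refl a S(1) b] by auto
  have "?R * ex (\<kappa> False (tot + 2 * (\<Sum>i\<in>{s0..r}. n i))) \<le> 1 * (A + Z * E r)"
    using R rej[of r] s0_bounds A0 Z0 E0[of r] ex_nonneg by (intro mult_mono) auto
  moreover have "(1 - ?R) * ex (\<kappa> True (tot + 2 * (\<Sum>i\<in>{s0..r}. n i))) \<le> exp (- (2 ^ r)) / 8 * 1"
    using R ex_le_1[OF \<kappa>(2)] ex_nonneg by (intro mult_mono) auto
  ultimately show ?case unfolding T_0 by simp
next
  case (Suc f)
  define s where "s = r - Suc f"
  have s: "1 \<le> s" "s0 \<le> s" "s \<le> r" "r - f = Suc s" using Suc.prems s0_bounds by (auto simp: s_def)
  let ?R = "rejp S M a s"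
  let ?X = "\<Sum>j\<in>{Suc (Suc s)..r}. exp (- (2 ^ (j - 1))) / 8 * E j"
  let ?e = "exp (- (2 ^ s)) / 8" and ?er = "exp (- (2 ^ r)) / 8 :: real"
  have R: "0 \<le> ?R" "?R \<le> 1" "1 - ?R \<le> ?e"
    using rejp_bounds pass_close[where M=M, OF s(1,3) a S(1) b] by auto
  have X0: "0 \<le> ?X" using E0 by (intro sum_nonneg) auto
  have IH: "T f \<le> A + Z * (E (Suc s) + ?X) + ?er" using Suc s by simp
  have 1: "?R * ex (\<kappa> False (tot + 2 * (\<Sum>i\<in>{s0..s}. n i))) \<le> ?R * (A + Z * E s)"
    using R rej[of s] s by (intro mult_left_mono) auto
  have 2: "(1 - ?R) * T f \<le> (1 - ?R) * (A + Z * (E (Suc s) + ?X) + ?er)" using R IH by (intro mult_left_mono) auto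
  have 3: "?R * (Z * E s) \<le> 1 * (Z * E s)" "(1 - ?R) * (Z * ?X) \<le> 1 * (Z * ?X)" "(1 - ?R) * ?er \<le> 1 * ?er"
    "(1 - ?R) * (Z * E (Suc s)) \<le> ?e * (Z * E (Suc s))"
    using R Z0 E0 X0 by (intro mult_right_mono; auto)+
  have split: "(\<Sum>j\<in>{Suc s..r}. exp (- (2 ^ (j - 1))) / 8 * E j) = ?e * E (Suc s) + ?X"
    using s Suc.prems by (subst sum.atLeast_Suc_atMost) (auto simp: s_def)
  have "T (Suc f) \<le> ?R * (A + Z * E s) + (1 - ?R) * (A + Z * (E (Suc s) + ?X) + ?er)"
    using T_Suc[OF Suc.prems] 1 2 unfolding s_def by linarith
  also have "\<dots> = A + ?R * (Z * E s) + (1 - ?R) * (Z * E (Suc s)) + (1 - ?R) * (Z * ?X) + (1 - ?R) * ?er"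
    by (simp add: algebra_simps)
  also have "\<dots> \<le> A + Z * E s + ?e * (Z * E (Suc s)) + Z * ?X + ?er" using 3 by linarith
  also have "\<dots> = A + Z * (E s + (?e * E (Suc s) + ?X)) + ?er" by (simp add: algebra_simps)
  finally show ?case unfolding s_def[symmetric] split .
qed

text \<open>Here acceptance is the desired outcome and lowers the value by G. Wrong rejections cost
  the moment Z E j and forfeit G, both weighted by exp(-2^j) / 4.\<close>

lemma test_far:
  assumes Sb: "card S \<le> K" "\<And>b. b \<in> S \<Longrightarrow> good b (M b)" "\<And>b. b \<in> S \<Longrightarrow> \<Delta>\<^sup>2 \<le> D2 a b"
    and acc: "ex (\<kappa> True (tot + 2 * (\<Sum>i\<in>{s0..r}. n i))) \<le> A + Z - G" "0 \<le> G"
    and \<epsilon>: "(\<Sum>j\<in>{s0..r}. exp (- (2 ^ j)) / 4 :: real) \<le> 1" and f: "f \<le> r - s0"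
  shows "T f \<le> A + Z * (1 + (\<Sum>j\<in>{r-f..r}. exp (- (2 ^ j)) / 4 * E j)) - (1 - (\<Sum>j\<in>{r-f..r}. exp (- (2 ^ j)) / 4)) * G"
  using f
proof (induction f)
  case 0
  let ?R = "rejp S M a r" and ?e = "exp (- (2 ^ r)) / 4 :: real"
  have R: "0 \<le> ?R" "?R \<le> 1" "?R \<le> ?e" using rejp_bounds reject_far[where M=M, OF r_pos order_refl a S Sb] by auto
  have 1: "?R * ex (\<kappa> False (tot + 2 * (\<Sum>i\<in>{s0..r}. n i))) \<le> ?R * (A + Z * E r)"
    using R rej[of r] s0_bounds by (intro mult_left_mono) auto
  have 2: "(1 - ?R) * ex (\<kappa> True (tot + 2 * (\<Sum>i\<in>{s0..r}. n i))) \<le> (1 - ?R) * (A + Z - G)"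
    using R acc by (intro mult_left_mono) auto
  have 3: "?R * (Z * E r) \<le> ?e * (Z * E r)" "(1 - ?R) * Z \<le> 1 * Z" "?R * G \<le> ?e * G"
    using R Z0 E0 acc by (intro mult_right_mono; auto)+
  have "T 0 \<le> ?R * (A + Z * E r) + (1 - ?R) * (A + Z - G)" unfolding T_0 using 1 2 by linarith
  also have "\<dots> = A + ?R * (Z * E r) + (1 - ?R) * Z - G + ?R * G" by (simp add: algebra_simps)
  also have "\<dots> \<le> A + ?e * (Z * E r) + Z - G + ?e * G" using 3 by linarith
  also have "\<dots> = A + Z * (1 + ?e * E r) - (1 - ?e) * G" by (simp add: algebra_simps)
  finally show ?case by simp
next
  case (Suc f)
  define s where "s = r - Suc f"
  have s: "1 \<le> s" "s0 \<le> s" "s \<le> r" "r - f = Suc s" using Suc.prems s0_bounds by (auto simp: s_def)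
  let ?R = "rejp S M a s" and ?e = "exp (- (2 ^ s)) / 4 :: real"
  let ?X = "\<Sum>j\<in>{Suc s..r}. exp (- (2 ^ j)) / 4 * E j" and ?y = "\<Sum>j\<in>{Suc s..r}. exp (- (2 ^ j)) / 4 :: real"
  have R: "0 \<le> ?R" "?R \<le> 1" "?R \<le> ?e" using rejp_bounds reject_far[where M=M, OF s(1,3) a S Sb] by auto
  have X0: "0 \<le> ?X" "0 \<le> ?y" using E0 by (auto intro!: sum_nonneg)
  have y1: "?y \<le> 1"
  proof -
    have "?y \<le> (\<Sum>j\<in>{s0..r}. exp (- (2 ^ j)) / 4)" using s by (intro sum_mono2) auto
    then show ?thesis using \<epsilon> by linarith
  qed
  have IH: "T f \<le> A + Z * (1 + ?X) - (1 - ?y) * G" using Suc s by simp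
  have 1: "?R * ex (\<kappa> False (tot + 2 * (\<Sum>i\<in>{s0..s}. n i))) \<le> ?R * (A + Z * E s)"
    using R rej[of s] s by (intro mult_left_mono) auto
  have 2: "(1 - ?R) * T f \<le> (1 - ?R) * (A + Z * (1 + ?X) - (1 - ?y) * G)" using R IH by (intro mult_left_mono) auto
  have 3: "?R * (Z * E s) \<le> ?e * (Z * E s)" "(1 - ?R) * (Z * (1 + ?X)) \<le> 1 * (Z * (1 + ?X))" "?R * G \<le> ?e * G"
    using R Z0 E0 acc X0 by (intro mult_right_mono; auto)+
  have 4: "?R * ((1 - ?y) * G) \<le> ?e * G"
  proof -
    have "(1 - ?y) * G \<le> 1 * G" using X0 acc by (intro mult_right_mono) auto
    then have "?R * ((1 - ?y) * G) \<le> ?R * G" using R by (intro mult_left_mono) auto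
    then show ?thesis using 3(3) by linarith
  qed
  have sp: "(\<Sum>j\<in>{s..r}. exp (- (2 ^ j)) / 4 * E j) = ?e * E s + ?X" "(\<Sum>j\<in>{s..r}. exp (- (2 ^ j)) / 4) = ?e + ?y"
    using s by (simp_all add: sum.atLeast_Suc_atMost)
  have "T (Suc f) \<le> ?R * (A + Z * E s) + (1 - ?R) * (A + Z * (1 + ?X) - (1 - ?y) * G)"
    using T_Suc[OF Suc.prems] 1 2 unfolding s_def by linarith
  also have "\<dots> = A + ?R * (Z * E s) + (1 - ?R) * (Z * (1 + ?X)) - (1 - ?y) * G + ?R * ((1 - ?y) * G)"
    by (simp add: algebra_simps)
  also have "\<dots> \<le> A + ?e * (Z * E s) + Z * (1 + ?X) - (1 - ?y) * G + ?e * G" using 3 4 by linarith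
  also have "\<dots> = A + Z * (1 + (?e * E s + ?X)) - (1 - (?e + ?y)) * G" by (simp add: algebra_simps)
  finally show ?case unfolding s_def[symmetric] sp .
qed

text \<open>For invalid guesses nothing is claimed about finding groups: if acceptance and rejection
  both cost at most A, the rejection probabilities are irrelevant.\<close>

lemma test_any:
  assumes Z: "Z = 0" and acc: "ex (\<kappa> True (tot + 2 * (\<Sum>i\<in>{s0..r}. n i))) \<le> A" and f: "f \<le> r - s0"
  shows "T f \<le> A"
  using f
proof (induction f)
  case 0
  have "rejp S M a r * ex (\<kappa> False (tot + 2 * (\<Sum>i\<in>{s0..r}. n i))) \<le> rejp S M a r * A"
    using rejp_bounds rej[of r] Z s0_bounds by (intro mult_left_mono) auto
  moreover have "(1 - rejp S M a r) * ex (\<kappa> True (tot + 2 * (\<Sum>i\<in>{s0..r}. n i))) \<le> (1 - rejp S M a r) * A"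
    using rejp_bounds acc by (intro mult_left_mono) auto
  ultimately show ?case unfolding T_0 by (simp add: algebra_simps)
next
  case (Suc f)
  define s where "s = r - Suc f"
  have s: "s0 \<le> s" "s \<le> r" using Suc.prems by (auto simp: s_def)
  have "rejp S M a s * ex (\<kappa> False (tot + 2 * (\<Sum>i\<in>{s0..s}. n i))) \<le> rejp S M a s * A"
    using rejp_bounds rej[of s] Z s by (intro mult_left_mono) auto
  moreover have "(1 - rejp S M a s) * T f \<le> (1 - rejp S M a s) * A"
    using rejp_bounds Suc by (intro mult_left_mono) auto
  ultimately show ?case using T_Suc[OF Suc.prems] unfolding s_def by (simp add: algebra_simps)
qed

end

end

section \<open>The potential of the loop\<close>

context sri
begin

text \<open>Counted in halves, since a call with parameter n takes 2 n samples. The plan allows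
  \<open>nmax + Sg\<close> per accepted arm and \<open>n s0\<close> per finished draw;
  \<open>U Sw\<close> and one more \<open>nmax\<close> are the slack that makes the initial value
  strongly negative.\<close>

definition Exc :: "nat \<Rightarrow> nat \<Rightarrow> nat set \<Rightarrow> nat \<Rightarrow> real" where
  "Exc tot0 k S t = (real t - real tot0) / 2 - real (card S) * (real nmax + Sg)
     - (real U - real k) * real (n s0) - real U * Sw - real nmax"

text \<open>Bounds the failure probability of the remaining \<open>k\<close> draws: a wrong acceptance, a bad estimate of
  an accepted arm, a group that is never hit, and an overrun of the budget, the last controlled by an
  exponential moment of the number \<open>Exc\<close> of samples spent beyond the planned ones.\<close>

definition Pot :: "nat \<Rightarrow> real \<Rightarrow> nat \<Rightarrow> nat set \<Rightarrow> nat \<Rightarrow> real" where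
  "Pot tot0 \<eta> k S t = real k * (exp (- (2 ^ r)) / 8) + (real K - real (card S)) * (exp (- (2 ^ r)) / 3)
     + (if easy then (real K - real (card S)) * (1 - \<theta> / 2) ^ k + exp (\<eta> * Exc tot0 k S t + real k / 8) else 0)"

text \<open>The budget is compared with T_max only after a draw, so the last draw may exceed it by a
  complete test and one final mean.\<close>

definition over :: nat where "over = 2 * (\<Sum>i\<in>{s0..r}. n i) + 2 * nmax"

definition OUT :: "nat \<Rightarrow> nat set \<Rightarrow> nat \<Rightarrow> bool" where
  "OUT tot0 S t \<longleftrightarrow> separated S \<and> card S \<le> K \<and> (easy \<longrightarrow> card S = K) \<and> real t \<le> real tot0 + Tmax + real over"

lemma separated_finite: "separated S \<Longrightarrow> finite S"
  by (auto simp: separated_def intro: finite_subset)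

lemma \<theta>_half: "0 \<le> 1 - \<theta> / 2" "1 - \<theta> / 2 \<le> 1"
proof -
  have "1 / real K \<le> 1 / 2" using K_ge_2 by (intro divide_left_mono) auto
  then have "\<theta> \<le> 1 / 2" using \<theta> by linarith
  then show "0 \<le> 1 - \<theta> / 2" "1 - \<theta> / 2 \<le> 1" using \<theta> by auto
qed

lemma Pot_nonneg: "card S \<le> K \<Longrightarrow> 0 \<le> Pot tot0 \<eta> k S t"
  using \<theta>_half by (simp add: Pot_def)

lemma Exc_reject:
  "Exc tot0 k S (t + 2 * (\<Sum>i\<in>{s0..j}. n i)) = Exc tot0 (Suc k) S t + (\<Sum>i\<in>{Suc s0..j}. real (n i))" if "s0 \<le> j"
proof -
  have "real (\<Sum>i\<in>{s0..j}. n i) = real (n s0) + (\<Sum>i\<in>{Suc s0..j}. real (n i))"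
    using that by (simp add: sum.atLeast_Suc_atMost)
  then show ?thesis by (simp add: Exc_def algebra_simps add_divide_distrib diff_divide_distrib)
qed

lemma Exc_accept:
  assumes "finite S" "a \<notin> S"
  shows "Exc tot0 k (insert a S) (t + 2 * (\<Sum>i\<in>{s0..r}. n i) + 2 * nmax) = Exc tot0 (Suc k) S t"
proof -
  have "real (\<Sum>i\<in>{s0..r}. n i) = real (n s0) + Sg"
    using s0_bounds by (simp add: sum.atLeast_Suc_atMost Sg_def)
  then show ?thesis using assms by (simp add: Exc_def algebra_simps add_divide_distrib diff_divide_distrib)
qed

lemma Exc_overrun:
  assumes "Tmax < real t - real tot0" "card S < K" "k \<le> U"
  shows "0 \<le> Exc tot0 k S t"
proof -
  have lin: "0 \<le> t / 2 - cX - u - w - m"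
    if "cX + X \<le> KX" "u \<le> v" "T / 2 = KX + v + w" "T < t" "m \<le> X" for cX X KX u v w t T m :: real
    using that by linarith
  have "real (card S) + 1 \<le> real K" using assms(2) by linarith
  then have "(real (card S) + 1) * (real nmax + Sg) \<le> real K * (real nmax + Sg)"
    using Sg_nonneg by (intro mult_right_mono) auto
  then have 1: "real (card S) * (real nmax + Sg) + (real nmax + Sg) \<le> real K * (real nmax + Sg)"
    by (simp only: distrib_right mult_1)
  have 2: "(real U - real k) * real (n s0) \<le> real U * real (n s0)" by (intro mult_right_mono) auto
  have 3: "Tmax / 2 = real K * (real nmax + Sg) + real U * real (n s0) + real U * Sw" by (simp add: Tmax_eq)
  show ?thesis unfolding Exc_def using Sg_nonneg by (intro lin[OF 1 2 3 assms(1)]) simp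
qed

text \<open>\<open>Pot\<close> behaves like a supermartingale: averaged over the drawn arm and the
  outcome of its test, its value after the draw does not exceed its value before. At every stop with
  a failure it is at least 1, hence bounds the failure probability.\<close>

lemma loop_bound:
  fixes \<kappa> :: "nat set \<Rightarrow> nat \<Rightarrow> src \<Rightarrow> ennreal"
  assumes \<kappa>: "\<And>S t. finite S \<Longrightarrow> \<kappa> S t \<in> borel_measurable SRC" "\<And>S t \<omega>. \<kappa> S t \<omega> \<le> 1"
    and \<eta>: "0 \<le> \<eta>" "\<forall>j\<in>{Suc s0..r}. \<eta> * (\<Sum>i\<in>{Suc s0..j}. real (n i)) \<le> 2 ^ j / 4"
    and q: "0 \<le> q" "\<And>S t. OUT tot0 S t \<Longrightarrow> ex (\<kappa> S t) \<le> q"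
  shows "separated S \<Longrightarrow> S \<noteq> {} \<Longrightarrow> (\<And>b. b \<in> S \<Longrightarrow> good b (M b)) \<Longrightarrow> card S < K \<Longrightarrow> k \<le> U \<Longrightarrow> tot0 \<le> tot
    \<Longrightarrow> real tot - real tot0 \<le> Tmax \<Longrightarrow>
    ex (\<lambda>\<omega>. loopK PP \<delta> \<Delta> \<theta> tot0 k S M tot \<omega> \<kappa>) \<le> q + Pot tot0 \<eta> k S tot"
proof (induction k arbitrary: S M tot)
  case 0
  show ?case
  proof (cases easy)
    case True
    \<comment> \<open>No draws are left but a group is missing: the term for missing groups is at
      least 1 and the bound is trivial.\<close>
    have "1 \<le> real K - real (card S)" using 0(4) by linarith
    then have "1 \<le> Pot tot0 \<eta> 0 S tot" using True unfolding Pot_def by (simp add: add_increasing add_increasing2)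
    then show ?thesis using ex_le_1[of "\<kappa> S tot", OF \<kappa>(2)] q(1) by simp
  next
    case False
    then have "OUT tot0 S tot" using 0 by (auto simp: OUT_def)
    then show ?thesis using q(2)[of S tot] Pot_nonneg[of S tot0 \<eta> 0 tot] 0(4) by simp
  qed
next
  case (Suc k)
  note prems = Suc.prems
  have finS: "finite S" by (rule separated_finite[OF prems(1)])
  then have finI: "finite (insert a S)" for a by simp
  define cont where "cont S M tot \<omega> = (if card S = K \<or> Tmax < real (tot - tot0) then \<kappa> S tot \<omega>
      else loopK PP \<delta> \<Delta> \<theta> tot0 k S M tot \<omega> \<kappa>)" for S M tot \<omega>
  have cont1: "cont S M t \<omega> \<le> 1" for S M t \<omega> by (simp add: cont_def \<kappa> loopK_le_1)
  have contm: "(\<lambda>x. cont S (fst x) t (snd x)) \<in> borel_measurable (MEANS \<Otimes>\<^sub>M SRC)" if "finite S" "S \<noteq> {}" for S t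
    unfolding cont_def using loopK_measurable[OF \<kappa>(1) that] measurable_compose[OF measurable_snd_SRC \<kappa>(1)[OF that(1)]] by simp
  have contb: "ex (cont S' M' t') \<le> q + Pot tot0 \<eta> k S' t'"
    if S': "separated S'" "S' \<noteq> {}" "\<And>b. b \<in> S' \<Longrightarrow> good b (M' b)" "card S' \<le> K" and t': "tot0 \<le> t'" "t' \<le> tot + over" for S' M' t'
  proof -
    have tb: "real t' \<le> real tot0 + Tmax + real over" using t'(2) prems(7) by linarith
    consider "card S' = K" | "card S' < K" "Tmax < real (t' - tot0)" | "card S' < K" "\<not> Tmax < real (t' - tot0)"
      using S'(4) by linarith
    then show ?thesis
    proof cases
      case 1
      then have "OUT tot0 S' t'" using S' tb by (auto simp: OUT_def)
      then show ?thesis using q(2)[of S' t'] Pot_nonneg[OF S'(4), of tot0 \<eta> k t'] 1 by (simp add: cont_def[abs_def])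
    next
      case 2
      show ?thesis
      proof (cases easy)
        case True
        \<comment> \<open>An overrun makes the exponential term at least 1, which pays for stopping
          without K arms.\<close>
        have "0 \<le> Exc tot0 k S' t'" using 2 prems(5) t'(1) by (intro Exc_overrun) (auto simp: of_nat_diff)
        then have "1 \<le> exp (\<eta> * Exc tot0 k S' t' + real k / 8)" using \<eta> by simp
        moreover have "0 \<le> (real K - real (card S')) * (1 - \<theta> / 2) ^ k" using S'(4) \<theta>_half by simp
        ultimately have "1 \<le> Pot tot0 \<eta> k S' t'" using True S'(4) unfolding Pot_def by (simp add: add_increasing)
        then show ?thesis using ex_le_1[of "cont S' M' t'"] cont1 q(1) by (smt (verit))
      next
        case False
        then have "OUT tot0 S' t'" using S' tb by (auto simp: OUT_def)
        then show ?thesis using q(2)[of S' t'] Pot_nonneg[OF S'(4), of tot0 \<eta> k t'] 2 by (simp add: cont_def[abs_def])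
      qed
    next
      case 3
      then have "cont S' M' t' = (\<lambda>\<omega>. loopK PP \<delta> \<Delta> \<theta> tot0 k S' M' t' \<omega> \<kappa>)" by (auto simp: cont_def)
      then show ?thesis using Suc.IH[of S' M' t'] S' 3 prems(5) t' by (auto simp: of_nat_diff)
    qed
  qed
  define KK where "KK a acc t \<omega> = (if acc then cont (insert a S) (M(a := means (single a nmax) \<omega> a)) (t + 2 * nmax) (adv (single a (2 * nmax)) 0 \<omega>)
        else cont S M t \<omega>)" for a acc t \<omega>
  have KK1: "KK a acc t \<omega> \<le> 1" for a acc t \<omega> by (simp add: KK_def cont1)
  have KKm: "KK a acc t \<in> borel_measurable SRC" for a acc t
  proof (cases acc)
    case True
    have "(\<lambda>\<omega>. cont (insert a S) (M(a := means (single a nmax) \<omega> a)) (t + 2 * nmax) (adv (single a (2 * nmax)) 0 \<omega>)) \<in> borel_measurable SRC"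
      by (rule borel_measurable_curried[OF contm[OF finI]]) (intro insert_not_empty measurable_MEANS_upd measurable_const measurable_means_coord measurable_adv measurable_ident_sets refl; simp)+
    then show ?thesis unfolding KK_def using True by simp
  next
    case False
    have "cont S M t \<in> borel_measurable SRC"
      using borel_measurable_curried[where f="\<lambda>_. M" and g="\<lambda>\<omega>. \<omega>", OF contm[OF finS prems(2), of t]] by (simp add: measurable_ident_sets)
    then show ?thesis unfolding KK_def using False by simp
  qed
  define TT where "TT a \<omega> = testK PP \<Delta> r S M a (r - s0) tot \<omega> (KK a)" for a \<omega>
  have TT1: "TT a \<omega> \<le> 1" for a \<omega> unfolding TT_def by (rule testK_le_1[OF KK1])
  have TTm: "TT a \<in> borel_measurable SRC" for a
  proof -
    have "(\<lambda>x. testK PP \<Delta> r S (fst x) a (r - s0) tot (snd x) (\<lambda>b t. (\<lambda>M. KK a b t) (fst x))) \<in> borel_measurable (MEANS \<Otimes>\<^sub>M SRC)"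
      by (rule testK_measurable[OF finS prems(2)]) (rule measurable_compose[OF measurable_snd_SRC KKm])
    from borel_measurable_curried[where f="\<lambda>_. M" and g="\<lambda>\<omega>. \<omega>", OF this]
    show ?thesis unfolding TT_def by (simp add: measurable_ident_sets)
  qed
  have step: "ex (\<lambda>\<omega>. loopK PP \<delta> \<Delta> \<theta> tot0 (Suc k) S M tot \<omega> \<kappa>) = (\<Sum>a<N. ex (TT a)) / real N"
  proof -
    have "loopK PP \<delta> \<Delta> \<theta> tot0 (Suc k) S M tot \<omega> \<kappa> = TT (snd \<omega> 0) (adv (\<lambda>_. 0) 1 \<omega>)" for \<omega>
      unfolding TT_def KK_def cont_def by (simp add: Let_def)
    then show ?thesis using ex_draw[of TT, OF TTm TT1] by simp
  qed
  define m where "m = real K - real (card S)"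
  define e0 where "e0 = exp (- (2 ^ r)) / (8::real)"
  define g where "g = exp (- (2 ^ r)) / (3::real)"
  define \<gamma> where "\<gamma> = (1 - \<theta> / 2) ^ k"
  \<comment> \<open>A and Z split the value after a rejected draw: going up to level j multiplies
    only the exponential part Z, by \<open>Ej \<eta> j\<close>.\<close>
  define A where "A = q + real k * e0 + m * g + (if easy then m * \<gamma> else 0)"
  define Z where "Z = (if easy then exp (\<eta> * Exc tot0 (Suc k) S tot + real k / 8) else 0)"
  have m1: "1 \<le> m" using prems(4) unfolding m_def by linarith
  have pos: "0 \<le> e0" "0 \<le> g" "0 \<le> \<gamma>" "0 \<le> Z" using \<theta>_half by (auto simp: e0_def g_def \<gamma>_def Z_def)
  have A0: "0 \<le> A" using q(1) m1 pos by (auto simp: A_def)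
  have rejb: "ex (KK a False (tot + 2 * (\<Sum>i\<in>{s0..j}. n i))) \<le> A + Z * Ej \<eta> j" if j: "s0 \<le> j" "j \<le> r" for a j
  proof -
    have "(\<Sum>i\<in>{s0..j}. n i) \<le> (\<Sum>i\<in>{s0..r}. n i)" using j by (intro sum_mono2) auto
    then have t: "tot + 2 * (\<Sum>i\<in>{s0..j}. n i) \<le> tot + over" by (simp add: over_def)
    have "KK a False (tot + 2 * (\<Sum>i\<in>{s0..j}. n i)) = cont S M (tot + 2 * (\<Sum>i\<in>{s0..j}. n i))" by (auto simp: KK_def)
    then have "ex (KK a False (tot + 2 * (\<Sum>i\<in>{s0..j}. n i))) \<le> q + Pot tot0 \<eta> k S (tot + 2 * (\<Sum>i\<in>{s0..j}. n i))"
      using contb[OF prems(1-3), of "tot + 2 * (\<Sum>i\<in>{s0..j}. n i)"] prems(4,6) t by simp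
    also have "\<dots> = A + Z * Ej \<eta> j"
      unfolding Pot_def Exc_reject[OF j(1)] A_def Z_def Ej_def m_def e0_def g_def \<gamma>_def
      by (auto simp: exp_add[symmetric] algebra_simps)
    finally show ?thesis .
  qed
  have accb: "ex (KK a True (tot + 2 * (\<Sum>i\<in>{s0..r}. n i))) \<le> A + Z - (if easy then \<gamma> else 0)"
    if a: "a < N" "\<And>b. b \<in> S \<Longrightarrow> \<Delta>\<^sup>2 / 16 < D2 a b" for a
  proof -
    let ?t = "tot + 2 * (\<Sum>i\<in>{s0..r}. n i) + 2 * nmax"
    \<comment> \<open>D2 a a = 0, so drawing a stored arm again counts as drawing a close
      one.\<close>
    have aS: "a \<notin> S" using a(2)[of a] \<Delta> by (auto simp: D2_def ip_def vdiff_def)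
    have sep: "separated (insert a S)"
    proof -
      have "D2 b a = D2 a b" for b by (auto simp: D2_def ip_def vdiff_def algebra_simps intro!: sum.cong)
      then have "D2 b a > \<Delta>\<^sup>2 / 16" if "b \<in> S" for b using a(2)[OF that] by metis
      then show ?thesis using prems(1) a unfolding separated_def by blast
    qed
    obtain E where E: "E \<in> sets \<Omega>" "{\<omega> \<in> space \<Omega>. \<not> good a (means (single a nmax) \<omega> a)} \<subseteq> E" "\<Omega>.prob E \<le> g"
      using prob_not_good[OF a(1)] unfolding g_def by blast
    have tov: "tot0 \<le> ?t" "?t \<le> tot + over" using prems(6) by (auto simp: over_def)
    have cardI: "real (card (insert a S)) = real (card S) + 1" "card (insert a S) \<le> K" using aS finS prems(4) by auto
    \<comment> \<open>A new arm reduces the number of missing arms by one. The released g pays for a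
      possibly bad estimate of the new arm; the released \<gamma> is the gain.\<close>
    have P: "q + Pot tot0 \<eta> k (insert a S) ?t = A - g + Z - (if easy then \<gamma> else 0)"
    proof -
      have "real K - (real (card S) + 1) = m - 1" by (simp add: m_def)
      then show ?thesis
        unfolding Pot_def Exc_accept[OF finS aS] cardI(1) A_def Z_def e0_def[symmetric] g_def[symmetric] \<gamma>_def[symmetric]
        by (simp add: algebra_simps)
    qed
    have hm: "(\<lambda>x. cont (insert a S) (M(a := fst x a)) ?t (snd x)) \<in> borel_measurable (MEANS \<Otimes>\<^sub>M SRC)"
      by (rule borel_measurable_curried[OF contm[OF finI]]) (intro insert_not_empty measurable_MEANS_upd measurable_const measurable_MEANS_coord[OF measurable_fst_MEANS] measurable_snd_SRC; simp)+
    have "ex (\<lambda>\<omega>. cont (insert a S) (M(a := means (single a nmax) \<omega> a)) ?t (adv (single a (2 * nmax)) 0 \<omega>)) \<le> g + (q + Pot tot0 \<eta> k (insert a S) ?t)"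
    proof (rule ex_mean_le[where h="\<lambda>mm \<omega>. cont (insert a S) (M(a := mm a)) ?t \<omega>" and Gd="\<lambda>mm. good a (mm a)", OF a(1) hm cont1 E(1) E(2) E(3)])
      show "0 \<le> q + Pot tot0 \<eta> k (insert a S) ?t" using q(1) Pot_nonneg[OF cardI(2)] by simp
      fix mm :: "nat \<Rightarrow> vec \<times> vec" assume "good a (mm a)"
      then show "ex (cont (insert a S) (M(a := mm a)) ?t) \<le> q + Pot tot0 \<eta> k (insert a S) ?t"
        using prems(3) by (intro contb[OF sep _ _ cardI(2) tov]) auto
    qed
    then show ?thesis unfolding P by (simp add: KK_def[abs_def] add_diff_eq)
  qed
  have Tz: "TT a = (\<lambda>\<omega>. testK PP \<Delta> r S M a (r - s0) (tot + 2 * (\<Sum>i\<in>{s0..<r-(r-s0)}. n i)) \<omega> (KK a))" for a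
    using s0_bounds by (simp add: TT_def fun_eq_iff)
  have E0: "0 \<le> Ej \<eta> j" for j by (simp add: Ej_def)
  have rr: "r - (r - s0) = s0" using s0_bounds by simp
  have close: "ex (TT a) \<le> A + 9/8 * Z + e0" if a: "a < N" and b: "b \<in> S" "D2 a b \<le> \<Delta>\<^sup>2 / 16" for a b
  proof -
    have "ex (TT a) \<le> A + Z * (Ej \<eta> (r - (r - s0)) + (\<Sum>j\<in>{Suc (r - (r - s0))..r}. exp (- (2 ^ (j - 1))) / 8 * Ej \<eta> j)) + exp (- (2 ^ r)) / 8"
      unfolding Tz
      by (rule test_close[where \<kappa>="KK a" and E="Ej \<eta>" and f="r - s0" and tot=tot and M=M, OF KKm KK1 finS prems(2) a A0 pos(4) E0 rejb b(1) prems(3)[OF b(1)] b(2) order_refl])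
    also have "\<dots> \<le> A + Z * (9/8) + e0"
      unfolding rr e0_def using close_sum[OF \<eta>(2)] pos(4) by (intro add_mono mult_left_mono) auto
    finally show ?thesis by simp
  qed
  have "(\<Sum>a<N. ex (TT a)) / real N \<le> q + Pot tot0 \<eta> (Suc k) S tot"
  proof (cases easy)
    case False
    have "ex (TT a) \<le> A + e0" if a: "a < N" for a
    proof (cases "\<exists>b\<in>S. D2 a b \<le> \<Delta>\<^sup>2 / 16")
      case True
      then show ?thesis using close[OF a] False by (auto simp: Z_def)
    next
      case nb: False
      then have acc: "ex (KK a True (tot + 2 * (\<Sum>i\<in>{s0..r}. n i))) \<le> A"
        using accb[OF a] False by (auto simp: Z_def not_le)
      have "ex (TT a) \<le> A" unfolding Tz
        by (rule test_any[where \<kappa>="KK a" and E="Ej \<eta>" and f="r - s0" and tot=tot and M=M, OF KKm KK1 finS prems(2) a A0 pos(4) E0 rejb _ acc order_refl]) (use False in \<open>auto simp: Z_def\<close>)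
      then show ?thesis using pos by simp
    qed
    then have "(\<Sum>a<N. ex (TT a)) \<le> (\<Sum>a<N. A + e0)" by (intro sum_mono) auto
    then have "(\<Sum>a<N. ex (TT a)) / real N \<le> A + e0" using N_ge_2 by (simp add: field_simps)
    also have "A + e0 = q + Pot tot0 \<eta> (Suc k) S tot"
      using False unfolding A_def Pot_def m_def[symmetric] e0_def[symmetric] g_def[symmetric] by (simp add: algebra_simps)
    finally show ?thesis .
  next
    case True
    have Tb: "ex (TT a) \<le> A + 9/8 * Z + e0 - (if a \<in> far S then \<gamma> / 2 else 0)" if a: "a < N" for a
    proof (cases "a \<in> far S")
      case False
      then obtain b where b: "b \<in> S" "veq d (\<mu> a) (\<mu> b)" using a by (auto simp: far_def)
      then have "D2 a b = 0" by (simp add: D2_eq_0_iff)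
      then show ?thesis using close[OF a b(1)] False by simp
    next
      case fa: True
      have D: "\<Delta>\<^sup>2 \<le> D2 a b" if "b \<in> S" for b
        using easy_far[OF True a, of b] fa that prems(1) by (auto simp: far_def separated_def)
      have D': "\<Delta>\<^sup>2 / 16 < D2 a b" if "b \<in> S" for b
        using D[OF that] \<Delta> zero_less_power[of \<Delta> 2] by linarith
      have acc: "ex (KK a True (tot + 2 * (\<Sum>i\<in>{s0..r}. n i))) \<le> A + Z - \<gamma>" using accb[OF a D'] True by simp
      have e1: "(\<Sum>j\<in>{s0..r}. exp (- (2 ^ j)) / 4 :: real) \<le> 1" using far_sum(2)[OF \<eta>(2,1)] by linarith
      have "ex (TT a) \<le> A + Z * (1 + (\<Sum>j\<in>{r-(r-s0)..r}. exp (- (2 ^ j)) / 4 * Ej \<eta> j)) - (1 - (\<Sum>j\<in>{r-(r-s0)..r}. exp (- (2 ^ j)) / 4)) * \<gamma>"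
        unfolding Tz using prems(4) D prems(3)
        by (intro test_far[where \<kappa>="KK a" and E="Ej \<eta>" and f="r - s0" and tot=tot and M=M, OF KKm KK1 finS prems(2) a A0 pos(4) E0 rejb _ _ _ acc pos(3) e1 order_refl]) auto
      also have "\<dots> \<le> A + Z * (9/8) - (1/2) * \<gamma>"
        unfolding rr using far_sum[OF \<eta>(2,1)] pos(3,4) by (intro diff_mono add_mono mult_left_mono mult_right_mono) auto
      finally show ?thesis using fa pos(1) by simp
    qed
    have "(\<Sum>a<N. ex (TT a)) \<le> (\<Sum>a<N. (A + 9/8 * Z + e0) - (if a \<in> far S then \<gamma> / 2 else 0))"
      using Tb by (intro sum_mono) auto
    also have "\<dots> = real N * (A + 9/8 * Z + e0) - real (card (far S)) * (\<gamma> / 2)"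
    proof -
      have "(\<Sum>a<N. if a \<in> far S then \<gamma> / 2 else 0) = (\<Sum>a\<in>{..<N} \<inter> far S. \<gamma> / 2)" by (rule sum.inter_restrict[symmetric]) simp
      also have "{..<N} \<inter> far S = far S" by (auto simp: far_def)
      finally show ?thesis by (simp add: sum_subtractf)
    qed
    \<comment> \<open>At least m \<theta> N arms are far, each with gain \<gamma> / 2. On average
      this is m \<theta> \<gamma> / 2, the decrease of m (1 - \<theta>/2)^k in one draw.\<close>
    also have "\<dots> \<le> real N * (A + 9/8 * Z + e0) - (m * (\<theta> * real N)) * (\<gamma> / 2)"
      using card_far[OF True prems(1)] pos(3) unfolding m_def by (intro diff_left_mono mult_right_mono) auto
    also have "\<dots> = real N * (A + 9/8 * Z + e0 - m * \<theta> * \<gamma> / 2)" by (simp add: algebra_simps)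
    finally have "(\<Sum>a<N. ex (TT a)) / real N \<le> A + 9/8 * Z + e0 - m * \<theta> * \<gamma> / 2"
      using N_ge_2 by (simp add: divide_le_eq mult.commute)
    \<comment> \<open>The factor 9/8 of one draw is absorbed by the summand k/8 in the exponent of
      \<open>Pot\<close>.\<close>
    also have "\<dots> \<le> A + exp (1/8) * Z + e0 - m * \<theta> * \<gamma> / 2"
    proof -
      have "9/8 \<le> exp (1/8::real)" using exp_ge_add_one_self[of "1/8::real"] by simp
      then have "9/8 * Z \<le> exp (1/8) * Z" using pos(4) by (intro mult_right_mono)
      then show ?thesis by linarith
    qed
    also have "\<dots> = q + Pot tot0 \<eta> (Suc k) S tot"
    proof -
      have "exp (1/8) * Z = exp (\<eta> * Exc tot0 (Suc k) S tot + real (Suc k) / 8)"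
        using True by (simp add: Z_def exp_add[symmetric] add_divide_distrib algebra_simps)
      moreover have "m * \<gamma> - m * \<theta> * \<gamma> / 2 = m * (1 - \<theta> / 2) ^ Suc k" by (simp add: \<gamma>_def algebra_simps)
      ultimately show ?thesis using True unfolding Pot_def A_def m_def[symmetric] e0_def[symmetric] g_def[symmetric]
        by (simp add: algebra_simps)
    qed
    finally show ?thesis .
  qed
  then show ?case unfolding step .
qed

text \<open>The initial potential and the estimate of the first arm add up to at most \<delta>/32 +
  \<delta>/12 + \<delta>/8 + \<delta>/16: wrong acceptances, bad estimates, missing groups and
  overrun.\<close>

lemma SRI_bound:
  fixes \<kappa> :: "nat set \<Rightarrow> nat \<Rightarrow> src \<Rightarrow> ennreal"
  assumes \<kappa>: "\<And>S t. finite S \<Longrightarrow> \<kappa> S t \<in> borel_measurable SRC" "\<And>S t \<omega>. \<kappa> S t \<omega> \<le> 1"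
    and q: "0 \<le> q" "\<And>S t. OUT tot S t \<Longrightarrow> ex (\<kappa> S t) \<le> q"
  shows "ex (\<lambda>\<omega>. SRIK PP \<delta> \<Delta> \<theta> tot \<omega> \<kappa>) \<le> q + \<delta> / 2"
proof -
  obtain \<eta> where \<eta>: "0 \<le> \<eta>" "2 * real U \<le> \<eta> * (real nmax + real U * Sw)"
    "\<forall>j\<in>{Suc s0..r}. \<eta> * (\<Sum>i\<in>{Suc s0..j}. real (n i)) \<le> 2 ^ j / 4"
    using eta_exists by blast
  let ?g = "exp (- (2 ^ r)) / 3 :: real" and ?t = "tot + 2 * nmax"
  define L where "L a M \<omega> = loopK PP \<delta> \<Delta> \<theta> tot U {a} M ?t \<omega> \<kappa>" for a M \<omega>
  define TT where "TT a \<omega> = L a (\<lambda>_. means (single a nmax) \<omega> a) (adv (single a (2 * nmax)) 0 \<omega>)" for a \<omega>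
  have L1: "L a M \<omega> \<le> 1" for a M \<omega> unfolding L_def by (rule loopK_le_1[OF \<kappa>(2)])
  have Lm: "(\<lambda>x. L a (\<lambda>_. fst x a) (snd x)) \<in> borel_measurable (MEANS \<Otimes>\<^sub>M SRC)" for a
    unfolding L_def
    by (rule borel_measurable_curried[OF loopK_measurable[OF \<kappa>(1)]])
       (auto intro!: measurable_MEANSI measurable_MEANS_coord[OF measurable_fst_MEANS] measurable_snd_SRC)
  have TTm: "TT a \<in> borel_measurable SRC" for a
    unfolding TT_def
    by (rule borel_measurable_curried[OF Lm]) (auto intro!: measurable_means measurable_adv measurable_ident_sets)
  define B where "B = real U * (exp (- (2 ^ r)) / 8) + (real K - 1) * ?g + (if easy then (real K - 1) * (1 - \<theta> / 2) ^ U + exp (- real U) else 0)"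
  have Tmx: "real ?t - real tot \<le> Tmax"
  proof -
    have "1 * (real nmax + Sg) \<le> real K * (real nmax + Sg)" using K_ge_2 Sg_nonneg by (intro mult_right_mono) auto
    then show ?thesis unfolding Tmax_eq using Sg_nonneg Sw_nonneg by (simp add: add_increasing2)
  qed
  have TTb: "ex (TT a) \<le> ?g + (q + B)" if a: "a < N" for a
  proof -
    obtain E where E: "E \<in> sets \<Omega>" "{\<omega> \<in> space \<Omega>. \<not> good a (means (single a nmax) \<omega> a)} \<subseteq> E" "\<Omega>.prob E \<le> ?g"
      using prob_not_good[OF a] by blast
    have P: "Pot tot \<eta> U {a} ?t \<le> B"
    proof -
      \<comment> \<open>The first arm uses up its own \<open>nmax\<close>; the slack
        \<open>nmax + U Sw\<close> is left, so the exponent is at most -2U + U/8.\<close>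
      have "Exc tot U {a} ?t \<le> - (real nmax + real U * Sw)" using Sg_nonneg by (simp add: Exc_def)
      then have "\<eta> * Exc tot U {a} ?t \<le> \<eta> * (- (real nmax + real U * Sw))" using \<eta>(1) by (rule mult_left_mono)
      then have "\<eta> * Exc tot U {a} ?t + real U / 8 \<le> - real U" using \<eta>(2) by (simp only: mult_minus_right)
      then show ?thesis unfolding Pot_def B_def by auto
    qed
    have sep: "separated {a}" using a by (auto simp: separated_def)
    have "0 \<le> B" using order_trans[OF Pot_nonneg P] K_ge_2 by simp
    then show ?thesis unfolding TT_def
    proof (intro ex_mean_le[where h="\<lambda>mm. L a (\<lambda>_. mm a)" and Gd="\<lambda>mm. good a (mm a)", OF a Lm L1 E(1) E(2) E(3)])
      fix mm :: "nat \<Rightarrow> vec \<times> vec" assume g: "good a (mm a)"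
      have "ex (L a (\<lambda>_. mm a)) \<le> q + Pot tot \<eta> U {a} ?t"
        unfolding L_def using g K_ge_2 Tmx by (intro loop_bound[OF \<kappa> \<eta>(1,3) q sep]) auto
      then show "ex (L a (\<lambda>_. mm a)) \<le> q + B" using P by linarith
    qed (use q in auto)
  qed
  have "ex (\<lambda>\<omega>. SRIK PP \<delta> \<Delta> \<theta> tot \<omega> \<kappa>) = (\<Sum>a<N. ex (TT a)) / real N"
  proof -
    have "SRIK PP \<delta> \<Delta> \<theta> tot \<omega> \<kappa> = TT (snd \<omega> 0) (adv (\<lambda>_. 0) 1 \<omega>)" for \<omega>
      unfolding TT_def L_def SRIK_def Let_def ..
    then show ?thesis using ex_draw[of TT, OF TTm] L1 by (simp add: TT_def)
  qed
  also have "\<dots> \<le> (\<Sum>a<N. ?g + (q + B)) / real N" using TTb by (intro divide_right_mono sum_mono) auto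
  also have "\<dots> = ?g + (q + B)" using N_ge_2 by simp
  also have "\<dots> \<le> q + \<delta> / 2"
  proof -
    have er: "exp (- (2 ^ r)) \<le> \<delta> / (4 * real U)" by (rule exp_r)
    have 1: "real U * (exp (- (2 ^ r)) / 8) \<le> \<delta> / 32"
      using mult_left_mono[OF er, of "real U / 8"] U_pos by simp
    have 2: "real K * ?g \<le> \<delta> / 12"
    proof -
      have "real K * ?g \<le> real U * ?g" using U_ge_K K_pos by (intro mult_right_mono) auto
      also have "\<dots> \<le> \<delta> / 12" using mult_left_mono[OF er, of "real U / 3"] U_pos by simp
      finally show ?thesis .
    qed
    have l8: "exp (- ln (8 * real K / \<delta>)) = \<delta> / (8 * real K)" using K_pos \<delta> by (simp add: exp_minus)
    have 3: "(real K - 1) * (1 - \<theta> / 2) ^ U \<le> \<delta> / 8"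
    proof -
      have "(1 - \<theta> / 2) ^ U \<le> exp (- (\<theta> / 2)) ^ U" using \<theta>_half exp_ge_add_one_self[of "- (\<theta> / 2)"] by (intro power_mono) auto
      also have "\<dots> = exp (real U * - (\<theta> / 2))" by (rule exp_of_nat_mult[symmetric])
      also have "\<dots> \<le> exp (- ln (8 * real K / \<delta>))"
      proof -
        have "(8 / \<theta> * ln (8 * real K / \<delta>)) * (\<theta> / 2) \<le> real U * (\<theta> / 2)" using U_ge \<theta> by (intro mult_right_mono) auto
        moreover have "(8 / \<theta> * ln (8 * real K / \<delta>)) * (\<theta> / 2) = 4 * ln (8 * real K / \<delta>)" using \<theta> by simp
        ultimately show ?thesis using ln8K by simp
      qed
      finally have "(1 - \<theta> / 2) ^ U \<le> \<delta> / (8 * real K)" unfolding l8 .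
      then have "(real K - 1) * (1 - \<theta> / 2) ^ U \<le> real K * (\<delta> / (8 * real K))"
        using \<theta>_half K_ge_2 by (intro mult_mono) auto
      then show ?thesis using K_pos by simp
    qed
    have 4: "exp (- real U) \<le> \<delta> / 16"
    proof -
      have "exp (- real U) \<le> exp (- ln (8 * real K / \<delta>))" using U_ge_ln by simp
      also have "\<dots> \<le> \<delta> / 16" unfolding l8 using K_ge_2 \<delta> by (intro divide_left_mono) auto
      finally show ?thesis .
    qed
    have 5: "(if easy then (real K - 1) * (1 - \<theta> / 2) ^ U + exp (- real U) else 0) \<le> \<delta> / 8 + \<delta> / 16" using 3 4 \<delta> by auto
    have "x + (k - 1) * x = k * x" for x k :: real by (simp add: algebra_simps)
    note this[of ?g "real K"]
    then show ?thesis unfolding B_def using 1 2 5 \<delta> by linarith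
  qed
  finally show ?thesis .
qed

end

section \<open>Gap estimate and ADC\<close>

context clustering
begin

lemma Delta_star_le:
  assumes "a < N" "b < N" "\<not> veq d (\<mu> a) (\<mu> b)"
  shows "Delta_star d N \<mu> \<le> vnorm d (vdiff (\<mu> a) (\<mu> b))"
  unfolding Delta_star_def using assms by (intro Min_le[OF finite_gaps]) blast

lemma Delta_star_attained:
  obtains a b where "a < N" "b < N" "\<not> veq d (\<mu> a) (\<mu> b)" "Delta_star d N \<mu> = vnorm d (vdiff (\<mu> a) (\<mu> b))"
proof -
  let ?A = "{vnorm d (vdiff (\<mu> a) (\<mu> b)) | a b. a < N \<and> b < N \<and> \<not> veq d (\<mu> a) (\<mu> b)}"
  have "\<exists>a<N. \<exists>b<N. \<not> veq d (\<mu> a) (\<mu> b)"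
  proof (rule ccontr)
    assume "\<not> ?thesis"
    then have "\<forall>a<N. \<forall>b<N. veq d (\<mu> a) (\<mu> b)" by blast
    then have "Gstar d N \<mu> \<subseteq> {{..<N}}" by (auto simp: Gstar_def)
    from card_mono[OF _ this] show False using K_ge_2 by (simp add: card_Gstar)
  qed
  then have "?A \<noteq> {}" by auto
  from Min_in[OF finite_gaps this] show ?thesis using that unfolding Delta_star_def by blast
qed

lemma Delta_star_pos: "0 < Delta_star d N \<mu>"
proof (rule Delta_star_attained)
  fix a b assume ab: "\<not> veq d (\<mu> a) (\<mu> b)" "Delta_star d N \<mu> = vnorm d (vdiff (\<mu> a) (\<mu> b))"
  then have "D2 a b \<noteq> 0" by (simp add: D2_eq_0_iff)
  then have "0 < D2 a b" by (simp add: less_le)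
  then show ?thesis unfolding ab(2) vnorm_def D2_def by simp
qed

lemma Delta_star_sq_le: "a < N \<Longrightarrow> b < N \<Longrightarrow> \<not> veq d (\<mu> a) (\<mu> b) \<Longrightarrow> (Delta_star d N \<mu>)\<^sup>2 \<le> D2 a b"
  using power_mono[OF Delta_star_le, of a b 2] Delta_star_pos by (simp add: D2_def)

definition transversal :: "nat set \<Rightarrow> bool" where
  "transversal S \<longleftrightarrow> S \<subseteq> {..<N} \<and> card S = K \<and> (\<forall>a\<in>S. \<forall>b\<in>S. a \<noteq> b \<longrightarrow> \<not> veq d (\<mu> a) (\<mu> b))"

text \<open>The classes of the K arms of S are distinct, and there are only K groups, so every group
  is among them.\<close>

lemma transversal_rep:
  assumes S: "transversal S" and a: "a < N"
  obtains b where "b \<in> S" "veq d (\<mu> a) (\<mu> b)"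
proof -
  let ?cl = "\<lambda>a. {b. b < N \<and> veq d (\<mu> b) (\<mu> a)}"
  have sub: "?cl ` S \<subseteq> Gstar d N \<mu>" using S by (auto simp: Gstar_def transversal_def)
  have inj: "inj_on ?cl S"
  proof (rule inj_onI, rule ccontr)
    fix x y assume ab: "x \<in> S" "y \<in> S" "?cl x = ?cl y" "x \<noteq> y"
    then have "x \<in> ?cl y" using S by (auto simp: transversal_def veq_def)
    then show False using S ab by (auto simp: transversal_def)
  qed
  have "?cl ` S = Gstar d N \<mu>"
    by (rule card_subset_eq[OF Gstar_finite(1) sub]) (use inj S in \<open>simp add: card_image card_Gstar transversal_def\<close>)
  then have "?cl a \<in> ?cl ` S" using a by (auto simp: Gstar_def)
  then obtain b where b: "b \<in> S" "?cl a = ?cl b" by auto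
  then have "a \<in> ?cl b" using a by (auto simp: veq_def)
  then show ?thesis using that b by auto
qed

definition quad :: "nat \<Rightarrow> nat \<Rightarrow> nat \<Rightarrow> nat \<Rightarrow> src \<Rightarrow> real" where
  "quad a n b m \<omega> = ip d (vdiff (noise a 0 n \<omega>) (noise b 0 m \<omega>)) (vdiff (noise a 1 n \<omega>) (noise b 1 m \<omega>))"

definition lin :: "vec \<Rightarrow> nat \<Rightarrow> nat \<Rightarrow> nat \<Rightarrow> nat \<Rightarrow> src \<Rightarrow> real" where
  "lin u a n b m \<omega> = ip d u (noise a 0 n \<omega>) + ip d u (noise a 1 n \<omega>) - ip d u (noise b 0 m \<omega>) - ip d u (noise b 1 m \<omega>)"

lemma measurable_quad: "quad a n b m \<in> borel_measurable \<Omega>"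
  unfolding quad_def[abs_def] by (intro measurable_ip measurable_vdiff measurable_noise)

lemma measurable_lin: "lin u a n b m \<in> borel_measurable \<Omega>"
  unfolding lin_def[abs_def] by (intro borel_measurable_diff borel_measurable_add measurable_ip measurable_noise measurable_const) simp_all

lemma lin_uminus: "lin (\<lambda>i. - u i) a n b m \<omega> = - lin u a n b m \<omega>"
  by (simp add: lin_def ip_def sum_negf)

lemma stat_noise:
  "stat d (means m \<omega> a) (means m \<omega> b) = D2 a b + lin (vdiff (\<mu> a) (\<mu> b)) a (m a) b (m b) \<omega> + quad a (m a) b (m b) \<omega>"
  unfolding stat_def D2_def lin_def quad_def noise_def means_def ip_def vdiff_def
  by (simp add: sum_subtractf[symmetric] sum.distrib[symmetric]) (intro sum.cong refl, algebra)

text \<open>The accuracy is relative to D2 a b: one half for the bilinear and one quarter for the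
  linear noise. The sample size is tuned to S, and S < 16 D2 a b transfers it. Two signs of each
  part give the factor 4; 8464 is 92^2, from c6.\<close>

lemma gap_pair_tail:
  fixes v S t :: real
  assumes ab: "a < N" "b < N" "a \<noteq> b" and n: "0 < n" and t: "0 \<le> t" and D: "S / 16 < D2 a b" "0 < S"
    and v: "v = \<sigma>\<^sup>2 / real n" "2048 * (t * v) \<le> S" "64 * (cHW * (t * v)) \<le> S" "8464 * (cHW * (real d * t * v\<^sup>2)) \<le> S\<^sup>2"
  shows "\<exists>E\<in>sets \<Omega>. {\<omega> \<in> space \<Omega>. 3/4 * D2 a b < \<bar>lin (vdiff (\<mu> a) (\<mu> b)) a n b n \<omega> + quad a n b n \<omega>\<bar>} \<subseteq> E \<and> \<Omega>.prob E \<le> 4 * exp (- t)"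
proof -
  define D where "D = D2 a b"
  define u where "u = vdiff (\<mu> a) (\<mu> b)"
  have D': "S < 16 * D" "0 < D" using D by (auto simp: D_def)
  have SD: "S\<^sup>2 \<le> 256 * D\<^sup>2" using power_mono[of S "16 * D" 2] D' D(2) by (simp add: power_mult_distrib)
  have v0: "0 < v" using sigma_pos n by (simp add: v)
  have iu: "ip d u u = D" by (simp add: D_def D2_def u_def)
  have iu': "ip d (\<lambda>i. - u i) (\<lambda>i. - u i) = D" using iu by (simp add: ip_def)
  have h1: "cHW * t * (real d * (2 * \<sigma>\<^sup>2 / real n)\<^sup>2) \<le> (D / 2)\<^sup>2"
  proof -
    have "cHW * t * (real d * (2 * \<sigma>\<^sup>2 / real n)\<^sup>2) = 4 * (cHW * (real d * t * v\<^sup>2))" unfolding v(1) by (simp add: power_mult_distrib power_divide)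
    moreover have "(D / 2)\<^sup>2 = D\<^sup>2 / 4" by (simp add: power_divide)
    moreover have "4 * X \<le> e / 4" if "8464 * X \<le> s" "s \<le> 256 * e" "0 \<le> e" for X s e :: real using that by linarith
    ultimately show ?thesis using v(4) SD by (simp only: zero_le_power2)
  qed
  have h2: "cHW * t * (2 * \<sigma>\<^sup>2 / real n) \<le> D / 2"
  proof -
    have "cHW * t * (2 * \<sigma>\<^sup>2 / real n) = 2 * (cHW * (t * v))" unfolding v(1) by simp
    then show ?thesis using v(3) D' by linarith
  qed
  define V where "V = 4 * (v * D)"
  have V0: "0 < V" using v0 D' by (simp add: V_def)
  have h3: "2 * t * V \<le> (D / 4)\<^sup>2"
  proof -
    have "2 * t * V = (8 * (t * v)) * D" by (simp add: V_def)
    also have "\<dots> \<le> (D / 16) * D" using v(2) D' by (intro mult_right_mono) linarith+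
    finally show ?thesis by (simp add: power2_eq_square)
  qed
  let ?E1 = "{\<omega> \<in> space \<Omega>. D / 2 < 1 * quad a n b n \<omega>}" and ?E2 = "{\<omega> \<in> space \<Omega>. D / 2 < -1 * quad a n b n \<omega>}"
  let ?E3 = "{\<omega> \<in> space \<Omega>. D / 4 \<le> lin u a n b n \<omega>}" and ?E4 = "{\<omega> \<in> space \<Omega>. D / 4 \<le> lin (\<lambda>i. - u i) a n b n \<omega>}"
  have s: "?E1 \<in> sets \<Omega>" "?E2 \<in> sets \<Omega>" "?E3 \<in> sets \<Omega>" "?E4 \<in> sets \<Omega>"
    by (intro borel_measurable_less borel_measurable_le borel_measurable_times borel_measurable_const measurable_quad measurable_lin)+
  have p12: "\<Omega>.prob ?E1 \<le> exp (- t)" "\<Omega>.prob ?E2 \<le> exp (- t)"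
    unfolding quad_def by (rule noise_pair_bilinear_tail[OF ab n _ t _ h1 h2]; use D' in simp)+
  have p34: "\<Omega>.prob ?E3 \<le> exp (- t)" "\<Omega>.prob ?E4 \<le> exp (- t)"
    unfolding lin_def by (rule noise_pair_linear_tail[OF ab n V0 _ _ h3]; use D' in \<open>simp add: iu iu' V_def v(1)\<close>)+
  have "\<Omega>.prob (?E1 \<union> ?E2 \<union> (?E3 \<union> ?E4)) \<le> (\<Omega>.prob ?E1 + \<Omega>.prob ?E2) + (\<Omega>.prob ?E3 + \<Omega>.prob ?E4)"
    using s by (intro order_trans[OF measure_Un_le] add_mono measure_Un_le sets.Un)
  then have "\<Omega>.prob (?E1 \<union> ?E2 \<union> (?E3 \<union> ?E4)) \<le> 4 * exp (- t)" using p12 p34 by linarith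
  moreover have "{\<omega> \<in> space \<Omega>. 3/4 * D < \<bar>lin u a n b n \<omega> + quad a n b n \<omega>\<bar>} \<subseteq> ?E1 \<union> ?E2 \<union> (?E3 \<union> ?E4)"
  proof
    fix \<omega> assume w: "\<omega> \<in> {\<omega> \<in> space \<Omega>. 3/4 * D < \<bar>lin u a n b n \<omega> + quad a n b n \<omega>\<bar>}"
    then have "D / 2 < quad a n b n \<omega> \<or> D / 2 < - quad a n b n \<omega> \<or> D / 4 \<le> lin u a n b n \<omega> \<or> D / 4 \<le> - lin u a n b n \<omega>"
      unfolding mem_Collect_eq by linarith
    then show "\<omega> \<in> ?E1 \<union> ?E2 \<union> (?E3 \<union> ?E4)" using w by (auto simp: lin_uminus)
  qed
  ultimately show ?thesis using s unfolding D_def u_def by (intro bexI[of _ "?E1 \<union> ?E2 \<union> (?E3 \<union> ?E4)"]) (auto simp: D_def u_def)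
qed

text \<open>The event says that j looks at least as close to a as b, when b has the mean of a. Half
  of D2 a j is left to each kind of noise. As J >= I, both variance terms of
  \<open>noise_triple\<close> are covered by 6 vI vJ.\<close>

lemma adc_pair_tail:
  fixes vI vJ G t :: real
  assumes abj: "a < N" "b < N" "j < N" "a \<noteq> b" "a \<noteq> j" "b \<noteq> j" and IJ: "0 < I" "I \<le> J" and t: "0 \<le> t"
    and D: "G \<le> D2 a j" "0 < G"
    and v: "vI = \<sigma>\<^sup>2 / real I" "vJ = \<sigma>\<^sup>2 / real J" "64 * (t * vI) \<le> G" "32 * (cHW * (t * vI))\<^sup>2 \<le> G\<^sup>2"
      "64 * (cHW * (real d * t * (vI * vJ))) \<le> G\<^sup>2"
  shows "\<exists>E\<in>sets \<Omega>. {\<omega> \<in> space \<Omega>. D2 a j + lin (vdiff (\<mu> a) (\<mu> j)) a I j J \<omega> \<le> quad a I b J \<omega> - quad a I j J \<omega>} \<subseteq> E \<and> \<Omega>.prob E \<le> 2 * exp (- t)"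
proof -
  define D where "D = D2 a j"
  define u where "u = vdiff (\<mu> a) (\<mu> j)"
  have J0: "0 < J" using IJ by simp
  have D': "G \<le> D" "0 < D" using D by (auto simp: D_def)
  have GD: "G\<^sup>2 \<le> D\<^sup>2" using power_mono[of G D 2] D' D(2) by simp
  have v0: "0 < vI" "0 < vJ" using sigma_pos IJ J0 by (simp_all add: v)
  have vJI: "vJ \<le> vI" unfolding v using IJ by (intro divide_left_mono) auto
  have iu': "ip d (\<lambda>i. - u i) (\<lambda>i. - u i) = D" by (simp add: D_def D2_def u_def ip_def)
  define \<phi> where "\<phi> = sqrt (6 * (vI * vJ))"
  have \<phi>: "0 \<le> \<phi>" "\<phi>\<^sup>2 = 6 * (vI * vJ)" using v0 by (auto simp: \<phi>_def)
  have vJ2: "vJ\<^sup>2 \<le> vI * vJ" unfolding power2_eq_square using vJI v0 by (intro mult_right_mono) auto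
  have h0: "4 * ((\<sigma>\<^sup>2)\<^sup>2 / (real I * real J)) + 2 * ((\<sigma>\<^sup>2)\<^sup>2 / (real J)\<^sup>2) \<le> \<phi>\<^sup>2"
  proof -
    have "(\<sigma>\<^sup>2)\<^sup>2 / (real I * real J) = vI * vJ" "(\<sigma>\<^sup>2)\<^sup>2 / (real J)\<^sup>2 = vJ\<^sup>2" by (simp_all add: v power2_eq_square)
    then show ?thesis using vJ2 unfolding \<phi>(2) by linarith
  qed
  have D2e: "(D / 2)\<^sup>2 = D\<^sup>2 / 4" by (simp add: power_divide)
  have h1: "cHW * t * (real d * \<phi>\<^sup>2) \<le> (D / 2)\<^sup>2"
  proof -
    have "cHW * t * (real d * \<phi>\<^sup>2) = 6 * (cHW * (real d * t * (vI * vJ)))" unfolding \<phi>(2) by simp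
    moreover have "6 * X \<le> e / 4" if "64 * X \<le> s" "s \<le> e" "0 \<le> e" for X s e :: real using that by linarith
    ultimately show ?thesis using v(5) GD unfolding D2e by (simp only: zero_le_power2)
  qed
  have lin6: "6 * X \<le> e / 4" if "32 * X \<le> s" "s \<le> e" "0 \<le> e" for X s e :: real using that by linarith
  have h2: "cHW * t * \<phi> \<le> D / 2"
  proof (rule power2_le_imp_le)
    have "(cHW * t * \<phi>)\<^sup>2 = (cHW * t)\<^sup>2 * (6 * (vI * vJ))" by (simp only: power_mult_distrib \<phi>(2))
    also have "\<dots> \<le> (cHW * t)\<^sup>2 * (6 * (vI * vI))" using vJI v0 by (intro mult_left_mono) auto
    also have "\<dots> = 6 * (cHW * (t * vI))\<^sup>2" by (simp add: power_mult_distrib power2_eq_square)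
    also have "\<dots> \<le> (D / 2)\<^sup>2" using lin6[OF v(4) GD] unfolding D2e by simp
    finally show "(cHW * t * \<phi>)\<^sup>2 \<le> (D / 2)\<^sup>2" .
  qed (use D' in simp)
  define V where "V = 4 * (vI * D)"
  have V0: "0 < V" using v0 D' by (simp add: V_def)
  have VI: "2 * (\<sigma>\<^sup>2 / real I * D) + 2 * (\<sigma>\<^sup>2 / real J * D) \<le> V"
    unfolding v(1,2)[symmetric] V_def using mult_right_mono[OF vJI less_imp_le[OF D'(2)]] by linarith
  have h3: "2 * t * V \<le> (D / 2)\<^sup>2"
  proof -
    have "2 * t * V = (8 * (t * vI)) * D" by (simp add: V_def)
    also have "\<dots> \<le> (D / 4) * D" using v(3) D' D(2) by (intro mult_right_mono) linarith+
    finally show ?thesis by (simp add: power2_eq_square)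
  qed
  let ?E1 = "{\<omega> \<in> space \<Omega>. D / 2 < quad a I b J \<omega> - quad a I j J \<omega>}" and ?E2 = "{\<omega> \<in> space \<Omega>. D / 2 \<le> lin (\<lambda>i. - u i) a I j J \<omega>}"
  have s: "?E1 \<in> sets \<Omega>" "?E2 \<in> sets \<Omega>"
    by (intro borel_measurable_less borel_measurable_le borel_measurable_diff borel_measurable_const measurable_quad measurable_lin)+
  have p1: "\<Omega>.prob ?E1 \<le> exp (- t)"
    unfolding quad_def by (rule noise_triple_bilinear_tail[OF abj IJ(1) J0 t _ \<phi>(1) h0 h1 h2]) (use D' in simp)
  have p2: "\<Omega>.prob ?E2 \<le> exp (- t)"
    unfolding lin_def by (rule noise_triple_linear_tail[OF abj IJ(1) J0 V0 _ _ h3]) (use D' VI in \<open>simp_all add: iu'\<close>)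
  have "\<Omega>.prob (?E1 \<union> ?E2) \<le> \<Omega>.prob ?E1 + \<Omega>.prob ?E2" using s by (rule measure_Un_le)
  then have "\<Omega>.prob (?E1 \<union> ?E2) \<le> 2 * exp (- t)" using p1 p2 by linarith
  moreover have "{\<omega> \<in> space \<Omega>. D + lin u a I j J \<omega> \<le> quad a I b J \<omega> - quad a I j J \<omega>} \<subseteq> ?E1 \<union> ?E2"
  proof
    fix \<omega> assume w: "\<omega> \<in> {\<omega> \<in> space \<Omega>. D + lin u a I j J \<omega> \<le> quad a I b J \<omega> - quad a I j J \<omega>}"
    then have "D / 2 < quad a I b J \<omega> - quad a I j J \<omega> \<or> D / 2 \<le> - lin u a I j J \<omega>"
      unfolding mem_Collect_eq by linarith
    then show "\<omega> \<in> ?E1 \<union> ?E2" using w by (auto simp: lin_uminus)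
  qed
  ultimately show ?thesis using s unfolding D_def u_def by (intro bexI[of _ "?E1 \<union> ?E2"]) (auto simp: D_def u_def)
qed

lemma finite_union_tail:
  assumes "finite I" and "\<And>i. i \<in> I \<Longrightarrow> \<exists>E\<in>sets \<Omega>. B i \<subseteq> E \<and> \<Omega>.prob E \<le> p"
  shows "\<exists>E\<in>sets \<Omega>. (\<Union>i\<in>I. B i) \<subseteq> E \<and> \<Omega>.prob E \<le> real (card I) * p"
proof -
  obtain E where E: "\<And>i. i \<in> I \<Longrightarrow> E i \<in> sets \<Omega> \<and> B i \<subseteq> E i \<and> \<Omega>.prob (E i) \<le> p" using assms(2) by metis
  have "\<Omega>.prob (\<Union>i\<in>I. E i) \<le> (\<Sum>i\<in>I. \<Omega>.prob (E i))" using E assms(1) by (intro measure_UNION_le) auto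
  also have "\<dots> \<le> real (card I) * p" using sum_mono[of I "\<lambda>i. \<Omega>.prob (E i)" "\<lambda>_. p"] E by simp
  finally show ?thesis using E assms(1) by (intro bexI[of _ "\<Union>i\<in>I. E i"]) (auto intro!: sets.finite_UN)
qed

end

lemma ln_12_ge_1: "1 \<le> ln (12::real)"
proof -
  have "exp 1 \<le> (12::real)" using exp_le by linarith
  then show ?thesis by (simp add: ln_ge_iff)
qed

text \<open>The statistic is symmetric in the two arms, so one order suffices; the saved factor 2
  brings the union bound for the gap down to 2 \<delta> / 3.\<close>

lemma card_increasing_pairs:
  fixes S :: "nat set"
  assumes "finite S"
  shows "2 * card {(a, b). a \<in> S \<and> b \<in> S \<and> a < b} \<le> card S ^ 2"
proof -
  let ?A = "{(a, b). a \<in> S \<and> b \<in> S \<and> a < b}"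
  have f: "finite ?A" by (rule finite_subset[of _ "S \<times> S"]) (use assms in auto)
  have "card (prod.swap ` ?A) = card ?A" by (intro card_image) (simp add: inj_on_def)
  moreover have "card (?A \<union> prod.swap ` ?A) = card ?A + card (prod.swap ` ?A)"
    using f by (intro card_Un_disjoint) auto
  moreover have "card (?A \<union> prod.swap ` ?A) \<le> card (S \<times> S)" using assms by (intro card_mono) auto
  ultimately show ?thesis by (simp add: card_cartesian_product power2_eq_square)
qed

section \<open>Union bounds over pairs of arms\<close>

locale acb = clustering +
  fixes \<delta> :: real
  assumes \<delta>: "0 < \<delta>" "\<delta> < 1"
begin

abbreviation "ds \<equiv> Delta_star d N \<mu>"
abbreviation "Dp \<equiv> Delta_p PP \<delta>"
abbreviation "\<Delta>0 \<equiv> Delta0_sq PP \<delta>"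

lemma NK: "2 \<le> real K" "real K \<le> real N" "2 \<le> real N" using K_ge_2 K_le_N N_ge_2 by auto

lemma ln_6N_ge_1: "1 \<le> ln (6 * real N / \<delta>)"
proof -
  have "12 * \<delta> \<le> 6 * real N" using NK \<delta> by linarith
  then have "12 \<le> 6 * real N / \<delta>" using \<delta> by (simp add: pos_le_divide_eq)
  then show ?thesis using ln_12_ge_1 ln_mono[of 12 "6 * real N / \<delta>"] by linarith
qed

lemma Delta0_ge: "\<sigma>\<^sup>2 \<le> \<Delta>0"
proof -
  have "1 \<le> sqrt (real d)" using d_pos by simp
  moreover have "0 \<le> ln (real K)" using NK by simp
  moreover have "0 \<le> ln (ln (6 * real N / \<delta>))" using ln_6N_ge_1 by simp
  ultimately have "1 \<le> ln (real K) + sqrt (real d) + ln (ln (6 * real N / \<delta>))" by linarith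
  then have "\<sigma>\<^sup>2 * 1 \<le> \<sigma>\<^sup>2 * (ln (real K) + sqrt (real d) + ln (ln (6 * real N / \<delta>)))"
    by (rule mult_left_mono) simp
  then show ?thesis by (simp add: Delta0_sq_def)
qed

lemma Delta0_pos: "0 < \<Delta>0" using Delta0_ge sigma_pos by linarith

lemma Dp_sq: "(Dp p)\<^sup>2 = \<Delta>0 / 2 ^ p"
proof -
  have "(2 powr (- real p / 2))\<^sup>2 = (2::real) powr (- real p)"
    by (simp add: power2_eq_square powr_add[symmetric])
  moreover have "(2::real) powr (- real p) = 1 / 2 ^ p" using powr_minus_divide[of 2 "real p"] by (simp only: powr_realpow zero_less_numeral)
  moreover have "(sqrt \<Delta>0)\<^sup>2 = \<Delta>0" using Delta0_pos by (intro real_sqrt_pow2) linarith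
  ultimately show ?thesis unfolding Delta_p_def power_mult_distrib by simp
qed

lemma Dp_pos: "0 < Dp p" using Delta0_pos by (simp add: Delta_p_def)

abbreviation "lam \<equiv> ln (3 * (real K)\<^sup>2 / \<delta>)"

lemma K_sq: "4 \<le> (real K)\<^sup>2" using power_mono[OF NK(1), of 2] by simp

lemma lam_pos: "0 < lam"
proof -
  have "\<delta> < 3 * (real K)\<^sup>2" using K_sq \<delta> by linarith
  then have "1 < 3 * (real K)\<^sup>2 / \<delta>" using \<delta> by simp
  then show ?thesis by simp
qed

definition gap_ok :: "nat set \<Rightarrow> (nat \<Rightarrow> vec \<times> vec) \<Rightarrow> bool" where
  "gap_ok S mm \<longleftrightarrow> (\<forall>a\<in>S. \<forall>b\<in>S. a \<noteq> b \<longrightarrow> \<bar>stat d (mm a) (mm b) - D2 a b\<bar> \<le> 3/4 * D2 a b)"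

lemma stat_commute: "stat d m m' = stat d m' m"
  unfolding stat_def ip_def vdiff_def by (intro sum.cong refl) algebra

lemma D2_commute: "D2 a b = D2 b a"
  unfolding D2_def ip_def vdiff_def by (intro sum.cong refl) algebra

text \<open>At most K^2 / 2 pairs, each failing with probability 4 exp(-lam), where exp(-lam) =
  \<delta> / (3 K^2).\<close>

lemma gap_tail:
  fixes S n p
  defines "n \<equiv> n'_p PP \<delta> p" and "m \<equiv> (\<lambda>a. if a \<in> S then n else 0)"
  assumes S: "S \<subseteq> {..<N}" "card S = K" "\<And>a b. a \<in> S \<Longrightarrow> b \<in> S \<Longrightarrow> a \<noteq> b \<Longrightarrow> (Dp p)\<^sup>2 / 16 < D2 a b"
  shows "\<exists>E\<in>sets \<Omega>. {\<omega> \<in> space \<Omega>. \<not> gap_ok S (means m \<omega>)} \<subseteq> E \<and> \<Omega>.prob E \<le> 2 * \<delta> / 3"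
proof -
  define s where "s = (Dp p)\<^sup>2"
  have s0: "0 < s" using Dp_pos[of p] by (simp add: s_def)
  have nge: "c6 cHW * \<sigma>\<^sup>2 / s * (lam + sqrt (real d * lam)) \<le> real n"
    unfolding n_def n'_p_def s_def by (rule order_trans[OF _ real_nat_ceiling_ge]) simp
  have c6: "2048 \<le> c6 cHW" "64 * cHW \<le> c6 cHW" "92 * sqrt cHW \<le> c6 cHW" by (auto simp: c6_def)
  have sq0: "0 \<le> sqrt (real d * lam)" using lam_pos by simp
  have part: "c * \<sigma>\<^sup>2 / s * x \<le> real n" if "c \<le> c6 cHW" "0 \<le> x" "x \<le> lam + sqrt (real d * lam)" for c x
  proof -
    have "c * \<sigma>\<^sup>2 / s * x \<le> c6 cHW * \<sigma>\<^sup>2 / s * (lam + sqrt (real d * lam))"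
      using that sigma_pos s0 c6(1) lam_pos by (intro mult_mono divide_right_mono mult_right_mono) auto
    then show ?thesis using nge by linarith
  qed
  have n0: "0 < real n"
  proof -
    have "0 < 2048 * \<sigma>\<^sup>2 / s * lam" using sigma_pos s0 lam_pos by simp
    then show ?thesis using part[OF c6(1), of lam] lam_pos sq0 by linarith
  qed
  define v where "v = \<sigma>\<^sup>2 / real n"
  have v0: "0 < v" using sigma_pos n0 by (simp add: v_def)
  have 1: "2048 * (lam * v) \<le> s" unfolding v_def by (rule variance_from_count[OF part[OF c6(1)] n0 s0]) (use lam_pos in auto)
  have 2: "64 * (cHW * (lam * v)) \<le> s"
    using variance_from_count[OF part[OF c6(2), of lam] n0 s0] lam_pos sq0 unfolding v_def by (simp add: mult.assoc)
  have 3: "92 * sqrt cHW * (sqrt (real d * lam) * v) \<le> s"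
    unfolding v_def by (rule variance_from_count[OF part[OF c6(3)] n0 s0]) (use lam_pos in auto)
  have 4: "8464 * (cHW * (real d * lam * v\<^sup>2)) \<le> s\<^sup>2"
  proof -
    have "(92 * sqrt cHW * (sqrt (real d * lam) * v))\<^sup>2 \<le> s\<^sup>2" using 3 v0 cHW_pos sq0 by (intro power_mono) auto
    then show ?thesis using cHW_pos lam_pos by (simp add: power_mult_distrib)
  qed
  let ?I = "{(a, b). a \<in> S \<and> b \<in> S \<and> a < b}"
  have finS: "finite S" using S(1) finite_subset by blast
  have fI: "finite ?I" by (rule finite_subset[of _ "S \<times> S"]) (use finS in auto)
  let ?B = "\<lambda>(a, b). {\<omega> \<in> space \<Omega>. 3/4 * D2 a b < \<bar>lin (vdiff (\<mu> a) (\<mu> b)) a n b n \<omega> + quad a n b n \<omega>\<bar>}"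
  have "\<exists>E\<in>sets \<Omega>. ?B i \<subseteq> E \<and> \<Omega>.prob E \<le> 4 * exp (- lam)" if "i \<in> ?I" for i
  proof -
    obtain a b where i0: "i = (a, b)" by (cases i)
    then have i: "i = (a, b)" "a \<in> S" "b \<in> S" "a < b" using that by auto
    have "a < N" "b < N" "a \<noteq> b" "0 < n" using i S(1) n0 by auto
    then show ?thesis unfolding i(1) prod.case
      using S(3)[of a b] i s0 lam_pos 1 2 4 by (intro gap_pair_tail[where S=s and v=v]) (auto simp: v_def s_def)
  qed
  then have "\<exists>E\<in>sets \<Omega>. (\<Union>i\<in>?I. ?B i) \<subseteq> E \<and> \<Omega>.prob E \<le> real (card ?I) * (4 * exp (- lam))" by (rule finite_union_tail[OF fI])
  then obtain E where E: "E \<in> sets \<Omega>" "(\<Union>i\<in>?I. ?B i) \<subseteq> E" "\<Omega>.prob E \<le> real (card ?I) * (4 * exp (- lam))"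
    by (elim bexE conjE) (intro that)
  have cE: "real (card ?I) * (4 * exp (- lam)) \<le> 2 * \<delta> / 3"
  proof -
    have e: "exp (- lam) = \<delta> / (3 * (real K)\<^sup>2)" using NK \<delta> by (simp add: exp_minus)
    have "real (2 * card ?I) \<le> real (card S ^ 2)" using card_increasing_pairs[OF finS] by (simp only: of_nat_le_iff)
    then have "2 * real (card ?I) \<le> (real K)\<^sup>2" using S(2) by simp
    then have "(2 * real (card ?I)) * (2 * exp (- lam)) \<le> (real K)\<^sup>2 * (2 * exp (- lam))" by (rule mult_right_mono) simp
    also have "\<dots> = 2 * \<delta> / 3" unfolding e using NK by simp
    finally show ?thesis by simp
  qed
  have sE: "{\<omega> \<in> space \<Omega>. \<not> gap_ok S (means m \<omega>)} \<subseteq> (\<Union>i\<in>?I. ?B i)"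
  proof
    fix \<omega> assume w: "\<omega> \<in> {\<omega> \<in> space \<Omega>. \<not> gap_ok S (means m \<omega>)}"
    then obtain a b where ab: "a \<in> S" "b \<in> S" "a \<noteq> b" "\<not> \<bar>stat d (means m \<omega> a) (means m \<omega> b) - D2 a b\<bar> \<le> 3/4 * D2 a b"
      by (auto simp: gap_ok_def)
    obtain a' b' where ab': "a' \<in> S" "b' \<in> S" "a' < b'" "\<not> \<bar>stat d (means m \<omega> a') (means m \<omega> b') - D2 a' b'\<bar> \<le> 3/4 * D2 a' b'"
      using ab stat_commute[of "means m \<omega> a" "means m \<omega> b"] D2_commute[of a b] by (cases "a < b") auto
    then have "\<omega> \<in> ?B (a', b')" using w by (simp add: stat_noise m_def)
    then show "\<omega> \<in> (\<Union>i\<in>?I. ?B i)" using ab' by blast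
  qed
  show ?thesis by (intro bexI[OF _ E(1)] conjI order_trans[OF E(3) cE] subset_trans[OF sE E(2)])
qed

text \<open>A pair attaining the smallest gap has representatives in S, which bounds the minimum
  from above; every pair bounds it from below. Halving the estimate, as ACB does, puts the squared
  guess for ADC between 1/8 and 7/8 of the true squared gap.\<close>

lemma gap2_bounds:
  assumes S: "transversal S" and g: "gap_ok S mm"
  shows "ds\<^sup>2 / 4 \<le> gap2 d S mm" "gap2 d S mm \<le> 7/4 * ds\<^sup>2"
proof -
  let ?A = "{stat d (mm a) (mm b) | a b. a \<in> S \<and> b \<in> S \<and> a \<noteq> b}"
  have SN: "a < N" if "a \<in> S" for a using S that by (auto simp: transversal_def)
  have f: "finite ?A"
    by (rule finite_subset[of _ "(\<lambda>(a, b). stat d (mm a) (mm b)) ` ({..<N} \<times> {..<N})"]) (use SN in force)+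
  obtain a b where ab: "a < N" "b < N" "\<not> veq d (\<mu> a) (\<mu> b)" "ds = vnorm d (vdiff (\<mu> a) (\<mu> b))"
    by (rule Delta_star_attained)
  obtain a' where a': "a' \<in> S" "veq d (\<mu> a) (\<mu> a')" by (rule transversal_rep[OF S ab(1)])
  obtain b' where b': "b' \<in> S" "veq d (\<mu> b) (\<mu> b')" by (rule transversal_rep[OF S ab(2)])
  have ne: "a' \<noteq> b'" using ab(3) a' b' by (auto simp: veq_def)
  have D: "D2 a' b' = ds\<^sup>2"
  proof -
    have "D2 a' b' = D2 a b" using a'(2) b'(2) unfolding D2_def by (intro ip_cong) (auto simp: vdiff_def veq_def)
    then show ?thesis using ab(4) by (simp add: D2_def)
  qed
  have in_A: "stat d (mm a') (mm b') \<in> ?A" using a' b' ne by blast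
  have "gap2 d S mm \<le> stat d (mm a') (mm b')" unfolding gap2_def by (rule Min_le[OF f in_A])
  moreover have "\<bar>stat d (mm a') (mm b') - D2 a' b'\<bar> \<le> 3/4 * D2 a' b'" using g a'(1) b'(1) ne unfolding gap_ok_def by blast
  ultimately show "gap2 d S mm \<le> 7/4 * ds\<^sup>2" unfolding D by linarith
  show "ds\<^sup>2 / 4 \<le> gap2 d S mm"
    unfolding gap2_def
  proof (rule Min.boundedI[OF f])
    show "?A \<noteq> {}" using in_A by blast
    fix x assume "x \<in> ?A"
    then obtain a b where x: "x = stat d (mm a) (mm b)" "a \<in> S" "b \<in> S" "a \<noteq> b" by blast
    then have "\<bar>x - D2 a b\<bar> \<le> 3/4 * D2 a b" using g by (auto simp: gap_ok_def)
    moreover have "ds\<^sup>2 \<le> D2 a b" using S x SN by (intro Delta_star_sq_le) (auto simp: transversal_def)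
    ultimately show "ds\<^sup>2 / 4 \<le> x" by linarith
  qed
qed

abbreviation "L0 \<equiv> adc_L0 PP (\<delta>/3)"

lemma exp_L0: "exp (- L0) = \<delta> / (18 * real N * real K)"
  using NK \<delta> by (simp add: adc_L0_def exp_minus)

lemma L0_pos: "0 < L0"
proof -
  have "1 * 1 \<le> real N * real K" using NK by (intro mult_mono) auto
  then have "\<delta> < 18 * real N * real K" using \<delta> by linarith
  then have "1 < 18 * real N * real K / \<delta>" using \<delta> by simp
  then show ?thesis by (simp add: adc_L0_def mult.assoc)
qed

text \<open>The dimension terms are balanced: the roots with K/N in I and N/K in J multiply to d L0,
  exactly what the bilinear noise requires of the product of the two variances.\<close>

lemma adc_counts:
  fixes \<Delta> I J
  assumes \<Delta>: "0 < \<Delta>\<^sup>2"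
  defines "I \<equiv> adc_I PP (\<delta>/3) \<Delta>" and "J \<equiv> adc_J PP (\<delta>/3) \<Delta>"
  shows "0 < I" "I \<le> J" "64 * (L0 * (\<sigma>\<^sup>2 / real I)) \<le> \<Delta>\<^sup>2" "32 * (cHW * (L0 * (\<sigma>\<^sup>2 / real I)))\<^sup>2 \<le> (\<Delta>\<^sup>2)\<^sup>2"
    "64 * (cHW * (real d * L0 * (\<sigma>\<^sup>2 / real I * (\<sigma>\<^sup>2 / real J)))) \<le> (\<Delta>\<^sup>2)\<^sup>2"
proof -
  let ?k = "sqrt (real d * real K / real N * L0)" and ?n = "sqrt (real d * real N / real K * L0)"
  have I1: "c4 cHW * \<sigma>\<^sup>2 / \<Delta>\<^sup>2 * L0 \<le> real I" and I2: "c5 cHW * \<sigma>\<^sup>2 / \<Delta>\<^sup>2 * ?k \<le> real I"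
    unfolding I_def adc_I_def by (rule order_trans[OF _ real_nat_ceiling_ge]; simp)+
  have J2: "c5 cHW * \<sigma>\<^sup>2 / \<Delta>\<^sup>2 * ?n \<le> real J"
    unfolding J_def adc_J_def by (rule order_trans[OF _ real_nat_ceiling_ge]; simp)
  have c4: "64 \<le> c4 cHW" "4 * sqrt 2 * cHW \<le> c4 cHW" by (auto simp: c4_def)
  have c5: "0 < c5 cHW" using cHW_pos by (simp add: c5_def)
  have kn: "?k \<le> ?n"
  proof -
    have "real K / real N \<le> 1" "1 \<le> real N / real K" using NK by auto
    then have "real K / real N \<le> real N / real K" by linarith
    then have "(real d * L0) * (real K / real N) \<le> (real d * L0) * (real N / real K)" using L0_pos by (intro mult_left_mono) auto
    then show ?thesis by (simp add: algebra_simps)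
  qed
  show IJ: "I \<le> J"
    unfolding I_def J_def adc_I_def adc_J_def using kn c5
    by (intro nat_mono ceiling_mono max.mono order_refl mult_left_mono) auto
  have part: "c * \<sigma>\<^sup>2 / \<Delta>\<^sup>2 * L0 \<le> real I" if "c \<le> c4 cHW" for c
  proof -
    have "c * \<sigma>\<^sup>2 / \<Delta>\<^sup>2 * L0 \<le> c4 cHW * \<sigma>\<^sup>2 / \<Delta>\<^sup>2 * L0" using that L0_pos by (intro mult_right_mono divide_right_mono) auto
    then show ?thesis using I1 by linarith
  qed
  have I0: "0 < real I"
  proof -
    have "0 < 64 * \<sigma>\<^sup>2 / \<Delta>\<^sup>2 * L0" using sigma_pos \<Delta> L0_pos by simp
    then show ?thesis using part[OF c4(1)] by linarith
  qed
  then have J0: "0 < real J" using IJ by simp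
  show "0 < I" using I0 by simp
  show "64 * (L0 * (\<sigma>\<^sup>2 / real I)) \<le> \<Delta>\<^sup>2" by (rule variance_from_count[OF part[OF c4(1)] I0 \<Delta>])
  define vI where "vI = \<sigma>\<^sup>2 / real I"
  define vJ where "vJ = \<sigma>\<^sup>2 / real J"
  have v0: "0 < vI" "0 < vJ" using sigma_pos I0 J0 by (auto simp: vI_def vJ_def)
  have "4 * sqrt 2 * cHW * (L0 * vI) \<le> \<Delta>\<^sup>2" unfolding vI_def by (rule variance_from_count[OF part[OF c4(2)] I0 \<Delta>])
  then have "(4 * sqrt 2 * cHW * (L0 * vI))\<^sup>2 \<le> (\<Delta>\<^sup>2)\<^sup>2" using cHW_pos L0_pos v0 by (intro power_mono) auto
  then show "32 * (cHW * (L0 * (\<sigma>\<^sup>2 / real I)))\<^sup>2 \<le> (\<Delta>\<^sup>2)\<^sup>2" unfolding vI_def[symmetric] by (simp add: power_mult_distrib)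
  have "c5 cHW * (?k * vI) \<le> \<Delta>\<^sup>2" unfolding vI_def by (rule variance_from_count[OF I2 I0 \<Delta>])
  moreover have "c5 cHW * (?n * vJ) \<le> \<Delta>\<^sup>2" unfolding vJ_def by (rule variance_from_count[OF J2 J0 \<Delta>])
  ultimately have "(c5 cHW * (?k * vI)) * (c5 cHW * (?n * vJ)) \<le> \<Delta>\<^sup>2 * \<Delta>\<^sup>2" using c5 v0 L0_pos \<Delta> by (intro mult_mono) auto
  moreover have "(c5 cHW * (?k * vI)) * (c5 cHW * (?n * vJ)) = (c5 cHW * c5 cHW) * ((?k * ?n) * (vI * vJ))" by (simp only: ac_simps)
  moreover have "?k * ?n = real d * L0"
  proof -
    have "(real d * real K / real N * L0) * (real d * real N / real K * L0) = (real d * L0)\<^sup>2"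
      using NK by (simp add: power2_eq_square)
    then have "?k * ?n = sqrt ((real d * L0)\<^sup>2)" by (simp only: real_sqrt_mult[symmetric])
    then show ?thesis using L0_pos by simp
  qed
  moreover have "c5 cHW * c5 cHW = 64 * cHW" using cHW_pos by (simp add: c5_def)
  ultimately show "64 * (cHW * (real d * L0 * (\<sigma>\<^sup>2 / real I * (\<sigma>\<^sup>2 / real J)))) \<le> (\<Delta>\<^sup>2)\<^sup>2"
    unfolding vI_def[symmetric] vJ_def[symmetric] power2_eq_square[of "\<Delta>\<^sup>2"] by (simp only: mult.assoc)
qed

lemma transversal_unique:
  assumes "transversal S" "b \<in> S" "b' \<in> S" "veq d (\<mu> a) (\<mu> b)" "veq d (\<mu> a) (\<mu> b')"
  shows "b = b'"
proof -
  have "veq d (\<mu> b) (\<mu> b')" using assms(4,5) by (simp add: veq_def)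
  then show ?thesis using assms(1-3) unfolding transversal_def by blast
qed

text \<open>Strict inequality makes the minimiser unique, so the unspecified choice among ties
  cannot interfere.\<close>

lemma adc_out_correct:
  assumes S: "transversal S"
    and best: "\<And>a b j. a < N \<Longrightarrow> a \<notin> S \<Longrightarrow> b \<in> S \<Longrightarrow> veq d (\<mu> a) (\<mu> b) \<Longrightarrow> j \<in> S \<Longrightarrow> j \<noteq> b \<Longrightarrow>
        stat d (mm a) (mm b) < stat d (mm a) (mm j)"
  shows "adc_out PP S mm = Gstar d N \<mu>"
proof -
  have am: "arg_min_on (\<lambda>b. stat d (mm a) (mm b)) S = b" if a: "a < N" "a \<notin> S" "b \<in> S" "veq d (\<mu> a) (\<mu> b)" for a b
    unfolding arg_min_on_def arg_min_def
  proof (rule some_equality)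
    show "is_arg_min (\<lambda>b. stat d (mm a) (mm b)) (\<lambda>x. x \<in> S) b"
      using best[OF a] a(3) unfolding is_arg_min_def by (metis less_asym less_irrefl)
    fix x assume "is_arg_min (\<lambda>b. stat d (mm a) (mm b)) (\<lambda>x. x \<in> S) x"
    then show "x = b" using best[OF a, of x] a(3) unfolding is_arg_min_def by blast
  qed
  have grp: "insert b {a. a < N \<and> a \<notin> S \<and> arg_min_on (\<lambda>b. stat d (mm a) (mm b)) S = b} = {a. a < N \<and> veq d (\<mu> a) (\<mu> b)}"
    (is "?L = ?R") if b: "b \<in> S" for b
  proof (rule set_eqI)
    fix a
    show "a \<in> ?L \<longleftrightarrow> a \<in> ?R"
    proof (cases "a < N \<and> a \<notin> S")
      case True
      obtain b' where b': "b' \<in> S" "veq d (\<mu> a) (\<mu> b')" using transversal_rep[OF S] True by blast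
      have "veq d (\<mu> a) (\<mu> b) \<longleftrightarrow> b' = b"
        using transversal_unique[OF S b'(1) b b'(2)] b'(2) by blast
      then show ?thesis using am[OF _ _ b'] True b by auto
    next
      case False
      then show ?thesis using S b by (auto simp: transversal_def veq_def)
    qed
  qed
  have "adc_out PP S mm = (\<lambda>b. {a. a < N \<and> veq d (\<mu> a) (\<mu> b)}) ` S"
    unfolding adc_out_def by (intro image_cong refl) (use grp in simp)
  also have "\<dots> = Gstar d N \<mu>"
  proof
    show "(\<lambda>b. {a. a < N \<and> veq d (\<mu> a) (\<mu> b)}) ` S \<subseteq> Gstar d N \<mu>" using S by (auto simp: Gstar_def transversal_def)
    show "Gstar d N \<mu> \<subseteq> (\<lambda>b. {a. a < N \<and> veq d (\<mu> a) (\<mu> b)}) ` S"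
    proof
      fix G assume "G \<in> Gstar d N \<mu>"
      then obtain c where c: "c < N" "G = {a. a < N \<and> veq d (\<mu> a) (\<mu> c)}" by (auto simp: Gstar_def)
      obtain b where b: "b \<in> S" "veq d (\<mu> c) (\<mu> b)" by (rule transversal_rep[OF S c(1)])
      then have "G = {a. a < N \<and> veq d (\<mu> a) (\<mu> b)}" unfolding c by (auto simp: veq_def)
      then show "G \<in> (\<lambda>b. {a. a < N \<and> veq d (\<mu> a) (\<mu> b)}) ` S" using b(1) by blast
    qed
  qed
  finally show ?thesis .
qed

text \<open>At most N K wrong comparisons, each of probability 2 exp(-L0) = \<delta> / (9 N
  K).\<close>

lemma adc_tail:
  fixes \<Delta> :: real
  assumes S: "transversal S" and \<Delta>: "0 < \<Delta>\<^sup>2" "\<Delta>\<^sup>2 \<le> ds\<^sup>2"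
  shows "\<exists>E\<in>sets \<Omega>. {\<omega> \<in> space \<Omega>. adc_out PP S (means (adc_n PP (\<delta>/3) \<Delta> S) \<omega>) \<noteq> Gstar d N \<mu>} \<subseteq> E \<and> \<Omega>.prob E \<le> \<delta> / 9"
proof -
  define I where "I = adc_I PP (\<delta>/3) \<Delta>"
  define J where "J = adc_J PP (\<delta>/3) \<Delta>"
  note cnt = adc_counts[OF \<Delta>(1), folded I_def J_def]
  have SN: "S \<subseteq> {..<N}" using S by (simp add: transversal_def)
  have finS: "finite S" using SN finite_subset by blast
  define rep where "rep a = (SOME b. b \<in> S \<and> veq d (\<mu> a) (\<mu> b))" for a
  have rep: "rep a \<in> S" "veq d (\<mu> a) (\<mu> (rep a))" if "a < N" for a
    using someI_ex[of "\<lambda>b. b \<in> S \<and> veq d (\<mu> a) (\<mu> b)"] transversal_rep[OF S that] unfolding rep_def by blast+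
  let ?Q = "{(a, j). a < N \<and> a \<notin> S \<and> j \<in> S \<and> j \<noteq> rep a}"
  have Qs: "?Q \<subseteq> {..<N} \<times> S" by auto
  have fQ: "finite ?Q" by (rule finite_subset[OF Qs]) (use finS in auto)
  have cQ: "card ?Q \<le> N * K" using card_mono[OF _ Qs] finS S by (simp add: card_cartesian_product transversal_def)
  let ?B = "\<lambda>(a, j). {\<omega> \<in> space \<Omega>. D2 a j + lin (vdiff (\<mu> a) (\<mu> j)) a I j J \<omega> \<le> quad a I (rep a) J \<omega> - quad a I j J \<omega>}"
  have "\<exists>E\<in>sets \<Omega>. ?B i \<subseteq> E \<and> \<Omega>.prob E \<le> 2 * exp (- L0)" if "i \<in> ?Q" for i
  proof -
    obtain a j where i0: "i = (a, j)" by (cases i)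
    then have i: "i = (a, j)" "a < N" "a \<notin> S" "j \<in> S" "j \<noteq> rep a" using that by auto
    have ne: "\<not> veq d (\<mu> a) (\<mu> j)"
      using transversal_unique[OF S i(4) rep(1)[OF i(2)] _ rep(2)[OF i(2)]] i(5) by blast
    have lt: "rep a < N" "j < N" "a \<noteq> rep a" "a \<noteq> j" "rep a \<noteq> j" using rep(1)[OF i(2)] i SN by auto
    have G: "\<Delta>\<^sup>2 \<le> D2 a j" using Delta_star_sq_le[OF i(2) lt(2) ne] \<Delta> by linarith
    show ?thesis unfolding i(1) prod.case
      by (rule adc_pair_tail[OF i(2) lt cnt(1,2) less_imp_le[OF L0_pos] G \<Delta>(1) refl refl cnt(3-5)])
  qed
  then have "\<exists>E\<in>sets \<Omega>. (\<Union>i\<in>?Q. ?B i) \<subseteq> E \<and> \<Omega>.prob E \<le> real (card ?Q) * (2 * exp (- L0))" by (rule finite_union_tail[OF fQ])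
  then obtain E where E: "E \<in> sets \<Omega>" "(\<Union>i\<in>?Q. ?B i) \<subseteq> E" "\<Omega>.prob E \<le> real (card ?Q) * (2 * exp (- L0))"
    by (elim bexE conjE) (intro that)
  have cE: "real (card ?Q) * (2 * exp (- L0)) \<le> \<delta> / 9"
  proof -
    have "real (card ?Q) \<le> real N * real K" unfolding of_nat_mult[symmetric] of_nat_le_iff by (rule cQ)
    then have "real (card ?Q) * (2 * exp (- L0)) \<le> real N * real K * (2 * exp (- L0))" by (rule mult_right_mono) simp
    also have "\<dots> = \<delta> / 9" unfolding exp_L0 using NK by simp
    finally show ?thesis .
  qed
  have sE: "{\<omega> \<in> space \<Omega>. adc_out PP S (means (adc_n PP (\<delta>/3) \<Delta> S) \<omega>) \<noteq> Gstar d N \<mu>} \<subseteq> (\<Union>i\<in>?Q. ?B i)"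
  proof (rule subsetI, rule ccontr)
    fix \<omega> assume w: "\<omega> \<in> {\<omega> \<in> space \<Omega>. adc_out PP S (means (adc_n PP (\<delta>/3) \<Delta> S) \<omega>) \<noteq> Gstar d N \<mu>}" "\<omega> \<notin> (\<Union>i\<in>?Q. ?B i)"
    let ?mm = "means (adc_n PP (\<delta>/3) \<Delta> S) \<omega>"
    have "adc_out PP S ?mm = Gstar d N \<mu>"
    proof (rule adc_out_correct[OF S])
      fix a b j assume a: "a < N" "a \<notin> S" "b \<in> S" "veq d (\<mu> a) (\<mu> b)" "j \<in> S" "j \<noteq> b"
      have b: "b = rep a" by (rule transversal_unique[OF S a(3) rep(1)[OF a(1)] a(4) rep(2)[OF a(1)]])
      have u0: "vdiff (\<mu> a) (\<mu> b) i = 0" if "i < d" for i using a(4) that by (simp add: veq_def vdiff_def)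
      have "lin (vdiff (\<mu> a) (\<mu> b)) a I b J \<omega> = 0" unfolding lin_def by (simp add: ip_zero_left[OF u0])
      moreover have "D2 a b = 0" using a(4) by (simp add: D2_eq_0_iff)
      ultimately have 1: "stat d (?mm a) (?mm b) = quad a I b J \<omega>"
        unfolding stat_noise using a by (simp add: adc_n_def I_def J_def)
      have 2: "stat d (?mm a) (?mm j) = D2 a j + lin (vdiff (\<mu> a) (\<mu> j)) a I j J \<omega> + quad a I j J \<omega>"
        unfolding stat_noise using a by (simp add: adc_n_def I_def J_def)
      have "(a, j) \<in> ?Q" using a b by auto
      then have "\<omega> \<notin> ?B (a, j)" using w(2) by blast
      then have "\<not> D2 a j + lin (vdiff (\<mu> a) (\<mu> j)) a I j J \<omega> \<le> quad a I b J \<omega> - quad a I j J \<omega>" using w(1) b by simp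
      then show "stat d (?mm a) (?mm b) < stat d (?mm a) (?mm j)" unfolding 1 2 by linarith
    qed
    then show False using w(1) by simp
  qed
  show ?thesis by (intro bexI[OF _ E(1)] conjI order_trans[OF E(3) cE] subset_trans[OF sE E(2)])
qed

end

section \<open>The rounds of ACB\<close>

text \<open>Lets the block sizes be set to 0 beyond N, as reading a fresh block requires.\<close>

lemma adc_out_cong:
  assumes "S \<subseteq> {..<pN P}" "\<And>a. a < pN P \<Longrightarrow> mm a = mm' a"
  shows "adc_out P S mm = adc_out P S mm'"
proof -
  have e: "stat (pd P) (mm a) (mm b) = stat (pd P) (mm' a) (mm' b)" if "a < pN P" "b \<in> S" for a b
    using assms that by auto
  have "arg_min_on (\<lambda>b. stat (pd P) (mm a) (mm b)) S = arg_min_on (\<lambda>b. stat (pd P) (mm' a) (mm' b)) S" if "a < pN P" for a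
    unfolding arg_min_on_def arg_min_def is_arg_min_def
    by (rule arg_cong[where f=Eps], rule ext) (use e[OF that] in auto)
  then show ?thesis unfolding adc_out_def by (intro image_cong refl arg_cong2[where f=insert] Collect_cong) auto
qed

lemma adc_count_mono:
  assumes "0 < \<Delta>\<^sup>2" "\<Delta>\<^sup>2 \<le> \<Delta>'\<^sup>2" "0 < pcHW P" "0 \<le> adc_L0 P \<delta>"
  shows "adc_J P \<delta> \<Delta>' \<le> adc_J P \<delta> \<Delta>" "adc_I P \<delta> \<Delta>' \<le> adc_I P \<delta> \<Delta>"
proof -
  have d: "c * (psig P)\<^sup>2 / \<Delta>'\<^sup>2 * x \<le> c * (psig P)\<^sup>2 / \<Delta>\<^sup>2 * x" if "0 \<le> c" "0 \<le> x" for c x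
    using that assms by (intro mult_right_mono divide_left_mono mult_pos_pos) auto
  have "0 \<le> c4 (pcHW P)" "0 \<le> c5 (pcHW P)" using assms by (auto simp: c4_def c5_def le_max_iff_disj)
  then show "adc_J P \<delta> \<Delta>' \<le> adc_J P \<delta> \<Delta>" "adc_I P \<delta> \<Delta>' \<le> adc_I P \<delta> \<Delta>"
    unfolding adc_J_def adc_I_def using assms
    by (intro nat_mono ceiling_mono max.mono d; simp)+
qed

lemma roundK_le_1:
  fixes \<kappa> :: "nat set set option \<Rightarrow> nat \<Rightarrow> src \<Rightarrow> ennreal"
  assumes "\<And>G t \<omega>. \<kappa> G t \<omega> \<le> 1"
  shows "roundK P \<delta> l p f tot \<omega> \<kappa> \<le> 1"
proof -
  have "cur \<omega> ((\<lambda>_. 0), 0, tot) = \<omega>" by (simp add: cur_def adv_def)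
  then show ?thesis using roundK_simulates[of P \<delta> l p f "((\<lambda>_. 0), 0, tot)" \<omega> \<kappa>] assms by (simp split: prod.splits)
qed

text \<open>Telescoping with 1/(L+1)^2 <= 1/L - 1/(L+1). For L = 0 the convention 1/0 = 0 keeps the
  statement true.\<close>

lemma sum_inverse_squares: "(\<Sum>l<L. 1 / (real (Suc l))\<^sup>2) \<le> 2 - 1 / real L"
proof (induction L)
  case (Suc L)
  show ?case
  proof (cases "L = 0")
    case False
    have "1 / real (Suc L) + 1 / (real (Suc L))\<^sup>2 \<le> 1 / real L"
      using False by (simp add: divide_simps power2_eq_square) (simp add: algebra_simps)
    then show ?thesis using Suc by simp
  qed simp
qed simp

context acb
begin

abbreviation "ts \<equiv> theta_star d N \<mu>"

text \<open>The random guess handed to ADC is at least ds / sqrt 8 by \<open>gap2_bounds\<close>, so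
  its sample sizes are at most those for this value.\<close>

definition FC :: "nat \<Rightarrow> nat" where
  "FC p = K * (2 * n'_p PP \<delta> p) + (K * (2 * adc_J PP (\<delta>/3) (ds / sqrt 8)) + N * (2 * adc_I PP (\<delta>/3) (ds / sqrt 8)))"

text \<open>The gap estimate fails with 2 \<delta> / 3; for fixed means behind a good estimate, ADC
  with parameter \<delta> / 3 fails with \<delta> / 9.\<close>

lemma finish_bound:
  fixes \<kappa> :: "nat set set \<Rightarrow> nat \<Rightarrow> src \<Rightarrow> ennreal"
  assumes \<kappa>: "\<And>G t. \<kappa> G t \<in> borel_measurable SRC" "\<And>G t \<omega>. \<kappa> G t \<omega> \<le> 1"
    and S: "S \<subseteq> {..<N}" "card S = K" "\<And>a b. a \<in> S \<Longrightarrow> b \<in> S \<Longrightarrow> a \<noteq> b \<Longrightarrow> (Dp p)\<^sup>2 / 16 < D2 a b"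
    and q: "0 \<le> q" "\<And>t. t \<le> tot + FC p \<Longrightarrow> ex (\<kappa> (Gstar d N \<mu>) t) \<le> q"
  shows "ex (\<lambda>\<omega>. finishK PP \<delta> p S tot \<omega> \<kappa>) \<le> q + 7 * \<delta> / 9"
proof -
  define n where "n = n'_p PP \<delta> p"
  define m where "m = (\<lambda>a. if a \<in> S then n else 0)"
  have finS: "finite S" using S(1) finite_subset by blast
  have tr: "transversal S"
  proof -
    have "\<not> veq d (\<mu> a) (\<mu> b)" if "a \<in> S" "b \<in> S" "a \<noteq> b" for a b
    proof -
      have "D2 a b \<noteq> 0" using S(3)[OF that] zero_le_power2[of "Dp p"] by linarith
      then show ?thesis by (simp add: D2_eq_0_iff)
    qed
    then show ?thesis using S(1,2) by (auto simp: transversal_def)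
  qed
  define h where "h mm \<omega> = adcK PP (\<delta>/3) S (tot + (\<Sum>a\<in>S. 2 * n)) mm \<omega> \<kappa>" for mm \<omega>
  have h: "(\<lambda>x. h (fst x) (snd x)) \<in> borel_measurable (MEANS \<Otimes>\<^sub>M SRC)" unfolding h_def by (rule adcK_measurable[OF \<kappa>(1) finS])
  have h1: "h mm \<omega> \<le> 1" for mm \<omega> unfolding h_def adcK_def Let_def by (rule \<kappa>(2))
  have "\<exists>E\<in>sets \<Omega>. {\<omega> \<in> space \<Omega>. \<not> gap_ok S (means m \<omega>)} \<subseteq> E \<and> \<Omega>.prob E \<le> 2 * \<delta> / 3"
    unfolding m_def n_def by (rule gap_tail[OF S(1,2)]) (rule S(3))
  then obtain E where E: "E \<in> sets \<Omega>" "{\<omega> \<in> space \<Omega>. \<not> gap_ok S (means m \<omega>)} \<subseteq> E" "\<Omega>.prob E \<le> 2 * \<delta> / 3"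
    by (elim bexE conjE) (intro that)
  have main: "ex (h mm) \<le> \<delta> / 9 + q" if g: "gap_ok S mm" for mm
  proof -
    note gb = gap2_bounds[OF tr g]
    define \<Delta> where "\<Delta> = sqrt (gap2 d S mm) / sqrt 2"
    have ds: "0 < ds\<^sup>2" using Delta_star_pos by simp
    have "0 \<le> gap2 d S mm" using gb(1) ds by linarith
    then have D2: "\<Delta>\<^sup>2 = gap2 d S mm / 2" by (simp add: \<Delta>_def power_divide)
    have e8: "(ds / sqrt 8)\<^sup>2 = ds\<^sup>2 / 8" by (simp add: power_divide)
    have D: "0 < \<Delta>\<^sup>2" "\<Delta>\<^sup>2 \<le> ds\<^sup>2" "(ds / sqrt 8)\<^sup>2 \<le> \<Delta>\<^sup>2" "0 < (ds / sqrt 8)\<^sup>2" unfolding e8 D2 using gb ds by linarith+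
    define m' where "m' = adc_n PP (\<delta>/3) \<Delta> S"
    define m'' where "m'' = (\<lambda>a. if a < N then m' a else 0)"
    define T where "T = tot + (\<Sum>a\<in>S. 2 * n) + (\<Sum>a<N. 2 * m' a)"
    have cong: "adc_out PP S (means m' \<omega>) = adc_out PP S (means m'' \<omega>)" for \<omega>
      by (rule adc_out_cong) (use S(1) in \<open>auto simp: means_def m''_def\<close>)
    have hm: "h mm \<omega> = \<kappa> (adc_out PP S (means m'' \<omega>)) T (adv (\<lambda>a. 2 * m'' a) 0 \<omega>)" for \<omega>
    proof -
      have "(\<lambda>a. if a < N then 2 * m' a else 0) = (\<lambda>a. 2 * m'' a)" by (auto simp: m''_def)
      moreover have "adc_n PP (\<delta>/3) (sqrt (gap2 (pd PP) S mm) / sqrt 2) S = m'" by (simp add: m'_def \<Delta>_def)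
      ultimately show ?thesis unfolding h_def adcK_def Let_def T_def by (simp only: cong params.simps)
    qed
    have T: "T \<le> tot + FC p"
    proof -
      have JI: "adc_J PP (\<delta>/3) \<Delta> \<le> adc_J PP (\<delta>/3) (ds / sqrt 8)" "adc_I PP (\<delta>/3) \<Delta> \<le> adc_I PP (\<delta>/3) (ds / sqrt 8)"
        using D(3,4) cHW_pos L0_pos by (auto intro!: adc_count_mono)
      have "(\<Sum>a<N. 2 * m' a) \<le> (\<Sum>a<N. (if a \<in> S then 2 * adc_J PP (\<delta>/3) (ds / sqrt 8) else 0) + 2 * adc_I PP (\<delta>/3) (ds / sqrt 8))"
        using JI by (intro sum_mono) (auto simp: m'_def adc_n_def)
      also have "\<dots> = (\<Sum>a\<in>{..<N} \<inter> S. 2 * adc_J PP (\<delta>/3) (ds / sqrt 8)) + N * (2 * adc_I PP (\<delta>/3) (ds / sqrt 8))"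
        unfolding sum.distrib by (subst sum.inter_restrict) simp_all
      also have "{..<N} \<inter> S = S" using S(1) by auto
      finally show ?thesis using S(2) by (simp add: T_def FC_def n_def)
    qed
    obtain E where E: "E \<in> sets \<Omega>" "{\<omega> \<in> space \<Omega>. adc_out PP S (means m' \<omega>) \<noteq> Gstar d N \<mu>} \<subseteq> E" "\<Omega>.prob E \<le> \<delta> / 9"
      using adc_tail[OF tr D(1,2), folded m'_def] by (elim bexE conjE) (intro that)
    have "ex (\<lambda>\<omega>. \<kappa> (adc_out PP S (means m'' \<omega>)) T (adv (\<lambda>a. 2 * m'' a) 0 \<omega>)) \<le> \<delta> / 9 + q"
    proof (rule ex_means_le[where n=m'' and h="\<lambda>mm \<omega>. \<kappa> (adc_out PP S mm) T \<omega>" and Gd="\<lambda>mm. adc_out PP S mm = Gstar d N \<mu>", OF _ _ \<kappa>(2) E(1) _ E(3) q(1)])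
      show "(\<lambda>x. \<kappa> (adc_out PP S (fst x)) T (snd x)) \<in> borel_measurable (MEANS \<Otimes>\<^sub>M SRC)"
        by (rule measurable_adc_out[OF finS measurable_fst_MEANS, where F="\<lambda>G x. \<kappa> G T (snd x)"])
           (rule measurable_compose[OF measurable_snd_SRC \<kappa>(1)])
      show "{\<omega> \<in> space \<Omega>. adc_out PP S (means m'' \<omega>) \<noteq> Gstar d N \<mu>} \<subseteq> E" using E(2) unfolding cong .
      show "ex (\<kappa> (adc_out PP S mm) T) \<le> q" if "adc_out PP S mm = Gstar d N \<mu>" for mm
        unfolding that by (rule q(2)[OF T])
    qed (simp add: m''_def)
    then show ?thesis unfolding hm[abs_def] .
  qed
  have "ex (\<lambda>\<omega>. h (means m \<omega>) (adv (\<lambda>a. 2 * m a) 0 \<omega>)) \<le> 2 * \<delta> / 3 + (\<delta> / 9 + q)"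
    by (rule ex_means_le[where n=m and h=h and Gd="gap_ok S", OF _ h h1 E _ main]) (use S(1) \<delta> q(1) in \<open>auto simp: m_def\<close>)
  then show ?thesis unfolding h_def m_def finishK_adcK[OF n_def] by simp
qed

definition th :: "nat \<Rightarrow> nat \<Rightarrow> real" where "th l p = max (theta_pl PP p l) (1 / real N)"

text \<open>T_max plus the possible overrun of the last draw.\<close>

definition SC :: "nat \<Rightarrow> nat \<Rightarrow> real" where
  "SC l p = sri_Tmax PP (delta_l \<delta> l) (Dp p) (th l p)
     + 2 * (\<Sum>s\<in>{sri_s0 PP (delta_l \<delta> l) (Dp p) (th l p)..sri_r PP (delta_l \<delta> l) (th l p)}. real (sri_n PP (Dp p) s))
     + 2 * real (sri_nmax PP (delta_l \<delta> l) (Dp p) (th l p))"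

definition ez :: "nat \<Rightarrow> nat \<Rightarrow> bool" where "ez l p \<longleftrightarrow> Dp p \<le> ds \<and> th l p \<le> ts"

lemma delta_l_bounds: "0 < delta_l \<delta> l" "delta_l \<delta> l < 1"
proof -
  have "1 \<le> (real l + 1) ^ 3" by simp
  then have "\<delta> < 6 * (real l + 1) ^ 3" using \<delta> by linarith
  then show "0 < delta_l \<delta> l" "delta_l \<delta> l < 1" using \<delta> by (auto simp: delta_l_def)
qed

lemma sri_round: "sri cHW d N K \<sigma> \<nu> \<mu> (delta_l \<delta> l) (Dp p) (th l p)"
proof unfold_locales
  show "0 < delta_l \<delta> l" "delta_l \<delta> l < 1" by (rule delta_l_bounds)+
  show "0 < Dp p" by (rule Dp_pos)
  show "0 < th l p" using NK by (simp add: th_def theta_pl_def less_max_iff_disj)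
  have "1 / real N \<le> 1 / real K" using NK by (intro divide_left_mono) auto
  moreover have "theta_pl PP p l \<le> 1 / real K"
    unfolding theta_pl_def using NK by (intro divide_left_mono) auto
  ultimately show "th l p \<le> 1 / real K" by (simp add: th_def)
qed

lemma SC_nonneg: "0 \<le> SC l p"
  unfolding SC_def sri_Tmax_def Let_def by (intro add_nonneg_nonneg mult_nonneg_nonneg sum_nonneg divide_nonneg_nonneg) auto

lemma SRI_round_bound:
  fixes \<kappa> :: "nat set \<Rightarrow> nat \<Rightarrow> src \<Rightarrow> ennreal"
  assumes \<kappa>: "\<And>S t. finite S \<Longrightarrow> \<kappa> S t \<in> borel_measurable SRC" "\<And>S t \<omega>. \<kappa> S t \<omega> \<le> 1"
    and q: "0 \<le> q" "\<And>S t. S \<subseteq> {..<N} \<Longrightarrow> (\<And>a b. a \<in> S \<Longrightarrow> b \<in> S \<Longrightarrow> a \<noteq> b \<Longrightarrow> (Dp p)\<^sup>2 / 16 < D2 a b)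
        \<Longrightarrow> (ez l p \<Longrightarrow> card S = K) \<Longrightarrow> real t \<le> real tot + SC l p \<Longrightarrow> ex (\<kappa> S t) \<le> q"
  shows "ex (\<lambda>\<omega>. SRIK PP (delta_l \<delta> l) (Dp p) (th l p) tot \<omega> \<kappa>) \<le> q + delta_l \<delta> l / 2"
proof -
  interpret S: sri cHW d N K \<sigma> \<nu> \<mu> "delta_l \<delta> l" "Dp p" "th l p" by (rule sri_round)
  show ?thesis
  proof (rule S.SRI_bound[OF \<kappa> q(1)])
    fix S t assume O: "S.OUT tot S t"
    have "real t \<le> real tot + SC l p" using O by (simp add: S.OUT_def S.over_def SC_def)
    then show "ex (\<kappa> S t) \<le> q" using O by (intro q(2)) (auto simp: S.OUT_def S.separated_def S.easy_def ez_def)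
  qed
qed

text \<open>Finishing happens at most once in a run, so its 7 \<delta> / 9 is contained in Q and not
  added per call. Leaving the round with \<open>None\<close> has to be bounded only if no pair of
  guesses in it was valid, since a valid one yields K arms.\<close>

lemma round_bound:
  fixes \<kappa> :: "nat set set option \<Rightarrow> nat \<Rightarrow> src \<Rightarrow> ennreal"
  assumes \<kappa>: "\<And>G t. \<kappa> G t \<in> borel_measurable SRC" "\<And>G t \<omega>. \<kappa> G t \<omega> \<le> 1" and Q: "0 \<le> Q"
    and some: "\<And>t. real t \<le> B \<Longrightarrow> ex (\<kappa> (Some (Gstar d N \<mu>)) t) + 7 * \<delta> / 9 \<le> Q"
  shows "(\<And>t. real t \<le> real tot + (\<Sum>i\<in>{p..<p+f}. SC l i) \<Longrightarrow> (\<And>i. p \<le> i \<Longrightarrow> i < p + f \<Longrightarrow> \<not> ez l i) \<Longrightarrow> ex (\<kappa> None t) \<le> Q)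
    \<Longrightarrow> (\<And>i. p \<le> i \<Longrightarrow> i < p + f \<Longrightarrow> real tot + (\<Sum>i\<in>{p..<p+f}. SC l i) + real (FC i) \<le> B)
    \<Longrightarrow> ex (\<lambda>\<omega>. roundK PP \<delta> l p f tot \<omega> \<kappa>) \<le> real f * (delta_l \<delta> l / 2) + Q"
proof (induction f arbitrary: p tot)
  case 0
  then show ?case using 0(1)[of tot] by simp
next
  case (Suc f)
  have sum: "(\<Sum>i\<in>{p..<p+Suc f}. SC l i) = SC l p + (\<Sum>i\<in>{Suc p..<Suc p+f}. SC l i)"
    by (simp add: sum.atLeast_Suc_lessThan)
  have rest: "0 \<le> (\<Sum>i\<in>{Suc p..<Suc p+f}. SC l i)" by (intro sum_nonneg SC_nonneg)
  have dl: "0 \<le> real f * (delta_l \<delta> l / 2)" using delta_l_bounds(1)[of l] by simp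
  define \<kappa>' where "\<kappa>' S t \<omega> = (if card S = pK PP then finishK PP \<delta> p S t \<omega> (\<lambda>G. \<kappa> (Some G)) else roundK PP \<delta> l (Suc p) f t \<omega> \<kappa>)" for S t \<omega>
  have rk1: "roundK PP \<delta> l p f t \<omega> \<kappa> \<le> 1" for p f t \<omega>
    by (rule roundK_le_1[OF \<kappa>(2)])
  have "ex (\<lambda>\<omega>. SRIK PP (delta_l \<delta> l) (Dp p) (th l p) tot \<omega> \<kappa>') \<le> (real f * (delta_l \<delta> l / 2) + Q) + delta_l \<delta> l / 2"
  proof (rule SRI_round_bound)
    show "\<kappa>' S t \<in> borel_measurable SRC" if "finite S" for S t
      unfolding \<kappa>'_def using roundK_measurable[of \<kappa>, OF \<kappa>(1)] finishK_measurable[of "\<lambda>G. \<kappa> (Some G)", OF \<kappa>(1) that] by simp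
    show "\<kappa>' S t \<omega> \<le> 1" for S t \<omega>
      unfolding \<kappa>'_def finishK_def Let_def using rk1 \<kappa>(2) by simp
    show "0 \<le> real f * (delta_l \<delta> l / 2) + Q" using dl Q by simp
    fix S t
    assume S: "S \<subseteq> {..<N}" "\<And>a b. a \<in> S \<Longrightarrow> b \<in> S \<Longrightarrow> a \<noteq> b \<Longrightarrow> (Dp p)\<^sup>2 / 16 < D2 a b" "ez l p \<Longrightarrow> card S = K"
      and t: "real t \<le> real tot + SC l p"
    show "ex (\<kappa>' S t) \<le> real f * (delta_l \<delta> l / 2) + Q"
    proof (cases "card S = K")
      case True
      have "ex (\<lambda>\<omega>. finishK PP \<delta> p S t \<omega> (\<lambda>G. \<kappa> (Some G))) \<le> (Q - 7 * \<delta> / 9) + 7 * \<delta> / 9"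
      proof (rule finish_bound[OF \<kappa>(1) \<kappa>(2) S(1) True S(2)])
        \<comment> \<open>Instance at total 0, used only to see that Q - 7 \<delta> / 9 is
          nonnegative.\<close>
        have "ex (\<kappa> (Some (Gstar d N \<mu>)) 0) + 7 * \<delta> / 9 \<le> Q"
        proof (rule some)
          show "real 0 \<le> B" using Suc.prems(2)[of p] rest SC_nonneg[of l p] unfolding sum by simp
        qed
        then show "0 \<le> Q - 7 * \<delta> / 9" using ex_nonneg[of "\<kappa> (Some (Gstar d N \<mu>)) 0"] by linarith
        fix t' assume "t' \<le> t + FC p"
        then have "real t' \<le> real t + real (FC p)" by linarith
        also have "\<dots> \<le> B" using Suc.prems(2)[of p] t rest unfolding sum by simp
        finally show "ex (\<kappa> (Some (Gstar d N \<mu>)) t') \<le> Q - 7 * \<delta> / 9" using some[of t'] by linarith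
      qed
      then show ?thesis using True dl by (simp add: \<kappa>'_def[abs_def])
    next
      case False
      then have nez: "\<not> ez l p" using S(3) by blast
      have "ex (\<lambda>\<omega>. roundK PP \<delta> l (Suc p) f t \<omega> \<kappa>) \<le> real f * (delta_l \<delta> l / 2) + Q"
      proof (rule Suc.IH)
        fix t' assume t': "real t' \<le> real t + (\<Sum>i\<in>{Suc p..<Suc p+f}. SC l i)" "\<And>i. Suc p \<le> i \<Longrightarrow> i < Suc p + f \<Longrightarrow> \<not> ez l i"
        show "ex (\<kappa> None t') \<le> Q"
        proof (rule Suc.prems(1))
          show "real t' \<le> real tot + (\<Sum>i\<in>{p..<p+Suc f}. SC l i)" using t t'(1) unfolding sum by linarith
          fix i assume "p \<le> i" "i < p + Suc f"
          then show "\<not> ez l i" using nez t'(2)[of i] by (cases "i = p") auto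
        qed
      next
        fix i assume "Suc p \<le> i" "i < Suc p + f"
        then have "real tot + (\<Sum>i\<in>{p..<p+Suc f}. SC l i) + real (FC i) \<le> B" by (intro Suc.prems(2)) auto
        then show "real t + (\<Sum>i\<in>{Suc p..<Suc p+f}. SC l i) + real (FC i) \<le> B" using t unfolding sum by linarith
      qed
      then show ?thesis using False by (simp add: \<kappa>'_def[abs_def])
    qed
  qed
  moreover have "roundK PP \<delta> l p (Suc f) tot \<omega> \<kappa> = SRIK PP (delta_l \<delta> l) (Dp p) (th l p) tot \<omega> \<kappa>'" for \<omega>
    unfolding roundK.simps th_def \<kappa>'_def[abs_def] by simp
  ultimately show ?case by (simp add: algebra_simps add_divide_distrib)
qed

definition TC :: "nat \<Rightarrow> real" where "TC L = (\<Sum>l<L. \<Sum>p<Suc l. SC l p)"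

text \<open>The induction removes the last round by absorbing it into the continuation, so \<kappa>
  and Q must be general.\<close>

lemma rounds_bound:
  fixes \<kappa> :: "nat set set option \<Rightarrow> nat \<Rightarrow> src \<Rightarrow> ennreal"
  assumes "\<And>G t. \<kappa> G t \<in> borel_measurable SRC" "\<And>G t \<omega>. \<kappa> G t \<omega> \<le> 1" "0 \<le> Q"
    and "\<And>t. real t \<le> B \<Longrightarrow> ex (\<kappa> (Some (Gstar d N \<mu>)) t) + 7 * \<delta> / 9 \<le> Q"
    and "\<And>t. real t \<le> TC L \<Longrightarrow> (\<And>l p. l < L \<Longrightarrow> p \<le> l \<Longrightarrow> \<not> ez l p) \<Longrightarrow> ex (\<kappa> None t) \<le> Q"
    and "\<And>p. p < L \<Longrightarrow> TC L + real (FC p) \<le> B"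
  shows "ex (\<lambda>\<omega>. roundsK PP \<delta> L \<omega> \<kappa>) \<le> (\<Sum>l<L. real (Suc l) * (delta_l \<delta> l / 2)) + Q"
  using assms
proof (induction L arbitrary: \<kappa> Q)
  case 0
  then show ?case using 0(5)[of 0] by (simp add: TC_def)
next
  case (Suc L)
  note prems = Suc.prems
  define \<kappa>' where "\<kappa>' G t \<omega> = (case G of None \<Rightarrow> roundK PP \<delta> L 0 (Suc L) t \<omega> \<kappa> | Some _ \<Rightarrow> \<kappa> G t \<omega>)" for G t \<omega>
  let ?e = "real (Suc L) * (delta_l \<delta> L / 2)"
  have e0: "0 \<le> ?e" using delta_l_bounds(1)[of L] by simp
  have TCS: "TC (Suc L) = TC L + (\<Sum>p\<in>{0..<0+Suc L}. SC L p)" by (simp add: TC_def atLeast0LessThan)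
  have r0: "0 \<le> (\<Sum>p\<in>{0..<0+Suc L}. SC L p)" by (intro sum_nonneg SC_nonneg)
  have "ex (\<lambda>\<omega>. roundsK PP \<delta> L \<omega> \<kappa>') \<le> (\<Sum>l<L. real (Suc l) * (delta_l \<delta> l / 2)) + (?e + Q)"
  proof (rule Suc.IH)
    show "\<kappa>' G t \<in> borel_measurable SRC" for G t
      unfolding \<kappa>'_def using roundK_measurable[of \<kappa>, OF prems(1)] prems(1)[of G t] by (cases G) (simp_all del: roundK.simps)
    show "\<kappa>' G t \<omega> \<le> 1" for G t \<omega> unfolding \<kappa>'_def using roundK_le_1[OF prems(2)] prems(2) by (cases G) (simp_all del: roundK.simps)
    show "0 \<le> ?e + Q" using e0 prems(3) by simp
    show "ex (\<kappa>' (Some (Gstar d N \<mu>)) t) + 7 * \<delta> / 9 \<le> ?e + Q" if "real t \<le> B" for t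
      using prems(4)[OF that] e0 by (simp add: \<kappa>'_def[abs_def])
    show "TC L + real (FC p) \<le> B" if "p < L" for p using prems(6)[of p] that r0 unfolding TCS by simp
    fix t assume t: "real t \<le> TC L" "\<And>l p. l < L \<Longrightarrow> p \<le> l \<Longrightarrow> \<not> ez l p"
    have "ex (\<lambda>\<omega>. roundK PP \<delta> L 0 (Suc L) t \<omega> \<kappa>) \<le> ?e + Q"
    proof (rule round_bound[where \<kappa>=\<kappa> and B=B and Q=Q, OF prems(1-4)])
      fix t' assume t': "real t' \<le> real t + (\<Sum>i\<in>{0..<0 + Suc L}. SC L i)" "\<And>i. 0 \<le> i \<Longrightarrow> i < 0 + Suc L \<Longrightarrow> \<not> ez L i"
      show "ex (\<kappa> None t') \<le> Q"
      proof (rule prems(5))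
        show "real t' \<le> TC (Suc L)" using t' t unfolding TCS by linarith
        fix l p assume "l < Suc L" "p \<le> l"
        then show "\<not> ez l p" using t(2)[of l p] t'(2)[of p] by (cases "l = L") auto
      qed
    next
      fix i assume "0 \<le> i" "i < 0 + Suc L"
      then show "real t + (\<Sum>i\<in>{0..<0 + Suc L}. SC L i) + real (FC i) \<le> B" using prems(6)[of i] t(1) unfolding TCS by simp
    qed
    then show "ex (\<kappa>' None t) \<le> ?e + Q" by (simp add: \<kappa>'_def[abs_def] del: roundK.simps)
  qed
  then show ?case by (simp add: \<kappa>'_def[abs_def] add.assoc del: roundK.simps)
qed

text \<open>Round l makes l + 1 calls with failure \<delta> / (12 (l+1)^3) each; this is what the
  cube in \<open>delta_l\<close> is for.\<close>

lemma sum_delta_l: "(\<Sum>l<L. real (Suc l) * (delta_l \<delta> l / 2)) \<le> \<delta> / 6"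
proof -
  have "real (Suc l) * (delta_l \<delta> l / 2) = \<delta> / 12 * (1 / (real (Suc l))\<^sup>2)" for l
    by (simp add: delta_l_def power3_eq_cube power2_eq_square add.commute)
  then have "(\<Sum>l<L. real (Suc l) * (delta_l \<delta> l / 2)) = \<delta> / 12 * (\<Sum>l<L. 1 / (real (Suc l))\<^sup>2)"
    by (simp only: sum_distrib_left)
  also have "\<dots> \<le> \<delta> / 12 * 2"
    using sum_inverse_squares[of L] \<delta> by (intro mult_left_mono order_trans[OF sum_inverse_squares]) auto
  finally show ?thesis by simp
qed

end

section \<open>Budget\<close>

lemma real_nat_ceiling_le: "0 \<le> x \<Longrightarrow> real (nat \<lceil>x\<rceil>) \<le> x + 1"
  by linarith

lemma sum_powers_le:
  fixes x :: real
  assumes "0 \<le> x" "x < 1" "finite A"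
  shows "(\<Sum>s\<in>A. x ^ s) \<le> 1 / (1 - x)"
  using sum_le_suminf[OF summable_geometric, of x A] assms by (simp add: suminf_geometric)

lemma nat_ceiling_log2_le:
  assumes "1 \<le> y"
  shows "2 ^ nat \<lceil>log 2 y\<rceil> \<le> 2 * y" "y \<le> 2 ^ nat \<lceil>log 2 y\<rceil>"
proof -
  have "0 \<le> log 2 y" using assms by simp
  then have "real (nat \<lceil>log 2 y\<rceil>) \<le> log 2 y + 1" by (rule real_nat_ceiling_le)
  then have "2 powr real (nat \<lceil>log 2 y\<rceil>) \<le> 2 powr (log 2 y + 1)" by simp
  also have "\<dots> = 2 * y" using assms by (simp add: powr_add)
  finally show "2 ^ nat \<lceil>log 2 y\<rceil> \<le> 2 * y" by (simp add: powr_realpow)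
  have "y = 2 powr (log 2 y)" using assms by simp
  also have "\<dots> \<le> 2 powr real (nat \<lceil>log 2 y\<rceil>)" by (rule powr_mono[OF real_nat_ceiling_ge]) simp
  also have "\<dots> = 2 ^ nat \<lceil>log 2 y\<rceil>" by (rule powr_realpow) simp
  finally show "y \<le> 2 ^ nat \<lceil>log 2 y\<rceil>" .
qed

context clustering
begin

definition C1 :: real where "C1 = 336 * (1 + (3 * c1 cHW + 2 * c2 cHW)) + 3 * (1 + c3 cHW)"

lemma C1_pos: "0 < C1"
proof -
  have "0 \<le> c1 cHW" "0 \<le> c2 cHW" "0 \<le> c3 cHW" using cHW_pos by (auto simp: c1_def c2_def c3_def le_max_iff_disj)
  then show ?thesis by (simp add: C1_def)
qed

end

section \<open>Cost of one call of SRI\<close>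

context sri
begin

text \<open>The cost of a call will be bounded by a multiple of U W: \<rho> is the inverse
  signal-to-noise ratio, and the number r of levels in \<open>Wr\<close> is the origin of the
  iterated logarithms.\<close>

definition a where "a = 3 * c1 cHW + 2 * c2 cHW"
definition \<rho> where "\<rho> = \<sigma>\<^sup>2 / \<Delta>\<^sup>2"
definition Wr where "Wr = ln (real K) + sqrt (real d) + real r"
definition W where "W = 1 + \<rho> * Wr"
definition H where "H = 4 * (1 + a) * W"

lemma c_nonneg: "0 \<le> c1 cHW" "0 \<le> c2 cHW" "0 \<le> c3 cHW"
  using cHW_pos by (auto simp: c1_def c2_def c3_def le_max_iff_disj)

lemma a_nonneg: "0 \<le> a" using c_nonneg by (simp add: a_def)
lemma \<rho>_pos: "0 < \<rho>" using sigma_pos \<Delta> by (simp add: \<rho>_def)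
lemma lnK_nonneg: "0 \<le> ln (real K)" using K_ge_2 by simp
lemma sqrt_d_ge: "1 \<le> sqrt (real d)" using d_pos by simp
lemma Wr_pos: "0 \<le> Wr" using lnK_nonneg sqrt_d_ge by (simp add: Wr_def)
lemma r_ge_1: "1 \<le> real r" using r_pos by simp
lemma W_ge_1: "1 \<le> W" using Wr_pos \<rho>_pos by (simp add: W_def)

lemma H_ge: "x \<le> 4 * Wr \<Longrightarrow> 1 + a * \<rho> * x \<le> H"
proof -
  assume "x \<le> 4 * Wr"
  then have "a * \<rho> * x \<le> a * \<rho> * (4 * Wr)" using a_nonneg \<rho>_pos by (intro mult_left_mono) auto
  also have "\<dots> = 4 * (a * (\<rho> * Wr))" by simp
  finally have 1: "a * \<rho> * x \<le> 4 * (a * (\<rho> * Wr))" .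
  have 2: "H = 4 + 4 * a + 4 * (\<rho> * Wr) + 4 * (a * (\<rho> * Wr))" by (simp add: H_def W_def algebra_simps)
  have "0 \<le> \<rho> * Wr" using \<rho>_pos Wr_pos by simp
  then show ?thesis unfolding 2 using 1 a_nonneg by linarith
qed

lemma H_ge_4: "4 \<le> H"
proof -
  have "1 * 1 \<le> (1 + a) * W" using a_nonneg W_ge_1 by (intro mult_mono) auto
  then show ?thesis unfolding H_def mult.assoc by linarith
qed

text \<open>The square root of 2^s is replaced by (3/2)^s, written as 2^s (3/4)^s: after division by
  2^s the dimension term is summable over the levels.\<close>

lemma n_le:
  assumes s: "1 \<le> s"
  shows "real (n s) \<le> 1 + a * \<rho> * (2 ^ s + ln (real K) + sqrt (real d) * (2 ^ s * (3/4) ^ s))"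
proof -
  let ?x = "c1 cHW * \<sigma>\<^sup>2 / \<Delta>\<^sup>2 * (2 ^ s + ln (12 * real K))" and ?y = "c2 cHW * \<sigma>\<^sup>2 / \<Delta>\<^sup>2 * sqrt (real d * (2 ^ s + ln 6))"
  have p2: "(2::real) ^ 1 \<le> 2 ^ s" using s by (intro power_increasing) auto
  have l12: "ln (12 * real K) \<le> 4 + ln (real K)"
  proof -
    have "ln (12::real) \<le> ln (2 ^ 4)" by simp
    also have "\<dots> = 4 * ln 2" by (subst ln_realpow) auto
    also have "\<dots> \<le> 4" using ln_2_less_1 by simp
    finally show ?thesis using K_ge_2 by (simp add: ln_mult)
  qed
  have x: "?x \<le> (3 * c1 cHW * \<rho>) * (2 ^ s + ln (real K))"
  proof -
    have "2 ^ s + ln (12 * real K) \<le> 3 * (2 ^ s + ln (real K))" using p2 l12 lnK_nonneg by simp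
    then have "(c1 cHW * \<rho>) * (2 ^ s + ln (12 * real K)) \<le> (c1 cHW * \<rho>) * (3 * (2 ^ s + ln (real K)))"
      using c_nonneg \<rho>_pos by (intro mult_left_mono) auto
    moreover have "?x = (c1 cHW * \<rho>) * (2 ^ s + ln (12 * real K))" by (simp add: \<rho>_def)
    moreover have "(c1 cHW * \<rho>) * (3 * z) = (3 * c1 cHW * \<rho>) * z" for z by simp
    ultimately show ?thesis by (simp only:)
  qed
  have y: "?y \<le> (2 * c2 cHW * \<rho>) * (sqrt (real d) * (2 ^ s * (3/4) ^ s))"
  proof -
    have "sqrt (2 ^ s + ln 6) \<le> 2 * (2 ^ s * (3/4) ^ s)"
    proof (rule real_le_lsqrt)
      have "ln (6::real) \<le> ln (2 ^ 3)" by simp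
      also have "\<dots> = 3 * ln 2" by (subst ln_realpow) auto
      finally have "ln (6::real) \<le> 3" using ln_2_less_1 by simp
      then have "(2::real) ^ s + ln 6 \<le> 4 * 2 ^ s" using p2 by simp
      also have "\<dots> \<le> 4 * (9/4) ^ s" by (intro mult_left_mono power_mono) auto
      also have "(9/4::real) ^ s = (2 ^ s * (3/4) ^ s)\<^sup>2"
      proof -
        have "(2 ^ s * (3/4::real) ^ s)\<^sup>2 = ((3/2) ^ s)\<^sup>2" by (simp add: power_mult_distrib[symmetric])
        also have "\<dots> = ((3/2)\<^sup>2) ^ s" by (simp only: power_mult[symmetric] mult.commute)
        finally show ?thesis by (simp add: power2_eq_square)
      qed
      finally show "2 ^ s + ln 6 \<le> (2 * (2 ^ s * (3/4::real) ^ s))\<^sup>2" by (simp add: power_mult_distrib)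
    qed (auto simp: add_nonneg_nonneg)
    then have "sqrt (real d) * sqrt (2 ^ s + ln 6) \<le> sqrt (real d) * (2 * (2 ^ s * (3/4) ^ s))" by (intro mult_left_mono) auto
    then have "(c2 cHW * \<rho>) * sqrt (real d * (2 ^ s + ln 6)) \<le> (c2 cHW * \<rho>) * (sqrt (real d) * (2 * (2 ^ s * (3/4) ^ s)))"
      unfolding real_sqrt_mult by (rule mult_left_mono) (use c_nonneg \<rho>_pos in auto)
    moreover have "?y = (c2 cHW * \<rho>) * sqrt (real d * (2 ^ s + ln 6))" by (simp add: \<rho>_def)
    moreover have "(c2 cHW * \<rho>) * (u * (2 * z)) = (2 * c2 cHW * \<rho>) * (u * z)" for u z by simp
    ultimately show ?thesis by (simp only:)
  qed
  have x0: "0 \<le> ?x" using c_nonneg ln_12K_pos by (intro mult_nonneg_nonneg divide_nonneg_nonneg) auto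
  have y0: "0 \<le> ?y" using c_nonneg by (intro mult_nonneg_nonneg divide_nonneg_nonneg) (auto simp: add_nonneg_nonneg)
  have "real (n s) \<le> max ?x ?y + 1"
    unfolding sri_n_def using real_nat_ceiling_le[of "max ?x ?y"] x0 by (simp add: le_max_iff_disj)
  also have "\<dots> \<le> ?x + ?y + 1" using x0 y0 by simp
  also have "\<dots> \<le> (3 * c1 cHW * \<rho>) * (2 ^ s + ln (real K)) + (2 * c2 cHW * \<rho>) * (sqrt (real d) * (2 ^ s * (3/4) ^ s)) + 1"
    using x y by linarith
  also have "\<dots> \<le> (a * \<rho>) * (2 ^ s + ln (real K)) + (a * \<rho>) * (sqrt (real d) * (2 ^ s * (3/4) ^ s)) + 1"
    using c_nonneg \<rho>_pos lnK_nonneg by (intro add_mono mult_right_mono) (auto simp: a_def)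
  finally show ?thesis by (simp add: algebra_simps)
qed

lemma sum_n_le: "(\<Sum>s\<in>{s0..r}. real (n s)) \<le> 2 ^ r * H"
proof -
  let ?A = "{s0..r}" and ?G = "ln (real K)" and ?q = "sqrt (real d)"
  have cA: "real (card ?A) \<le> real r" using s0_bounds by simp
  have rp: "real r \<le> 2 ^ r" using less_exp[of r] by (metis less_imp_le of_nat_le_iff of_nat_numeral of_nat_power)
  have 1: "(\<Sum>s\<in>?A. (2::real) ^ s) \<le> 2 * 2 ^ r"
  proof -
    have "(\<Sum>s\<in>?A. (2::real) ^ s) \<le> (\<Sum>s<Suc r. 2 ^ s)" by (intro sum_mono2) auto
    also have "(\<Sum>s<m. (2::real) ^ s) = 2 ^ m - 1" for m by (induction m) auto
    finally show ?thesis by simp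
  qed
  have 2: "(\<Sum>s\<in>?A. (2::real) ^ s * (3/4) ^ s) \<le> 2 ^ r * 4"
  proof -
    have "(\<Sum>s\<in>?A. (2::real) ^ s * (3/4) ^ s) \<le> (\<Sum>s\<in>?A. 2 ^ r * (3/4) ^ s)"
      by (intro sum_mono mult_right_mono power_increasing) auto
    also have "\<dots> = 2 ^ r * (\<Sum>s\<in>?A. (3/4) ^ s)" by (simp add: sum_distrib_left)
    also have "\<dots> \<le> 2 ^ r * 4" using sum_powers_le[of "3/4" ?A] by (intro mult_left_mono) auto
    finally show ?thesis .
  qed
  have "(\<Sum>s\<in>?A. real (n s)) \<le> (\<Sum>s\<in>?A. 1 + a * \<rho> * (2 ^ s + ?G + ?q * (2 ^ s * (3/4) ^ s)))"
    using s0_bounds by (intro sum_mono n_le) auto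
  also have "\<dots> = real (card ?A) + a * \<rho> * ((\<Sum>s\<in>?A. 2 ^ s) + real (card ?A) * ?G + ?q * (\<Sum>s\<in>?A. 2 ^ s * (3/4) ^ s))"
    by (simp add: sum.distrib sum_distrib_left[symmetric])
  also have "\<dots> \<le> 2 ^ r + a * \<rho> * (2 * 2 ^ r + 2 ^ r * ?G + ?q * (2 ^ r * 4))"
    by (intro add_mono mult_left_mono mult_right_mono order_trans[OF cA rp] 1 2) (use a_nonneg \<rho>_pos lnK_nonneg in auto)
  also have "\<dots> = 2 ^ r * (1 + a * \<rho> * (2 + ?G + 4 * ?q))" by (simp add: algebra_simps)
  also have "\<dots> \<le> 2 ^ r * H"
  proof (intro mult_left_mono H_ge)
    have "2 + x + 4 * y \<le> 4 * (x + y + z)" if "1 \<le> z" "0 \<le> x" "1 \<le> y" for x y z :: real using that by auto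
    then show "2 + ?G + 4 * ?q \<le> 4 * Wr" unfolding Wr_def using r_ge_1 lnK_nonneg sqrt_d_ge by blast
  qed simp
  finally show ?thesis .
qed

text \<open>Divided by 2^s, the leading term is the same at each level and contributes r, while the
  log K and dimension terms form geometric series and contribute constants.\<close>

lemma Sw_le: "Sw \<le> 32 * H"
proof -
  let ?A = "{s0+1..r}" and ?G = "ln (real K)" and ?q = "sqrt (real d)"
  have cA: "real (card ?A) \<le> real r" using s0_bounds by simp
  have pw: "2 powr (real s - 4) = 2 ^ s / (16::real)" for s by (simp add: powr_diff powr_realpow)
  have half: "(\<Sum>s\<in>?A. (1/2::real) ^ s) \<le> 2" using sum_powers_le[of "1/2" ?A] by simp
  have tq: "(\<Sum>s\<in>?A. (3/4::real) ^ s) \<le> 4" using sum_powers_le[of "3/4" ?A] by simp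
  have "Sw \<le> (\<Sum>s\<in>?A. 16 * ((1/2) ^ s + a * \<rho> * (1 + ?G * (1/2) ^ s + ?q * (3/4) ^ s)))"
    unfolding Sw_def
  proof (rule sum_mono)
    fix s assume "s \<in> ?A"
    then have "real (n s) \<le> 1 + a * \<rho> * (2 ^ s + ?G + ?q * (2 ^ s * (3/4) ^ s))" using s0_bounds by (intro n_le) auto
    then have "real (n s) / (2 ^ s / 16) \<le> (1 + a * \<rho> * (2 ^ s + ?G + ?q * (2 ^ s * (3/4) ^ s))) / (2 ^ s / 16)" by (intro divide_right_mono) auto
    also have "\<dots> = 16 * ((1/2) ^ s + a * \<rho> * (1 + ?G * (1/2) ^ s + ?q * (3/4) ^ s))"
      by (simp add: field_simps power_divide)
    finally show "real (n s) / 2 powr (real s - 4) \<le> 16 * ((1/2) ^ s + a * \<rho> * (1 + ?G * (1/2) ^ s + ?q * (3/4) ^ s))"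
      unfolding pw .
  qed
  also have "\<dots> = 16 * ((\<Sum>s\<in>?A. (1/2) ^ s) + a * \<rho> * (real (card ?A) + ?G * (\<Sum>s\<in>?A. (1/2) ^ s) + ?q * (\<Sum>s\<in>?A. (3/4) ^ s)))"
    by (simp add: sum.distrib sum_distrib_left[symmetric])
  also have "\<dots> \<le> 16 * (2 + a * \<rho> * (real r + ?G * 2 + ?q * 4))"
    using cA half tq a_nonneg \<rho>_pos lnK_nonneg by (intro add_mono mult_left_mono) auto
  also have "\<dots> \<le> 16 * (1 + H)"
    using H_ge[of "real r + ?G * 2 + ?q * 4"] lnK_nonneg sqrt_d_ge by (simp add: Wr_def)
  also have "\<dots> \<le> 32 * H" using H_ge_4 by simp
  finally show ?thesis .
qed

text \<open>If \<open>s0\<close> > 1, minimality gives n(s0 - 1) <= 1 and doubling gives n(s0) <= 2;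
  if \<open>s0\<close> = 1, the bound for level 1 applies.\<close>

lemma n_s0_le: "real (n s0) \<le> H"
proof (cases "s0 = 1")
  case True
  have "real (n 1) \<le> 1 + a * \<rho> * (2 + ln (real K) + sqrt (real d) * (3/2))" using n_le[of 1] by simp
  also have "\<dots> \<le> H"
  proof (rule H_ge)
    have "2 + x + y * (3/2) \<le> 4 * (x + y + z)" if "1 \<le> z" "0 \<le> x" "1 \<le> y" for x y z :: real using that by auto
    then show "2 + ln (real K) + sqrt (real d) * (3/2) \<le> 4 * Wr" unfolding Wr_def using r_ge_1 lnK_nonneg sqrt_d_ge by blast
  qed
  finally show ?thesis unfolding True .
next
  case False
  then have s: "1 \<le> s0 - 1" "s0 = Suc (s0 - 1)" using s0_bounds by auto
  have "s0 \<le> (LEAST s. 1 \<le> s \<and> 2 \<le> n s)" by (simp add: sri_s0_def)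
  then have "s0 - 1 < (LEAST s. 1 \<le> s \<and> 2 \<le> n s)" using s by linarith
  from not_less_Least[OF this] have "n (s0 - 1) \<le> 1" using s(1) by linarith
  then have "n s0 \<le> 2" using n_double[of "s0 - 1", folded s(2)] by linarith
  then show ?thesis using H_ge_4 by linarith
qed

lemma K_ln_le: "8 * (real K * ln (8 * real K / \<delta>)) \<le> real U"
proof -
  have t: "real K \<le> 1 / \<theta>" using \<theta> K_pos by (simp add: field_simps)
  have "(8 * real K) * ln (8 * real K / \<delta>) \<le> (8 / \<theta>) * ln (8 * real K / \<delta>)" using t ln8K by (intro mult_right_mono) auto
  then show ?thesis using U_ge by simp
qed

text \<open>2^r is at most 2 log(4U/\<delta>) = 2 log(8K/\<delta>) + 2 log(U/(2K)). The first
  logarithm times 8K is at most U, the second is bounded by U/(2K). So full tests of K accepted arms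
  cost no more than the U draws.\<close>

lemma K_pow_r_le: "real K * 2 ^ r \<le> 3 * real U"
proof -
  have "2 ^ r \<le> 2 * ln (4 * real U / \<delta>)"
    unfolding sri_r_def using nat_ceiling_log2_le(1)[of "ln (4 * real U / \<delta>)"] ln4U by simp
  moreover have "ln (4 * real U / \<delta>) \<le> ln (8 * real K / \<delta>) + real U / (2 * real K)"
  proof -
    have "4 * real U / \<delta> = (8 * real K / \<delta>) * (real U / (2 * real K))" using K_pos by simp
    then have "ln (4 * real U / \<delta>) = ln (8 * real K / \<delta>) + ln (real U / (2 * real K))"
      using K_pos \<delta> U_pos by (simp only: ln_mult_pos divide_pos_pos mult_pos_pos zero_less_numeral)
    then show ?thesis using ln_bound[of "real U / (2 * real K)"] K_pos U_pos by simp
  qed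
  moreover have "x \<le> 2 * z" if "x \<le> 2 * y" "y \<le> z" for x y z :: real using that by auto
  ultimately have "2 ^ r \<le> 2 * (ln (8 * real K / \<delta>) + real U / (2 * real K))" by blast
  then have "real K * 2 ^ r \<le> real K * (2 * (ln (8 * real K / \<delta>) + real U / (2 * real K)))" using K_pos by (intro mult_left_mono) auto
  also have "\<dots> = 2 * (real K * ln (8 * real K / \<delta>)) + real U" using K_pos by (simp add: algebra_simps)
  finally show ?thesis using K_ln_le U_pos by linarith
qed

lemma nmax_le: "real nmax \<le> 2 ^ r * H + (1 + c3 cHW) * W * ln (8 * real K / \<delta>)"
proof -
  let ?l = "ln (8 * real K / \<delta>)"
  let ?z = "c3 cHW * \<sigma>\<^sup>2 / \<Delta>\<^sup>2 * sqrt (real d) * ln (2 * real K)"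
  have nr: "real (n r) \<le> 2 ^ r * H"
    using member_le_sum[of r "{s0..r}" "\<lambda>s. real (n s)"] s0_bounds sum_n_le by simp
  have z0: "0 \<le> ?z" using c_nonneg ln_2K_pos by (intro mult_nonneg_nonneg divide_nonneg_nonneg) auto
  have l2: "ln (2 * real K) \<le> ?l"
  proof -
    have "2 * real K * \<delta> \<le> 2 * real K * 4" using K_pos \<delta> by (intro mult_left_mono) auto
    then have "2 * real K \<le> 8 * real K / \<delta>" using \<delta> by (simp add: pos_le_divide_eq)
    then show ?thesis using K_pos by (intro ln_mono) auto
  qed
  have qW: "\<rho> * sqrt (real d) \<le> W"
  proof -
    have "\<rho> * sqrt (real d) \<le> \<rho> * Wr" using \<rho>_pos lnK_nonneg by (intro mult_left_mono) (auto simp: Wr_def)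
    then show ?thesis by (simp add: W_def)
  qed
  have "?z = c3 cHW * (\<rho> * sqrt (real d) * ln (2 * real K))" by (simp add: \<rho>_def)
  also have "\<dots> \<le> c3 cHW * (W * ?l)"
    using qW l2 W_ge_1 c_nonneg ln_2K_pos \<rho>_pos by (intro mult_left_mono mult_mono) auto
  finally have z: "?z \<le> c3 cHW * (W * ?l)" .
  have "1 * 1 \<le> W * ?l" using W_ge_1 ln8K by (intro mult_mono) auto
  then have "real (nat \<lceil>?z\<rceil>) \<le> (1 + c3 cHW) * (W * ?l)" using real_nat_ceiling_le[OF z0] z by (simp add: distrib_right)
  moreover have "real nmax = max (real (n r)) (real (nat \<lceil>?z\<rceil>))" by (simp add: sri_nmax_def)
  moreover have "0 \<le> 2 ^ r * H" using H_ge_4 by simp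
  moreover have "0 \<le> (1 + c3 cHW) * (W * ?l)" using W_ge_1 ln8K c_nonneg by simp
  ultimately show ?thesis using nr by (simp add: mult.assoc)
qed

lemma cost_le: "Tmax + 2 * (\<Sum>s\<in>{s0..r}. real (n s)) + 2 * real nmax \<le> C1 * real U * W"
proof -
  let ?l = "ln (8 * real K / \<delta>)"
  define Y where "Y = real nmax + (\<Sum>s\<in>{s0..r}. real (n s))"
  have Y0: "0 \<le> Y" by (simp add: Y_def sum_nonneg)
  have Sg: "Sg \<le> (\<Sum>s\<in>{s0..r}. real (n s))" unfolding Sg_def by (intro sum_mono2) auto
  have Y: "Y \<le> 2 * (2 ^ r * H) + (1 + c3 cHW) * W * ?l" using nmax_le sum_n_le unfolding Y_def by linarith
  have "real K * Y \<le> real K * (2 * (2 ^ r * H) + (1 + c3 cHW) * W * ?l)" using Y K_pos by (intro mult_left_mono) auto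
  also have "\<dots> = 2 * ((real K * 2 ^ r) * H) + ((1 + c3 cHW) * W) * (real K * ?l)" by (simp add: algebra_simps)
  also have "\<dots> \<le> 2 * ((3 * real U) * H) + ((1 + c3 cHW) * W) * real U"
    using K_pow_r_le K_ln_le H_ge_4 W_ge_1 c_nonneg K_pos ln8K U_pos by (intro add_mono mult_left_mono mult_right_mono) auto
  finally have KY: "real K * Y \<le> 6 * (real U * H) + (1 + c3 cHW) * (real U * W)" by (simp add: mult_ac)
  have T: "Tmax \<le> 2 * (real K * Y) + 2 * (real U * H) + 64 * (real U * H)"
  proof -
    have "real K * (real nmax + Sg) \<le> real K * Y" using Sg K_pos unfolding Y_def by (intro mult_left_mono) auto
    moreover have "real U * real (n s0) \<le> real U * H" using n_s0_le by (intro mult_left_mono) auto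
    moreover have "real U * Sw \<le> 32 * (real U * H)" using mult_left_mono[OF Sw_le, of "real U"] by (simp add: mult.left_commute)
    moreover have "2 * x + 2 * y + 2 * z \<le> 2 * X + 2 * V + 64 * V" if "x \<le> X" "y \<le> V" "z \<le> 32 * V" for x y z X V :: real using that by linarith
    ultimately show ?thesis unfolding Tmax_eq mult.assoc by blast
  qed
  have "2 * Y \<le> real K * Y" using K_ge_2 Y0 by (intro mult_right_mono) auto
  then have "Tmax + 2 * Y \<le> 3 * (real K * Y) + 66 * (real U * H)" using T by linarith
  also have "\<dots> \<le> 84 * (real U * H) + 3 * ((1 + c3 cHW) * (real U * W))" using KY by linarith
  \<comment> \<open>84 H = 336 (1 + a) W explains the constants of \<open>C1\<close>.\<close>
  also have "\<dots> = C1 * real U * W" by (simp add: C1_def H_def a_def algebra_simps)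
  finally show ?thesis by (simp add: Y_def)
qed

end

lemma ln_ge_neg_half: "2/3 \<le> t \<Longrightarrow> - 1/2 \<le> ln t" for t :: real
proof -
  assume t: "2/3 \<le> t"
  have "ln (1 / t) \<le> 1 / t - 1" using t by (intro ln_le_minus_one) simp
  moreover have "ln (1 / t) = - ln t" using t by (simp add: ln_div)
  moreover have "1 / t \<le> 3/2" using t by (simp add: field_simps)
  ultimately show ?thesis by linarith
qed

lemma ln_2_ge: "2/3 \<le> ln (2::real)" using ln2_ge_two_thirds by simp

lemma ln_le_ln_power: "0 < z \<Longrightarrow> z \<le> y ^ k \<Longrightarrow> 0 < y \<Longrightarrow> ln z \<le> real k * ln y" for y z :: real
  using ln_mono[of z "y ^ k"] by (simp add: ln_realpow)

section \<open>The logarithmic factors of the bound\<close>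

context clustering
begin

lemma theta_star_bounds: "1 / real N \<le> theta_star d N \<mu>" "theta_star d N \<mu> * real K \<le> 1"
proof -
  let ?G = "Gstar d N \<mu>" and ?m = "Min (card ` Gstar d N \<mu>)"
  have ne: "card ` ?G \<noteq> {}" using N_ge_2 by (auto simp: Gstar_def lessThan_empty_iff)
  have f: "finite (card ` ?G)" using Gstar_finite by simp
  have "1 \<le> ?m"
  proof (rule Min.boundedI[OF f ne])
    fix c assume "c \<in> card ` ?G"
    then obtain a where a: "a < N" "c = card {b. b < N \<and> veq d (\<mu> b) (\<mu> a)}" by (auto simp: Gstar_def)
    then have "{a} \<subseteq> {b. b < N \<and> veq d (\<mu> b) (\<mu> a)}" by (simp add: veq_def)
    from card_mono[OF _ this] show "1 \<le> c" unfolding a(2) by simp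
  qed
  then show "1 / real N \<le> theta_star d N \<mu>" using N_ge_2 by (simp add: theta_star_def divide_le_cancel)
  have "?m * K = (\<Sum>G\<in>?G. ?m)" by (simp add: card_Gstar)
  also have "\<dots> \<le> (\<Sum>G\<in>?G. card G)" using f by (intro sum_mono Min_le) auto
  also have "\<dots> = card (\<Union>?G)" using Gstar_disjoint Gstar_finite by (subst card_Union_disjoint) auto
  also have "\<dots> \<le> card {..<N}" by (intro card_mono) (auto simp: Gstar_def)
  finally have "real (?m * K) \<le> real N" by (simp only: of_nat_le_iff card_lessThan)
  then show "theta_star d N \<mu> * real K \<le> 1" using N_ge_2 by (simp add: theta_star_def)
qed

end

context acb
begin

abbreviation "L \<equiv> Lstar PP \<delta> ts ds"
text \<open>A is \<Delta>0 / \<sigma>^2 (where \<Delta>0 stands for the squared quantity), Z is the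
  bracket and Lam the logarithm in the claimed budget.\<close>

definition A where "A = ln (real K) + sqrt (real d) + ln (ln (6 * real N / \<delta>))"
definition Z where "Z = ln (real K) + sqrt (real d) + ln (ln L) + ln (ln (real N / \<delta>))"
definition Lam where "Lam = ln (L * real K / \<delta>)"
definition M where "M = max (\<Delta>0 / ds\<^sup>2) 1"

lemma ts: "0 < ts" "1 / real N \<le> ts" "ts * real K \<le> 1"
proof -
  have "0 < 1 / real N" using NK by simp
  then show "0 < ts" using theta_star_bounds(1) by linarith
qed (rule theta_star_bounds)+

lemma Delta0_A: "\<Delta>0 = \<sigma>\<^sup>2 * A" by (simp add: Delta0_sq_def A_def)

lemma M_ge_1: "1 \<le> M" by (simp add: M_def)

lemma X_ge: "1 \<le> 1 / (ts * real K)" "1 \<le> 1 / (ts * real K) * M"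
proof -
  show 1: "1 \<le> 1 / (ts * real K)" using ts NK by simp
  have "1 * 1 \<le> 1 / (ts * real K) * M" using 1 M_ge_1 ts(1) by (intro mult_mono) auto
  then show "1 \<le> 1 / (ts * real K) * M" by simp
qed

text \<open>The third part uses that L is an integer: log L is then either 0, where
  \<open>ln 0 = 0\<close>, or at least log 2, so the iterated logarithm is bounded below.\<close>

lemma L_ge: "1 \<le> L" "log 2 (1 / (ts * real K) * M) \<le> L" "L = 1 \<or> 2 \<le> L"
proof -
  let ?k = "\<lceil>log 2 (1 / (ts * real K) * M)\<rceil>"
  have L: "L = max 1 (real_of_int ?k)" by (simp add: Lstar_def M_def)
  show "1 \<le> L" unfolding L by simp
  show "log 2 (1 / (ts * real K) * M) \<le> L" unfolding L by linarith
  show "L = 1 \<or> 2 \<le> L"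
  proof (cases "?k \<le> 1")
    case True
    then have "real_of_int ?k \<le> 1" by simp
    then show ?thesis unfolding L by simp
  next
    case False
    then have "2 \<le> real_of_int ?k" by linarith
    then show ?thesis unfolding L by simp
  qed
qed

text \<open>Rounding up the two logarithms separately makes each guess of the pair (ps + ms, ps)
  valid; the price is a factor of at most 4 in 2^(ps + ms).\<close>

definition ps where "ps = nat \<lceil>log 2 M\<rceil>"
definition ms where "ms = nat \<lceil>log 2 (1 / (ts * real K))\<rceil>"

lemma pow_ls: "2 ^ (ps + ms) \<le> 4 * (1 / (ts * real K) * M)"
proof -
  have "(2::real) ^ ps * 2 ^ ms \<le> (2 * M) * (2 * (1 / (ts * real K)))"
    unfolding ps_def ms_def using nat_ceiling_log2_le(1)[OF M_ge_1] nat_ceiling_log2_le(1)[OF X_ge(1)] M_ge_1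
    by (intro mult_mono) auto
  then show ?thesis by (simp add: power_add)
qed

lemma K_pow_ls: "real K * 2 ^ (ps + ms) \<le> 4 * (M / ts)"
proof -
  have "real K * 2 ^ (ps + ms) \<le> real K * (4 * (1 / (ts * real K) * M))" using pow_ls by (intro mult_left_mono) auto
  then show ?thesis using NK by simp
qed

lemma ls_le: "real (ps + ms) + 1 \<le> 4 * L"
proof -
  have "real (ps + ms) = log 2 (2 ^ (ps + ms))" by simp
  also have "\<dots> \<le> log 2 (4 * (1 / (ts * real K) * M))" using pow_ls X_ge(2) by (subst log_le_cancel_iff) auto
  also have "\<dots> = log 2 4 + log 2 (1 / (ts * real K) * M)" using X_ge(2) by (subst log_mult) auto
  also have "log 2 4 = (2::real)" using log_pow_cancel[of 2 2] by simp
  finally show ?thesis using L_ge(1,2) by linarith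
qed

lemma ez_ls: "ez (ps + ms) ps"
proof -
  have Mp: "M \<le> 2 ^ ps" unfolding ps_def by (rule nat_ceiling_log2_le(2)[OF M_ge_1])
  have ds: "0 < ds\<^sup>2" using Delta_star_pos by simp
  have "\<Delta>0 / ds\<^sup>2 \<le> 2 ^ ps" using Mp by (simp add: M_def)
  then have "\<Delta>0 / 2 ^ ps \<le> ds\<^sup>2" using ds by (simp add: field_simps)
  then have "(Dp ps)\<^sup>2 \<le> ds\<^sup>2" unfolding Dp_sq .
  then have "Dp ps \<le> ds" by (rule power2_le_imp_le[OF _ less_imp_le[OF Delta_star_pos]])
  moreover have "1 / (real K * 2 ^ ms) \<le> ts"
  proof -
    have "1 / (ts * real K) \<le> 2 ^ ms" unfolding ms_def by (rule nat_ceiling_log2_le(2)[OF X_ge(1)])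
    then have "1 \<le> 2 ^ ms * (ts * real K)" using ts(1) NK by (simp add: pos_divide_le_eq)
    then show ?thesis using NK by (simp add: pos_divide_le_eq mult_ac)
  qed
  ultimately show ?thesis using ts by (simp add: ez_def th_def theta_pl_def)
qed

lemma N_over: "2 \<le> real N / \<delta>"
proof -
  have "2 * \<delta> \<le> real N" using NK \<delta> by linarith
  then show ?thesis using \<delta> by (simp add: pos_le_divide_eq)
qed

lemma LK_over: "2 \<le> L * real K / \<delta>" "real K / \<delta> \<le> L * real K / \<delta>" "1 \<le> real K / \<delta>" "L \<le> L * real K / \<delta>"
proof -
  show 1: "real K / \<delta> \<le> L * real K / \<delta>" using L_ge(1) NK \<delta> by (simp add: divide_right_mono)
  have "2 * \<delta> \<le> real K" using NK \<delta> by linarith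
  then have 2: "2 \<le> real K / \<delta>" using \<delta> by (simp add: pos_le_divide_eq)
  then show "2 \<le> L * real K / \<delta>" "1 \<le> real K / \<delta>" using 1 by linarith+
  have "L * 1 \<le> L * (real K / \<delta>)" using 2 L_ge(1) by (intro mult_left_mono) auto
  then show "L \<le> L * real K / \<delta>" by simp
qed

lemma Lam_ge: "2/3 \<le> Lam"
  unfolding Lam_def using ln_mono[of 2 "L * real K / \<delta>"] LK_over(1) ln_2_ge by linarith

lemma x_ge: "2/3 \<le> ln (real N / \<delta>)"
  using ln_mono[of 2 "real N / \<delta>"] N_over ln_2_ge by linarith

lemma y_ge: "L = 1 \<or> 2/3 \<le> ln L"
  using L_ge(3) ln_mono[of 2 L] ln_2_ge by fastforce

lemma lnln_L_ge: "- 1/2 \<le> ln (ln L)"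
  using y_ge ln_ge_neg_half[of "ln L"] by auto

lemma base_ge: "5/3 \<le> ln (real K) + sqrt (real d)"
proof -
  have "2/3 \<le> ln (real K)" using ln_mono[of 2 "real K"] NK ln_2_ge by linarith
  moreover have "1 \<le> sqrt (real d)" using d_pos by simp
  ultimately show ?thesis by linarith
qed

text \<open>Both iterated logarithms may be negative, but not below -1/2 each, and log K + sqrt d >=
  2/3 + 1 outweighs them.\<close>

lemma Z_ge: "2/3 \<le> Z" "ln (real K) + sqrt (real d) \<le> 5/2 * Z"
proof -
  have w: "-1 \<le> ln (ln L) + ln (ln (real N / \<delta>))" using lnln_L_ge ln_ge_neg_half[OF x_ge] by linarith
  have gen: "2/3 \<le> b + u + v \<and> b \<le> 5/2 * (b + u + v)" if "5/3 \<le> b" "-1 \<le> u + v" for b u v :: real using that by auto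
  from gen[OF base_ge w] show "2/3 \<le> Z" "ln (real K) + sqrt (real d) \<le> 5/2 * Z" by (simp_all add: Z_def)
qed

text \<open>For x, y >= 2/3 the sum 28 x + 6 y is at most 64 x y, which turns the logarithm of a sum
  into a sum of logarithms. If L = 1, then y = 0 and its logarithm is 0 by convention.\<close>

lemma ln_ln_combine: "ln (28 * ln (real N / \<delta>) + 6 * ln L) \<le> 6 + ln (ln L) + ln (ln (real N / \<delta>))"
proof -
  let ?x = "ln (real N / \<delta>)" and ?y = "ln L"
  have l64: "ln (64::real) \<le> 6"
  proof -
    have "ln (64::real) = ln (2 ^ 6)" by simp
    also have "\<dots> = 6 * ln 2" by (subst ln_realpow) auto
    finally show ?thesis using ln_2_less_1 by simp
  qed
  show ?thesis
  proof (cases "L = 1")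
    case True
    have "ln (28 * ?x) \<le> ln (64 * ?x)" using x_ge by (intro ln_mono) auto
    also have "\<dots> = ln 64 + ln ?x" using x_ge by (intro ln_mult_pos) auto
    finally show ?thesis using True l64 by simp
  next
    case False
    then have y: "2/3 \<le> ?y" using y_ge by blast
    have x0: "0 \<le> ?x" and y0: "0 \<le> ?y" using x_ge y by linarith+
    have 1: "?x * (2/3) \<le> ?x * ?y" by (rule mult_left_mono[OF y x0])
    have 2: "(2/3) * ?y \<le> ?x * ?y" by (rule mult_right_mono[OF x_ge y0])
    have "28 * X + 6 * Y \<le> 64 * P" if "X * (2/3) \<le> P" "(2/3) * Y \<le> P" "0 \<le> X" "0 \<le> Y" for X Y P :: real using that by linarith
    from this[OF 1 2 x0 y0] have "28 * ?x + 6 * ?y \<le> 64 * (?x * ?y)" .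
    then have "ln (28 * ?x + 6 * ?y) \<le> ln (64 * (?x * ?y))" using x_ge y by (intro ln_mono add_pos_pos mult_pos_pos) auto
    also have "\<dots> = ln 64 + (ln ?x + ln ?y)" using x_ge y by (simp add: ln_mult_pos)
    finally show ?thesis using l64 by linarith
  qed
qed

lemma A_le: "A \<le> 5 * Z"
proof -
  let ?x = "ln (real N / \<delta>)"
  have "ln (6 * real N / \<delta>) \<le> 4 * ?x"
  proof -
    have "2 ^ 3 \<le> (real N / \<delta>) ^ 3" using N_over by (intro power_mono) auto
    then have "6 * (real N / \<delta>) \<le> (real N / \<delta>) ^ 3 * (real N / \<delta>)" using N_over by (intro mult_right_mono) auto
    then have "6 * real N / \<delta> \<le> (real N / \<delta>) ^ 4" by (simp add: power4_eq_xxxx power3_eq_cube)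
    from ln_le_ln_power[OF _ this] show ?thesis using N_over NK \<delta> by simp
  qed
  then have "ln (ln (6 * real N / \<delta>)) \<le> ln (4 * ?x)" using ln_6N_ge_1 by (intro ln_mono) auto
  also have "\<dots> = ln 4 + ln ?x" using x_ge by (intro ln_mult_pos) auto
  finally have 1: "ln (ln (6 * real N / \<delta>)) \<le> 2 + ln ?x"
  proof -
    have "ln (4::real) = ln (2 ^ 2)" by simp
    also have "\<dots> = 2 * ln 2" by (subst ln_realpow) auto
    finally have "ln (4::real) \<le> 2" using ln_2_less_1 by simp
    moreover assume "ln (ln (6 * real N / \<delta>)) \<le> ln 4 + ln ?x"
    ultimately show ?thesis by linarith
  qed
  have "A \<le> Z + 5/2" unfolding A_def Z_def using 1 lnln_L_ge by linarith
  then show ?thesis using Z_ge(1) by linarith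
qed

lemma A_ge: "1 \<le> A" "sqrt (real d) \<le> A"
proof -
  have "0 \<le> ln (ln (6 * real N / \<delta>))" using ln_6N_ge_1 by simp
  moreover have "0 \<le> ln (real K)" using NK by simp
  moreover have "1 \<le> sqrt (real d)" using d_pos by simp
  ultimately show "1 \<le> A" "sqrt (real d) \<le> A" unfolding A_def by linarith+
qed

text \<open>For M = 1 the quantity L is about log(1 / (ts K)) at most, and 1 / (ts K) <= N, so log
  log L is dominated by the iterated logarithm in A. For larger M it also depends on the
  gap.\<close>

lemma Z_le: "M = 1 \<Longrightarrow> Z \<le> 2 * A"
proof -
  assume M: "M = 1"
  let ?v = "ln (ln (6 * real N / \<delta>))"
  have v0: "0 \<le> ?v" using ln_6N_ge_1 by simp
  have "real N / \<delta> \<le> 6 * real N / \<delta>" using \<delta> by (intro divide_right_mono) auto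
  then have "ln (real N / \<delta>) \<le> ln (6 * real N / \<delta>)" using N_over by (intro ln_mono) auto
  then have 1: "ln (ln (real N / \<delta>)) \<le> ?v" by (rule ln_mono) (use x_ge in linarith)
  have 2: "ln (ln L) \<le> ?v"
  proof (cases "L = 1")
    case True
    then show ?thesis using v0 by simp
  next
    case False
    let ?X = "1 / (ts * real K)"
    have L: "L = real_of_int \<lceil>log 2 ?X\<rceil>" using False M by (auto simp: Lstar_def M_def max_def split: if_splits)
    have "?X \<le> real N"
    proof -
      have "1 * 1 \<le> (ts * real N) * real K" using ts(2) NK by (intro mult_mono) (auto simp: field_simps)
      then show ?thesis using ts(1) NK by (simp add: field_simps)
    qed
    moreover have "0 < ?X" using X_ge(1) by linarith
    ultimately have "log 2 ?X \<le> log 2 (real N)" using NK by (subst log_le_cancel_iff) auto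
    also have "\<dots> = ln (real N) / ln 2" by (rule log_def)
    also have "\<dots> \<le> ln (real N) / (2/3)" using ln_2_ge NK by (intro divide_left_mono) auto
    also have "ln (real N) \<le> real N - 1" using NK by (intro ln_le_minus_one) auto
    finally have "log 2 ?X \<le> 3/2 * (real N - 1)" by simp
    then have "L \<le> 3/2 * (real N - 1) + 1" unfolding L by linarith
    also have "\<dots> \<le> 6 * real N" using NK(3) by argo
    also have "\<dots> \<le> 6 * real N / \<delta>" using \<delta> NK by (simp add: pos_le_divide_eq mult_left_le)
    finally have "ln L \<le> ln (6 * real N / \<delta>)" using L_ge(1) by (intro ln_mono) auto
    then show ?thesis by (rule ln_mono) (use y_ge False in auto)
  qed
  have "0 \<le> ln (real K) + sqrt (real d)" using base_ge by linarith
  then show ?thesis unfolding Z_def A_def using 1 2 by auto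
qed

text \<open>The two regimes \<open>\<Delta>\<^sub>0 \<ge> \<Delta>\<^sub>*\<close> and \<open>\<Delta>\<^sub>0 < \<Delta>\<^sub>*\<close> give the two terms on the right.\<close>

lemma M_cases:
  assumes "0 \<le> u" "M = 1 \<Longrightarrow> u \<le> k * A" "u \<le> m * Z" "0 \<le> k" "0 \<le> m"
  shows "M / ts * (u / A) \<le> m * (\<sigma>\<^sup>2 / (ds\<^sup>2 * ts) * Z) + k * (1 / ts)"
proof -
  have ds: "0 < ds\<^sup>2" using Delta_star_pos by simp
  have A0: "0 < A" using A_ge by linarith
  have p1: "0 \<le> m * (\<sigma>\<^sup>2 / (ds\<^sup>2 * ts) * Z)" using assms Z_ge(1) ts(1) by (intro mult_nonneg_nonneg divide_nonneg_nonneg) auto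
  have p2: "0 \<le> k * (1 / ts)" using assms ts(1) by simp
  show ?thesis
  proof (cases "M = 1")
    case True
    have "u / A \<le> k" using assms(2)[OF True] A0 by (simp add: pos_divide_le_eq)
    then have "1 / ts * (u / A) \<le> 1 / ts * k" using ts(1) by (intro mult_left_mono) auto
    then have "M / ts * (u / A) \<le> k * (1 / ts)" unfolding True by (simp only: mult.commute)
    then show ?thesis using p1 by linarith
  next
    case False
    then have "M = \<sigma>\<^sup>2 * A / ds\<^sup>2" by (auto simp: M_def Delta0_A max_def split: if_splits)
    then have "M / ts * (u / A) = \<sigma>\<^sup>2 / (ds\<^sup>2 * ts) * u" using A0 by simp
    also have "\<dots> \<le> \<sigma>\<^sup>2 / (ds\<^sup>2 * ts) * (m * Z)" using assms(3) ts(1) by (intro mult_left_mono) auto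
    finally show ?thesis using p2 by (simp only: mult.left_commute)
  qed
qed

end

section \<open>Total cost of the calls and of the finishing phase\<close>

context acb
begin

lemma inverse_delta_l: "l \<le> ps + ms \<Longrightarrow> 1 / delta_l \<delta> l \<le> 384 * L ^ 3 / \<delta>"
proof -
  assume "l \<le> ps + ms"
  then have "real l + 1 \<le> 4 * L" using ls_le by linarith
  then have "(real l + 1) ^ 3 \<le> (4 * L) ^ 3" by (intro power_mono) auto
  then have "6 * (real l + 1) ^ 3 / \<delta> \<le> 6 * (4 * L) ^ 3 / \<delta>" using \<delta> by (intro divide_right_mono mult_left_mono) auto
  then show ?thesis by (simp add: delta_l_def power_mult_distrib)
qed

lemma ln_8K_le:
  assumes l: "l \<le> ps + ms"
  shows "ln (8 * real K / delta_l \<delta> l) \<le> 15 * Lam"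
proof -
  let ?Y = "L * real K / \<delta>"
  have "8 * real K / delta_l \<delta> l = 8 * real K * (1 / delta_l \<delta> l)" by simp
  also have "\<dots> \<le> 8 * real K * (384 * L ^ 3 / \<delta>)" using inverse_delta_l[OF l] by (intro mult_left_mono) auto
  also have "\<dots> = 3072 * (L ^ 3 * (real K / \<delta>))" by simp
  \<comment> \<open>The numerical factor becomes a power of Y = L K / \<delta>, because Y >= 2; 12 +
    3 = 15 is the factor of Lam.\<close>
  also have "\<dots> \<le> 2 ^ 12 * (L ^ 3 * (real K / \<delta>) ^ 3)"
    using LK_over(3) L_ge(1) NK \<delta> self_le_power[of "real K / \<delta>" 3] by (intro mult_mono) auto
  also have "\<dots> = 2 ^ 12 * ?Y ^ 3" by (simp add: power_mult_distrib power_divide)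
  also have "\<dots> \<le> ?Y ^ 12 * ?Y ^ 3" using LK_over(1) by (intro mult_right_mono power_mono) auto
  also have "\<dots> = ?Y ^ 15" by (simp add: power_add[symmetric])
  finally have "ln (8 * real K / delta_l \<delta> l) \<le> real 15 * ln ?Y"
    using LK_over(1) delta_l_bounds(1)[of l] NK by (intro ln_le_ln_power) auto
  then show ?thesis by (simp add: Lam_def)
qed

text \<open>Used with both lower bounds on the guessed proportion: T = K 2^(l-p) for the cost, T = N
  for the number r of levels.\<close>

lemma U_le_gen:
  assumes T: "1 \<le> T" "1 / T \<le> th l p"
  shows "real (sri_U PP (delta_l \<delta> l) (th l p)) \<le> 9 * (T * ln (8 * real K / delta_l \<delta> l))"
proof -
  interpret S: sri cHW d N K \<sigma> \<nu> \<mu> "delta_l \<delta> l" "Dp p" "th l p" by (rule sri_round)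
  let ?l = "ln (8 * real K / delta_l \<delta> l)"
  have t: "1 / th l p \<le> T" using T S.\<theta>(1) by (simp add: field_simps)
  have l2: "2 \<le> ?l" by (rule S.ln8K)
  have nn: "0 \<le> 8 / th l p * ?l" using S.\<theta>(1) l2 by simp
  have "real (sri_U PP (delta_l \<delta> l) (th l p)) \<le> 8 / th l p * ?l + 1"
    unfolding sri_U_def using real_nat_ceiling_le[OF nn] by simp
  also have "8 / th l p * ?l \<le> 8 * (T * ?l)"
  proof -
    have "8 / th l p * ?l = 8 * ((1 / th l p) * ?l)" by simp
    also have "\<dots> \<le> 8 * (T * ?l)" using t l2 by (intro mult_left_mono mult_right_mono) auto
    finally show ?thesis .
  qed
  also have "8 * (T * ?l) + 1 \<le> 9 * (T * ?l)"
  proof -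
    have "1 * 1 \<le> T * ?l" using T(1) l2 by (intro mult_mono) auto
    then show ?thesis by linarith
  qed
  finally show ?thesis by simp
qed

lemma U_le:
  assumes "l \<le> ps + ms"
  shows "real (sri_U PP (delta_l \<delta> l) (th l p)) \<le> 135 * (real K * 2 ^ (l - p) * Lam)"
proof -
  have "1 * 1 \<le> real K * 2 ^ (l - p)" using NK by (intro mult_mono) auto
  then have "real (sri_U PP (delta_l \<delta> l) (th l p)) \<le> 9 * (real K * 2 ^ (l - p) * ln (8 * real K / delta_l \<delta> l))"
    by (intro U_le_gen) (auto simp: th_def theta_pl_def)
  also have "\<dots> \<le> 9 * (real K * 2 ^ (l - p) * (15 * Lam))"
    using ln_8K_le[OF assms] by (intro mult_left_mono) auto
  finally show ?thesis by simp
qed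

text \<open>4U / \<open>delta_l\<close> is at most polynomial in N/\<delta> and L, so its iterated
  logarithm is bounded by those of N/\<delta> and L.\<close>

lemma r_le:
  assumes l: "l \<le> ps + ms"
  shows "ln (real K) + sqrt (real d) + real (sri_r PP (delta_l \<delta> l) (th l p)) \<le> 20 * Z"
proof -
  interpret S: sri cHW d N K \<sigma> \<nu> \<mu> "delta_l \<delta> l" "Dp p" "th l p" by (rule sri_round)
  define e where "e = delta_l \<delta> l"
  have e: "0 < e" unfolding e_def by (rule delta_l_bounds)
  define y where "y = ln (4 * real (sri_U PP e (th l p)) / e)"
  have y1: "1 < y" unfolding y_def e_def by (rule S.ln4U)
  have U: "real (sri_U PP e (th l p)) \<le> 9 * (real N * (8 * real K / e))"
  proof -
    have "real (sri_U PP e (th l p)) \<le> 9 * (real N * ln (8 * real K / e))"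
      unfolding e_def using NK by (intro U_le_gen) (auto simp: th_def)
    also have "ln (8 * real K / e) \<le> 8 * real K / e" using NK e ln_bound[of "8 * real K / e"] by simp
    finally show ?thesis using NK by (simp add: mult_left_mono)
  qed
  have "4 * real (sri_U PP e (th l p)) / e \<le> 4 * (9 * (real N * (8 * real K / e))) / e"
    using U e by (intro divide_right_mono mult_left_mono) auto
  also have "\<dots> = 288 * (real N * real K) * (1 / e)\<^sup>2" by (simp add: power2_eq_square)
  also have "\<dots> \<le> 288 * (real N * real N) * (384 * L ^ 3 / \<delta>)\<^sup>2"
    using inverse_delta_l[OF l] NK e unfolding e_def by (intro mult_mono power_mono) auto
  also have "\<dots> = 42467328 * ((real N / \<delta>)\<^sup>2 * L ^ 6)"
    by (simp add: power_mult_distrib power_divide power2_eq_square power_mult[symmetric] power_add[symmetric])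
  \<comment> \<open>42467328 = 288 * 384^2 is below 2^26, and N/\<delta> >= 2.\<close>
  also have "\<dots> \<le> (real N / \<delta>) ^ 26 * ((real N / \<delta>)\<^sup>2 * L ^ 6)"
  proof (rule mult_right_mono)
    have "(42467328::real) \<le> 2 ^ 26" by simp
    also have "\<dots> \<le> (real N / \<delta>) ^ 26" using N_over by (intro power_mono) auto
    finally show "42467328 \<le> (real N / \<delta>) ^ 26" .
  qed (use L_ge(1) in auto)
  also have "\<dots> = (real N / \<delta>) ^ 28 * L ^ 6" by (simp add: power_add[symmetric] mult.assoc[symmetric])
  finally have "y \<le> ln ((real N / \<delta>) ^ 28 * L ^ 6)"
    unfolding y_def using S.U_pos e by (intro ln_mono) (auto simp: e_def)
  also have "\<dots> = 28 * ln (real N / \<delta>) + 6 * ln L"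
  proof -
    have n0: "0 < real N / \<delta>" "0 < L" using N_over L_ge(1) by linarith+
    show ?thesis
      by (simp only: ln_mult_pos[OF zero_less_power[OF n0(1)] zero_less_power[OF n0(2)]] ln_realpow of_nat_numeral)
  qed
  finally have "ln y \<le> ln (28 * ln (real N / \<delta>) + 6 * ln L)" using y1 by (intro ln_mono) auto
  also note ln_ln_combine
  finally have lny: "ln y \<le> 6 + ln (ln L) + ln (ln (real N / \<delta>))" .
  have ln0: "0 \<le> ln y" using y1 by simp
  have "real (sri_r PP e (th l p)) \<le> log 2 y + 1"
    unfolding sri_r_def y_def[symmetric] using y1 by (intro real_nat_ceiling_le) simp
  also have "log 2 y \<le> 2 * ln y"
  proof -
    have "log 2 y \<le> ln y / (2/3)" unfolding log_def using ln_2_ge ln0 by (intro divide_left_mono) auto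
    also have "\<dots> = 3/2 * ln y" by simp
    also have "\<dots> \<le> 2 * ln y" using ln0 by linarith
    finally show ?thesis .
  qed
  finally have r: "real (sri_r PP e (th l p)) \<le> 2 * ln y + 1" by simp
  have gen: "b + R \<le> 20 * (b + u + v)" if "R \<le> 2 * t + 1" "t \<le> 6 + u + v" "5/3 \<le> b" "2/3 \<le> b + u + v" for R t b u v :: real
    using that by argo
  show ?thesis
    unfolding Z_def e_def[symmetric] using gen[OF r lny base_ge Z_ge(1)[unfolded Z_def]] .
qed

text \<open>The number of draws scales with 2^(l-p) and the samples per draw with 2^p, so all calls
  of round l have the same bound, proportional to 2^l.\<close>

lemma SC_le:
  assumes l: "l \<le> ps + ms" and p: "p \<le> l"
  shows "SC l p \<le> 135 * C1 * (real K * Lam) * ((A + 20 * Z) / A) * 2 ^ l"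
proof -
  interpret S: sri cHW d N K \<sigma> \<nu> \<mu> "delta_l \<delta> l" "Dp p" "th l p" by (rule sri_round)
  have A0: "0 < A" using A_ge by linarith
  have rho: "S.\<rho> = 2 ^ p / A" unfolding S.\<rho>_def Dp_sq Delta0_A using sigma_pos A0 by simp
  have W: "S.W \<le> 1 + 2 ^ p / A * (20 * Z)"
    unfolding S.W_def rho S.Wr_def using r_le[OF l, of p] A0 by (intro add_mono mult_left_mono) auto
  have LamK: "0 \<le> real K * 2 ^ (l - p) * Lam" using Lam_ge by simp
  have "SC l p \<le> C1 * real S.U * S.W" unfolding SC_def by (rule S.cost_le)
  also have "\<dots> \<le> C1 * (135 * (real K * 2 ^ (l - p) * Lam)) * (1 + 2 ^ p / A * (20 * Z))"
    using U_le[OF l, of p] W C1_pos S.W_ge_1 LamK by (intro mult_mono mult_left_mono) auto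
  also have "\<dots> = 135 * C1 * (real K * Lam) * (2 ^ (l - p) + (2 ^ (l - p) * 2 ^ p) * (20 * Z / A))" by (simp add: algebra_simps)
  also have "2 ^ (l - p) * 2 ^ p = (2::real) ^ l" using p by (simp add: power_add[symmetric])
  also have "135 * C1 * (real K * Lam) * (2 ^ (l - p) + 2 ^ l * (20 * Z / A)) \<le> 135 * C1 * (real K * Lam) * (2 ^ l + 2 ^ l * (20 * Z / A))"
    using C1_pos Lam_ge by (intro mult_left_mono add_mono power_increasing) auto
  also have "2 ^ l + 2 ^ l * (20 * Z / A) = (A + 20 * Z) / A * 2 ^ l" using A0 by (simp add: field_simps)
  finally show ?thesis by (simp only: mult.assoc)
qed

definition E1 where "E1 = \<sigma>\<^sup>2 / (ds\<^sup>2 * ts) * L * Lam * Z"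
definition E2 where "E2 = L / ts * Lam"

text \<open>Each round has at most 4 L calls, the sum of the 2^l is at most twice its last term, and
  K 2^(ps + ms) <= 4 M / ts.\<close>

lemma TC_le: "TC (Suc (ps + ms)) \<le> 177120 * C1 * (E1 + E2)"
proof -
  let ?ls = "ps + ms"
  define Q where "Q = 135 * C1 * (real K * Lam) * ((A + 20 * Z) / A)"
  have A0: "0 < A" using A_ge by linarith
  have u0: "0 \<le> A + 20 * Z" using A0 Z_ge(1) by linarith
  have Q0: "0 \<le> Q" unfolding Q_def using C1_pos Lam_ge A0 u0 by (intro mult_nonneg_nonneg divide_nonneg_nonneg) auto
  have gen: "(1080 * c * k * v * u) * (4 * m) = (4320 * c * (k * v)) * (m * u)" for c k v u m :: real by simp
  have "TC (Suc ?ls) \<le> (\<Sum>l<Suc ?ls. \<Sum>p<Suc l. Q * 2 ^ l)"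
    unfolding TC_def Q_def by (intro sum_mono SC_le) auto
  also have "\<dots> \<le> (\<Sum>l<Suc ?ls. (4 * L) * (Q * 2 ^ l))"
  proof (rule sum_mono)
    fix l assume "l \<in> {..<Suc ?ls}"
    then have "real (Suc l) \<le> 4 * L" using ls_le by simp
    then have "real (Suc l) * (Q * 2 ^ l) \<le> (4 * L) * (Q * 2 ^ l)" using Q0 by (intro mult_right_mono) auto
    then show "(\<Sum>p<Suc l. Q * 2 ^ l) \<le> (4 * L) * (Q * 2 ^ l)" by simp
  qed
  also have "\<dots> = (4 * L * Q) * (\<Sum>l<Suc ?ls. 2 ^ l)" by (simp only: sum_distrib_left mult.assoc)
  also have "(\<Sum>l<m. (2::real) ^ l) = 2 ^ m - 1" for m by (induction m) auto
  also have "(4 * L * Q) * (2 ^ Suc ?ls - 1) \<le> (4 * L * Q) * (2 * 2 ^ ?ls)" using Q0 L_ge(1) by (intro mult_left_mono) auto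
  also have "\<dots> = (1080 * C1 * L * Lam * ((A + 20 * Z) / A)) * (real K * 2 ^ ?ls)" unfolding Q_def by simp
  also have "\<dots> \<le> (1080 * C1 * L * Lam * ((A + 20 * Z) / A)) * (4 * (M / ts))"
    using K_pow_ls C1_pos L_ge(1) Lam_ge A0 u0 by (intro mult_left_mono mult_nonneg_nonneg divide_nonneg_nonneg) auto
  also have "\<dots> = (4320 * C1 * (L * Lam)) * (M / ts * ((A + 20 * Z) / A))" by (rule gen)
  \<comment> \<open>41 = 1 + 20 * 2, from Z <= 2 A when M = 1; in the other regime A <= 5 Z even
    gives 25.\<close>
  also have "\<dots> \<le> (4320 * C1 * (L * Lam)) * (41 * (\<sigma>\<^sup>2 / (ds\<^sup>2 * ts) * Z) + 41 * (1 / ts))"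
  proof (intro mult_left_mono M_cases)
    show "A + 20 * Z \<le> 41 * A" if "M = 1" using Z_le[OF that] by linarith
    show "A + 20 * Z \<le> 41 * Z" using A_le Z_ge(1) by linarith
  qed (use u0 C1_pos L_ge(1) Lam_ge in auto)
  also have "\<dots> = 177120 * C1 * (E1 + E2)" by (simp add: E1_def E2_def algebra_simps)
  finally show ?thesis .
qed

lemma lam_le: "lam \<le> 4 * Lam" "1 \<le> lam"
proof -
  let ?Y = "L * real K / \<delta>"
  have "3 * (real K)\<^sup>2 / \<delta> \<le> 3 * (real K / \<delta>)\<^sup>2"
    using \<delta> by (simp add: power2_eq_square field_simps mult_left_le_one_le)
  also have "\<dots> \<le> 2\<^sup>2 * (real K / \<delta>)\<^sup>2" by simp
  also have "\<dots> \<le> ?Y\<^sup>2 * ?Y\<^sup>2" using LK_over by (intro mult_mono power_mono) auto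
  also have "\<dots> = ?Y ^ 4" by (simp add: power_add[symmetric])
  finally have "lam \<le> real 4 * ln ?Y" using LK_over(1) NK \<delta> by (intro ln_le_ln_power) auto
  then show "lam \<le> 4 * Lam" by (simp add: Lam_def)
  have "12 * \<delta> \<le> 3 * (real K)\<^sup>2" using K_sq \<delta> by linarith
  then have "12 \<le> 3 * (real K)\<^sup>2 / \<delta>" using \<delta> by (simp add: pos_le_divide_eq)
  then show "1 \<le> lam" using ln_mono[of 12 "3 * (real K)\<^sup>2 / \<delta>"] ln_12_ge_1 by linarith
qed

text \<open>K 2^p is at most 4 M / ts for every p of the relevant rounds; the ceilings account for
  the 2 N.\<close>

lemma estimate_cost_le:
  assumes p: "p \<le> ps + ms"
  shows "real K * (2 * real (n'_p PP \<delta> p)) \<le> 2 * real N + 160 * c6 cHW * (E1 + E2)"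
proof -
  have A0: "0 < A" using A_ge by linarith
  have q1: "1 \<le> sqrt (real d)" using d_pos by simp
  have c6: "0 \<le> c6 cHW" by (simp add: c6_def le_max_iff_disj)
  have rho: "\<sigma>\<^sup>2 / (Dp p)\<^sup>2 = 2 ^ p / A" unfolding Dp_sq Delta0_A using sigma_pos A0 by simp
  have "lam + sqrt (real d * lam) \<le> 8 * (Lam * sqrt (real d))"
  proof -
    have "sqrt lam \<le> lam" using lam_le(2) by (simp add: real_sqrt_le_iff real_le_lsqrt power2_eq_square)
    then have "sqrt (real d) * sqrt lam \<le> sqrt (real d) * lam" by (intro mult_left_mono) auto
    moreover have "1 * lam \<le> sqrt (real d) * lam" using q1 lam_le(2) by (intro mult_right_mono) auto
    moreover have "sqrt (real d) * lam \<le> sqrt (real d) * (4 * Lam)" using lam_le(1) by (intro mult_left_mono) auto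
    moreover have "v + w \<le> 8 * (y * q)" if "w \<le> z" "1 * v \<le> z" "z \<le> q * (4 * y)" for v w z q y :: real using that by argo
    ultimately show ?thesis unfolding real_sqrt_mult by blast
  qed
  then have le: "c6 cHW * (2 ^ p / A) * (lam + sqrt (real d * lam)) \<le> c6 cHW * (2 ^ p / A) * (8 * (Lam * sqrt (real d)))"
    using c6 A0 by (intro mult_left_mono) auto
  have x0: "0 \<le> c6 cHW * (2 ^ p / A) * (lam + sqrt (real d * lam))"
    using c6 A0 lam_le(2) by (intro mult_nonneg_nonneg add_nonneg_nonneg) auto
  have eq: "n'_p PP \<delta> p = nat \<lceil>c6 cHW * (2 ^ p / A) * (lam + sqrt (real d * lam))\<rceil>"
    unfolding n'_p_def rho[symmetric] by simp
  have n: "real (n'_p PP \<delta> p) \<le> c6 cHW * (2 ^ p / A) * (8 * (Lam * sqrt (real d))) + 1"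
    unfolding eq by (rule order_trans[OF real_nat_ceiling_le[OF x0] add_right_mono[OF le]])
  have gen: "(16 * c * v * s) * (4 * m) = (64 * c * v) * (m * s)" for c v s m :: real by simp
  have "real K * (2 * real (n'_p PP \<delta> p)) \<le> real K * (2 * (c6 cHW * (2 ^ p / A) * (8 * (Lam * sqrt (real d))) + 1))"
    using n by (intro mult_left_mono) auto
  also have "\<dots> = 2 * real K + (16 * c6 cHW * Lam * (sqrt (real d) / A)) * (real K * 2 ^ p)" by (simp add: algebra_simps)
  also have "\<dots> \<le> 2 * real N + (16 * c6 cHW * Lam * (sqrt (real d) / A)) * (4 * (M / ts))"
  proof -
    have "real K * 2 ^ p \<le> real K * 2 ^ (ps + ms)" using p by (intro mult_left_mono power_increasing) auto
    then have "real K * 2 ^ p \<le> 4 * (M / ts)" using K_pow_ls by linarith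
    then show ?thesis using c6 Lam_ge A0 NK by (intro add_mono mult_left_mono mult_nonneg_nonneg divide_nonneg_nonneg) auto
  qed
  also have "(16 * c6 cHW * Lam * (sqrt (real d) / A)) * (4 * (M / ts)) = (64 * c6 cHW * Lam) * (M / ts * (sqrt (real d) / A))" by (rule gen)
  also have "\<dots> \<le> (64 * c6 cHW * Lam) * (5/2 * (\<sigma>\<^sup>2 / (ds\<^sup>2 * ts) * Z) + 5/2 * (1 / ts))"
  proof (intro mult_left_mono M_cases)
    show "sqrt (real d) \<le> 5/2 * A" using A_ge by linarith
    have "0 \<le> ln (real K)" using NK by simp
    then show "sqrt (real d) \<le> 5/2 * Z" using Z_ge(2) by linarith
  qed (use c6 Lam_ge in auto)
  also have "\<dots> = 160 * c6 cHW * ((\<sigma>\<^sup>2 / (ds\<^sup>2 * ts) * Lam * Z) + 1 / ts * Lam)" by (simp add: algebra_simps)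
  also have "\<dots> \<le> 160 * c6 cHW * (E1 + E2)"
  proof (intro mult_left_mono add_mono)
    have "\<sigma>\<^sup>2 / (ds\<^sup>2 * ts) * 1 * Lam * Z \<le> E1" unfolding E1_def
      using L_ge(1) ts(1) Lam_ge Z_ge(1) by (intro mult_right_mono mult_left_mono) auto
    then show "\<sigma>\<^sup>2 / (ds\<^sup>2 * ts) * Lam * Z \<le> E1" by simp
    show "1 / ts * Lam \<le> E2" unfolding E2_def using L_ge(1) ts(1) Lam_ge by (intro mult_right_mono divide_right_mono) auto
  qed (use c6 in auto)
  finally show ?thesis by simp
qed

definition E3 where "E3 = real N * ln (real N / \<delta>) + sqrt (real d * real N * real K * ln (real N / \<delta>))"

lemma adc_cost_le:
  "real (K * (2 * adc_J PP (\<delta>/3) (ds / sqrt 8)) + N * (2 * adc_I PP (\<delta>/3) (ds / sqrt 8)))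
    \<le> 4 * real N + (224 * c4 cHW + 96 * c5 cHW) * (\<sigma>\<^sup>2 / ds\<^sup>2) * E3"
proof -
  let ?x = "ln (real N / \<delta>)"
  define g where "g = \<sigma>\<^sup>2 / ds\<^sup>2"
  define R where "R = sqrt (real d * real N * real K * L0)"
  have g0: "0 \<le> g" by (simp add: g_def)
  have c: "0 \<le> c4 cHW" "0 \<le> c5 cHW" using cHW_pos by (auto simp: c4_def c5_def le_max_iff_disj)
  have e8: "k * \<sigma>\<^sup>2 / (ds / sqrt 8)\<^sup>2 = 8 * k * g" for k by (simp add: power_divide g_def)
  have L0x: "L0 \<le> 7 * ?x"
  proof -
    have "6 * real N * real K / (\<delta>/3) = 18 * (real N * real K) / \<delta>" by simp
    also have "\<dots> \<le> 18 * (real N * real N) / \<delta>" using NK \<delta> by (intro divide_right_mono mult_left_mono) auto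
    also have "\<dots> \<le> 18 * (real N / \<delta>)\<^sup>2" using \<delta> by (simp add: power2_eq_square field_simps mult_left_le_one_le)
    also have "\<dots> \<le> 2 ^ 5 * (real N / \<delta>)\<^sup>2" by simp
    also have "\<dots> \<le> (real N / \<delta>) ^ 5 * (real N / \<delta>)\<^sup>2" using N_over by (intro mult_right_mono power_mono) auto
    also have "\<dots> = (real N / \<delta>) ^ 7" by (simp add: power_add[symmetric])
    finally have "ln (6 * real N * real K / (\<delta>/3)) \<le> real 7 * ?x" using N_over NK \<delta> by (intro ln_le_ln_power) auto
    then show ?thesis by (simp add: adc_L0_def)
  qed
  have R: "R \<le> 3 * sqrt (real d * real N * real K * ?x)"
  proof -
    have "real d * real N * real K * L0 \<le> real d * real N * real K * (9 * ?x)" using L0x x_ge by (intro mult_left_mono) auto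
    then have "R \<le> sqrt (9 * (real d * real N * real K * ?x))" unfolding R_def by (intro real_sqrt_le_mono) (simp add: mult_ac)
    also have "\<dots> = 3 * sqrt (real d * real N * real K * ?x)" unfolding real_sqrt_mult[of 9] using real_sqrt_abs[of 3] by simp
    finally show ?thesis .
  qed
  \<comment> \<open>Treats K calls of size J and N calls of size I together: k calls whose size has
    the ratio m/k under the root, with m k = N K, give the common root R. The factor 8 comes from
    the guess ds / sqrt 8.\<close>
  have part: "real k * (2 * real (nat \<lceil>max (c4 cHW * \<sigma>\<^sup>2 / (ds / sqrt 8)\<^sup>2 * L0) (c5 cHW * \<sigma>\<^sup>2 / (ds / sqrt 8)\<^sup>2 * sqrt (real d * real m / real k * L0))\<rceil>))
      \<le> 2 * real N + 16 * c4 cHW * g * (real N * L0) + 16 * c5 cHW * g * R"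
    if k: "0 < k" "k \<le> N" and km: "real m * real k = real N * real K" for k m :: nat
  proof -
    let ?s = "sqrt (real d * real m / real k * L0)"
    let ?X = "8 * c4 cHW * g * L0" and ?Y = "8 * c5 cHW * g * ?s"
    have X0: "0 \<le> ?X" "0 \<le> ?Y" using c g0 L0_pos by (auto intro!: mult_nonneg_nonneg)
    have s: "real k * ?s = R"
    proof -
      have "real k * ?s = sqrt ((real k)\<^sup>2 * (real d * real m / real k * L0))" by (simp only: real_sqrt_mult real_sqrt_abs abs_of_nat)
      also have "(real k)\<^sup>2 * (real d * real m / real k * L0) = real d * (real m * real k) * L0" using k(1) by (simp add: power2_eq_square)
      finally show ?thesis unfolding km R_def by (simp add: mult.assoc)
    qed
    have "real (nat \<lceil>max ?X ?Y\<rceil>) \<le> ?X + ?Y + 1" using real_nat_ceiling_le[of "max ?X ?Y"] X0 by linarith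
    then have "real k * (2 * real (nat \<lceil>max ?X ?Y\<rceil>)) \<le> real k * (2 * (?X + ?Y + 1))" by (intro mult_left_mono) auto
    also have "\<dots> = 2 * real k + 16 * c4 cHW * g * (real k * L0) + 16 * c5 cHW * g * (real k * ?s)" by (simp add: algebra_simps)
    also have "\<dots> \<le> 2 * real N + 16 * c4 cHW * g * (real N * L0) + 16 * c5 cHW * g * R"
      unfolding s using k c g0 L0_pos by (intro add_mono mult_left_mono mult_right_mono) auto
    finally show ?thesis unfolding e8 .
  qed
  have J: "real K * (2 * real (adc_J PP (\<delta>/3) (ds / sqrt 8))) \<le> 2 * real N + 16 * c4 cHW * g * (real N * L0) + 16 * c5 cHW * g * R"
    using part[of K N] K_ge_2 K_le_N by (simp add: adc_J_def)
  have I: "real N * (2 * real (adc_I PP (\<delta>/3) (ds / sqrt 8))) \<le> 2 * real N + 16 * c4 cHW * g * (real N * L0) + 16 * c5 cHW * g * R"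
    using part[of N K] N_ge_2 by (simp add: adc_I_def mult.commute)
  have u: "16 * c4 cHW * g * (real N * L0) \<le> 16 * c4 cHW * g * (real N * (7 * ?x))" using L0x c g0 by (intro mult_left_mono) auto
  have v: "16 * c5 cHW * g * R \<le> 16 * c5 cHW * g * (3 * sqrt (real d * real N * real K * ?x))" using R c g0 by (intro mult_left_mono) auto
  have gen: "a + b \<le> 4 * n + 2 * u' + 2 * v'" if "a \<le> 2 * n + u + v" "b \<le> 2 * n + u + v" "u \<le> u'" "v \<le> v'" for a b n u v u' v' :: real
    using that by linarith
  have 1: "real (K * (2 * adc_J PP (\<delta>/3) (ds / sqrt 8)) + N * (2 * adc_I PP (\<delta>/3) (ds / sqrt 8)))
      \<le> 4 * real N + 2 * (16 * c4 cHW * g * (real N * (7 * ?x))) + 2 * (16 * c5 cHW * g * (3 * sqrt (real d * real N * real K * ?x)))"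
    unfolding of_nat_add of_nat_mult of_nat_numeral by (rule gen[OF J I u v])
  have 2: "224 * c4 cHW * g * (real N * ?x) \<le> 224 * c4 cHW * g * E3" "96 * c5 cHW * g * sqrt (real d * real N * real K * ?x) \<le> 96 * c5 cHW * g * E3"
    unfolding E3_def using c g0 x_ge by (auto intro!: mult_left_mono)
  have "2 * (16 * c4 cHW * g * (real N * (7 * ?x))) = 224 * c4 cHW * g * (real N * ?x)"
    "2 * (16 * c5 cHW * g * (3 * sqrt (real d * real N * real K * ?x))) = 96 * c5 cHW * g * sqrt (real d * real N * real K * ?x)" by simp_all
  moreover have "(224 * c4 cHW + 96 * c5 cHW) * g * E3 = 224 * c4 cHW * g * E3 + 96 * c5 cHW * g * E3" by (simp add: algebra_simps)
  ultimately show ?thesis using 1 2 unfolding g_def[symmetric] by linarith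
qed

lemma budget:
  assumes "p < Suc (ps + ms)"
  shows "TC (Suc (ps + ms)) + real (FC p)
    \<le> budget_bound PP \<delta> 6 (177120 * C1 + 160 * c6 cHW) (224 * c4 cHW + 96 * c5 cHW) ts ds"
proof -
  have p: "p \<le> ps + ms" using assms by simp
  have "real (FC p) \<le> (2 * real N + 160 * c6 cHW * (E1 + E2)) + (4 * real N + (224 * c4 cHW + 96 * c5 cHW) * (\<sigma>\<^sup>2 / ds\<^sup>2) * E3)"
    using estimate_cost_le[OF p] adc_cost_le unfolding FC_def of_nat_add[of "K * (2 * n'_p PP \<delta> p)"] by simp
  moreover have "budget_bound PP \<delta> 6 (177120 * C1 + 160 * c6 cHW) (224 * c4 cHW + 96 * c5 cHW) ts ds
     = 6 * real N + (177120 * C1 + 160 * c6 cHW) * E1 + (177120 * C1 + 160 * c6 cHW) * E2 + (224 * c4 cHW + 96 * c5 cHW) * (\<sigma>\<^sup>2 / ds\<^sup>2) * E3"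
    unfolding budget_bound_def Let_def E1_def E2_def E3_def Lam_def Z_def by simp
  moreover have "177120 * C1 * (E1 + E2) + 160 * c6 cHW * (E1 + E2) = (177120 * C1 + 160 * c6 cHW) * E1 + (177120 * C1 + 160 * c6 cHW) * E2"
    by (simp add: algebra_simps)
  ultimately show ?thesis using TC_le by linarith
qed

end

section \<open>From finitely many rounds to the outcome of ACB\<close>

definition fail :: "(nat set set \<Rightarrow> nat \<Rightarrow> bool) \<Rightarrow> nat set set option \<Rightarrow> nat \<Rightarrow> src \<Rightarrow> ennreal" where
  "fail R G t = (\<lambda>_. case G of None \<Rightarrow> 1 | Some G' \<Rightarrow> if R G' t then 0 else 1)"

lemma measurable_fail: "fail R G t \<in> borel_measurable SRC"
  unfolding fail_def by simp

lemma fail_cases: "fail R G t \<omega> = 0 \<or> fail R G t \<omega> = 1"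
  by (simp add: fail_def split: option.split)

lemma acb_rounds_stable: "acb_rounds P X Us \<delta> L = (Some G, s) \<Longrightarrow> acb_rounds P X Us \<delta> (L + k) = (Some G, s)"
  by (induction k) auto

text \<open>A finished run is not changed by further rounds, so the least terminating number of
  rounds can be replaced by any terminating one.\<close>

lemma ACB_iff: "ACB P \<delta> \<omega> = Some (G, \<tau>) \<longleftrightarrow> (\<exists>L s. acb_rounds P (fst \<omega>) (snd \<omega>) \<delta> L = (Some G, s) \<and> total s = \<tau>)"
proof -
  let ?r = "acb_rounds P (fst \<omega>) (snd \<omega>) \<delta>"
  define L0 where "L0 = (LEAST L. fst (?r L) \<noteq> None)"
  show ?thesis
  proof (cases "\<exists>L. fst (?r L) \<noteq> None")
    case True
    then have "fst (?r L0) \<noteq> None" unfolding L0_def by (rule LeastI_ex)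
    then obtain G0 s0 where 0: "?r L0 = (Some G0, s0)" by (cases "?r L0") auto
    have A: "ACB P \<delta> \<omega> = Some (G0, total s0)" using True 0 by (simp add: ACB_def Let_def L0_def)
    have uniq: "(G', s') = (G0, s0)" if "?r L = (Some G', s')" for L G' s'
    proof -
      have "L0 \<le> L" unfolding L0_def using that by (intro Least_le) simp
      then have "?r L = (Some G0, s0)" using acb_rounds_stable[OF 0, of "L - L0"] by simp
      then show ?thesis using that by simp
    qed
    show ?thesis
    proof
      assume "ACB P \<delta> \<omega> = Some (G, \<tau>)"
      then have "G0 = G" "total s0 = \<tau>" unfolding A by simp_all
      then show "\<exists>L s. ?r L = (Some G, s) \<and> total s = \<tau>" using 0 by blast
    next
      assume "\<exists>L s. ?r L = (Some G, s) \<and> total s = \<tau>"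
      then obtain L s where L: "?r L = (Some G, s)" "total s = \<tau>" by blast
      from uniq[OF L(1)] show "ACB P \<delta> \<omega> = Some (G, \<tau>)" unfolding A using L(2) by simp
    qed
  next
    case False
    then have n: "fst (?r L) = None" for L by blast
    have 1: "?r L \<noteq> (Some G, s)" for L s using n[of L] by auto
    have "ACB P \<delta> \<omega> = None" unfolding ACB_def Let_def if_not_P[OF False] ..
    then show ?thesis using 1 by simp
  qed
qed

text \<open>With \<open>fail R\<close> as final continuation the program is the indicator of failure
  within L rounds; not having terminated counts as failure.\<close>

lemma roundsK_fail_eq_0_iff:
  "roundsK P \<delta> L \<omega> (fail R) = 0 \<longleftrightarrow> (\<exists>G s. acb_rounds P (fst \<omega>) (snd \<omega>) \<delta> L = (Some G, s) \<and> R G (total s))"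
proof -
  obtain G s where e: "acb_rounds P (fst \<omega>) (snd \<omega>) \<delta> L = (G, s)" by (rule prod.exhaust)
  show ?thesis unfolding roundsK_simulates e by (cases G) (simp_all add: fail_def)
qed

lemma roundsK_fail_cases: "roundsK P \<delta> L \<omega> (fail R) = 0 \<or> roundsK P \<delta> L \<omega> (fail R) = 1"
  unfolding roundsK_simulates split_beta by (rule fail_cases)

context clustering
begin

lemma sets_roundsK_eq_0: "{\<omega> \<in> space \<Omega>. roundsK P \<delta> L \<omega> (fail R) = 0} \<in> sets \<Omega>"
proof -
  have "(\<lambda>\<omega>. roundsK P \<delta> L \<omega> (fail R)) \<in> borel_measurable \<Omega>"
    by (intro borel_measurable_Omega roundsK_measurable measurable_fail)
  then have "(\<lambda>\<omega>. roundsK P \<delta> L \<omega> (fail R)) -` {0} \<inter> space \<Omega> \<in> sets \<Omega>" by (rule measurable_sets) simp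
  moreover have "(\<lambda>\<omega>. roundsK P \<delta> L \<omega> (fail R)) -` {0} \<inter> space \<Omega> = {\<omega> \<in> space \<Omega>. roundsK P \<delta> L \<omega> (fail R) = 0}" by blast
  ultimately show ?thesis by (simp only:)
qed

text \<open>Termination has no fixed deadline; as a countable union over the number of rounds the
  event is measurable.\<close>

lemma outcome_sets:
  shows outcome_eq: "{\<omega> \<in> space \<Omega>. \<exists>G \<tau>. ACB P \<delta> \<omega> = Some (G, \<tau>) \<and> R G \<tau>} = (\<Union>L. {\<omega> \<in> space \<Omega>. roundsK P \<delta> L \<omega> (fail R) = 0})"
    and sets_outcome: "{\<omega> \<in> space \<Omega>. \<exists>G \<tau>. ACB P \<delta> \<omega> = Some (G, \<tau>) \<and> R G \<tau>} \<in> sets \<Omega>"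
proof -
  show 1: "{\<omega> \<in> space \<Omega>. \<exists>G \<tau>. ACB P \<delta> \<omega> = Some (G, \<tau>) \<and> R G \<tau>} = (\<Union>L. {\<omega> \<in> space \<Omega>. roundsK P \<delta> L \<omega> (fail R) = 0})"
  proof -
    have "(\<exists>G \<tau>. ACB P \<delta> \<omega> = Some (G, \<tau>) \<and> R G \<tau>) \<longleftrightarrow> (\<exists>L. roundsK P \<delta> L \<omega> (fail R) = 0)" for \<omega>
      unfolding ACB_iff roundsK_fail_eq_0_iff by blast
    then show ?thesis by blast
  qed
  show "{\<omega> \<in> space \<Omega>. \<exists>G \<tau>. ACB P \<delta> \<omega> = Some (G, \<tau>) \<and> R G \<tau>} \<in> sets \<Omega>"
    unfolding 1 by (intro sets.countable_nat_UN) (use sets_roundsK_eq_0 in blast)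
qed

end

context acb
begin

text \<open>Only rounds up to ps + ms are inspected, and a run that has not ended by then is counted
  as failed; the total is \<delta>/6 + 7 \<delta>/9 <= \<delta>. The relation R covers correctness
  and budget at once.\<close>

lemma success:
  fixes R
  assumes R: "\<And>\<tau>. real \<tau> \<le> budget_bound PP \<delta> 6 (177120 * C1 + 160 * c6 cHW) (224 * c4 cHW + 96 * c5 cHW) ts ds \<Longrightarrow> R (Gstar d N \<mu>) \<tau>"
  shows "1 - \<delta> \<le> \<Omega>.prob {\<omega> \<in> space \<Omega>. \<exists>G \<tau>. ACB PP \<delta> \<omega> = Some (G, \<tau>) \<and> R G \<tau>}"
proof -
  let ?ls = "Suc (ps + ms)"
  define f where "f = (\<lambda>\<omega>. roundsK PP \<delta> ?ls \<omega> (fail R))"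
  define S where "S = {\<omega> \<in> space \<Omega>. f \<omega> = 0}"
  have f01: "f \<omega> = 0 \<or> f \<omega> = 1" for \<omega> unfolding f_def by (rule roundsK_fail_cases)
  have f1: "f \<omega> \<le> 1" for \<omega> using f01[of \<omega>] by auto
  have "ex f \<le> (\<Sum>l<?ls. real (Suc l) * (delta_l \<delta> l / 2)) + 7 * \<delta> / 9"
    unfolding f_def
  proof (rule rounds_bound)
    show "fail R G t \<in> borel_measurable SRC" for G t by (rule measurable_fail)
    show "fail R G t \<omega> \<le> 1" for G t \<omega> using fail_cases[of R G t \<omega>] by auto
    show "0 \<le> 7 * \<delta> / 9" using \<delta> by simp
    show "TC ?ls + real (FC p) \<le> budget_bound PP \<delta> 6 (177120 * C1 + 160 * c6 cHW) (224 * c4 cHW + 96 * c5 cHW) ts ds" if "p < ?ls" for p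
      by (rule budget[OF that])
    show "ex (fail R (Some (Gstar d N \<mu>)) t) + 7 * \<delta> / 9 \<le> 7 * \<delta> / 9"
      if "real t \<le> budget_bound PP \<delta> 6 (177120 * C1 + 160 * c6 cHW) (224 * c4 cHW + 96 * c5 cHW) ts ds" for t
      using R[OF that] by (simp add: fail_def ex_def)
    show "ex (fail R None t) \<le> 7 * \<delta> / 9" if "\<And>l p. l < ?ls \<Longrightarrow> p \<le> l \<Longrightarrow> \<not> ez l p" for t
      using that[of "ps + ms" ps] ez_ls by simp
  qed
  then have exf: "ex f \<le> \<delta>" using sum_delta_l[of ?ls] \<delta> by linarith
  have S: "S \<in> sets \<Omega>" unfolding S_def f_def by (rule sets_roundsK_eq_0)
  have "emeasure \<Omega> (space \<Omega> - S) = (\<integral>\<^sup>+\<omega>. indicator (space \<Omega> - S) \<omega> \<partial>\<Omega>)"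
    by (rule nn_integral_indicator[symmetric]) (rule sets.Diff[OF sets.top S])
  also have "\<dots> \<le> (\<integral>\<^sup>+\<omega>. f \<omega> \<partial>\<Omega>)"
  proof (rule nn_integral_mono)
    fix \<omega> assume w: "\<omega> \<in> space \<Omega>"
    show "indicator (space \<Omega> - S) \<omega> \<le> f \<omega>"
    proof (cases "f \<omega> = 0")
      case True
      then show ?thesis using w by (simp add: S_def)
    next
      case False
      then have "f \<omega> = 1" using f01 by blast
      then show ?thesis by (simp add: indicator_def)
    qed
  qed
  also have "\<dots> = ennreal (ex f)" by (rule ex_eq[OF f1, symmetric])
  also have "\<dots> \<le> ennreal \<delta>" using exf by (rule ennreal_leI)
  finally have "\<Omega>.prob (space \<Omega> - S) \<le> \<delta>" using \<delta> by (simp add: \<Omega>.emeasure_eq_measure)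
  then have "1 - \<delta> \<le> \<Omega>.prob S" using \<Omega>.prob_compl[OF S] by linarith
  also have "\<dots> \<le> \<Omega>.prob {\<omega> \<in> space \<Omega>. \<exists>G \<tau>. ACB PP \<delta> \<omega> = Some (G, \<tau>) \<and> R G \<tau>}"
  proof (rule \<Omega>.finite_measure_mono[OF _ sets_outcome])
    show "S \<subseteq> {\<omega> \<in> space \<Omega>. \<exists>G \<tau>. ACB PP \<delta> \<omega> = Some (G, \<tau>) \<and> R G \<tau>}"
      unfolding outcome_eq S_def f_def by blast
  qed
  finally show ?thesis .
qed

end

theorem theorem4:
  fixes cHW :: real
  assumes "0 < cHW" and "hanson_wright cHW"
  shows "(\<forall>d N K \<sigma> \<delta> \<nu> \<mu>. env_ok d N K \<sigma> \<nu> \<mu> \<and> 0 < \<delta> \<longrightarrow>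
            measure (Omega N \<nu>)
              {\<omega> \<in> space (Omega N \<nu>).
                 \<exists>G \<tau>. ACB \<lparr>pcHW = cHW, pd = d, pN = N, pK = K, psig = \<sigma>\<rparr> \<delta> \<omega> = Some (G, \<tau>)
                        \<and> G = Gstar d N \<mu>} \<ge> 1 - \<delta>)
       \<and> (\<exists>c c' c''. 0 < c \<and> 0 < c' \<and> 0 < c'' \<and>
            (\<forall>d N K \<sigma> \<delta> \<nu> \<mu>. env_ok d N K \<sigma> \<nu> \<mu> \<and> 0 < \<delta> \<longrightarrow>
              measure (Omega N \<nu>)
                {\<omega> \<in> space (Omega N \<nu>).
                   \<exists>G \<tau>. ACB \<lparr>pcHW = cHW, pd = d, pN = N, pK = K, psig = \<sigma>\<rparr> \<delta> \<omega> = Some (G, \<tau>)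
                          \<and> real \<tau> \<le> budget_bound \<lparr>pcHW = cHW, pd = d, pN = N, pK = K, psig = \<sigma>\<rparr> \<delta> c c' c''
                                        (theta_star d N \<mu>) (Delta_star d N \<mu>)} \<ge> 1 - \<delta>))"
proof -
  \<comment> \<open>\<open>C1\<close> written out: the constants depend on cHW only and have to be
    fixed before an environment is given.\<close>
  define c' where "c' = 177120 * (336 * (1 + (3 * c1 cHW + 2 * c2 cHW)) + 3 * (1 + c3 cHW)) + 160 * c6 cHW"
  define c'' where "c'' = 224 * c4 cHW + 96 * c5 cHW"
  have nn: "0 \<le> c1 cHW" "0 \<le> c2 cHW" "0 \<le> c3 cHW" "0 < c4 cHW" "0 \<le> c5 cHW" "0 \<le> c6 cHW"
    using assms(1) by (auto simp: c1_def c2_def c3_def c4_def c5_def c6_def le_max_iff_disj less_max_iff_disj)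
  have pos: "0 < c'" "0 < c''" using nn by (auto simp: c'_def c''_def intro!: add_pos_nonneg)
  have main: "1 - \<delta> \<le> measure (Omega N \<nu>) {\<omega> \<in> space (Omega N \<nu>).
      \<exists>G \<tau>. ACB \<lparr>pcHW = cHW, pd = d, pN = N, pK = K, psig = \<sigma>\<rparr> \<delta> \<omega> = Some (G, \<tau>) \<and> R G \<tau>}"
    if env: "env_ok d N K \<sigma> \<nu> \<mu>" "0 < \<delta>"
      and R: "\<And>\<tau>. real \<tau> \<le> budget_bound \<lparr>pcHW = cHW, pd = d, pN = N, pK = K, psig = \<sigma>\<rparr> \<delta> 6 c' c'' (theta_star d N \<mu>) (Delta_star d N \<mu>)
            \<Longrightarrow> R (Gstar d N \<mu>) \<tau>"
    for d N K \<sigma> \<delta> \<nu> \<mu> R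
  \<comment> \<open>For \<delta> >= 1 the claimed probability bound is at most 0.\<close>
  proof (cases "\<delta> < 1")
    case True
    interpret acb cHW d N K \<sigma> \<nu> \<mu> \<delta> by unfold_locales (use assms env True in auto)
    show ?thesis using R unfolding c'_def c''_def C1_def[symmetric] by (rule success)
  next
    case False
    then have "1 - \<delta> \<le> 0" by simp
    then show ?thesis using measure_nonneg by (rule order_trans)
  qed
  show ?thesis
  proof (intro conjI allI impI exI)
    show "(0::real) < 6" "0 < c'" "0 < c''" using pos by auto
  qed (elim conjE, rule main, assumption, assumption, simp)+
qed

end
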